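(* Let $\Phi:D\to\mathbb{R}^d$ be a $(d+p+1)$-admissible warping function with control weight $v_0$, where $p=0$ if $R_\Phi=\sup_{\xi\in D}\|\mathrm{D}\Phi(\xi)\|=\infty$ and $p\in\mathbb{N}_0$ otherwise. Let $m_0:\Lambda\times\Lambda\to(0,\infty)$ be a continuous symmetric weight for which there is a constant $C^{(0)}$ with $1\le m_0(\lambda,\rho)\le C^{(0)}m_0(\lambda,\nu)m_0(\nu,\rho)$ for all $\lambda,\rho,\nu\in\Lambda$, and with $$m_0((y,\xi),(z,\eta))\le(1+|y-z|)^p\cdot v_1(\Phi(\xi)-\Phi(\eta))\qquad\text{for all }y,z\in\mathbb{R}^d,\ \xi,\eta\in D,$$ for some continuous and submultiplicative weight $v_1:\mathbb{R}^d\to(0,\infty)$ with $v_1(\upsilon)=v_1(-\upsilon)$ for all $\upsilon\in\mathbb{R}^d$. With $w_2(\upsilon):=(1+|\upsilon|)^{d+1}\cdot v_1(\upsilon)\cdot[v_0(\upsilon)]^{9d/2+3p+3}$, let $\theta_1,\theta_2\in L^2_{v_0^{d/2}}(\mathbb{R}^d)\cap C^{d+p+1}(\mathbb{R}^d)$ be nonzero with $$v_0^n\cdot\frac{\partial^{(d+p+1)-n}}{\partial\upsilon_j^{(d+p+1)-n}}\theta_i\in L^2_{w_2}(\mathbb{R}^d)\qquad\text{for all }i\in\{1,2\},\ j\in\{1,\dots,d\},\ 0\le n\le d+p+1.$$ Then, for any rich, solid Banach space $Y\hookrightarrow L^1_{\mathrm{loc}}(\Lambda)$ with $\mathcal{B}_{m_0}(Y)\hookrightarrow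 Y$, we have $$\mathrm{Co}(\mathcal{G}(\theta_1,\Phi),Y)=\mathrm{Co}(\mathcal{G}(\theta_2,\Phi),Y).$$ In particular, the statement holds for $Y=L^{p,q}_\kappa(\Lambda)$ with $1\le p,q\le\infty$ ($p$ here being a Lebesgue exponent, unrelated to the integer $p$ above) and any weight $\kappa:\Lambda\to[1,\infty)$ for which there is $c>0$ with $m_\kappa\le c\,m_0$, where $m_\kappa(\lambda,\rho):=\max\{\kappa(\lambda)/\kappa(\rho),\kappa(\rho)/\kappa(\lambda)\}$.
   Context: Notation. $|\cdot|$ is the Euclidean norm, $\|\cdot\|$ for matrices the induced operator norm, $(T_xf)(y)=f(y-x)$, $\widehat f(\xi)=\int f(x)e^{-2\pi i\langle x,\xi\rangle}dx$ with inverse $\mathcal{F}^{-1}$; $B^{-T}$ is the inverse transpose of a matrix $B$. A weight is a measurable function with values in $(0,\infty)$; $\|f\|_{L^p_v}=\|vf\|_{L^p}$. A weight $v$ on $\mathbb{R}^d$ is submultiplicative if $v(\sigma+\tau)\le v(\sigma)v(\tau)$ and radially increasing if $v(\sigma)\le v(\tau)$ whenever $|\sigma|\le|\tau|$. $m_0$ is symmetric if $m_0(\lambda,\rho)=m_0(\rho,\lambda)$. $D\subset\mathbb{R}^d$ is non-empty and open, $\Lambda=\mathbb{R}^d\times D$ with Lebesgue measure, $L^{2,\mathcal F}(D)=\{f\in L^2(\mathbb{R}^d):\widehat f=0\text{ a.e. outside }D\}$. For measurable $F$ on $\Lambda$, $\|F\|_{L^{p,q}_\kappa}=\bigl\|\omega\mapsto\|(\kappa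 F)(\cdot,\omega)\|_{L^p(\mathbb{R}^d)}\bigr\|_{L^q(D)}$. $k$-admissible warping functions ($k\in\mathbb{N}_0$). $\Phi:D\to\mathbb{R}^d$ is a $k$-admissible warping function with control weight $v_0:\mathbb{R}^d\to(0,\infty)$ if $v_0$ is continuous, submultiplicative and radially increasing, $\Phi$ is a $C^{k+1}$-diffeomorphism (onto $\mathbb{R}^d$), $A:=\mathrm{D}\Phi^{-1}$ has positive determinant, and with $\phi_\tau(\upsilon):=A^T(\upsilon+\tau)A^{-T}(\tau)$ one has $\|\partial^\alpha\phi_\tau(\upsilon)\|\le v_0(\upsilon)$ for all $\tau,\upsilon\in\mathbb{R}^d$ and all multiindices $|\alpha|\le k$. Put $w(\tau)=\det A(\tau)$. Warped time-frequency system. For $\theta\in L^2_{v_0^{d/2}}(\mathbb{R}^d)$ and $(y,\omega)\in\Lambda$, $g_\omega:=w(\Phi(\omega))^{-1/2}(T_{\Phi(\omega)}\theta)\circ\Phi$ (extended by zero to $\mathbb{R}^d$), $g_{y,\omega}:=T_y\mathcal{F}^{-1}g_\omega\in L^{2,\mathcal F}(D)$, $\mathcal{G}(\theta,\Phi)=(g_\lambda)_{\lambda\in\Lambda}$. Voice transform: $V_\theta f(\lambda)=\langle f,g_\lambda\rangle$. Kernels. $K(F)(\lambda)=\int_\Lambda K(\lambda,\rho)F(\rho)d\rho$. For measurable $L:X\times X\to\mathbb{C}$, $\|L\|_{\mathcal{A}_1(X)}=\max\{\operatorname{ess\,sup}_x\int|L(x,y)|dy,\operatorname{ess\,sup}_y\int|L(x,y)|dx\}$.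 $\mathcal{B}_{m_0}$ is the space of measurable kernels $K$ on $\Lambda$ with $\|K\|_{\mathcal{B}_{m_0}}:=\bigl\|(\omega,\eta)\mapsto\|(y,z)\mapsto(m_0K)((y,\omega),(z,\eta))\|_{\mathcal{A}_1(\mathbb{R}^d)}\bigr\|_{\mathcal{A}_1(D)}<\infty$. $\mathcal{B}_{m_0}(Y)\hookrightarrow Y$ means: every $K\in\mathcal{B}_{m_0}$ induces a bounded operator $F\mapsto K(F)$ on $Y$ with $\|K(\cdot)\|_{Y\to Y}\le\|K\|_{\mathcal{B}_{m_0}}$. Banach spaces $Y$. $Y\subset L^1_{\mathrm{loc}}(\Lambda)$ is solid if $F,G$ measurable, $|F|\le|G|$ a.e. and $G\in Y$ imply $F\in Y$ and $\|F\|_Y\le\|G\|_Y$; it is rich if it contains all (locally) integrable, compactly supported functions. Coorbit space. Fix any $\nu\in\Lambda$ and put $v(y,\omega):=m_0((y,\omega),\nu)\cdot\max\{w(\Phi(\omega)),[w(\Phi(\omega))]^{-1}\}$. Let $\mathcal{H}^1_v=\mathcal{H}^1_v(\theta)=\{f\in L^{2,\mathcal F}(D):V_\theta f\in L^1_v(\Lambda)\}$ with norm $\|V_\theta f\|_{L^1_v}$, and let $(\mathcal{H}^1_v)^\urcorner$ be its space of bounded antilinear functionals; for $f\in(\mathcal{H}^1_v)^\urcorner$ set $V_\theta f(\lambda)=f(g_\lambda)$. Then $\mathrm{Co}(\mathcal{G}(\theta,\Phi),Y)=\{f\in(\mathcal{H}^1_v)^\urcorner:V_\theta f\in Y\}$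 with norm $\|V_\theta f\|_Y$. *)

theory Defs
  imports "HOL-Analysis.Analysis" "HOL-Probability.Essential_Supremum"
begin

text \<open>
  Elements of \<open>L\<^sup>p\<close>-type spaces are represented by functions, not by almost-everywhere classes;
  a function on an open set \<open>S\<close> is a total function of which only the values on \<open>S\<close> matter
  (all measure-theoretic conditions refer to Lebesgue measure restricted to \<open>S\<close>).
\<close>

section \<open>Lebesgue spaces\<close>

definition ennreal_powr :: "ennreal \<Rightarrow> real \<Rightarrow> ennreal" where
  "ennreal_powr x a = (if x = \<infinity> then \<infinity> else ennreal (enn2real x powr a))"

text \<open>The argument takes values in \<open>[0,\<infinity>]\<close> so that mixed norms can be formed by nesting.\<close>

definition Lp_enorm :: "ennreal \<Rightarrow> 'a measure \<Rightarrow> ('a \<Rightarrow> ennreal) \<Rightarrow> ennreal" where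
  "Lp_enorm p M h =
     (if p = \<infinity> then esssup M h
      else ennreal_powr (\<integral>\<^sup>+x. ennreal_powr (h x) (enn2real p) \<partial>M) (1 / enn2real p))"

definition L2_enorm :: "(real^'d \<Rightarrow> complex) \<Rightarrow> ennreal" where
  "L2_enorm f = Lp_enorm 2 lebesgue (\<lambda>x. ennreal (cmod (f x)))"

definition L2_space :: "(real^'d \<Rightarrow> complex) set" where
  "L2_space = {f. f \<in> borel_measurable lebesgue \<and> L2_enorm f < \<infinity>}"

definition weighted_L2 :: "(real^'d \<Rightarrow> real) \<Rightarrow> (real^'d \<Rightarrow> complex) set" where
  "weighted_L2 v = {f. (\<lambda>x. v x *\<^sub>R f x) \<in> L2_space}"

definition L2_inner :: "(real^'d \<Rightarrow> complex) \<Rightarrow> (real^'d \<Rightarrow> complex) \<Rightarrow> complex" where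
  "L2_inner f g = (LINT x|lebesgue. f x * cnj (g x))"

section \<open>Fourier transform\<close>

definition fourier_L1 :: "(real^'d \<Rightarrow> complex) \<Rightarrow> real^'d \<Rightarrow> complex" where
  "fourier_L1 f \<xi> = (LINT x|lebesgue. f x * cis (- 2 * pi * (x \<bullet> \<xi>)))"

text \<open>
  Plancherel extension to \<open>L\<^sup>2\<close>: the limit in \<open>L\<^sup>2\<close> of the Fourier integrals of the truncations
  of \<open>f\<close> to balls. It is determined up to null sets, as is the inverse transform below.
\<close>

definition fourier_L2 :: "(real^'d \<Rightarrow> complex) \<Rightarrow> real^'d \<Rightarrow> complex" where
  "fourier_L2 f = (SOME g. g \<in> L2_space \<and>
     (\<lambda>n::nat. L2_enorm (\<lambda>\<xi>. fourier_L1 (\<lambda>x. indicator (cball 0 (real n)) x *\<^sub>R f x) \<xi> - g \<xi>))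
       \<longlonglongrightarrow> 0)"

definition inv_fourier_L2 :: "(real^'d \<Rightarrow> complex) \<Rightarrow> real^'d \<Rightarrow> complex" where
  "inv_fourier_L2 g = (SOME f. f \<in> L2_space \<and> (AE \<xi> in lebesgue. fourier_L2 f \<xi> = g \<xi>))"

definition L2_band :: "(real^'d) set \<Rightarrow> (real^'d \<Rightarrow> complex) set" where
  "L2_band D = {f \<in> L2_space. AE \<xi> in lebesgue. \<xi> \<notin> D \<longrightarrow> fourier_L2 f \<xi> = 0}"

definition translate :: "real^'d \<Rightarrow> (real^'d \<Rightarrow> 'b) \<Rightarrow> real^'d \<Rightarrow> 'b" where
  "translate x f = (\<lambda>y. f (y - x))"

section \<open>Derivatives and admissible warping functions\<close>

definition partial_deriv :: "'d \<Rightarrow> (real^'d \<Rightarrow> 'b::real_normed_vector) \<Rightarrow> real^'d \<Rightarrow> 'b" where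
  "partial_deriv j f x = frechet_derivative f (at x) (axis j 1)"

text \<open>
  A multiindex of order \<open>n\<close> is given by a list of \<open>n\<close> coordinates, each listed as often as it is
  differentiated; for functions of class \<open>C\<^sup>n\<close> the order of the list is immaterial.
\<close>

definition multi_deriv :: "'d list \<Rightarrow> (real^'d \<Rightarrow> 'b::real_normed_vector) \<Rightarrow> real^'d \<Rightarrow> 'b" where
  "multi_deriv js f = foldr partial_deriv js f"

primrec Ck_on :: "nat \<Rightarrow> (real^'d) set \<Rightarrow> (real^'d \<Rightarrow> 'b::real_normed_vector) \<Rightarrow> bool" where
  "Ck_on 0 S f \<longleftrightarrow> continuous_on S f"
| "Ck_on (Suc k) S f \<longleftrightarrow>
     (\<forall>x\<in>S. f differentiable (at x)) \<and> (\<forall>j. Ck_on k S (partial_deriv j f))"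

definition Ck_diffeo ::
    "nat \<Rightarrow> (real^'d) set \<Rightarrow> (real^'d) set \<Rightarrow> (real^'d \<Rightarrow> real^'d) \<Rightarrow> bool" where
  "Ck_diffeo k S T f \<longleftrightarrow> bij_betw f S T \<and> Ck_on k S f \<and> Ck_on k T (inv_into S f)"

definition mat_norm :: "real^'d^'d \<Rightarrow> real" where
  "mat_norm M = onorm ((*v) M)"

definition submultiplicative :: "(real^'d \<Rightarrow> real) \<Rightarrow> bool" where
  "submultiplicative v \<longleftrightarrow> (\<forall>\<sigma> \<tau>. v (\<sigma> + \<tau>) \<le> v \<sigma> * v \<tau>)"

definition radially_increasing :: "(real^'d \<Rightarrow> real) \<Rightarrow> bool" where
  "radially_increasing v \<longleftrightarrow> (\<forall>\<sigma> \<tau>. norm \<sigma> \<le> norm \<tau> \<longrightarrow> v \<sigma> \<le> v \<tau>)"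

definition warp_jac :: "(real^'d) set \<Rightarrow> (real^'d \<Rightarrow> real^'d) \<Rightarrow> real^'d \<Rightarrow> real^'d^'d" where
  "warp_jac D \<Phi> \<tau> = jacobian (inv_into D \<Phi>) (at \<tau>)"

definition warp_weight :: "(real^'d) set \<Rightarrow> (real^'d \<Rightarrow> real^'d) \<Rightarrow> real^'d \<Rightarrow> real" where
  "warp_weight D \<Phi> \<tau> = det (warp_jac D \<Phi> \<tau>)"

definition warp_phi ::
    "(real^'d) set \<Rightarrow> (real^'d \<Rightarrow> real^'d) \<Rightarrow> real^'d \<Rightarrow> real^'d \<Rightarrow> real^'d^'d" where
  "warp_phi D \<Phi> \<tau> \<upsilon> =
     transpose (warp_jac D \<Phi> (\<upsilon> + \<tau>)) ** transpose (matrix_inv (warp_jac D \<Phi> \<tau>))"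

definition admissible_warping ::
    "nat \<Rightarrow> (real^'d) set \<Rightarrow> (real^'d \<Rightarrow> real^'d) \<Rightarrow> (real^'d \<Rightarrow> real) \<Rightarrow> bool" where
  "admissible_warping k D \<Phi> v0 \<longleftrightarrow>
     (\<forall>\<tau>. 0 < v0 \<tau>) \<and> continuous_on UNIV v0 \<and> submultiplicative v0 \<and> radially_increasing v0 \<and>
     Ck_diffeo (k + 1) D UNIV \<Phi> \<and>
     (\<forall>\<tau>. 0 < det (warp_jac D \<Phi> \<tau>)) \<and>
     (\<forall>\<tau> \<upsilon> js. length js \<le> k \<longrightarrow> mat_norm (multi_deriv js (warp_phi D \<Phi> \<tau>) \<upsilon>) \<le> v0 \<upsilon>)"

definition warp_R :: "(real^'d) set \<Rightarrow> (real^'d \<Rightarrow> real^'d) \<Rightarrow> ennreal" where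
  "warp_R D \<Phi> = (SUP \<xi>\<in>D. ennreal (mat_norm (jacobian \<Phi> (at \<xi>))))"

section \<open>Warped time-frequency systems\<close>

type_synonym 'd phase = "(real^'d) \<times> (real^'d)"

abbreviation phase_space :: "(real^'d) set \<Rightarrow> 'd phase set" where
  "phase_space D \<equiv> UNIV \<times> D"

definition warped_freq ::
    "(real^'d) set \<Rightarrow> (real^'d \<Rightarrow> real^'d) \<Rightarrow> (real^'d \<Rightarrow> complex) \<Rightarrow> real^'d \<Rightarrow> real^'d \<Rightarrow> complex" where
  "warped_freq D \<Phi> \<theta> \<omega> \<xi> =
     (if \<xi> \<in> D
      then complex_of_real (warp_weight D \<Phi> (\<Phi> \<omega>) powr (- 1 / 2)) * translate (\<Phi> \<omega>) \<theta> (\<Phi> \<xi>)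
      else 0)"

definition warped_atom ::
    "(real^'d) set \<Rightarrow> (real^'d \<Rightarrow> real^'d) \<Rightarrow> (real^'d \<Rightarrow> complex) \<Rightarrow> 'd phase \<Rightarrow> real^'d \<Rightarrow> complex" where
  "warped_atom D \<Phi> \<theta> = (\<lambda>(y, \<omega>). translate y (inv_fourier_L2 (warped_freq D \<Phi> \<theta> \<omega>)))"

definition voice ::
    "(real^'d) set \<Rightarrow> (real^'d \<Rightarrow> real^'d) \<Rightarrow> (real^'d \<Rightarrow> complex) \<Rightarrow> (real^'d \<Rightarrow> complex) \<Rightarrow>
     'd phase \<Rightarrow> complex" where
  "voice D \<Phi> \<theta> f \<mu> = L2_inner f (warped_atom D \<Phi> \<theta> \<mu>)"

section \<open>Kernels\<close>

definition kernel_op ::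
    "('d::finite) phase set \<Rightarrow> ('d phase \<Rightarrow> 'd phase \<Rightarrow> complex) \<Rightarrow> ('d phase \<Rightarrow> complex) \<Rightarrow>
     'd phase \<Rightarrow> complex" where
  "kernel_op \<Lambda> K F \<mu> = (LINT \<rho>|lebesgue_on \<Lambda>. K \<mu> \<rho> * F \<rho>)"

text \<open>The argument is the modulus of the kernel, with values in \<open>[0,\<infinity>]\<close>, to allow nesting.\<close>

definition A1_enorm :: "'x measure \<Rightarrow> ('x \<Rightarrow> 'x \<Rightarrow> ennreal) \<Rightarrow> ennreal" where
  "A1_enorm M L =
     max (esssup M (\<lambda>x. \<integral>\<^sup>+y. L x y \<partial>M)) (esssup M (\<lambda>y. \<integral>\<^sup>+x. L x y \<partial>M))"

definition B_enorm ::
    "(real^'d) set \<Rightarrow> ('d phase \<Rightarrow> 'd phase \<Rightarrow> real) \<Rightarrow>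
     ('d phase \<Rightarrow> 'd phase \<Rightarrow> complex) \<Rightarrow> ennreal" where
  "B_enorm D m K =
     A1_enorm (lebesgue_on D) (\<lambda>\<omega> \<eta>.
       A1_enorm lebesgue (\<lambda>y z. ennreal (cmod (m (y, \<omega>) (z, \<eta>) *\<^sub>R K (y, \<omega>) (z, \<eta>)))))"

definition B_space ::
    "(real^'d) set \<Rightarrow> ('d phase \<Rightarrow> 'd phase \<Rightarrow> real) \<Rightarrow>
     ('d phase \<Rightarrow> 'd phase \<Rightarrow> complex) set" where
  "B_space D m =
     {K. (\<lambda>(\<mu>, \<rho>). K \<mu> \<rho>) \<in> borel_measurable (lebesgue_on (phase_space D \<times> phase_space D)) \<and>
         B_enorm D m K < \<infinity>}"

section \<open>Banach function spaces\<close>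

definition L1_loc :: "'a::euclidean_space set \<Rightarrow> ('a \<Rightarrow> complex) set" where
  "L1_loc \<Omega> = {F. F \<in> borel_measurable (lebesgue_on \<Omega>) \<and>
                  (\<forall>C. compact C \<and> C \<subseteq> \<Omega> \<longrightarrow> set_integrable lebesgue C F)}"

text \<open>
  A Banach space \<open>(Y, N)\<close> of almost-everywhere classes of measurable functions on \<open>\<Omega>\<close>, with \<open>Y\<close>
  the set of all representatives.
\<close>

definition banach_function_space ::
    "'a::euclidean_space set \<Rightarrow> ('a \<Rightarrow> complex) set \<Rightarrow> (('a \<Rightarrow> complex) \<Rightarrow> real) \<Rightarrow> bool" where
  "banach_function_space \<Omega> Y N \<longleftrightarrow>
     Y \<subseteq> borel_measurable (lebesgue_on \<Omega>) \<and>
     (\<forall>F\<in>Y. \<forall>G\<in>borel_measurable (lebesgue_on \<Omega>). (AE x in lebesgue_on \<Omega>. F x = G x) \<longrightarrow> G \<in> Y) \<and>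
     (\<lambda>x. 0) \<in> Y \<and>
     (\<forall>F\<in>Y. \<forall>G\<in>Y. (\<lambda>x. F x + G x) \<in> Y \<and> N (\<lambda>x. F x + G x) \<le> N F + N G) \<and>
     (\<forall>F\<in>Y. \<forall>c. (\<lambda>x. c * F x) \<in> Y \<and> N (\<lambda>x. c * F x) = cmod c * N F) \<and>
     (\<forall>F\<in>Y. 0 \<le> N F \<and> (N F = 0 \<longleftrightarrow> (AE x in lebesgue_on \<Omega>. F x = 0))) \<and>
     (\<forall>X::nat \<Rightarrow> 'a \<Rightarrow> complex.
        (\<forall>n. X n \<in> Y) \<and> (\<forall>e>0. \<exists>n0. \<forall>m\<ge>n0. \<forall>n\<ge>n0. N (\<lambda>x. X m x - X n x) < e) \<longrightarrow>
        (\<exists>F\<in>Y. (\<lambda>n. N (\<lambda>x. X n x - F x)) \<longlonglongrightarrow> 0))"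

definition embeds_in_L1_loc ::
    "'a::euclidean_space set \<Rightarrow> ('a \<Rightarrow> complex) set \<Rightarrow> (('a \<Rightarrow> complex) \<Rightarrow> real) \<Rightarrow> bool" where
  "embeds_in_L1_loc \<Omega> Y N \<longleftrightarrow>
     Y \<subseteq> L1_loc \<Omega> \<and>
     (\<forall>C. compact C \<and> C \<subseteq> \<Omega> \<longrightarrow> (\<exists>c. \<forall>F\<in>Y. (LINT x:C|lebesgue. cmod (F x)) \<le> c * N F))"

definition solid_space ::
    "'a::euclidean_space set \<Rightarrow> ('a \<Rightarrow> complex) set \<Rightarrow> (('a \<Rightarrow> complex) \<Rightarrow> real) \<Rightarrow> bool" where
  "solid_space \<Omega> Y N \<longleftrightarrow>
     (\<forall>F\<in>borel_measurable (lebesgue_on \<Omega>). \<forall>G\<in>Y.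
        (AE x in lebesgue_on \<Omega>. cmod (F x) \<le> cmod (G x)) \<longrightarrow> F \<in> Y \<and> N F \<le> N G)"

definition rich_space :: "'a::euclidean_space set \<Rightarrow> ('a \<Rightarrow> complex) set \<Rightarrow> bool" where
  "rich_space \<Omega> Y \<longleftrightarrow>
     (\<forall>F. integrable (lebesgue_on \<Omega>) F \<and>
          (\<exists>C. compact C \<and> C \<subseteq> \<Omega> \<and> (\<forall>x\<in>\<Omega> - C. F x = 0)) \<longrightarrow> F \<in> Y)"

definition B_acts_on ::
    "(real^'d) set \<Rightarrow> ('d phase \<Rightarrow> 'd phase \<Rightarrow> real) \<Rightarrow>
     ('d phase \<Rightarrow> complex) set \<Rightarrow> (('d phase \<Rightarrow> complex) \<Rightarrow> real) \<Rightarrow> bool" where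
  "B_acts_on D m Y N \<longleftrightarrow>
     (\<forall>K\<in>B_space D m. \<forall>F\<in>Y.
        (AE \<mu> in lebesgue_on (phase_space D). integrable (lebesgue_on (phase_space D)) (\<lambda>\<rho>. K \<mu> \<rho> * F \<rho>)) \<and>
        kernel_op (phase_space D) K F \<in> Y \<and>
        N (kernel_op (phase_space D) K F) \<le> enn2real (B_enorm D m K) * N F)"

definition Lpq_enorm ::
    "(real^'d) set \<Rightarrow> ennreal \<Rightarrow> ennreal \<Rightarrow> ('d phase \<Rightarrow> real) \<Rightarrow> ('d phase \<Rightarrow> complex) \<Rightarrow> ennreal" where
  "Lpq_enorm D p q \<kappa> F =
     Lp_enorm q (lebesgue_on D) (\<lambda>\<omega>. Lp_enorm p lebesgue (\<lambda>y. ennreal (cmod (\<kappa> (y, \<omega>) *\<^sub>R F (y, \<omega>)))))"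

definition Lpq_space ::
    "(real^'d) set \<Rightarrow> ennreal \<Rightarrow> ennreal \<Rightarrow> ('d phase \<Rightarrow> real) \<Rightarrow> ('d phase \<Rightarrow> complex) set" where
  "Lpq_space D p q \<kappa> =
     {F \<in> borel_measurable (lebesgue_on (phase_space D)). Lpq_enorm D p q \<kappa> F < \<infinity>}"

definition Lpq_norm ::
    "(real^'d) set \<Rightarrow> ennreal \<Rightarrow> ennreal \<Rightarrow> ('d phase \<Rightarrow> real) \<Rightarrow> ('d phase \<Rightarrow> complex) \<Rightarrow> real" where
  "Lpq_norm D p q \<kappa> F = enn2real (Lpq_enorm D p q \<kappa> F)"

section \<open>Coorbit spaces\<close>

definition coorbit_weight ::
    "(real^'d) set \<Rightarrow> (real^'d \<Rightarrow> real^'d) \<Rightarrow> ('d phase \<Rightarrow> 'd phase \<Rightarrow> real) \<Rightarrow> 'd phase \<Rightarrow>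
     'd phase \<Rightarrow> real" where
  "coorbit_weight D \<Phi> m \<nu> = (\<lambda>(y, \<omega>).
     m (y, \<omega>) \<nu> * max (warp_weight D \<Phi> (\<Phi> \<omega>)) (inverse (warp_weight D \<Phi> (\<Phi> \<omega>))))"

definition H1_enorm ::
    "(real^'d) set \<Rightarrow> (real^'d \<Rightarrow> real^'d) \<Rightarrow> ('d phase \<Rightarrow> real) \<Rightarrow> (real^'d \<Rightarrow> complex) \<Rightarrow>
     (real^'d \<Rightarrow> complex) \<Rightarrow> ennreal" where
  "H1_enorm D \<Phi> v \<theta> f =
     (\<integral>\<^sup>+\<mu>. ennreal (cmod (v \<mu> *\<^sub>R voice D \<Phi> \<theta> f \<mu>)) \<partial>lebesgue_on (phase_space D))"

definition H1_space ::
    "(real^'d) set \<Rightarrow> (real^'d \<Rightarrow> real^'d) \<Rightarrow> ('d phase \<Rightarrow> real) \<Rightarrow> (real^'d \<Rightarrow> complex) \<Rightarrow>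
     (real^'d \<Rightarrow> complex) set" where
  "H1_space D \<Phi> v \<theta> =
     {f \<in> L2_band D. voice D \<Phi> \<theta> f \<in> borel_measurable (lebesgue_on (phase_space D)) \<and>
                     H1_enorm D \<Phi> v \<theta> f < \<infinity>}"

text \<open>
  Functionals are partial maps whose domain is exactly the space they act on, so that equality of
  two sets of functionals includes equality of the underlying spaces. Boundedness forces a
  functional to respect almost-everywhere equality.
\<close>

definition H1_antidual ::
    "(real^'d) set \<Rightarrow> (real^'d \<Rightarrow> real^'d) \<Rightarrow> ('d phase \<Rightarrow> real) \<Rightarrow> (real^'d \<Rightarrow> complex) \<Rightarrow>
     ((real^'d \<Rightarrow> complex) \<rightharpoonup> complex) set" where
  "H1_antidual D \<Phi> v \<theta> =
     {\<phi>. dom \<phi> = H1_space D \<Phi> v \<theta> \<and>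
         (\<forall>f\<in>H1_space D \<Phi> v \<theta>. \<forall>g\<in>H1_space D \<Phi> v \<theta>.
            the (\<phi> (\<lambda>x. f x + g x)) = the (\<phi> f) + the (\<phi> g)) \<and>
         (\<forall>f\<in>H1_space D \<Phi> v \<theta>. \<forall>c. the (\<phi> (\<lambda>x. c * f x)) = cnj c * the (\<phi> f)) \<and>
         (\<exists>B. \<forall>f\<in>H1_space D \<Phi> v \<theta>. cmod (the (\<phi> f)) \<le> B * enn2real (H1_enorm D \<Phi> v \<theta> f))}"

definition voice_ext ::
    "(real^'d) set \<Rightarrow> (real^'d \<Rightarrow> real^'d) \<Rightarrow> (real^'d \<Rightarrow> complex) \<Rightarrow>
     ((real^'d \<Rightarrow> complex) \<rightharpoonup> complex) \<Rightarrow> 'd phase \<Rightarrow> complex" where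
  "voice_ext D \<Phi> \<theta> \<phi> \<mu> = the (\<phi> (warped_atom D \<Phi> \<theta> \<mu>))"

definition Co ::
    "(real^'d) set \<Rightarrow> (real^'d \<Rightarrow> real^'d) \<Rightarrow> ('d phase \<Rightarrow> real) \<Rightarrow> (real^'d \<Rightarrow> complex) \<Rightarrow>
     ('d phase \<Rightarrow> complex) set \<Rightarrow> ((real^'d \<Rightarrow> complex) \<rightharpoonup> complex) set" where
  "Co D \<Phi> v \<theta> Y = {\<phi> \<in> H1_antidual D \<Phi> v \<theta>. voice_ext D \<Phi> \<theta> \<phi> \<in> Y}"

definition Co_norm ::
    "(real^'d) set \<Rightarrow> (real^'d \<Rightarrow> real^'d) \<Rightarrow> (real^'d \<Rightarrow> complex) \<Rightarrow>
     (('d phase \<Rightarrow> complex) \<Rightarrow> real) \<Rightarrow> ((real^'d \<Rightarrow> complex) \<rightharpoonup> complex) \<Rightarrow> real" where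
  "Co_norm D \<Phi> \<theta> N \<phi> = N (voice_ext D \<Phi> \<theta> \<phi>)"

text \<open>Equality of normed spaces in the usual sense: the same elements, with equivalent norms.\<close>

definition eq_equiv_norms :: "'f set \<Rightarrow> ('f \<Rightarrow> real) \<Rightarrow> 'f set \<Rightarrow> ('f \<Rightarrow> real) \<Rightarrow> bool" where
  "eq_equiv_norms X N X' N' \<longleftrightarrow>
     X = X' \<and> (\<exists>C. \<forall>\<phi>\<in>X. N \<phi> \<le> C * N' \<phi> \<and> N' \<phi> \<le> C * N \<phi>)"

end

(*
Substituting the warped frequency turns the cross kernel <g2_rho, g1_lambda> into an oscillatory
integral of theta2 against a translate of theta1.  Admissibility makes the phase gradient comparable
to |y - z| up to powers of v0, so d+p+1 integrations by parts give decay in |y - z|, while the weight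
w2 gives decay in Phi(xi) - Phi(eta); hence all cross kernels lie in B_{m0}.  The Plancherel theorem
and w(Phi) d omega = d tau make V_theta a multiple of an isometry, so V_theta2 f is, up to a constant,
the kernel applied to V_theta1 f for f in L^{2,F}(D).  To carry this over to the antidual of H^1_v, an
element of H^1_v is approximated in norm by finite sums of atoms obtained from a finite-range sampling of the
reproducing integral; the samples can be taken outside a null set, which avoids any continuity of the
voice transform of a functional.  The kernel then maps Y boundedly to itself, giving both inclusions.
For L^{p,q}_kappa the weight is absorbed into the kernel and the boundedness is Schur's test in each
of the two variables, combined with Minkowski's inequality.
*)
theory Submission
 imports Defs "HOL-Combinatorics.Permutations" "HOL-Probability.Characteristic_Functions"
begin

text \<open>The hypotheses control only unmixed derivatives of the windows, while integrating by
  parts along the phase gradient u would produce mixed ones. The amplitude is therefore split by the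
  weights u_j^(2N) / sum_i u_i^(2N), N = d+p+1, and the j-th piece is integrated by parts N times in
  coordinate j alone. Each integration costs v0^3: v0^2 for a derivative measured relative to the
  gradient, v0 for one division by it. To the resulting v0^(3N) the Jacobian determinant adds v0^d,
  and the normalising factors w^(-1/2) together with the weight max(w, 1/w) of H^1_v add v0^(3d/2).
  The exponent 9d/2 + 3p + 3 of w2, helped by the factors v0^n, pays for these powers. Of the N
  powers of decay, p absorb (1 + |y - z|)^p, which is where finiteness of R_Phi enters, and d + 1
  remain for integrability. The factor (1 + |.|)^(d+1) in w2 turns L^2 hypotheses into L^1 bounds.
  Elements are functions measurable for completed measures, and the transforms involve choices fixed
  only up to null sets, so the work is done on the frequency side with Borel
  representatives.\<close>

abbreviation nn_lborel :: "('a::euclidean_space \<Rightarrow> ennreal) \<Rightarrow> ennreal" (binder "NN " 10) where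
 "nn_lborel f \<equiv> nn_integral lborel f"

abbreviation Borel :: "('a::topological_space \<Rightarrow> 'b::topological_space) set" where
 "Borel \<equiv> borel_measurable borel"

abbreviation Borel2 :: "('a::topological_space \<times> 'b::topological_space \<Rightarrow> 'c::topological_space) set" where
 "Borel2 \<equiv> borel_measurable (borel \<Otimes>\<^sub>M borel)"

abbreviation seq_limit :: "(nat \<Rightarrow> 'a::topological_space) \<Rightarrow> 'a \<Rightarrow> bool" (infixr "~~>" 60) where
 "X ~~> L \<equiv> X \<longlonglongrightarrow> L"

abbreviation integral_lborel :: "('a::euclidean_space \<Rightarrow> 'b::{banach, second_countable_topology}) \<Rightarrow> 'b" (binder "LB " 60) where
 "integral_lborel f \<equiv> integral\<^sup>L lborel f"

lemmas integrable_bd = Bochner_Integration.integrable_bound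
lemmas integral_eqI = Bochner_Integration.integral_cong
lemmas contI = borel_measurable_continuous_onI
lemmas integrable_sub = Bochner_Integration.integrable_diff
lemmas integrable_meas = borel_measurable_integrable

abbreviation cx :: "real \<Rightarrow> complex" where "cx \<equiv> complex_of_real"

section \<open>Change of variables\<close>

text \<open>
 The change of variables theorem of HOL-Analysis needs a well-ordered index type; copying the index
 type transports it to every finite one.
\<close>

datatype 'a ordered_copy = Copy (uncopy: 'a)

definition copy_index :: "'a::finite ordered_copy => nat" where
 "copy_index x = (SOME f. inj f) (uncopy x)"

lemma inj_copy_index: "inj (copy_index :: 'a::finite ordered_copy => nat)"
proof (rule injI)
 obtain f :: "'a => nat" where "inj f"
  using finite_imp_inj_to_nat_seg[of "UNIV::'a set"] by auto
 then have inj: "inj (SOME f :: 'a => nat. inj f)"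
  by (rule someI[where P=inj])
 fix x y :: "'a ordered_copy" assume "copy_index x = copy_index y"
 then show "x = y"
  by (intro ordered_copy.expand injD[OF inj]) (simp add: copy_index_def)
qed

lemma bij_Copy: "bij Copy"
 by (metis bijI' ordered_copy.exhaust ordered_copy.inject)

instantiation ordered_copy :: (finite) wellorder
begin

definition "x <= y \<longleftrightarrow> copy_index x <= copy_index y"
definition "x < y \<longleftrightarrow> copy_index x < copy_index y"

instance
proof
 fix P :: "'a ordered_copy => bool" and a
 assume *: "\<And>x. (\<And>y. y < x ==> P y) ==> P x"
 show "P a"
  by (induction "copy_index a" arbitrary: a rule: less_induct)
    (use * less_ordered_copy_def in blast)
qed (auto simp: less_eq_ordered_copy_def less_ordered_copy_def dest: injD[OF inj_copy_index])

end

lemma all_copy: "(\<forall>i. P i) \<longleftrightarrow> (\<forall>i. P (Copy i))"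
 by (metis ordered_copy.exhaust)

lemma bij_uncopy: "bij uncopy"
 and inv_Copy: "inv Copy = uncopy" and inv_uncopy: "inv uncopy = Copy"
proof -
 show "bij uncopy" by (rule o_bij[of Copy]) (auto simp: fun_eq_iff)
 show "inv Copy = uncopy" by (rule inv_equality) auto
 show "inv uncopy = Copy" by (rule inv_equality) auto
qed

instance ordered_copy :: (finite) finite
proof
 show "finite (UNIV :: 'a ordered_copy set)"
 proof -
  have "finite (range (Copy :: 'a => _))" by simp
  then show ?thesis by (simp only: bij_is_surj[OF bij_Copy])
 qed
qed

text \<open>The formula for the measure of an image applies to images of finite measure, so the two
  measures are compared on bounded Borel sets \<open>E\<close>, through the part \<open>T\<close> of
  \<open>S\<close> mapped into \<open>E\<close>; balls then exhaust an arbitrary \<open>E\<close>.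
  An equality of measures yields the substitution rule for every nonnegative integrand at
  once.\<close>

lemma density_differentiable_image:
 fixes g :: "real^'d::{finite,wellorder} => real^'d::_"
 assumes S: "S \<in> sets borel" "g ` S \<in> sets borel"
  and der: "\<And>x. x \<in> S ==> (g has_derivative g' x) (at x within S)"
  and inj: "inj_on g S"
  and meas: "(%x. indicator S x * \<bar>det (matrix (g' x))\<bar>) \<in> Borel"
 shows "density lborel (indicator (g ` S)) =
  distr (density lborel (%x. ennreal (indicator S x * \<bar>det (matrix (g' x))\<bar>))) borel
   (%x. if x \<in> S then g x else 0)" (is "?M1 = ?M2")
proof (rule measure_eqI)
 let ?g = "%x. if x \<in> S then g x else 0"
 have "continuous_on S g"
  using der has_derivative_continuous_on by blast
 then have g[measurable]: "?g \<in> Borel"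
  by (rule borel_measurable_continuous_on_if[OF S(1)]) auto
 note [measurable] = S meas
 show "sets ?M1 = sets ?M2" by simp
 have fin: "emeasure ?M1 E = emeasure ?M2 E" if E: "E \<in> sets borel" "bounded E" for E
 proof -
  have [measurable]: "E \<in> sets borel" by fact
  define T where "T = S \<inter> ?g -` E"
  have T: "T \<in> sets borel" unfolding T_def using measurable_sets_borel[OF g E(1)] S by blast
  have img: "g ` T = g ` S \<inter> E" by (auto simp: T_def)
  have "g ` T \<in> sets lborel" "bounded (g ` T)" unfolding img using E S bounded_subset by auto
  then have lm: "g ` T \<in> lmeasurable"
   by (simp add: bounded_set_imp_lmeasurable)
  have "((%x. \<bar>det (matrix (g' x))\<bar>) has_integral (measure lebesgue (g ` T))) T"
  proof (subst has_measure_differentiable_image[symmetric, of T g])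
   show "T \<in> sets lebesgue" using T by simp
   show "(g has_derivative g' x) (at x within T)" if "x \<in> T" for x
    using der[of x] that by (auto simp: T_def intro: has_derivative_subset)
   show "inj_on g T" using inj by (auto simp: T_def inj_on_def)
  qed (use lm in auto)
  then have "(NN x. ennreal \<bar>det (matrix (g' x))\<bar> * indicator T x) = measure lebesgue (g ` T)"
   by (rule nn_integral_has_integral_lebesgue'[rotated]) simp
  also have "... = emeasure lebesgue (g ` T)"
   using lm by (simp add: emeasure_eq_measure2)
  also have "... = emeasure lborel (g ` T)"
   using \<open>g ` T \<in> sets lborel\<close> by simp
  finally have eq: "emeasure lborel (g ` S \<inter> E) = (NN x. ennreal \<bar>det (matrix (g' x))\<bar> * indicator T x)"
   by (simp add: img)
  have "emeasure ?M2 E = emeasure (density lborel (%x. ennreal (indicator S x * \<bar>det (matrix (g' x))\<bar>))) (?g -` E)"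
   by (subst emeasure_distr) auto
  also have "... = (NN x. ennreal (indicator S x * \<bar>det (matrix (g' x))\<bar>) * indicator (?g -` E) x)"
   using measurable_sets_borel[OF g E(1)] by (subst emeasure_density) auto
  also have "... = emeasure lborel (g ` S \<inter> E)"
   unfolding eq by (rule nn_integral_cong) (auto simp: T_def indicator_def)
  also have "... = emeasure ?M1 E"
   by (subst emeasure_density) (auto simp: nn_integral_indicator[symmetric] indicator_inter_arith simp del: nn_integral_indicator)
  finally show ?thesis by simp
 qed
 fix E assume "E \<in> sets ?M1"
 then have E[measurable]: "E \<in> sets borel" by simp
 have inc: "incseq (%n::nat. E \<inter> ball 0 (real n))"
  by (auto simp: incseq_def)
 have U: "(\<Union>n::nat. E \<inter> ball 0 (real n)) = E"
  by (auto, meson reals_Archimedean2)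
 have *: "emeasure M E = (SUP n::nat. emeasure M (E \<inter> ball 0 (real n)))" if "sets M = sets borel" for M :: "(real^'d::_) measure"
 proof -
  have "(SUP n::nat. emeasure M (E \<inter> ball 0 (real n))) = emeasure M (\<Union>n::nat. E \<inter> ball 0 (real n))"
   by (rule SUP_emeasure_incseq[OF _ inc]) (auto simp: that)
  then show ?thesis by (simp only: U)
 qed
 have "(SUP n::nat. emeasure ?M1 (E \<inter> ball 0 (real n))) = (SUP n::nat. emeasure ?M2 (E \<inter> ball 0 (real n)))"
  by (intro SUP_cong refl fin) auto
 then show "emeasure ?M1 E = emeasure ?M2 E"
  using *[of ?M1] *[of ?M2] by simp
qed

lemma nn_integral_change_of_variables_wellorder:
 fixes g :: "real^'d::{finite,wellorder} => real^'d::_" and f :: "real^'d::_ => ennreal"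
 assumes S: "S \<in> sets borel" "g ` S \<in> sets borel"
  and der: "\<And>x. x \<in> S ==> (g has_derivative g' x) (at x within S)"
  and inj: "inj_on g S"
  and meas: "(%x. indicator S x * \<bar>det (matrix (g' x))\<bar>) \<in> Borel"
  and f[measurable]: "f \<in> Borel"
 shows "(NN y. indicator (g ` S) y * f y) =
     (NN x. indicator S x * (ennreal \<bar>det (matrix (g' x))\<bar> * f (g x)))"
proof -
 let ?g = "%x. if x \<in> S then g x else 0"
 have "continuous_on S g"
  using der has_derivative_continuous_on by blast
 then have g[measurable]: "?g \<in> Borel"
  by (rule borel_measurable_continuous_on_if[OF S(1)]) auto
 note [measurable] = S meas
 have "(NN y. indicator (g ` S) y * f y) = (\<integral>\<^sup>+y. f y \<partial>density lborel (indicator (g ` S)))"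
  by (subst nn_integral_density) auto
 also have "... = (NN x. ennreal (indicator S x * \<bar>det (matrix (g' x))\<bar>) * f (?g x))"
  by (subst density_differentiable_image[OF S der inj meas])
    (auto simp: nn_integral_distr nn_integral_density)
 also have "... = (NN x. indicator S x * (ennreal \<bar>det (matrix (g' x))\<bar> * f (g x)))"
  by (rule nn_integral_cong) (auto simp: indicator_def)
 finally show ?thesis .
qed

definition to_copy :: "real^'d::finite => real^('d ordered_copy)" where
 "to_copy x = (\<chi> i. x $ uncopy i)"

definition from_copy :: "real^('d::finite ordered_copy) => real^'d" where
 "from_copy x = (\<chi> i. x $ Copy i)"

lemma copy_inverse [simp]: "to_copy (from_copy x) = x" "from_copy (to_copy y) = y"
 by (simp_all add: to_copy_def from_copy_def vec_eq_iff)

lemma linear_to_copy: "linear to_copy" and linear_from_copy: "linear from_copy"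
 by (auto intro!: linearI simp: to_copy_def from_copy_def vec_eq_iff)

lemma measurable_to_copy [measurable]: "to_copy \<in> Borel"
 and measurable_from_copy [measurable]: "from_copy \<in> Borel"
 using linear_to_copy linear_from_copy
 by (auto intro!: contI linear_continuous_on simp: linear_conv_bounded_linear)

lemma prod_Basis_vec: "(\<Prod>b\<in>Basis. (f::real^'d) \<bullet> b) = (\<Prod>i\<in>UNIV. f $ i)"
proof -
 have "(\<Prod>b\<in>Basis. f \<bullet> b) = (\<Prod>b\<in>range (%i. axis i 1). f \<bullet> b)"
  by (rule arg_cong2[where f=prod]) (auto simp: Basis_vec_def)
 also have "... = (\<Prod>i\<in>UNIV. f \<bullet> axis i 1)"
  by (subst prod.reindex) (auto simp: inj_on_def axis_eq_axis)
 finally show ?thesis by (simp add: inner_axis)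
qed

text \<open>Boxes determine Lebesgue measure, and the preimage of a box under a relabelling of
  coordinates is the box with relabelled sides.\<close>

lemma distr_from_copy: "distr lborel borel from_copy = lborel"
proof (rule lborel_eqI[symmetric])
 fix l u :: "real^'d" assume le: "\<And>b. b \<in> Basis ==> l \<bullet> b <= u \<bullet> b"
 have le': "l $ i <= u $ i" for i
  using le[of "axis i 1"] by (simp add: inner_axis axis_in_Basis_iff)
 have "from_copy -` box l u = box (to_copy l) (to_copy u)"
  by (auto simp: mem_box_cart from_copy_def to_copy_def all_copy)
 then have "emeasure (distr lborel borel from_copy) (box l u) = emeasure lborel (box (to_copy l) (to_copy u))"
  by (subst emeasure_distr) auto
 also have "... = (\<Prod>b\<in>Basis. (to_copy u - to_copy l) \<bullet> b)"
 proof (rule emeasure_lborel_box)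
  fix b :: "real^'d ordered_copy" assume "b \<in> Basis"
  then obtain i where "b = axis i 1" by (auto simp: Basis_vec_def)
  then show "to_copy l \<bullet> b <= to_copy u \<bullet> b"
   by (simp add: inner_axis to_copy_def le')
 qed
 also have "(\<Prod>b\<in>Basis. (to_copy u - to_copy l) \<bullet> b) = (\<Prod>i\<in>UNIV. (u - l) $ uncopy i)"
  by (subst prod_Basis_vec) (simp add: to_copy_def)
 also have "... = (\<Prod>i\<in>UNIV. (u - l) $ i)"
  by (rule prod.reindex_bij_witness[of _ Copy uncopy]) auto
 finally show "emeasure (distr lborel borel from_copy) (box l u) = (\<Prod>b\<in>Basis. (u - l) \<bullet> b)"
  by (simp add: prod_Basis_vec)
qed auto

text \<open>In the Leibniz formula, conjugating a permutation by the relabelling keeps its sign and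
  only reorders the factors of its product.\<close>

lemma det_copy:
 fixes A :: "real^'d^'d"
 shows "det (\<chi> i j. A $ uncopy i $ uncopy j :: real^('d ordered_copy)^('d ordered_copy)) = det A"
proof -
 have "det (\<chi> i j. A $ uncopy i $ uncopy j :: real^('d ordered_copy)^('d ordered_copy))
   = (\<Sum>q\<in>{q. q permutes (UNIV :: 'd ordered_copy set)}. of_int (sign q) * (\<Prod>i\<in>UNIV. A $ uncopy i $ uncopy (q i)))"
  by (simp add: det_def)
 also have "... = (\<Sum>p\<in>{p. p permutes (UNIV :: 'd set)}. of_int (sign p) * (\<Prod>i\<in>UNIV. A $ i $ p i))"
 proof (rule sum.reindex_bij_witness[of _ "map_permutation UNIV Copy" "map_permutation UNIV uncopy"])
  note bij = bij_Copy bij_uncopy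
  note inv = inv_Copy inv_uncopy
  have mp: "map_permutation UNIV Copy p = Copy \<circ> p \<circ> uncopy" for p :: "'d => 'd"
   using bij by (auto simp: map_permutation_def inv restrict_id_def fun_eq_iff bij_def)
  have mp': "map_permutation UNIV uncopy q = uncopy \<circ> q \<circ> Copy" for q :: "'d ordered_copy => 'd ordered_copy"
   using bij by (auto simp: map_permutation_def inv restrict_id_def fun_eq_iff bij_def)
  fix q :: "'d ordered_copy => 'd ordered_copy" assume q: "q \<in> {q. q permutes UNIV}"
  show "map_permutation UNIV Copy (map_permutation UNIV uncopy q) = q"
   by (simp add: mp mp' fun_eq_iff)
  show "map_permutation UNIV uncopy q \<in> {p. p permutes UNIV}"
   using q map_permutation_permutes[of uncopy UNIV "UNIV" q] bij by auto
  have "sign (map_permutation UNIV uncopy q) = sign q"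
   by (rule sign_map_permutation) (use q bij in \<open>auto simp: bij_def\<close>)
  moreover have "(\<Prod>i\<in>UNIV. A $ uncopy i $ uncopy (q i)) = (\<Prod>i\<in>UNIV. A $ i $ (uncopy (q (Copy i))))"
   by (rule prod.reindex_bij_witness[of _ Copy uncopy]) auto
  ultimately show "of_int (sign (map_permutation UNIV uncopy q)) * (\<Prod>i\<in>UNIV. A $ i $ map_permutation UNIV uncopy q i)
    = of_int (sign q) * (\<Prod>i\<in>UNIV. A $ uncopy i $ uncopy (q i))"
   by (simp add: mp')
 next
  note bij = bij_Copy bij_uncopy
  note inv = inv_Copy inv_uncopy
  have mp: "map_permutation UNIV Copy p = Copy \<circ> p \<circ> uncopy" for p :: "'d => 'd"
   using bij by (auto simp: map_permutation_def inv restrict_id_def fun_eq_iff bij_def)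
  have mp': "map_permutation UNIV uncopy q = uncopy \<circ> q \<circ> Copy" for q :: "'d ordered_copy => 'd ordered_copy"
   using bij by (auto simp: map_permutation_def inv restrict_id_def fun_eq_iff bij_def)
  fix p :: "'d => 'd" assume p: "p \<in> {q. q permutes UNIV}"
  show "map_permutation UNIV uncopy (map_permutation UNIV Copy p) = p"
   by (simp add: mp mp' fun_eq_iff)
  show "map_permutation UNIV Copy p \<in> {p. p permutes UNIV}"
   using p map_permutation_permutes[of Copy UNIV "UNIV" p] bij by auto
 qed
 finally show ?thesis by (simp add: det_def)
qed

text \<open>Conjugation with \<open>to_copy\<close> and \<open>from_copy\<close> preserves Lebesgue
  integrals and the Jacobian determinant, so the well-ordered case applied to \<open>h\<close> is
  the general case.\<close>

theorem nn_integral_change_of_variables: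
 fixes g :: "real^'d => real^'d" and f :: "real^'d => ennreal"
 assumes S: "S \<in> sets borel" "g ` S \<in> sets borel"
  and der: "\<And>x. x \<in> S ==> (g has_derivative g' x) (at x within S)"
  and inj: "inj_on g S"
  and meas: "(%x. indicator S x * \<bar>det (matrix (g' x))\<bar>) \<in> Borel"
  and f[measurable]: "f \<in> Borel"
 shows "(NN y. indicator (g ` S) y * f y) =
     (NN x. indicator S x * (ennreal \<bar>det (matrix (g' x))\<bar> * f (g x)))"
proof -
 define h where "h = to_copy \<circ> g \<circ> from_copy"
 define h' where "h' = (%y. to_copy \<circ> g' (from_copy y) \<circ> from_copy)"
 define T where "T = from_copy -` S"
 have T: "T \<in> sets borel" 
  unfolding T_def using measurable_sets_borel[OF measurable_from_copy S(1)] .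
 have hT: "h ` T = from_copy -` (g ` S)"
 proof (intro set_eqI iffI)
  fix x assume "x \<in> from_copy -` (g ` S)"
  then obtain s where "s \<in> S" "from_copy x = g s" by auto
  then have "to_copy s \<in> T" "x = h (to_copy s)"
   unfolding h_def T_def by (simp_all flip: \<open>from_copy x = g s\<close>)
  then show "x \<in> h ` T" by (rule rev_image_eqI)
 qed (auto simp: h_def T_def)
 have hTm: "h ` T \<in> sets borel" 
  unfolding hT using measurable_sets_borel[OF measurable_from_copy S(2)] .
 have imT: "from_copy ` T \<subseteq> S" by (auto simp: T_def)
 have bl: "bounded_linear to_copy" "bounded_linear from_copy"
  using linear_to_copy linear_from_copy linear_conv_bounded_linear by blast+
 have derh: "(h has_derivative h' y) (at y within T)" if "y \<in> T" for y
 proof -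
  have "(g has_derivative g' (from_copy y)) (at (from_copy y) within from_copy ` T)"
   using that imT by (intro has_derivative_subset[OF der]) (auto simp: T_def)
  then have "(g \<circ> from_copy has_derivative g' (from_copy y) \<circ> from_copy) (at y within T)"
   by (rule diff_chain_within[OF bounded_linear_imp_has_derivative[OF bl(2)]])
  then have "(to_copy \<circ> (g \<circ> from_copy) has_derivative to_copy \<circ> (g' (from_copy y) \<circ> from_copy)) (at y within T)"
   by (rule diff_chain_within[OF _ bounded_linear_imp_has_derivative[OF bl(1)]])
  then show ?thesis by (simp add: h_def h'_def comp_assoc)
 qed
 have injh: "inj_on h T"
 proof (rule inj_onI)
  fix x y assume "x \<in> T" "y \<in> T" "h x = h y"
  then have "g (from_copy x) = g (from_copy y)"
   unfolding h_def by (metis comp_apply copy_inverse(2))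
  with \<open>x \<in> T\<close> \<open>y \<in> T\<close> have "from_copy x = from_copy y"
   using inj_onD[OF inj] by (simp add: T_def)
  then show "x = y" by (metis copy_inverse(1))
 qed
 have det: "det (matrix (h' y)) = det (matrix (g' (from_copy y)))" for y
 proof -
  have "matrix (h' y) = (\<chi> i j. matrix (g' (from_copy y)) $ uncopy i $ uncopy j)"
  proof -
   have ax: "from_copy (axis j 1) = axis (uncopy j) 1" for j
    by (cases j) (auto simp: from_copy_def axis_def vec_eq_iff)
   show ?thesis
    by (simp add: h'_def matrix_def to_copy_def ax)
  qed
  then show ?thesis by (simp add: det_copy)
 qed
 have "(%y. indicator T y * \<bar>det (matrix (h' y))\<bar>) = (%y. indicator S (from_copy y) * \<bar>det (matrix (g' (from_copy y)))\<bar>)"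
  unfolding det T_def by (auto simp: indicator_def)
 with measurable_compose[OF measurable_from_copy meas]
 have measS: "(%y. indicator T y * \<bar>det (matrix (h' y))\<bar>) \<in> Borel"
  by simp
 have cv: "(NN y. F y) = (NN y. F (from_copy y))" if [measurable]: "F \<in> Borel" for F :: "real^'d => ennreal"
  by (subst distr_from_copy[symmetric]) (simp add: nn_integral_distr)
 have "continuous_on S g"
  using der has_derivative_continuous_on by blast
 then have g[measurable]: "(%x. if x \<in> S then g x else 0) \<in> Borel"
  by (rule borel_measurable_continuous_on_if[OF S(1)]) auto
 note [measurable] = S meas
 have "(%x. ennreal (indicator S x * \<bar>det (matrix (g' x))\<bar>) * f (if x \<in> S then g x else 0)) \<in> Borel"
  by measurable
 also have "(%x. ennreal (indicator S x * \<bar>det (matrix (g' x))\<bar>) * f (if x \<in> S then g x else 0)) = 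
   (%x. indicator S x * (ennreal \<bar>det (matrix (g' x))\<bar> * f (g x)))"
  by (auto simp: indicator_def)
 finally have m2: "(%x. indicator S x * (ennreal \<bar>det (matrix (g' x))\<bar> * f (g x))) \<in> Borel" .
 have ind: "indicator (h ` T) y = (indicator (g ` S) (from_copy y) :: ennreal)" for y
  unfolding hT by (simp add: indicator_def)
 have indT: "indicator T y = (indicator S (from_copy y) :: ennreal)" for y
  unfolding T_def by (simp add: indicator_def)
 have "(NN y. indicator (g ` S) y * f y) = (NN y. indicator (h ` T) y * f (from_copy y))"
  unfolding ind by (rule cv) simp
 also have "... = (NN x. indicator T x * (ennreal \<bar>det (matrix (h' x))\<bar> * f (from_copy (h x))))"
  by (rule nn_integral_change_of_variables_wellorder[OF T hTm derh injh measS]) auto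
 also have "... = (NN x. indicator S x * (ennreal \<bar>det (matrix (g' x))\<bar> * f (g x)))"
  unfolding indT det h_def by (subst cv[OF m2]) simp
 finally show ?thesis .
qed

lemma borel_measurable_cnj [measurable (raw)]:
 "f \<in> borel_measurable M ==> (%x. cnj (f x)) \<in> borel_measurable M"
 by (erule measurable_compose, rule contI) (intro continuous_intros)

section \<open>Square-integrable functions\<close>

text \<open>The square of the L^2 norm, with values in \<open>[0,\<infinity>]\<close>. Without the
  root it is a plain integral; the triangle inequality is replaced by its version with factors 2,
  which is enough for limits.\<close>

definition sqnorm :: "'a measure => ('a => complex) => ennreal" where
 "sqnorm M f = (\<integral>\<^sup>+x. ennreal ((cmod (f x))\<^sup>2) \<partial>M)"

definition cinner :: "'a measure => ('a => complex) => ('a => complex) => complex" where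
 "cinner M f g = (LINT x|M. f x * cnj (g x))"

lemma cmod_add_square_le: "(cmod (a + b))\<^sup>2 <= 2 * (cmod a)\<^sup>2 + 2 * (cmod b)\<^sup>2"
proof -
 have "(cmod (a + b))\<^sup>2 <= (cmod a + cmod b)\<^sup>2"
  by (intro power_mono norm_triangle_ineq) auto
 also have "... <= 2 * (cmod a)\<^sup>2 + 2 * (cmod b)\<^sup>2"
  using sum_squares_bound[of "cmod a" "cmod b"] by (simp add: power2_sum)
 finally show ?thesis .
qed

lemma sqnorm_add_le:
 assumes [measurable]: "f \<in> borel_measurable M" "g \<in> borel_measurable M"
 shows "sqnorm M (%x. f x + g x) <= 2 * sqnorm M f + 2 * sqnorm M g"
proof -
 have "sqnorm M (%x. f x + g x) <= (\<integral>\<^sup>+x. 2 * ennreal ((cmod (f x))\<^sup>2) + 2 * ennreal ((cmod (g x))\<^sup>2) \<partial>M)"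
  unfolding sqnorm_def
 proof (rule nn_integral_mono)
  fix x
  have "ennreal ((cmod (f x + g x))\<^sup>2) <= ennreal (2 * (cmod (f x))\<^sup>2 + 2 * (cmod (g x))\<^sup>2)"
   by (intro ennreal_leI cmod_add_square_le)
  then show "ennreal ((cmod (f x + g x))\<^sup>2) <= 2 * ennreal ((cmod (f x))\<^sup>2) + 2 * ennreal ((cmod (g x))\<^sup>2)"
   by (simp add: ennreal_mult)
 qed
 also have "... = 2 * sqnorm M f + 2 * sqnorm M g"
  by (simp add: sqnorm_def nn_integral_add nn_integral_cmult)
 finally show ?thesis .
qed

lemma sqnorm_minus: "sqnorm M (%x. - f x) = sqnorm M f"
 by (simp add: sqnorm_def)

lemma sqnorm_minus_commute: "sqnorm M (%x. f x - g x) = sqnorm M (%x. g x - f x)"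
 by (simp add: sqnorm_def norm_minus_commute)

lemma sqnorm_diff_le:
 assumes [measurable]: "f \<in> borel_measurable M" "g \<in> borel_measurable M"
 shows "sqnorm M (%x. f x - g x) <= 2 * sqnorm M f + 2 * sqnorm M g"
 using sqnorm_add_le[of f M "%x. - g x"] by (simp add: sqnorm_minus)

lemma sqnorm_triangle:
 assumes [measurable]: "f \<in> borel_measurable M" "g \<in> borel_measurable M" "h \<in> borel_measurable M"
 shows "sqnorm M (%x. f x - h x) <= 2 * sqnorm M (%x. f x - g x) + 2 * sqnorm M (%x. g x - h x)"
 using sqnorm_add_le[of "%x. f x - g x" M "%x. g x - h x"] by simp

lemma sqnorm_cmult:
 assumes [measurable]: "f \<in> borel_measurable M"
 shows "sqnorm M (%x. c * f x) = ennreal ((cmod c)\<^sup>2) * sqnorm M f"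
 by (simp add: sqnorm_def norm_mult power_mult_distrib ennreal_mult nn_integral_cmult)

lemma sqnorm_cong_AE: "AE x in M. f x = g x ==> sqnorm M f = sqnorm M g"
 unfolding sqnorm_def by (intro nn_integral_cong_AE) auto

lemma sqnorm_completion: "sqnorm (completion M) f = sqnorm M f"
 by (simp add: sqnorm_def nn_integral_completion)

lemma sqnorm_eq_0_iff:
 assumes [measurable]: "f \<in> borel_measurable M"
 shows "sqnorm M f = 0 \<longleftrightarrow> (AE x in M. f x = 0)"
 by (simp add: sqnorm_def nn_integral_0_iff_AE)

lemma cinner_nn_bound:
 assumes [measurable]: "f \<in> borel_measurable M" "g \<in> borel_measurable M"
 shows "(\<integral>\<^sup>+x. ennreal (cmod (f x * cnj (g x))) \<partial>M)\<^sup>2 <= sqnorm M f * sqnorm M g"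
 using Cauchy_Schwarz_nn_integral[of "%x. ennreal (cmod (f x))" M "%x. ennreal (cmod (g x))"]
 by (simp add: sqnorm_def norm_mult ennreal_mult ennreal_power)

lemma ennreal_square_less_top: "(a::ennreal)\<^sup>2 < \<infinity> \<longleftrightarrow> a < \<infinity>"
 by (cases a) (auto simp: power2_eq_square ennreal_mult_less_top)

lemma integrable_cinner:
 assumes [measurable]: "f \<in> borel_measurable M" "g \<in> borel_measurable M"
  and "sqnorm M f < \<infinity>" "sqnorm M g < \<infinity>"
 shows "integrable M (%x. f x * cnj (g x))"
proof (rule integrableI_bounded)
 have "(\<integral>\<^sup>+x. ennreal (cmod (f x * cnj (g x))) \<partial>M)\<^sup>2 < \<infinity>"
  using cinner_nn_bound[of f M g] assms(3,4) by (simp add: ennreal_mult_less_top order_le_less_trans)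
 then show "(\<integral>\<^sup>+x. ennreal (cmod (f x * cnj (g x))) \<partial>M) < \<infinity>"
  by (simp only: ennreal_square_less_top)
qed measurable

lemma cmod_cinner_le:
 assumes [measurable]: "f \<in> borel_measurable M" "g \<in> borel_measurable M"
  and fin: "sqnorm M f < \<infinity>" "sqnorm M g < \<infinity>"
 shows "(cmod (cinner M f g))\<^sup>2 <= enn2real (sqnorm M f) * enn2real (sqnorm M g)"
proof -
 have "ennreal (cmod (cinner M f g)) <= (\<integral>\<^sup>+x. ennreal (cmod (f x * cnj (g x))) \<partial>M)"
  unfolding cinner_def by (rule integral_norm_bound_ennreal[OF integrable_cinner]) (use fin in auto)
 then have "(ennreal (cmod (cinner M f g)))\<^sup>2 <= (\<integral>\<^sup>+x. ennreal (cmod (f x * cnj (g x))) \<partial>M)\<^sup>2"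
  by (rule power_mono) simp
 also have "... <= sqnorm M f * sqnorm M g"
  by (rule cinner_nn_bound) auto
 also have "... = ennreal (enn2real (sqnorm M f) * enn2real (sqnorm M g))"
  using fin by (simp add: ennreal_mult)
 finally show ?thesis
  by (simp add: ennreal_power ennreal_le_iff)
qed

lemma sqnorm_eq_cinner:
 assumes [measurable]: "f \<in> borel_measurable M" and fin: "sqnorm M f < \<infinity>"
 shows "cinner M f f = of_real (enn2real (sqnorm M f))"
proof -
 have "cinner M f f = (LINT x|M. of_real ((cmod (f x))\<^sup>2))"
  unfolding cinner_def by (intro integral_eqI refl) (simp only: complex_norm_square)
 also have "... = of_real (LINT x|M. (cmod (f x))\<^sup>2)"
  by (rule integral_complex_of_real)
 also have "(LINT x|M. (cmod (f x))\<^sup>2) = enn2real (sqnorm M f)"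
  unfolding sqnorm_def by (rule integral_eq_nn_integral) auto
 finally show ?thesis .
qed

lemma sqnorm_less_top_add:
 assumes [measurable]: "f \<in> borel_measurable M" "g \<in> borel_measurable M"
  and fin: "sqnorm M f < \<infinity>" "sqnorm M g < \<infinity>"
 shows "sqnorm M (%x. f x + g x) < \<infinity>" "sqnorm M (%x. f x - g x) < \<infinity>"
 using sqnorm_add_le[of f M g] sqnorm_diff_le[of f M g] fin
 by (auto simp: ennreal_mult_less_top intro: order_le_less_trans)

lemma sqnorm_less_top_of_diff:
 assumes [measurable]: "f \<in> borel_measurable M" "g \<in> borel_measurable M"
  and fin: "sqnorm M f < \<infinity>" "sqnorm M (%x. f x - g x) < \<infinity>"
 shows "sqnorm M g < \<infinity>"
 using sqnorm_less_top_add(2)[of f M "%x. f x - g x"] fin by simp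

lemma cinner_add_left:
 assumes "integrable M (%x. f x * cnj (h x))" "integrable M (%x. g x * cnj (h x))"
 shows "cinner M (%x. f x + g x) h = cinner M f h + cinner M g h"
 using assms by (simp add: cinner_def algebra_simps)

lemma cinner_diff_left:
 assumes "integrable M (%x. f x * cnj (h x))" "integrable M (%x. g x * cnj (h x))"
 shows "cinner M (%x. f x - g x) h = cinner M f h - cinner M g h"
 using assms by (simp add: cinner_def algebra_simps)

lemma cinner_add_right:
 assumes "integrable M (%x. h x * cnj (f x))" "integrable M (%x. h x * cnj (g x))"
 shows "cinner M h (%x. f x + g x) = cinner M h f + cinner M h g"
 using assms by (simp add: cinner_def algebra_simps)

lemma cinner_diff_right:
 assumes "integrable M (%x. h x * cnj (f x))" "integrable M (%x. h x * cnj (g x))"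
 shows "cinner M h (%x. f x - g x) = cinner M h f - cinner M h g"
 using assms by (simp add: cinner_def algebra_simps)

lemma cinner_cnj: "cinner M g f = cnj (cinner M f g)"
proof -
 have "cnj (cinner M f g) = (LINT x|M. cnj (f x * cnj (g x)))"
  unfolding cinner_def by (rule Bochner_Integration.integral_cnj[symmetric])
 also have "... = cinner M g f"
  unfolding cinner_def by (intro integral_eqI) (auto simp: mult.commute)
 finally show ?thesis by simp
qed

lemma cinner_cmult_left: "cinner M (%x. c * f x) g = c * cinner M f g"
 and cinner_cmult_right: "cinner M f (%x. c * g x) = cnj c * cinner M f g"
proof -
 show "cinner M (%x. c * f x) g = c * cinner M f g"
  by (simp add: cinner_def mult.assoc)
 have "cinner M f (%x. c * g x) = (LINT x|M. cnj c * (f x * cnj (g x)))"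
  unfolding cinner_def by (intro integral_eqI) auto
 then show "cinner M f (%x. c * g x) = cnj c * cinner M f g"
  by (simp add: cinner_def)
qed

lemma cinner_cong_AE:
 assumes [measurable]: "f \<in> borel_measurable M" "f' \<in> borel_measurable M" "g \<in> borel_measurable M" "g' \<in> borel_measurable M"
  and "AE x in M. f x = f' x" "AE x in M. g x = g' x"
 shows "cinner M f g = cinner M f' g'"
 unfolding cinner_def by (rule integral_cong_AE) (use assms(5,6) in auto)

lemma enn2real_tendsto_0:
 assumes "(f \<longlongrightarrow> (0::ennreal)) F" shows "((%n. enn2real (f n)) \<longlongrightarrow> 0) F"
 using tendsto_enn2real[of f 0 F] assms by simp

text \<open>The difference of the inner products splits into three, each with a factor that tends to
  zero. Cauchy-Schwarz bounds them once the distances are finite, which holds eventually.\<close>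

lemma cinner_tendsto:
 assumes [measurable]: "\<And>n. f n \<in> borel_measurable M" "\<And>n. g n \<in> borel_measurable M"
   "F \<in> borel_measurable M" "G \<in> borel_measurable M"
  and fin: "sqnorm M F < \<infinity>" "sqnorm M G < \<infinity>"
  and f: "(%n::nat. sqnorm M (%x. f n x - F x)) ~~> 0"
  and g: "(%n. sqnorm M (%x. g n x - G x)) ~~> 0"
 shows "(%n. cinner M (f n) (g n)) ~~> cinner M F G"
proof -
 let ?a = "%n. enn2real (sqnorm M (%x. f n x - F x))"
 let ?b = "%n. enn2real (sqnorm M (%x. g n x - G x))"
 let ?A = "enn2real (sqnorm M F)" and ?B = "enn2real (sqnorm M G)"
 have ev: "\<forall>\<^sub>F n in sequentially. sqnorm M (%x. f n x - F x) < \<infinity> \<and> sqnorm M (%x. g n x - G x) < \<infinity>"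
  using order_tendstoD(2)[OF f, of \<infinity>] order_tendstoD(2)[OF g, of \<infinity>]
  by (auto elim: eventually_elim2)
 have bd: "\<forall>\<^sub>F n in sequentially. cmod (cinner M (f n) (g n) - cinner M F G)
    <= sqrt (?a n * ?b n) + sqrt (?a n * ?B) + sqrt (?A * ?b n)"
  using ev
 proof eventually_elim
  case (elim n)
  let ?f = "%x. f n x - F x" and ?g = "%x. g n x - G x"
  have [measurable]: "?f \<in> borel_measurable M" "?g \<in> borel_measurable M" by measurable
  have fin': "sqnorm M ?f < \<infinity>" "sqnorm M ?g < \<infinity>" using elim by auto
  have "cinner M (f n) (g n) = cinner M (%x. ?f x + F x) (%x. ?g x + G x)" by simp
  also have "... = cinner M ?f ?g + cinner M ?f G + (cinner M F ?g + cinner M F G)"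
  proof -
   have *: "cinner M a (%x. ?g x + G x) = cinner M a ?g + cinner M a G"
    if [measurable]: "a \<in> borel_measurable M" and "sqnorm M a < \<infinity>" for a
    by (rule cinner_add_right; rule integrable_cinner) (use fin fin' that in auto)
   have **: "cinner M (%x. ?f x + F x) b = cinner M ?f b + cinner M F b"
    if [measurable]: "b \<in> borel_measurable M" and "sqnorm M b < \<infinity>" for b
    by (rule cinner_add_left; rule integrable_cinner) (use fin fin' that in auto)
   have "cinner M (%x. ?f x + F x) (%x. ?g x + G x) = cinner M ?f (%x. ?g x + G x) + cinner M F (%x. ?g x + G x)"
    by (rule **) (use fin fin' in \<open>auto intro!: sqnorm_less_top_add(1)[of ?g M G, simplified]\<close>)
   then show ?thesis using *[of ?f] *[of F] fin fin' by simp
  qed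
  finally have "cinner M (f n) (g n) - cinner M F G = cinner M ?f ?g + cinner M ?f G + cinner M F ?g"
   by simp
  moreover have "cmod (cinner M ?f ?g) <= sqrt (?a n * ?b n)" "cmod (cinner M ?f G) <= sqrt (?a n * ?B)"
    "cmod (cinner M F ?g) <= sqrt (?A * ?b n)"
   by (rule real_le_rsqrt, rule cmod_cinner_le; use fin fin' in auto)+
  ultimately show ?case
   by (smt (verit) norm_triangle_ineq)
 qed
 have "(%n. sqrt (?a n * ?b n) + sqrt (?a n * ?B) + sqrt (?A * ?b n)) ~~> sqrt (0 * 0) + sqrt (0 * ?B) + sqrt (?A * 0)"
  by (intro tendsto_intros enn2real_tendsto_0 f g)
 then have "(%n. cinner M (f n) (g n) - cinner M F G) ~~> 0"
  by (intro Lim_null_comparison[OF bd]) simp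
 then show ?thesis by (rule LIM_zero_cancel)
qed

text \<open>Riesz-Fischer. A fast subsequence converges almost everywhere, and Fatou's lemma turns
  the Cauchy bound into a bound on the distance to the pointwise limit.\<close>

lemma sqnorm_complete:
 fixes X :: "nat => 'a => complex"
 assumes [measurable]: "\<And>n. X n \<in> borel_measurable M"
  and fin: "\<And>n. sqnorm M (X n) < \<infinity>"
  and cauchy: "\<And>e. e > 0 ==> \<exists>N. \<forall>m\<ge>N. \<forall>n\<ge>N. sqnorm M (%x. X m x - X n x) <= ennreal e"
 obtains F where "F \<in> borel_measurable M" "sqnorm M F < \<infinity>" "(%n. sqnorm M (%x. X n x - F x)) ~~> 0"
proof -
 have "\<exists>N. \<forall>m\<ge>N. \<forall>n\<ge>N. sqnorm M (%x. X m x - X n x) <= ennreal ((1/4)^k)" for k :: nat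
  by (rule cauchy) simp
 then obtain N where N: "\<And>k m n. m \<ge> N k ==> n \<ge> N k ==> sqnorm M (%x. X m x - X n x) <= ennreal ((1/4)^k)"
  by metis
 \<comment> \<open>The sum puts both \<open>r k\<close> and \<open>r (Suc k)\<close> beyond
   \<open>N k\<close>, and the summand \<open>k\<close> makes the indices tend to infinity.\<close>
 define r where "r k = (\<Sum>i\<le>k. N i) + k" for k
 have rN: "r k \<ge> N k" "r (Suc k) \<ge> N k" for k
  using member_le_sum[of k "{..k}" N] by (auto simp: r_def)
 \<comment> \<open>Against squared increments of size 4^-k the weight 2^k still leaves a finite
   integral, and where \<open>h\<close> is finite it forces increments of order 2^(-k/2), which are
   summable.\<close>
 define h where "h x = (\<Sum>k. ennreal (2 ^ k * (cmod (X (r (Suc k)) x - X (r k) x))\<^sup>2))" for x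
 have [measurable]: "h \<in> borel_measurable M" unfolding h_def by measurable
 have "(\<integral>\<^sup>+x. h x \<partial>M) = (\<Sum>k. (\<integral>\<^sup>+x. ennreal (2 ^ k * (cmod (X (r (Suc k)) x - X (r k) x))\<^sup>2) \<partial>M))"
  unfolding h_def by (rule nn_integral_suminf) measurable
 also have "... <= (\<Sum>k. ennreal ((1/2)^k))"
 proof (rule suminf_le)
  fix k
  have "(\<integral>\<^sup>+x. ennreal (2 ^ k * (cmod (X (r (Suc k)) x - X (r k) x))\<^sup>2) \<partial>M)
    = ennreal (2^k) * sqnorm M (%x. X (r (Suc k)) x - X (r k) x)"
   by (simp add: sqnorm_def ennreal_mult nn_integral_cmult)
  also have "... <= ennreal (2^k) * ennreal ((1/4)^k)"
   by (intro mult_left_mono N rN) auto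
  also have "... = ennreal ((1/2)^k)"
   by (simp add: ennreal_mult[symmetric] power_mult_distrib[symmetric])
  finally show "(\<integral>\<^sup>+x. ennreal (2 ^ k * (cmod (X (r (Suc k)) x - X (r k) x))\<^sup>2) \<partial>M) <= ennreal ((1/2)^k)" .
 qed auto
 also have "... = ennreal (\<Sum>k. (1/2)^k)"
  by (rule suminf_ennreal2) (auto intro: summable_geometric)
 finally have hfin: "(\<integral>\<^sup>+x. h x \<partial>M) < \<infinity>" by (simp add: order_le_less_trans)
 then have "AE x in M. h x \<noteq> \<infinity>"
  by (intro nn_integral_noteq_infinite) auto
 then have conv: "AE x in M. convergent (%k. X (r k) x)"
 proof eventually_elim
  case (elim x)
  define c where "c = enn2real (h x)"
  have hx: "h x = ennreal c" using elim by (simp add: c_def less_top)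
  have c: "c \<ge> 0" by (simp add: c_def)
  have "cmod (X (r (Suc k)) x - X (r k) x) <= sqrt c * (1 / sqrt 2) ^ k" for k
  proof -
   have "ennreal (2 ^ k * (cmod (X (r (Suc k)) x - X (r k) x))\<^sup>2) <= h x"
   proof -
    let ?q = "%k. ennreal (2 ^ k * (cmod (X (r (Suc k)) x - X (r k) x))\<^sup>2)"
    have "sum ?q {k} <= suminf ?q" by (rule sum_le_suminf) auto
    moreover have "sum ?q {k} = ?q k" by (rule sum.insert_remove[THEN trans]) simp_all
    ultimately show ?thesis unfolding h_def by (simp only:)
   qed
   then have "2 ^ k * (cmod (X (r (Suc k)) x - X (r k) x))\<^sup>2 <= c"
    using c by (simp add: hx)
   then have "(cmod (X (r (Suc k)) x - X (r k) x))\<^sup>2 <= c * (1/2)^k"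
    by (simp add: field_simps power_divide)
   then have "cmod (X (r (Suc k)) x - X (r k) x) <= sqrt (c * (1/2)^k)"
    by (rule real_le_rsqrt)
   also have "... = sqrt c * (1 / sqrt 2) ^ k"
    by (simp add: real_sqrt_mult real_sqrt_power real_sqrt_divide)
   finally show ?thesis .
  qed
  note bound = this
  have "summable (%k. sqrt c * (1 / sqrt 2) ^ k)"
   by (intro summable_mult summable_geometric) (simp add: real_less_lsqrt)
  then have "summable (%k. X (r (Suc k)) x - X (r k) x)"
   by (rule summable_comparison_test'[where N=0]) (rule bound)
  then have "convergent (%n. \<Sum>k<n. X (r (Suc k)) x - X (r k) x)"
   by (simp add: summable_iff_convergent)
  then have "convergent (%n. X (r n) x - X (r 0) x)"
   by (simp add: sum_lessThan_telescope[of "%k. X (r k) x"])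
  then have "convergent (%n. (X (r n) x - X (r 0) x) + X (r 0) x)"
   by (intro convergent_add convergent_const)
  then show ?case by simp
 qed
 define F where "F x = lim (%k. X (r k) x)" for x
 have [measurable]: "F \<in> borel_measurable M" unfolding F_def by measurable
 have lim: "AE x in M. (%k. X (r k) x) ~~> F x"
  using conv by eventually_elim (simp add: F_def convergent_LIMSEQ_iff)
 have r_ge: "k <= r k" for k by (simp add: r_def)
 have est: "sqnorm M (%x. X n x - F x) <= ennreal e" if "\<forall>m\<ge>N0. \<forall>n\<ge>N0. sqnorm M (%x. X m x - X n x) <= ennreal e" "n \<ge> N0" for n N0 e
 proof -
  have "sqnorm M (%x. X n x - F x) = (\<integral>\<^sup>+x. liminf (%k. ennreal ((cmod (X n x - X (r k) x))\<^sup>2)) \<partial>M)"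
   unfolding sqnorm_def
  proof (rule nn_integral_cong_AE)
   show "AE x in M. ennreal ((cmod (X n x - F x))\<^sup>2) = liminf (%k. ennreal ((cmod (X n x - X (r k) x))\<^sup>2))"
    using lim
   proof eventually_elim
    case (elim x)
    then have "(%k. ennreal ((cmod (X n x - X (r k) x))\<^sup>2)) ~~> ennreal ((cmod (X n x - F x))\<^sup>2)"
     by (intro tendsto_intros tendsto_ennrealI)
    then show ?case by (rule lim_imp_Liminf[symmetric, rotated]) simp
   qed
  qed
  also have "... <= liminf (%k. sqnorm M (%x. X n x - X (r k) x))"
   unfolding sqnorm_def by (rule nn_integral_liminf) measurable
  also have "... <= ennreal e"
  proof (rule Liminf_le)
   have "\<forall>k\<ge>N0. sqnorm M (%x. X n x - X (r k) x) <= ennreal e"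
    using that r_ge order_trans by blast
   then have "\<forall>\<^sub>F k in sequentially. sqnorm M (%x. X n x - X (r k) x) <= ennreal e"
    unfolding eventually_sequentially by blast
   then show "\<forall>\<^sub>F k in sequentially. sqnorm M (%x. X n x - X (r k) x) <= ennreal e" .
  qed simp
  finally show ?thesis .
 qed
 have "(%n. sqnorm M (%x. X n x - F x)) ~~> 0"
 proof (rule order_tendstoI)
  fix a :: ennreal assume "0 < a"
  then obtain e where e: "e > 0" "ennreal e < a"
  proof (cases a)
   case (real r)
   with \<open>0 < a\<close> show ?thesis by (intro that[of "r / 2"]) (auto simp: ennreal_less_iff)
  next
   case top
   then show ?thesis by (intro that[of 1]) auto
  qed
  from cauchy[OF e(1)] obtain N0 where N0: "\<forall>m\<ge>N0. \<forall>n\<ge>N0. sqnorm M (%x. X m x - X n x) <= ennreal e" by auto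
  show "\<forall>\<^sub>F n in sequentially. sqnorm M (%x. X n x - F x) < a"
   by (intro eventually_sequentiallyI[of N0] le_less_trans[OF est[OF N0] e(2)])
 qed auto
 moreover have "sqnorm M F < \<infinity>"
 proof -
  from cauchy[of 1] obtain N0 where "\<forall>m\<ge>N0. \<forall>n\<ge>N0. sqnorm M (%x. X m x - X n x) <= ennreal 1" by auto
  from est[OF this, of N0] have "sqnorm M (%x. X N0 x - F x) < \<infinity>" by (auto simp: order_le_less_trans)
  then show ?thesis using sqnorm_less_top_of_diff[of "X N0" M F] fin by simp
 qed
 ultimately show thesis using that[of F] by simp
qed

section \<open>Continuity of translations in L^1 and L^2\<close>

lemma nn_integral_lborel_translate:
 fixes F :: "'a::euclidean_space => ennreal"
 assumes [measurable]: "F \<in> Borel"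
 shows "(NN x. F (x + h)) = (NN x. F x)"
 by (subst (2) lborel_distr_plus[symmetric, of h]) (simp add: nn_integral_distr add.commute)

lemma integral_lborel_translate:
 fixes F :: "'a::euclidean_space => 'b::{banach, second_countable_topology}"
 assumes [measurable]: "F \<in> Borel"
 shows "(LB x. F (x + h)) = (LB x. F x)"
 by (subst (2) lborel_distr_plus[symmetric, of h]) (simp add: integral_distr add.commute)

lemma integrable_lborel_translate:
 fixes F :: "'a::euclidean_space => 'b::{banach, second_countable_topology}"
 assumes "integrable lborel F"
 shows "integrable lborel (%x. F (x + h))"
proof -
 have "integrable (distr lborel borel ((+) h)) F"
  by (simp add: lborel_distr_plus assms)
 then show ?thesis
  using integrable_meas[OF assms] by (subst (asm) integrable_distr_eq) (auto simp: add.commute)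
qed

text \<open>The integral equals twice the measure of \<open>U\<close> minus twice that of the
  overlap of \<open>U\<close> with its translate. A point of an open set stays inside under small
  shifts, so the overlap tends to all of \<open>U\<close> by dominated convergence.\<close>

lemma L1_translation_open:
 fixes U :: "'a::euclidean_space set"
 assumes U: "open U" "emeasure lborel U < \<infinity>" and h: "h ~~> 0"
 shows "(%n. LB x. \<bar>indicator U (x + h n) - indicator U x\<bar>) ~~> (0::real)"
proof -
 have [measurable]: "U \<in> sets borel" using U by simp
 have i: "integrable lborel (indicator U :: 'a => real)"
  using U by simp
 have it: "integrable lborel (%x. indicator U (x + a) :: real)" for a
  by (rule integrable_lborel_translate[OF i])
 have ip: "integrable lborel (%x. indicator U x * indicator U (x + a) :: real)" for a
  by (rule integrable_bd[OF i]) (auto simp: indicator_def)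
 have eq: "(LB x. \<bar>indicator U (x + a) - indicator U x\<bar>) =
   2 * measure lborel U - 2 * (LB x. indicator U x * indicator U (x + a) :: real)" for a
 proof -
  have "(LB x. \<bar>indicator U (x + a) - indicator U x\<bar> :: real) =
   (LB x. indicator U (x + a) + indicator U x - 2 * (indicator U x * indicator U (x + a)))"
   by (rule integral_eqI) (auto simp: indicator_def)
  also have "... = (LB x. indicator U (x + a)) + (LB x. indicator U x)
    - 2 * (LB x. indicator U x * indicator U (x + a))"
   using i it ip by simp
  also have "(LB x. indicator U (x + a) :: real) = (LB x. indicator U x)"
   by (rule integral_lborel_translate) simp
  finally show ?thesis by simp
 qed
 have "(%n. LB x. indicator U x * indicator U (x + h n) :: real) ~~> (LB x. indicator U x)"
 proof (rule integral_dominated_convergence[where w="indicator U"])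
  show "AE x in lborel. (%n. indicator U x * indicator U (x + h n) :: real) ~~> indicator U x"
  proof (rule AE_I2)
   fix x
   show "(%n. indicator U x * indicator U (x + h n) :: real) ~~> indicator U x"
   proof (cases "x \<in> U")
    case True
    have "(%n. x + h n) ~~> x + 0" by (intro tendsto_intros h)
    then have "\<forall>\<^sub>F n in sequentially. x + h n \<in> U"
     using U(1) True by (intro topological_tendstoD) auto
    then have "\<forall>\<^sub>F n in sequentially. (indicator U x * indicator U (x + h n) :: real) = indicator U x"
     by eventually_elim (use True in simp)
    then show ?thesis by (rule tendsto_eventually)
   qed auto
  qed
 qed (use i in \<open>auto simp: indicator_def\<close>)
 then have "(%n. 2 * measure lborel U - 2 * (LB x. indicator U x * indicator U (x + h n) :: real))
   ~~> 2 * measure lborel U - 2 * measure lborel U"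
  by (intro tendsto_intros) simp
 then show ?thesis by (simp add: eq)
qed

lemma L1_translation_perturb:
 fixes f s :: "'a::euclidean_space => real"
 assumes f: "integrable lborel f" and s: "integrable lborel s"
 shows "(LB x. \<bar>f (x + a) - f x\<bar>) <= (LB x. \<bar>s (x + a) - s x\<bar>) + 2 * (LB x. \<bar>f x - s x\<bar>)"
proof -
 note it = integrable_lborel_translate[OF f, of a] integrable_lborel_translate[OF s, of a]
 have id: "integrable lborel (%x. \<bar>f x - s x\<bar>)" using f s by auto
 have "(LB x. \<bar>f (x + a) - f x\<bar>) <= (LB x. \<bar>s (x + a) - s x\<bar> + (\<bar>f (x + a) - s (x + a)\<bar> + \<bar>f x - s x\<bar>))"
  by (rule integral_mono) (use f s it in auto)
 also have "... = (LB x. \<bar>s (x + a) - s x\<bar>) + ((LB x. \<bar>f (x + a) - s (x + a)\<bar>) + (LB x. \<bar>f x - s x\<bar>))"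
  using f s it by (subst Bochner_Integration.integral_add; auto)+
 also have "(LB x. \<bar>f (x + a) - s (x + a)\<bar>) = (LB x. \<bar>f x - s x\<bar>)"
  by (rule integral_lborel_translate[where F="%x. \<bar>f x - s x\<bar>"]) (use id in \<open>auto dest: integrable_meas\<close>)
 finally show ?thesis by simp
qed

text \<open>Translation continuity is closed under L^1 approximation, because translating leaves the
  approximation error unchanged.\<close>

lemma L1_translation_limit:
 fixes f :: "'a::euclidean_space => real"
 assumes f: "integrable lborel f"
  and approx: "\<And>e. e > 0 ==> \<exists>s. integrable lborel s \<and> (LB x. \<bar>f x - s x\<bar>) <= e \<and>
    (%n::nat. LB x. \<bar>s (x + h n) - s x\<bar>) ~~> 0"
 shows "(%n. LB x. \<bar>f (x + h n) - f x\<bar>) ~~> 0"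
proof (rule LIMSEQ_I)
 fix r :: real assume "r > 0"
 then obtain s where s: "integrable lborel s" "(LB x. \<bar>f x - s x\<bar>) <= r / 4"
    "(%n. LB x. \<bar>s (x + h n) - s x\<bar>) ~~> 0"
  using approx[of "r/4"] by auto
 obtain N where N: "\<And>n. n \<ge> N ==> (LB x. \<bar>s (x + h n) - s x\<bar>) < r / 2"
  using LIMSEQ_D[OF s(3), of "r/2"] \<open>r > 0\<close> by (auto simp: abs_less_iff)
 have "(LB x. \<bar>f (x + h n) - f x\<bar>) < r" if "n \<ge> N" for n
  using L1_translation_perturb[OF f s(1), of "h n"] N[OF that] s(2) by linarith
 then show "\<exists>no. \<forall>n\<ge>no. norm ((LB x. \<bar>f (x + h n) - f x\<bar>) - 0) < r"
  by (intro exI[of _ N]) (auto simp: integral_nonneg_AE)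
qed

text \<open>Induction over integrable functions. The content lies in the indicators, where outer
  regularity replaces a set of finite measure by an open one.\<close>

lemma L1_translation:
 fixes f :: "'a::euclidean_space => real"
 assumes "integrable lborel f" and h: "h ~~> 0"
 shows "(%n::nat. LB x. \<bar>f (x + h n) - f x\<bar>) ~~> 0"
 using assms(1)
proof (induction rule: integrable_induct)
 case (base A c)
 have [measurable]: "A \<in> sets borel" using base by simp
 have iA: "integrable lborel (indicator A :: 'a => real)" using base by simp
 have "(%n. LB x. \<bar>indicator A (x + h n) - indicator A x :: real\<bar>) ~~> 0"
 proof (rule L1_translation_limit[OF iA])
  fix e :: real assume "e > 0"
  obtain U where U: "open U" "A \<subseteq> U" "emeasure lborel (U - A) < ennreal e"
   using outer_regular_lborel[of A e] base \<open>e > 0\<close> by auto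
  have [measurable]: "U \<in> sets borel" using U by simp
  have "emeasure lborel ((U - A) \<union> A) <= emeasure lborel (U - A) + emeasure lborel A"
   by (rule emeasure_subadditive) auto
  also have "(U - A) \<union> A = U" using U(2) by auto
  finally have le: "emeasure lborel U <= emeasure lborel (U - A) + emeasure lborel A" .
  have "emeasure lborel (U - A) < \<infinity>"
   using U(3) by (rule less_trans) simp
  then have Ufin: "emeasure lborel U < \<infinity>"
   using base(2) by (intro le_less_trans[OF le]) simp
  have "(LB x. \<bar>indicator A x - indicator U x :: real\<bar>) = (LB x. indicator (U - A) x)"
   using U(2) by (intro integral_eqI) (auto simp: indicator_def)
  also have "... = measure lborel (U - A)" by simp
  also have "... <= e"
   using U(3) \<open>e > 0\<close> by (metis enn2real_leI less_imp_le measure_def)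
  finally show "\<exists>s::'a => real. integrable lborel s \<and> (LB x. \<bar>indicator A x - s x\<bar>) <= e \<and>
    (%n. LB x. \<bar>s (x + h n) - s x\<bar>) ~~> 0"
   using L1_translation_open[OF U(1) Ufin h] Ufin by (intro exI[of _ "indicator U"]) auto
 qed
 then have "(%n. \<bar>c\<bar> * (LB x. \<bar>indicator A (x + h n) - indicator A x :: real\<bar>)) ~~> \<bar>c\<bar> * 0"
  by (rule tendsto_mult_left)
 also have "(%n. \<bar>c\<bar> * (LB x. \<bar>indicator A (x + h n) - indicator A x :: real\<bar>)) =
   (%n. LB x. \<bar>indicator A (x + h n) *\<^sub>R c - indicator A x *\<^sub>R c\<bar>)"
  by (subst integral_mult_right_zero[symmetric]) (simp add: abs_mult[symmetric] algebra_simps)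
 finally show ?case by simp
next
 case (add f g)
 have lim: "(%n. (LB x. \<bar>f (x + h n) - f x\<bar>) + (LB x. \<bar>g (x + h n) - g x\<bar>)) ~~> 0 + 0"
  by (rule tendsto_add[OF add.IH])
 have le: "(LB x. \<bar>f (x + a) + g (x + a) - (f x + g x)\<bar>) \<le>
   (LB x. \<bar>f (x + a) - f x\<bar>) + (LB x. \<bar>g (x + a) - g x\<bar>)" for a
 proof -
  note it = integrable_lborel_translate[OF add.hyps(1), of a] integrable_lborel_translate[OF add.hyps(2), of a]
  have i: "integrable lborel (%x. \<bar>f (x + a) - f x\<bar>)" "integrable lborel (%x. \<bar>g (x + a) - g x\<bar>)"
   using add.hyps it by auto
  have "(LB x. \<bar>f (x + a) + g (x + a) - (f x + g x)\<bar>) <= (LB x. \<bar>f (x + a) - f x\<bar> + \<bar>g (x + a) - g x\<bar>)"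
   by (rule integral_mono) (use i add.hyps it in auto)
  then show ?thesis using i by simp
 qed
 show ?case
  by (rule tendsto_sandwich[OF _ _ tendsto_const lim[unfolded add_0_right]]; rule always_eventually; rule allI)
    (simp, rule le)
next
 case (lim f s)
 show ?case
 proof (rule L1_translation_limit[OF lim.hyps(4)])
  fix e :: real assume "e > 0"
  have [measurable]: "f \<in> Borel" "\<And>i. s i \<in> Borel"
   using lim.hyps(1)[THEN integrable_meas] lim.hyps(4)[THEN integrable_meas] by auto
  have "(%i. LB x. \<bar>f x - s i x\<bar>) ~~> integral\<^sup>L lborel (%x::'a. 0)"
  proof (rule integral_dominated_convergence[of "%x. 0" lborel "%i x. \<bar>f x - s i x\<bar>" "%x. 3 * norm (f x)"])
   show "AE x in lborel. (%i. \<bar>f x - s i x\<bar>) ~~> 0"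
   proof (rule AE_I2)
    fix x
    have "(%i. \<bar>f x - s i x\<bar>) ~~> \<bar>f x - f x\<bar>"
     using lim.hyps(2)[of x] by (intro tendsto_intros) auto
    then show "(%i. \<bar>f x - s i x\<bar>) ~~> 0" by simp
   qed
   show "AE x in lborel. norm \<bar>f x - s i x\<bar> <= 3 * norm (f x)" for i
    using lim.hyps(3)[of _ i] by (intro AE_I2) (smt (verit) UNIV_I real_norm_def space_lborel)
  qed (use lim.hyps(4) in auto)
  then have "(%i. LB x. \<bar>f x - s i x\<bar>) ~~> 0" by simp
  from LIMSEQ_D[OF this \<open>e > 0\<close>] obtain i where "norm ((LB x. \<bar>f x - s i x\<bar>) - 0) < e" by blast
  then show "\<exists>s. integrable lborel s \<and> (LB x. \<bar>f x - s x\<bar>) <= e \<and> (%n. LB x. \<bar>s (x + h n) - s x\<bar>) ~~> 0"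
   using lim.hyps(1) lim.IH by (intro exI[of _ "s i"]) auto
 qed
qed

lemma abs_diff_square_le: "0 <= a ==> 0 <= b ==> (a - b)\<^sup>2 <= \<bar>a\<^sup>2 - b\<^sup>2\<bar>" for a b :: real
proof -
 assume ab: "0 <= a" "0 <= b"
 have "(a - b)\<^sup>2 = \<bar>a - b\<bar> * \<bar>a - b\<bar>" by (simp add: power2_eq_square)
 also have "... <= \<bar>a + b\<bar> * \<bar>a - b\<bar>" using ab by (intro mult_right_mono) auto
 also have "... = \<bar>a\<^sup>2 - b\<^sup>2\<bar>" by (simp add: power2_eq_square abs_mult[symmetric] algebra_simps)
 finally show ?thesis .
qed

text \<open>Reduces L^2 continuity of translations to L^1 continuity of four squared functions:
  nonnegative reals satisfy (a - b)^2 <= |a^2 - b^2|, and splitting real and imaginary part into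
  positive and negative parts reaches that case.\<close>

lemma cmod_diff_square_le:
 "(cmod (z - w))\<^sup>2 <= 2 * (\<bar>(max 0 (Re z))\<^sup>2 - (max 0 (Re w))\<^sup>2\<bar> + \<bar>(max 0 (- Re z))\<^sup>2 - (max 0 (- Re w))\<^sup>2\<bar>
   + \<bar>(max 0 (Im z))\<^sup>2 - (max 0 (Im w))\<^sup>2\<bar> + \<bar>(max 0 (- Im z))\<^sup>2 - (max 0 (- Im w))\<^sup>2\<bar>)"
proof -
 have p2: "(p - q)\<^sup>2 <= 2 * p\<^sup>2 + 2 * q\<^sup>2" for p q :: real
  using zero_le_power2[of "p + q"] unfolding power2_sum power2_diff by linarith
 have *: "(a - b)\<^sup>2 <= 2 * (\<bar>(max 0 a)\<^sup>2 - (max 0 b)\<^sup>2\<bar> + \<bar>(max 0 (- a))\<^sup>2 - (max 0 (- b))\<^sup>2\<bar>)" for a b :: real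
 proof -
  have "a - b = (max 0 a - max 0 b) - (max 0 (- a) - max 0 (- b))" by auto
  then have "(a - b)\<^sup>2 <= 2 * (max 0 a - max 0 b)\<^sup>2 + 2 * (max 0 (- a) - max 0 (- b))\<^sup>2"
   using p2 by presburger
  also have "... <= 2 * (\<bar>(max 0 a)\<^sup>2 - (max 0 b)\<^sup>2\<bar> + \<bar>(max 0 (- a))\<^sup>2 - (max 0 (- b))\<^sup>2\<bar>)"
   using abs_diff_square_le[of "max 0 a" "max 0 b"] abs_diff_square_le[of "max 0 (-a)" "max 0 (-b)"] by simp
  finally show ?thesis .
 qed
 show ?thesis
  unfolding cmod_power2 minus_complex.sel
  by (rule order_trans[OF add_mono[OF *[of "Re z" "Re w"] *[of "Im z" "Im w"]]]) simp
qed

lemma sqnorm_translation: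
 fixes f :: "'a::euclidean_space => complex"
 assumes [measurable]: "f \<in> Borel" and fin: "sqnorm lborel f < \<infinity>" and h: "h ~~> 0"
 shows "(%n::nat. sqnorm lborel (%x. f (x + h n) - f x)) ~~> 0"
proof -
 have i: "integrable lborel (%x. (cmod (f x))\<^sup>2)"
  using fin unfolding sqnorm_def by (intro integrableI_bounded) auto
 have ip: "integrable lborel (%x. (max 0 (p (f x)))\<^sup>2)"
  if "\<And>z. \<bar>p z\<bar> <= cmod z" and [measurable]: "p \<in> Borel" for p :: "complex => real"
 proof (rule integrable_bd[OF i])
  show "AE x in lborel. norm ((max 0 (p (f x)))\<^sup>2) <= norm ((cmod (f x))\<^sup>2)"
  proof (rule AE_I2)
   fix x show "norm ((max 0 (p (f x)))\<^sup>2) <= norm ((cmod (f x))\<^sup>2)"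
    using that(1)[of "f x"] by (auto intro!: power_mono simp: max_def)
  qed
 qed measurable
 let ?D = "%p n x. \<bar>(max 0 (p (f (x + h n))))\<^sup>2 - (max 0 (p (f x)))\<^sup>2\<bar>"
 have lim: "(%n. LB x. ?D p n x) ~~> 0"
  if "\<And>z. \<bar>p z\<bar> <= cmod z" "p \<in> Borel" for p :: "complex => real"
  using L1_translation[OF ip[OF that] h] by simp
 have int: "integrable lborel (?D p n)"
  if "\<And>z. \<bar>p z\<bar> <= cmod z" "p \<in> Borel" for p :: "complex => real" and n
  using ip[OF that] integrable_lborel_translate[OF ip[OF that], of "h n"] by auto
 have p: "\<And>z. \<bar>Re z\<bar> <= cmod z" "Re \<in> Borel" "\<And>z. \<bar>- Re z\<bar> <= cmod z" "(%z. - Re z) \<in> Borel"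
   "\<And>z. \<bar>Im z\<bar> <= cmod z" "Im \<in> Borel" "\<And>z. \<bar>- Im z\<bar> <= cmod z" "(%z. - Im z) \<in> Borel"
  by (auto simp: abs_Re_le_cmod abs_Im_le_cmod)
 note L = lim[OF p(1,2)] lim[OF p(3,4)] lim[OF p(5,6)] lim[OF p(7,8)]
 note I = int[OF p(1,2)] int[OF p(3,4)] int[OF p(5,6)] int[OF p(7,8)]
 let ?S = "%n. 2 * ((LB x. ?D Re n x) + (LB x. ?D (%z. - Re z) n x) + (LB x. ?D Im n x) + (LB x. ?D (%z. - Im z) n x))"
 have bound: "sqnorm lborel (%x. f (x + h n) - f x) <= ennreal (?S n)" for n
 proof -
  have "sqnorm lborel (%x. f (x + h n) - f x) \<le>
   (NN x. ennreal (2 * (?D Re n x + ?D (%z. - Re z) n x + ?D Im n x + ?D (%z. - Im z) n x)))"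
   unfolding sqnorm_def by (intro nn_integral_mono ennreal_leI cmod_diff_square_le)
  also have "... = ennreal (LB x. 2 * (?D Re n x + ?D (%z. - Re z) n x + ?D Im n x + ?D (%z. - Im z) n x))"
   by (rule nn_integral_eq_integral) (intro integrable_mult_right Bochner_Integration.integrable_add I, auto)
  also have "(LB x. 2 * (?D Re n x + ?D (%z. - Re z) n x + ?D Im n x + ?D (%z. - Im z) n x)) = ?S n"
   using I[of n] by simp
  finally show ?thesis .
 qed
 have "?S ~~> 2 * (0 + 0 + 0 + 0)"
  by (intro tendsto_mult tendsto_add tendsto_const L)
 then have "(%n. ennreal (?S n)) ~~> ennreal (2 * (0 + 0 + 0 + 0))"
  by (rule tendsto_ennrealI)
 then have lim0: "(%n. ennreal (?S n)) ~~> 0"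
  by (simp only: add_0_right mult_zero_right ennreal_0)
 show ?thesis
  by (rule tendsto_sandwich[OF _ _ tendsto_const lim0]; rule always_eventually; rule allI)
    (simp, rule bound)
qed

lemma borel_measurable_cis [measurable]: "cis \<in> Borel"
 by (intro contI continuous_intros)

section \<open>The Fourier transform on L2\<close>

lemma gaussian_integrable_1d:
 assumes "s > 0"
 shows "integrable lborel (%t::real. exp (- t\<^sup>2 / (2 * s\<^sup>2)))"
proof -
 have "integrable lborel (normal_density 0 s)"
  using assms by (rule integrable_normal_density)
 then have "integrable lborel (%t. sqrt (2 * pi * s\<^sup>2) * normal_density 0 s t)"
  by (rule integrable_mult_right)
 also have "(%t. sqrt (2 * pi * s\<^sup>2) * normal_density 0 s t) = (%t. exp (- t\<^sup>2 / (2 * s\<^sup>2)))"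
  using assms by (auto simp: normal_density_def fun_eq_iff)
 finally show ?thesis .
qed

text \<open>After rescaling by \<open>s\<close> this is the characteristic function of the standard
  normal distribution.\<close>

lemma gaussian_fourier_1d:
 assumes s: "s > 0"
 shows "(LB t. cx (exp (- t\<^sup>2 / (2 * s\<^sup>2))) * cis (- 2 * pi * (t * u))) =
  cx (s * sqrt (2 * pi) * exp (- 2 * pi\<^sup>2 * s\<^sup>2 * u\<^sup>2))"
proof -
 have "(LB t. cx (exp (- t\<^sup>2 / (2 * s\<^sup>2))) * cis (- 2 * pi * (t * u)))
  = s *\<^sub>R (LB t. cx (exp (- (s * t)\<^sup>2 / (2 * s\<^sup>2))) * cis (- 2 * pi * (s * t * u)))"
  using lborel_integral_real_affine[of s "%t. cx (exp (- t\<^sup>2 / (2 * s\<^sup>2))) * cis (- 2 * pi * (t * u))" 0] s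
  by simp
 also have "(LB t. cx (exp (- (s * t)\<^sup>2 / (2 * s\<^sup>2))) * cis (- 2 * pi * (s * t * u))) =
  (LB t. sqrt (2 * pi) *\<^sub>R (std_normal_density t *\<^sub>R iexp ((- 2 * pi * s * u) * t)))"
  using s by (intro integral_eqI)
   (auto simp: std_normal_density_def power_mult_distrib scaleR_conv_of_real cis_conv_exp mult_ac)
 also have "... = sqrt (2 * pi) *\<^sub>R char std_normal_distribution (- 2 * pi * s * u)"
  unfolding char_def by (subst integral_density) (auto simp: scaleR_conv_of_real)
 finally show ?thesis
  by (simp add: char_std_normal_distribution scaleR_conv_of_real power_mult_distrib)
qed

lemma cis_sum: "finite A ==> cis (\<Sum>i\<in>A. f i) = (\<Prod>i\<in>A. cis (f i))"
 by (induction A rule: finite_induct) (auto simp: cis_mult[symmetric])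

lemma norm_square_Basis: "(norm (x::'a::euclidean_space))\<^sup>2 = (\<Sum>b\<in>Basis. (x \<bullet> b)\<^sup>2)"
 unfolding power2_norm_eq_inner by (subst euclidean_inner) (simp add: power2_eq_square)

lemma gaussian_prod:
 fixes x :: "'a::euclidean_space"
 shows "cx (exp (- (norm x)\<^sup>2 / (2 * s\<^sup>2))) * cis (- 2 * pi * (x \<bullet> y)) =
  (\<Prod>b\<in>Basis. cx (exp (- (x \<bullet> b)\<^sup>2 / (2 * s\<^sup>2))) * cis (- 2 * pi * ((x \<bullet> b) * (y \<bullet> b))))"
proof -
 have "- (norm x)\<^sup>2 / (2 * s\<^sup>2) = (\<Sum>b\<in>Basis. - (x \<bullet> b)\<^sup>2 / (2 * s\<^sup>2))"
  by (simp add: norm_square_Basis sum_divide_distrib sum_negf)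
 moreover have "- 2 * pi * (x \<bullet> y) = (\<Sum>b\<in>Basis. - 2 * pi * ((x \<bullet> b) * (y \<bullet> b)))"
  by (simp add: euclidean_inner[of x y] sum_distrib_left)
 ultimately show ?thesis
  by (simp only: exp_sum finite_Basis cis_sum of_real_prod prod.distrib)
qed

lemma lborel_prod_integral:
 fixes f :: "'a::euclidean_space => real => complex"
 assumes int: "\<And>b. b \<in> Basis ==> integrable lborel (f b)"
 shows "integrable lborel (%x. \<Prod>b\<in>Basis. f b (x \<bullet> b))"
  and "(LB x. (\<Prod>b\<in>Basis. f b (x \<bullet> b))) = (\<Prod>b\<in>Basis. LB t. f b t)"
proof -
 interpret product_sigma_finite "%_::'a. lborel :: real measure" ..
 have [measurable]: "b \<in> Basis ==> f b \<in> Borel" for b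
  using int[THEN integrable_meas] by simp
 have m: "(%x. \<Prod>b\<in>Basis. f b (x \<bullet> b)) \<in> Borel" by measurable
 have T: "(%g. \<Sum>b\<in>Basis. g b *\<^sub>R b) \<in> measurable (\<Pi>\<^sub>M b\<in>(Basis::'a set). lborel) borel" by measurable
 have eq: "(\<Prod>b\<in>Basis. f b ((\<Sum>c\<in>Basis. g c *\<^sub>R c) \<bullet> b)) = (\<Prod>b\<in>Basis. f b (g b))" for g
  by (intro prod.cong) auto
 have "integrable (\<Pi>\<^sub>M b\<in>(Basis::'a set). lborel) (%g. \<Prod>b\<in>Basis. f b (g b))"
  by (rule product_integrable_prod) (use int in auto)
 then show "integrable lborel (%x. \<Prod>b\<in>Basis. f b (x \<bullet> b))"
  by (subst lborel_eq, subst integrable_distr_eq[OF T m]) (simp only: eq)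
 show "(LB x. (\<Prod>b\<in>Basis. f b (x \<bullet> b))) = (\<Prod>b\<in>Basis. LB t. f b t)"
  by (subst lborel_eq, subst integral_distr[OF T m]) (simp only: eq, rule product_integral_prod, use int in auto)
qed

section \<open>Gaussian summation and Plancherel's theorem for integrable functions\<close>

definition gauss :: "real => 'a::euclidean_space => real" where
 "gauss s x = exp (- (norm x)\<^sup>2 / (2 * s\<^sup>2))"

text \<open>The Fourier transform of \<open>gauss s\<close>. It has total mass 1 and concentrates at
  the origin as \<open>s\<close> grows.\<close>

definition gauss_dual :: "real => 'a::euclidean_space => real" where
 "gauss_dual s x = (s * sqrt (2 * pi)) ^ DIM('a) * exp (- 2 * pi\<^sup>2 * s\<^sup>2 * (norm x)\<^sup>2)"

definition ft :: "('a::euclidean_space => complex) => 'a => complex" where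
 "ft f xi = (LB x. f x * cis (- 2 * pi * (x \<bullet> xi)))"

lemma measurable_gauss [measurable]: "gauss s \<in> Borel" "gauss_dual s \<in> Borel"
 unfolding gauss_def[abs_def] gauss_dual_def[abs_def] by measurable

lemma gauss_bounds: "0 < gauss s x" "gauss s x <= 1"
 by (auto simp: gauss_def)

lemma gauss_dual_nonneg: "s > 0 ==> 0 <= gauss_dual s x"
 by (simp add: gauss_dual_def)

lemma gauss_dual_le: "s > 0 ==> gauss_dual s (x::'a::euclidean_space) <= (s * sqrt (2 * pi)) ^ DIM('a)"
 unfolding gauss_dual_def by (intro mult_right_le_one_le) auto

lemma gauss_integrable:
 assumes "s > 0"
 shows "integrable lborel (%x::'a::euclidean_space. cx (gauss s x) * cis (- 2 * pi * (x \<bullet> y)))"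
 unfolding gauss_def gaussian_prod
proof (rule lborel_prod_integral(1))
 fix b :: 'a
 show "integrable lborel (%t. cx (exp (- t\<^sup>2 / (2 * s\<^sup>2))) * cis (- 2 * pi * (t * (y \<bullet> b))))"
  by (rule integrable_bd[OF gaussian_integrable_1d[OF assms]]) (auto simp: norm_mult)
qed

lemma gauss_fourier:
 assumes s: "s > 0"
 shows "(LB x. cx (gauss s x) * cis (- 2 * pi * (x \<bullet> (y::'a::euclidean_space)))) = gauss_dual s y"
proof -
 have int: "integrable lborel (%t. cx (exp (- t\<^sup>2 / (2 * s\<^sup>2))) * cis (- 2 * pi * (t * u)))" for u
  by (rule integrable_bd[OF gaussian_integrable_1d[OF s]]) (auto simp: norm_mult)
 have "(LB x. cx (gauss s x) * cis (- 2 * pi * (x \<bullet> y))) =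
  (\<Prod>b\<in>(Basis::'a set). cx (s * sqrt (2 * pi) * exp (- 2 * pi\<^sup>2 * s\<^sup>2 * (y \<bullet> b)\<^sup>2)))"
  unfolding gauss_def gaussian_prod
  by (subst lborel_prod_integral(2)[OF int]) (simp only: gaussian_fourier_1d[OF s])
 also have "... = cx (\<Prod>b\<in>(Basis::'a set). s * sqrt (2 * pi) * exp (- 2 * pi\<^sup>2 * s\<^sup>2 * (y \<bullet> b)\<^sup>2))"
  by (simp only: of_real_prod)
 also have "(\<Prod>b\<in>(Basis::'a set). s * sqrt (2 * pi) * exp (- 2 * pi\<^sup>2 * s\<^sup>2 * (y \<bullet> b)\<^sup>2)) = gauss_dual s y"
  by (simp only: prod.distrib prod_constant gauss_dual_def exp_sum[symmetric] finite_Basis sum_distrib_left[symmetric] norm_square_Basis[symmetric])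
    (simp add: power_mult_distrib)
 finally show ?thesis .
qed

lemma gauss_real_integrable: "s > 0 ==> integrable lborel (gauss s :: 'a::euclidean_space => real)"
 using gauss_integrable[of s "0::'a", THEN integrable_norm]
 by (simp add: norm_mult gauss_def[abs_def])

lemma gauss_dual_scale: "s > 0 ==> gauss_dual s (x::'a::euclidean_space) = s ^ DIM('a) * gauss_dual 1 (s *\<^sub>R x)"
 by (simp add: gauss_dual_def power_mult_distrib)

lemma gauss_dual_integral:
 "integrable lborel (gauss_dual 1 :: 'a::euclidean_space => real)"
 "(LB x. gauss_dual 1 (x::'a)) = 1"
proof -
 \<comment> \<open>With this \<open>c\<close> the exponents agree, since 1 / (2 c^2) = 2 pi^2. The
   mass of a Gaussian is then read off as its Fourier transform at 0.\<close>
 define c where "c = 1 / (2 * pi)"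
 have c: "c > 0" by (simp add: c_def)
 have eq: "gauss_dual 1 x = sqrt (2 * pi) ^ DIM('a) * gauss c x" for x :: 'a
  by (simp add: gauss_dual_def gauss_def c_def power2_eq_square)
 show "integrable lborel (gauss_dual 1 :: 'a => real)"
  unfolding eq[abs_def] by (intro integrable_mult_right gauss_real_integrable c)
 have "cx (LB x. gauss c (x::'a)) = (LB x. cx (gauss c (x::'a)))"
  by (rule integral_complex_of_real[symmetric])
 also have "... = gauss_dual c (0::'a)"
  using gauss_fourier[OF c, of "0::'a"] by simp
 finally have "(LB x. gauss c (x::'a)) = gauss_dual c (0::'a)"
  by (simp only: of_real_eq_iff)
 then have "(LB x. gauss_dual 1 (x::'a)) = sqrt (2 * pi) ^ DIM('a) * gauss_dual c (0::'a)"
  by (simp add: eq)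
 also have "... = (sqrt (2 * pi) * (c * sqrt (2 * pi))) ^ DIM('a)"
  by (simp only: gauss_dual_def power_mult_distrib) simp
 also have "sqrt (2 * pi) * (c * sqrt (2 * pi)) = 1"
  by (simp add: c_def)
 finally show "(LB x. gauss_dual 1 (x::'a)) = 1" by simp
qed

lemma measurable_ft [measurable]:
 assumes [measurable]: "f \<in> Borel"
 shows "ft f \<in> Borel"
 unfolding ft_def[abs_def] by measurable

lemma integrable_cis:
 assumes f: "integrable lborel (f::'a::euclidean_space => complex)" and [measurable]: "p \<in> Borel"
 shows "integrable lborel (%x. f x * cis (p x))"
 by (rule integrable_bd[OF integrable_norm[OF f]])
   (use integrable_meas[OF f] in \<open>auto simp: norm_mult\<close>)

lemma norm_ft_le: "norm (ft f xi) <= (LB x. norm (f x))"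
proof -
 have "norm (ft f xi) <= (LB x. norm (f x * cis (- 2 * pi * (x \<bullet> xi))))"
  unfolding ft_def by (rule integral_norm_bound)
 then show ?thesis by (simp add: norm_mult)
qed

lemma integrable_prod_lborel:
 fixes f :: "'a::euclidean_space => complex" and g :: "'b::euclidean_space => complex"
 assumes f: "integrable lborel f" and g: "integrable lborel g"
 shows "integrable (lborel \<Otimes>\<^sub>M lborel) (%(x, y). f x * g y)"
proof -
 have [measurable]: "f \<in> Borel" "g \<in> Borel"
  using f g by (auto dest: integrable_meas)
 show ?thesis
  by (rule lborel_pair.Fubini_integrable) (use f g in \<open>auto simp: norm_mult\<close>)
qed

lemma ft_multiplication:
 fixes f g :: "'a::euclidean_space => complex"
 assumes f: "integrable lborel f" and g: "integrable lborel g"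
 shows "(LB xi. ft f xi * g xi) = (LB x. f x * ft g x)"
proof -
 have [measurable]: "f \<in> Borel" "g \<in> Borel"
  using f g by (auto dest: integrable_meas)
 let ?h = "%x y. f x * g y * cis (- 2 * pi * (x \<bullet> y))"
 have i: "integrable (lborel \<Otimes>\<^sub>M lborel) (case_prod ?h)"
  by (rule integrable_bd[OF integrable_prod_lborel[OF f g]]) (auto simp: norm_mult)
 have "(LB y. LB x. ?h x y) = (LB x. LB y. ?h x y)"
  by (rule lborel_pair.Fubini_integral[OF i])
 moreover have "(LB x. ?h x y) = ft f y * g y" for y
 proof -
  have "(LB x. ?h x y) = (LB x. (f x * cis (- 2 * pi * (x \<bullet> y))) * g y)"
   by (intro integral_eqI) auto
  then show ?thesis by (simp add: ft_def)
 qed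
 moreover have "(LB y. ?h x y) = f x * ft g x" for x
 proof -
  have "(LB y. ?h x y) = (LB y. f x * (g y * cis (- 2 * pi * (y \<bullet> x))))"
   by (intro integral_eqI) (auto simp: inner_commute)
  then show ?thesis by (simp add: ft_def)
 qed
 ultimately show ?thesis by simp
qed

lemma lborel_integral_scale:
 fixes F :: "'a::euclidean_space => complex"
 assumes c: "c \<noteq> 0" and [measurable]: "F \<in> Borel"
 shows "(LB x. F x) = (\<bar>c\<bar> ^ DIM('a)) *\<^sub>R (LB x. F (c *\<^sub>R x))"
 by (subst lborel_affine[OF c, of 0]) (simp add: integral_density integral_distr)

lemma ft_gauss_convolution:
 fixes f :: "'a::euclidean_space => complex"
 assumes f: "integrable lborel f" and s: "s > 0"
 shows "ft (%xi. cx (gauss s xi) * cnj (ft f xi)) x =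
  (LB z. cnj (f (x + z)) * cx (gauss_dual s z))"
proof -
 have [measurable]: "f \<in> Borel"
  using f by (auto dest: integrable_meas)
 \<comment> \<open>Modulating the Gaussian by \<open>x\<close> translates its transform by
   \<open>x\<close>, so the multiplication formula produces a convolution.\<close>
 let ?G = "%xi. cx (gauss s xi) * cis (- 2 * pi * (xi \<bullet> (- x)))"
 have G: "integrable lborel ?G" by (rule gauss_integrable[OF s])
 have ftG: "ft ?G y = gauss_dual s (y - x)" for y
 proof -
  have "ft ?G y = (LB xi. cx (gauss s xi) * cis (- 2 * pi * (xi \<bullet> (y - x))))"
   unfolding ft_def
  proof (rule integral_eqI)
   fix xi :: 'a
   have "cis (- 2 * pi * (xi \<bullet> (- x))) * cis (- 2 * pi * (xi \<bullet> y)) = cis (- 2 * pi * (xi \<bullet> (y - x)))"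
    unfolding cis_mult by (rule arg_cong[where f=cis]) (simp add: inner_diff_right algebra_simps)
   then show "?G xi * cis (- 2 * pi * (xi \<bullet> y)) = cx (gauss s xi) * cis (- 2 * pi * (xi \<bullet> (y - x)))"
    by (simp only: mult.assoc)
  qed simp
  then show ?thesis by (simp only: gauss_fourier[OF s])
 qed
 have "ft (%xi. cx (gauss s xi) * cnj (ft f xi)) x = (LB xi. cnj (ft f xi * ?G xi))"
  unfolding ft_def[of "%xi. cx (gauss s xi) * cnj (ft f xi)"]
  by (rule integral_eqI) (auto simp: cis_cnj)
 also have "... = cnj (LB xi. ft f xi * ?G xi)"
  by (rule Bochner_Integration.integral_cnj)
 also have "... = cnj (LB y. f y * cx (gauss_dual s (y - x)))"
  by (simp only: ft_multiplication[OF f G] ftG)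
 also have "(LB y. f y * cx (gauss_dual s (y - x))) = (LB z. f (z + x) * cx (gauss_dual s (z + x - x)))"
  by (rule integral_lborel_translate[symmetric]) measurable
 also have "cnj ... = (LB z. cnj (f (z + x) * cx (gauss_dual s (z + x - x))))"
  by (rule Bochner_Integration.integral_cnj[symmetric])
 also have "... = (LB z. cnj (f (x + z)) * cx (gauss_dual s z))"
  by (rule integral_eqI) (auto simp: add.commute)
 finally show ?thesis .
qed

text \<open>The Gaussian factor makes all integrals absolutely convergent, so the multiplication
  formula and Fubini apply to |ft f|^2 written as a product with the conjugate. What appears is the
  autocorrelation of \<open>f\<close>, averaged with the dual Gaussian.\<close>

lemma ft_gauss_pairing:
 fixes f :: "'a::euclidean_space => complex"
 assumes f: "integrable lborel f" and s: "s > 0"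
 shows "(LB xi. cx ((cmod (ft f xi))\<^sup>2 * gauss s xi)) =
  (LB z. cx (gauss_dual s z) * cinner lborel f (%x. f (x + z)))"
proof -
 have [measurable]: "f \<in> Borel"
  using f by (auto dest: integrable_meas)
 let ?g = "%xi. cx (gauss s xi) * cnj (ft f xi)"
 define C where "C = (LB x. norm (f x))"
 define K where "K = (s * sqrt (2 * pi)) ^ DIM('a)"
 have C: "C \<ge> 0" "\<And>xi. norm (ft f xi) <= C" unfolding C_def by (auto intro: norm_ft_le integral_nonneg_AE)
 have K: "K \<ge> 0" "\<And>z::'a. 0 <= gauss_dual s z" "\<And>z::'a. gauss_dual s z <= K"
  unfolding K_def using s by (auto intro: gauss_dual_le gauss_dual_nonneg)
 have kb: "cmod (a * cnj b * cx (gauss_dual s z)) <= K * cmod a * cmod b" for a b :: complex and z :: 'a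
  using mult_right_mono[OF K(3)[of z], of "cmod a * cmod b"] K(2)[of z] by (simp add: norm_mult mult_ac)
 have g: "integrable lborel ?g"
 proof (rule integrable_bd[OF integrable_mult_right[where c=C, OF gauss_real_integrable[OF s]]])
  show "AE xi in lborel. norm (?g xi) <= norm (C * gauss s xi)"
  proof (rule AE_I2)
   fix xi :: 'a
   have "norm (?g xi) = cmod (ft f xi) * gauss s xi"
    using gauss_bounds(1)[of s xi] by (simp add: norm_mult)
   also have "... <= C * gauss s xi"
    using C gauss_bounds(1)[of s xi] by (intro mult_right_mono) auto
   finally show "norm (?g xi) <= norm (C * gauss s xi)" by simp
  qed
 qed measurable
 have "(LB xi. cx ((cmod (ft f xi))\<^sup>2 * gauss s xi)) = (LB xi. ft f xi * ?g xi)"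
 proof (rule integral_eqI)
  fix xi :: 'a
  have "cx ((cmod (ft f xi))\<^sup>2 * gauss s xi) = (ft f xi * cnj (ft f xi)) * gauss s xi"
   by (simp only: of_real_mult complex_norm_square)
  then show "cx ((cmod (ft f xi))\<^sup>2 * gauss s xi) = ft f xi * ?g xi"
   by (simp only: mult_ac)
 qed simp
 also have "... = (LB x. f x * (LB z. cnj (f (x + z)) * cx (gauss_dual s z)))"
  by (simp only: ft_multiplication[OF f g] ft_gauss_convolution[OF f s])
 also have "... = (LB x. LB z. f x * cnj (f (x + z)) * cx (gauss_dual s z))"
  by (simp add: mult.assoc)
 also have "... = (LB z. LB x. f x * cnj (f (x + z)) * cx (gauss_dual s z))"
 proof (rule lborel_pair.Fubini_integral[symmetric], rule lborel_pair.Fubini_integrable)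
  note ft = integrable_lborel_translate[OF f]
  have it: "integrable lborel (%z. f (x + z))" for x
   using ft[of x] by (simp add: add.commute)
  have inz: "integrable lborel (%z. f x * cnj (f (x + z)) * cx (gauss_dual s z))" for x
  proof (rule integrable_bd[OF integrable_mult_right[where c="K * norm (f x)", OF integrable_norm[OF it[of x]]]])
   show "AE z in lborel. norm (f x * cnj (f (x + z)) * cx (gauss_dual s z)) <= norm (K * norm (f x) * norm (f (x + z)))"
    using kb K(1) by (intro AE_I2) simp
  qed measurable
  have eqC: "(LB z. norm (f (x + z))) = C" for x
   using integral_lborel_translate[of "%z. norm (f z)" x] by (simp add: C_def add.commute)
  show "integrable lborel (%x. LB z. norm (case (x, z) of (x, z) => f x * cnj (f (x + z)) * cx (gauss_dual s z)))"
  proof (rule integrable_bd[OF integrable_mult_right[where c="K * C", OF integrable_norm[OF f]]])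
   show "AE x in lborel. norm (LB z. norm (case (x, z) of (x, z) => f x * cnj (f (x + z)) * cx (gauss_dual s z))) <= norm (K * C * norm (f x))"
   proof (rule AE_I2)
    fix x
    have "norm (LB z. norm (f x * cnj (f (x + z)) * cx (gauss_dual s z))) = (LB z. norm (f x * cnj (f (x + z)) * cx (gauss_dual s z)))"
     by (simp add: integral_nonneg_AE)
    also have "... <= (LB z. K * norm (f x) * norm (f (x + z)))"
     by (intro integral_mono integrable_norm inz integrable_mult_right it kb)
    also have "... = K * C * norm (f x)"
     by (simp add: eqC)
    finally show "norm (LB z. norm (case (x, z) of (x, z) => f x * cnj (f (x + z)) * cx (gauss_dual s z))) <= norm (K * C * norm (f x))"
     using K C by simp
   qed
  qed measurable
  show "AE x in lborel. integrable lborel (%y. case (x, y) of (x, z) => f x * cnj (f (x + z)) * cx (gauss_dual s z))"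
   using inz by auto
 qed measurable
 also have "... = (LB z. cx (gauss_dual s z) * cinner lborel f (%x. f (x + z)))"
  by (simp add: cinner_def mult.commute)
 finally show ?thesis .
qed

text \<open>Scaling \<open>z\<close> by 1/(n+1) turns the dual Gaussian into a fixed density of mass
  1 and moves the argument of the autocorrelation to 0. There it is continuous, by translation
  continuity in L^2, and its value is the squared norm; Cauchy-Schwarz supplies the dominating
  bound.\<close>

lemma autocorrelation_limit:
 fixes f :: "'a::euclidean_space => complex"
 assumes [measurable]: "f \<in> Borel" and fin: "sqnorm lborel f < \<infinity>"
 shows "(%n::nat. LB z. cx (gauss_dual (real (Suc n)) z) * cinner lborel f (%x. f (x + z)))
  ~~> cx (enn2real (sqnorm lborel f))"
proof -
 define A where "A z = cinner lborel f (%x. f (x + z))" for z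
 define c where "c n = 1 / real (Suc n)" for n :: nat
 have [measurable]: "A \<in> Borel"
  unfolding A_def[abs_def] cinner_def by measurable
 have tr: "sqnorm lborel (%x. f (x + z)) = sqnorm lborel f" for z
  unfolding sqnorm_def by (rule nn_integral_lborel_translate[where F="%x. ennreal ((cmod (f x))\<^sup>2)"]) measurable
 have Abd: "cmod (A z) <= enn2real (sqnorm lborel f)" for z
 proof -
  have "(cmod (A z))\<^sup>2 <= (enn2real (sqnorm lborel f))\<^sup>2"
   using cmod_cinner_le[of f lborel "%x. f (x + z)"] fin by (simp add: A_def tr power2_eq_square)
  then show ?thesis by (rule power2_le_imp_le) simp
 qed
 have Alim: "(%n. A (c n *\<^sub>R w)) ~~> A 0" for w
  unfolding A_def
 proof (rule cinner_tendsto)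
  have "c ~~> 0" unfolding c_def[abs_def] by (rule LIMSEQ_Suc[OF lim_1_over_n])
  then have "(%n. c n *\<^sub>R w) ~~> 0 *\<^sub>R w" by (intro tendsto_intros)
  then show "(%n. sqnorm lborel (%x. f (x + c n *\<^sub>R w) - f (x + 0))) ~~> 0"
   using sqnorm_translation[of f "%n. c n *\<^sub>R w"] fin by simp
 qed (use fin in \<open>auto simp: sqnorm_def\<close>)
 have "(%n. LB w. cx (gauss_dual 1 w) * A (c n *\<^sub>R w)) ~~> (LB w. cx (gauss_dual 1 (w::'a)) * A 0)"
 proof (rule integral_dominated_convergence[where w="%w. gauss_dual 1 w * enn2real (sqnorm lborel f)"])
  show "AE w in lborel. (%n. cx (gauss_dual 1 w) * A (c n *\<^sub>R w)) ~~> cx (gauss_dual 1 w) * A (0::'a)"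
   by (intro AE_I2 tendsto_intros Alim)
  show "AE w in lborel. norm (cx (gauss_dual 1 w) * A (c n *\<^sub>R w)) <= gauss_dual 1 w * enn2real (sqnorm lborel f)" for n
   using Abd by (intro AE_I2) (auto simp: norm_mult gauss_dual_nonneg intro!: mult_left_mono)
 qed (auto intro!: integrable_mult_left gauss_dual_integral)
 also have "(LB w. cx (gauss_dual 1 (w::'a)) * A 0) = A 0"
 proof -
  have "(LB w. cx (gauss_dual 1 (w::'a))) = 1"
   using integral_complex_of_real[of lborel "gauss_dual 1 :: 'a => real"] by (simp add: gauss_dual_integral)
  then show ?thesis by simp
 qed
 also have "A 0 = cx (enn2real (sqnorm lborel f))"
  using fin by (simp add: A_def sqnorm_eq_cinner)
 also have "(%n. LB w. cx (gauss_dual 1 w) * A (c n *\<^sub>R w)) =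
  (%n. LB z. cx (gauss_dual (real (Suc n)) z) * A z)"
 proof
  fix n
  have c: "c n > 0" "c n \<noteq> 0" "real (Suc n) * c n = 1" by (auto simp: c_def)
  have "(LB z. cx (gauss_dual (real (Suc n)) z) * A z)
   = (c n ^ DIM('a)) *\<^sub>R (LB w. cx (gauss_dual (real (Suc n)) (c n *\<^sub>R w)) * A (c n *\<^sub>R w))"
   using lborel_integral_scale[OF c(2), of "%z. cx (gauss_dual (real (Suc n)) z) * A z"] c by simp
  also have "... = (LB w. (c n ^ DIM('a)) *\<^sub>R (cx (gauss_dual (real (Suc n)) (c n *\<^sub>R w)) * A (c n *\<^sub>R w)))"
   by simp
  also have "... = (LB w. cx (gauss_dual 1 w) * A (c n *\<^sub>R w))"
  proof (rule integral_eqI)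
   fix w :: 'a
   have "c n ^ DIM('a) * gauss_dual (real (Suc n)) (c n *\<^sub>R w) = (real (Suc n) * c n) ^ DIM('a) * gauss_dual 1 ((real (Suc n) * c n) *\<^sub>R w)"
    by (subst gauss_dual_scale) (auto simp: power_mult_distrib simp del: of_nat_Suc)
   also have "... = gauss_dual 1 w" by (simp only: c) simp
   finally show "(c n ^ DIM('a)) *\<^sub>R (cx (gauss_dual (real (Suc n)) (c n *\<^sub>R w)) * A (c n *\<^sub>R w)) = cx (gauss_dual 1 w) * A (c n *\<^sub>R w)"
    by (simp only: scaleR_conv_of_real mult.assoc[symmetric] of_real_mult[symmetric])
  qed simp
  finally show "(LB w. cx (gauss_dual 1 w) * A (c n *\<^sub>R w)) = (LB z. cx (gauss_dual (real (Suc n)) z) * A z)" ..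
 qed
 finally show ?thesis unfolding A_def .
qed

text \<open>The Gaussian means of |ft f|^2 converge to the squared norm of \<open>f\<close>. Fatou's
  lemma gives one inequality, and the bound of \<open>gauss\<close> by 1 the other.\<close>

theorem plancherel_L1:
 fixes f :: "'a::euclidean_space => complex"
 assumes f: "integrable lborel f" and fin: "sqnorm lborel f < \<infinity>"
 shows "sqnorm lborel (ft f) = sqnorm lborel f"
proof -
 have [measurable]: "f \<in> Borel"
  using f by (auto dest: integrable_meas)
 define C where "C = (LB x. norm (f x))"
 have C: "C \<ge> 0" "\<And>xi. norm (ft f xi) <= C" unfolding C_def by (auto intro: norm_ft_le integral_nonneg_AE)
 define E where "E n = (NN xi. ennreal ((cmod (ft f xi))\<^sup>2 * gauss (real (Suc n)) xi))" for n :: nat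
 define r where "r n = (LB xi. (cmod (ft f xi))\<^sup>2 * gauss (real (Suc n)) xi)" for n :: nat
 have Er: "E n = ennreal (r n)" for n
  unfolding E_def r_def
 proof (rule nn_integral_eq_integral)
  show "integrable lborel (%xi. (cmod (ft f xi))\<^sup>2 * gauss (real (Suc n)) xi)"
  proof (rule integrable_bd[OF integrable_mult_right[where c="C\<^sup>2", OF gauss_real_integrable[of "real (Suc n)"]]])
   show "AE xi in lborel. norm ((cmod (ft f xi))\<^sup>2 * gauss (real (Suc n)) xi) <= norm (C\<^sup>2 * gauss (real (Suc n)) xi)"
    using C by (intro AE_I2) (auto simp: abs_mult intro!: mult_right_mono power_mono)
  qed auto
  show "AE xi in lborel. 0 <= (cmod (ft f xi))\<^sup>2 * gauss (real (Suc n)) xi"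
   by (intro AE_I2 mult_nonneg_nonneg) (auto intro: less_imp_le gauss_bounds)
 qed
 have "cx (r n) = (LB xi. cx ((cmod (ft f xi))\<^sup>2 * gauss (real (Suc n)) xi))" for n
  unfolding r_def by (rule integral_complex_of_real[symmetric])
 then have "(%n. cx (r n)) ~~> cx (enn2real (sqnorm lborel f))"
  using autocorrelation_limit[of f] fin by (simp only: ft_gauss_pairing[OF f]) (simp add: ft_gauss_pairing[OF f])
 then have "r ~~> enn2real (sqnorm lborel f)"
  using tendsto_of_real_iff by blast
 then have "E ~~> ennreal (enn2real (sqnorm lborel f))"
  unfolding Er[abs_def] by (rule tendsto_ennrealI)
 then have Elim: "E ~~> sqnorm lborel f" using fin by (simp only: ennreal_enn2real infinity_ennreal_def)
 show ?thesis
 proof (rule antisym)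
  have gl: "(%n. gauss (real (Suc n)) xi) ~~> 1" for xi :: 'a
  proof -
   have "(%n. inverse (real (Suc n))) ~~> 0" by (rule LIMSEQ_inverse_real_of_nat)
   then have "(%n. exp (- (norm xi)\<^sup>2 * (inverse (real (Suc n)))\<^sup>2 / 2)) ~~> exp (- (norm xi)\<^sup>2 * 0\<^sup>2 / 2)"
    by (intro tendsto_intros) auto
   moreover have "exp (- (norm xi)\<^sup>2 * (inverse (real (Suc n)))\<^sup>2 / 2) = gauss (real (Suc n)) xi" for n
    unfolding gauss_def by (rule arg_cong[where f=exp]) (simp add: field_simps power_divide)
   ultimately show ?thesis by simp
  qed
  have "sqnorm lborel (ft f) = (NN xi. liminf (%n. ennreal ((cmod (ft f xi))\<^sup>2 * gauss (real (Suc n)) xi)))"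
   unfolding sqnorm_def
  proof (rule nn_integral_cong)
   fix xi :: 'a
   have "(%n. ennreal ((cmod (ft f xi))\<^sup>2 * gauss (real (Suc n)) xi)) ~~> ennreal ((cmod (ft f xi))\<^sup>2 * 1)"
    by (intro tendsto_ennrealI tendsto_mult tendsto_const gl)
   then show "ennreal ((cmod (ft f xi))\<^sup>2) = liminf (%n. ennreal ((cmod (ft f xi))\<^sup>2 * gauss (real (Suc n)) xi))"
    using lim_imp_Liminf[of sequentially "%n. ennreal ((cmod (ft f xi))\<^sup>2 * gauss (real (Suc n)) xi)"] by simp
  qed
  also have "... <= liminf E"
   unfolding E_def[abs_def] by (rule nn_integral_liminf) measurable
  also have "... = sqnorm lborel f"
   by (rule lim_imp_Liminf[OF _ Elim]) simp
  finally show "sqnorm lborel (ft f) <= sqnorm lborel f" .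
 next
  have "E n <= sqnorm lborel (ft f)" for n
   unfolding E_def sqnorm_def
  proof (intro nn_integral_mono ennreal_leI)
   fix xi :: 'a
   show "(cmod (ft f xi))\<^sup>2 * gauss (real (Suc n)) xi <= (cmod (ft f xi))\<^sup>2"
    using gauss_bounds[of "real (Suc n)" xi] by (intro mult_right_le_one_le) auto
  qed
  then show "sqnorm lborel f <= sqnorm lborel (ft f)"
   by (intro LIMSEQ_le_const2[OF Elim]) auto
 qed
qed

lemma cinner_polarization:
 assumes [measurable]: "f \<in> borel_measurable M" "g \<in> borel_measurable M"
  and fin: "sqnorm M f < \<infinity>" "sqnorm M g < \<infinity>"
 defines "N \<equiv> %h. cx (enn2real (sqnorm M h))"
 shows "4 * cinner M f g = N (%x. f x + g x) - N (%x. f x - g x)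
   + \<i> * N (%x. f x + \<i> * g x) - \<i> * N (%x. f x - \<i> * g x)"
proof -
 have exp: "N (%x. f x + c * g x) = cinner M f f + cnj c * cinner M f g + c * cinner M g f + c * cnj c * cinner M g g" for c
 proof -
  have cg: "(%x. c * g x) \<in> borel_measurable M" "sqnorm M (%x. c * g x) < \<infinity>"
   using fin by (auto simp: sqnorm_cmult ennreal_mult_less_top)
  have fcg: "sqnorm M (%x. f x + c * g x) < \<infinity>"
   by (rule sqnorm_less_top_add(1)) (use cg fin in auto)
  have i: "integrable M (%x. f x * cnj (f x))" "integrable M (%x. f x * cnj (c * g x))"
    "integrable M (%x. c * g x * cnj (f x))" "integrable M (%x. c * g x * cnj (c * g x))"
   by (rule integrable_cinner; use fin cg in simp)+
  have "N (%x. f x + c * g x) = cinner M (%x. f x + c * g x) (%x. f x + c * g x)"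
   unfolding N_def by (rule sqnorm_eq_cinner[symmetric]) (use fcg in auto)
  also have "... = cinner M f (%x. f x + c * g x) + cinner M (%x. c * g x) (%x. f x + c * g x)"
   by (rule cinner_add_left; rule integrable_cinner) (use fin cg fcg in auto)
  also have "... = (cinner M f f + cinner M f (%x. c * g x)) + (cinner M (%x. c * g x) f + cinner M (%x. c * g x) (%x. c * g x))"
   using cinner_add_right[OF i(1,2)] cinner_add_right[OF i(3,4)] by simp
  also have "... = cinner M f f + cnj c * cinner M f g + c * cinner M g f + c * cnj c * cinner M g g"
   by (simp add: cinner_cmult_left cinner_cmult_right algebra_simps)
  finally show ?thesis .
 qed
 show ?thesis
 proof -
  have e: "N (%x. f x + g x) = cinner M f f + cinner M f g + cinner M g f + cinner M g g"
   "N (%x. f x - g x) = cinner M f f - cinner M f g - cinner M g f + cinner M g g"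
   "N (%x. f x + \<i> * g x) = cinner M f f - \<i> * cinner M f g + \<i> * cinner M g f + cinner M g g"
   "N (%x. f x - \<i> * g x) = cinner M f f + \<i> * cinner M f g - \<i> * cinner M g f + cinner M g g"
   using exp[of 1] exp[of "-1"] exp[of \<i>] exp[of "-\<i>"] by simp_all
  show ?thesis unfolding e by (simp add: algebra_simps)
 qed
qed

section \<open>Extension of the transform to square-integrable functions\<close>

definition sq_int :: "('a::euclidean_space => complex) => bool" where
 "sq_int f \<longleftrightarrow> f \<in> Borel \<and> sqnorm lborel f < \<infinity>"

definition trunc :: "nat => ('a::euclidean_space => complex) => 'a => complex" where
 "trunc n f x = indicator (cball 0 (real n)) x *\<^sub>R f x"

lemma sq_int_measurable: "sq_int f ==> f \<in> Borel" "sq_int f ==> sqnorm lborel f < top"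
 by (auto simp: sq_int_def)

lemma measurable_trunc [measurable]: "f \<in> Borel ==> trunc n f \<in> Borel"
 unfolding trunc_def[abs_def] by (intro borel_measurable_scaleR borel_measurable_indicator) auto

lemma sq_int_add: "sq_int f ==> sq_int g ==> sq_int (%x. f x + g x)"
 and sq_int_diff: "sq_int f ==> sq_int g ==> sq_int (%x. f x - g x)"
 and sq_int_cmult: "sq_int f ==> sq_int (%x. c * f x)"
 and sq_int_cnj: "sq_int f ==> sq_int (%x. cnj (f x))"
 using sqnorm_less_top_add[of f lborel g]
 by (auto simp: sq_int_def sqnorm_cmult ennreal_mult_less_top) (simp add: sqnorm_def)

lemma sq_int_trunc: "sq_int f ==> sq_int (trunc n f)"
proof -
 assume f: "sq_int f"
 have "sqnorm lborel (trunc n f) <= sqnorm lborel f"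
  unfolding sqnorm_def by (intro nn_integral_mono ennreal_leI) (auto simp: trunc_def indicator_def)
 then show ?thesis using f by (auto simp: sq_int_def intro: order_le_less_trans)
qed

lemma integrable_trunc:
 assumes f: "sq_int f" shows "integrable lborel (trunc n f)"
proof -
 have [measurable]: "f \<in> Borel" using f by (rule sq_int_measurable)
 let ?i = "indicator (cball 0 (real n)) :: 'a => complex"
 have i: "?i \<in> Borel"
  by (intro borel_measurable_indicator) auto
 have "sqnorm lborel ?i = emeasure lborel (cball (0::'a) (real n))"
 proof -
  have "sqnorm lborel ?i = (NN x. indicator (cball (0::'a) (real n)) x)"
   unfolding sqnorm_def by (intro nn_integral_cong) (auto simp: indicator_def)
  then show ?thesis by simp
 qed
 also have "... < \<infinity>" by (rule emeasure_bounded_finite) simp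
 finally have "integrable lborel (%x. f x * cnj (?i x))"
  using f i by (intro integrable_cinner) (auto simp: sq_int_def)
 then show ?thesis
  by (rule Bochner_Integration.integrable_cong[THEN iffD1, rotated 2]) (auto simp: trunc_def indicator_def)
qed

lemma trunc_tendsto:
 assumes f: "sq_int f" shows "(%n. sqnorm lborel (%x. trunc n f x - f x)) ~~> 0"
proof -
 have [measurable]: "f \<in> Borel" using f by (rule sq_int_measurable)
 have "(%n. NN x. ennreal ((cmod (trunc n f x - f x))\<^sup>2)) ~~> (NN (x::'a). 0)"
 proof (rule nn_integral_dominated_convergence[where w="%x. ennreal ((cmod (f x))\<^sup>2)"])
  show "(NN x. ennreal ((cmod (f x))\<^sup>2)) < \<infinity>"
   using f by (simp add: sq_int_def sqnorm_def)
  show "AE x in lborel. (%n. ennreal ((cmod (trunc n f x - f x))\<^sup>2)) ~~> 0"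
  proof (rule AE_I2)
   fix x :: 'a
   obtain N :: nat where "norm x <= real N" using real_arch_simple by blast
   then have "\<forall>\<^sub>F n in sequentially. ennreal ((cmod (trunc n f x - f x))\<^sup>2) = 0"
    by (intro eventually_sequentiallyI[of N]) (auto simp: trunc_def)
   then show "(%n. ennreal ((cmod (trunc n f x - f x))\<^sup>2)) ~~> 0"
    by (rule tendsto_eventually)
  qed
  show "AE x in lborel. ennreal ((cmod (trunc n f x - f x))\<^sup>2) <= ennreal ((cmod (f x))\<^sup>2)" for n
   by (intro AE_I2 ennreal_leI) (auto simp: trunc_def indicator_def)
 qed auto
 then show ?thesis by (simp add: sqnorm_def)
qed

lemma ft_linear:
 assumes f: "integrable lborel f" and g: "integrable lborel g"
 shows "ft (%x. f x + c * g x) = (%xi. ft f xi + c * ft g xi)"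
proof
 fix xi
 have i: "integrable lborel (%x. f x * cis (- 2 * pi * (x \<bullet> xi)))" "integrable lborel (%x. g x * cis (- 2 * pi * (x \<bullet> xi)))"
  by (rule integrable_cis; use f g in measurable)+
 have "ft (%x. f x + c * g x) xi = (LB x. f x * cis (- 2 * pi * (x \<bullet> xi)) + c * (g x * cis (- 2 * pi * (x \<bullet> xi))))"
  unfolding ft_def by (rule integral_eqI) (auto simp: algebra_simps)
 also have "... = ft f xi + c * ft g xi"
  using i by (simp add: ft_def)
 finally show "ft (%x. f x + c * g x) xi = ft f xi + c * ft g xi" .
qed

lemma ft_diff:
 assumes f: "integrable lborel f" and g: "integrable lborel g"
 shows "ft (%x. f x - g x) = (%xi. ft f xi - ft g xi)"
 using ft_linear[OF f g, of "-1"] by simp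

lemma sq_int_ft: "integrable lborel f ==> sq_int f ==> sq_int (ft f)"
 by (simp add: sq_int_def plancherel_L1)

lemma plancherel_L1_cinner:
 assumes "integrable lborel f" "sq_int f" "integrable lborel g" "sq_int g"
 shows "cinner lborel (ft f) (ft g) = cinner lborel f g"
proof -
 note sqF = sq_int_ft[OF assms(1,2)] and sqG = sq_int_ft[OF assms(3,4)]
 have *: "sqnorm lborel (%xi. ft f xi + c * ft g xi) = sqnorm lborel (%x. f x + c * g x)" for c
  unfolding ft_linear[OF assms(1,3), symmetric]
  by (rule plancherel_L1) (use assms sq_int_add[OF assms(2) sq_int_cmult[OF assms(4)]] in \<open>auto intro: sq_int_measurable\<close>)
 have "4 * cinner lborel (ft f) (ft g) = 4 * cinner lborel f g"
  using *[of 1] *[of "-1"] *[of \<i>] *[of "-\<i>"]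
   cinner_polarization[of "ft f" lborel "ft g"] cinner_polarization[of f lborel g] assms sqF sqG
  by (simp add: sq_int_def)
 then show ?thesis by simp
qed

text \<open>A relation, since the limit is determined only up to null sets. It is the Borel
  counterpart of the truncation limit that defines \<open>fourier_L2\<close>.\<close>

definition has_ft :: "('a::euclidean_space => complex) => ('a => complex) => bool" where
 "has_ft f g \<longleftrightarrow> sq_int f \<and> sq_int g \<and> (%n. sqnorm lborel (%xi. ft (trunc n f) xi - g xi)) ~~> 0"

text \<open>By Plancherel the transforms of the truncations are exactly as close to each other as
  the truncations, hence Cauchy.\<close>

lemma ex_has_ft:
 assumes f: "sq_int f" obtains g where "has_ft f g"
proof -
 note tr = integrable_trunc[OF f] sq_int_trunc[OF f]
 note sq = sq_int_ft[OF tr]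
 have eq: "sqnorm lborel (%x. ft (trunc m f) x - ft (trunc n f) x) = sqnorm lborel (%x. trunc m f x - trunc n f x)" for m n
  unfolding ft_diff[OF tr(1) tr(1), symmetric]
  by (rule plancherel_L1) (use tr sq_int_diff[OF tr(2) tr(2)] in \<open>auto intro: sq_int_measurable\<close>)
 obtain g where "g \<in> borel_measurable lborel" "sqnorm lborel g < \<infinity>" "(%n. sqnorm lborel (%x. ft (trunc n f) x - g x)) ~~> 0"
 proof (rule sqnorm_complete[of "%n. ft (trunc n f)" lborel])
  show "ft (trunc n f) \<in> borel_measurable lborel" "sqnorm lborel (ft (trunc n f)) < \<infinity>" for n
   using sq by (auto simp: sq_int_def)
  fix e :: real assume "e > 0"
  then have "\<forall>\<^sub>F n in sequentially. sqnorm lborel (%x. trunc n f x - f x) < ennreal (e / 4)"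
   by (intro order_tendstoD(2)[OF trunc_tendsto[OF f]]) simp
  then obtain N where "\<forall>n\<ge>N. sqnorm lborel (%x. trunc n f x - f x) < ennreal (e / 4)"
   by (auto simp: eventually_sequentially)
  then have N: "sqnorm lborel (%x. trunc n f x - f x) <= ennreal (e / 4)" if "n \<ge> N" for n
   using that less_imp_le by blast
  show "\<exists>N. \<forall>m\<ge>N. \<forall>n\<ge>N. sqnorm lborel (%x. ft (trunc m f) x - ft (trunc n f) x) <= ennreal e"
  proof (intro exI allI impI)
   fix m n assume mn: "m \<ge> N" "n \<ge> N"
   have "sqnorm lborel (%x. trunc m f x - trunc n f x) <= 2 * sqnorm lborel (%x. trunc m f x - f x) + 2 * sqnorm lborel (%x. f x - trunc n f x)"
    using f by (intro sqnorm_triangle) (auto dest: sq_int_measurable)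
   also have "... <= 2 * ennreal (e / 4) + 2 * ennreal (e / 4)"
    using N[OF mn(1)] N[OF mn(2)] by (intro add_mono mult_left_mono) (auto simp: sqnorm_minus_commute[of _ f])
   also have "2 * ennreal (e / 4) = ennreal (e / 2)"
    using ennreal_mult[of 2 "e / 4"] \<open>e > 0\<close> by simp
   also have "ennreal (e / 2) + ennreal (e / 2) = ennreal e"
    using ennreal_plus[of "e / 2" "e / 2"] \<open>e > 0\<close> by simp
   finally show "sqnorm lborel (%x. ft (trunc m f) x - ft (trunc n f) x) <= ennreal e"
    unfolding eq .
  qed
 qed
 then show thesis by (intro that[of g]) (use f in \<open>auto simp: has_ft_def sq_int_def\<close>)
qed

lemma has_ft_tendsto_unique:
 assumes [measurable]: "g \<in> borel_measurable M" "g' \<in> borel_measurable M" "\<And>n::nat. h n \<in> borel_measurable M"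
  and "(%n. sqnorm M (%x. h n x - g x)) ~~> 0" "(%n. sqnorm M (%x. h n x - g' x)) ~~> 0"
 shows "AE x in M. g x = g' x"
proof -
 have le: "sqnorm M (%x. g x - g' x) <= 2 * sqnorm M (%x. h n x - g x) + 2 * sqnorm M (%x. h n x - g' x)" for n
  using sqnorm_triangle[of g M "h n" g'] by (simp add: sqnorm_minus_commute[of _ g])
 have "(%n. 2 * sqnorm M (%x. h n x - g x) + 2 * sqnorm M (%x. h n x - g' x)) ~~> 2 * 0 + 2 * 0"
  by (intro tendsto_add ennreal_tendsto_cmult assms) auto
 then have "sqnorm M (%x. g x - g' x) <= 2 * 0 + 2 * 0"
  by (rule LIMSEQ_le_const) (use le in auto)
 then have "sqnorm M (%x. g x - g' x) = 0" by simp
 then show ?thesis by (subst (asm) sqnorm_eq_0_iff) auto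
qed

lemma has_ft_cong_right:
 assumes "has_ft f g" "sq_int g'" "AE x in lborel. g x = g' x"
 shows "has_ft f g'"
proof -
 have "sqnorm lborel (%xi. ft (trunc n f) xi - g xi) = sqnorm lborel (%xi. ft (trunc n f) xi - g' xi)" for n
  by (rule sqnorm_cong_AE) (use assms(3) in auto)
 then show ?thesis using assms by (simp add: has_ft_def)
qed

lemma has_ft_linear:
 assumes "has_ft f g" "has_ft f' g'" shows "has_ft (%x. f x + c * f' x) (%x. g x + c * g' x)"
proof -
 note sq = assms[unfolded has_ft_def]
 have tr: "integrable lborel (trunc n f)" "integrable lborel (trunc n f')" for n
  using sq integrable_trunc by auto
 have eq: "ft (trunc n (%x. f x + c * f' x)) = (%xi. ft (trunc n f) xi + c * ft (trunc n f') xi)" for n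
  by (subst ft_linear[OF tr, symmetric]) (rule arg_cong[where f=ft], auto simp: trunc_def fun_eq_iff algebra_simps)
 have [measurable]: "f \<in> Borel" "f' \<in> Borel" "g \<in> Borel" "g' \<in> Borel"
  using sq by (auto simp: sq_int_def)
 have le: "sqnorm lborel (%xi. ft (trunc n (%x. f x + c * f' x)) xi - (g xi + c * g' xi))
   <= 2 * sqnorm lborel (%xi. ft (trunc n f) xi - g xi) + 2 * (ennreal ((cmod c)\<^sup>2) * sqnorm lborel (%xi. ft (trunc n f') xi - g' xi))" for n
 proof -
  have "sqnorm lborel (%xi. ft (trunc n (%x. f x + c * f' x)) xi - (g xi + c * g' xi)) =
   sqnorm lborel (%xi. (ft (trunc n f) xi - g xi) + c * (ft (trunc n f') xi - g' xi))"
   unfolding eq by (rule arg_cong[where f="sqnorm lborel"]) (auto simp: algebra_simps)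
  also have "... <= 2 * sqnorm lborel (%xi. ft (trunc n f) xi - g xi) + 2 * sqnorm lborel (%xi. c * (ft (trunc n f') xi - g' xi))"
   by (rule sqnorm_add_le) measurable
  also have "sqnorm lborel (%xi. c * (ft (trunc n f') xi - g' xi)) = ennreal ((cmod c)\<^sup>2) * sqnorm lborel (%xi. ft (trunc n f') xi - g' xi)"
   by (rule sqnorm_cmult) measurable
  finally show ?thesis .
 qed
 have "(%n. 2 * sqnorm lborel (%xi. ft (trunc n f) xi - g xi) + 2 * (ennreal ((cmod c)\<^sup>2) * sqnorm lborel (%xi. ft (trunc n f') xi - g' xi)))
   ~~> 2 * 0 + 2 * (ennreal ((cmod c)\<^sup>2) * 0)"
  using sq by (intro tendsto_add ennreal_tendsto_cmult) auto
 then have lim: "(%n. 2 * sqnorm lborel (%xi. ft (trunc n f) xi - g xi) + 2 * (ennreal ((cmod c)\<^sup>2) * sqnorm lborel (%xi. ft (trunc n f') xi - g' xi)))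
   ~~> 0" by simp
 have "(%n. sqnorm lborel (%xi. ft (trunc n (%x. f x + c * f' x)) xi - (g xi + c * g' xi))) ~~> 0"
  by (rule tendsto_sandwich[OF _ _ tendsto_const lim]; rule always_eventually; rule allI) (simp, rule le)
 then show ?thesis
  using sq by (auto simp: has_ft_def intro!: sq_int_add sq_int_cmult)
qed

lemma has_ft_cinner:
 assumes "has_ft f g" "has_ft f' g'" shows "cinner lborel g g' = cinner lborel f f'"
proof -
 note sq = assms[unfolded has_ft_def]
 have "(%n. cinner lborel (ft (trunc n f)) (ft (trunc n f'))) ~~> cinner lborel g g'"
  by (rule cinner_tendsto) (use sq in \<open>auto simp: sq_int_def\<close>)
 moreover have "cinner lborel (ft (trunc n f)) (ft (trunc n f')) = cinner lborel (trunc n f) (trunc n f')" for n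
  using sq by (intro plancherel_L1_cinner) (auto intro: integrable_trunc sq_int_trunc)
 moreover have "(%n. cinner lborel (trunc n f) (trunc n f')) ~~> cinner lborel f f'"
  by (rule cinner_tendsto) (use sq trunc_tendsto in \<open>auto simp: sq_int_def\<close>)
 ultimately show ?thesis using LIMSEQ_unique by simp
qed

lemma has_ft_sqnorm: assumes "has_ft f g" shows "sqnorm lborel g = sqnorm lborel f"
proof -
 have sq: "sq_int f" "sq_int g" using assms by (auto simp: has_ft_def)
 have "cx (enn2real (sqnorm lborel g)) = cx (enn2real (sqnorm lborel f))"
  using has_ft_cinner[OF assms assms] sq by (simp add: sqnorm_eq_cinner sq_int_def)
 then have "enn2real (sqnorm lborel g) = enn2real (sqnorm lborel f)" by (simp only: of_real_eq_iff)
 then show ?thesis using sq by (metis ennreal_enn2real infinity_ennreal_def sq_int_measurable(2))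
qed

lemma has_ft_L1:
 assumes f: "integrable lborel f" "sq_int f" shows "has_ft f (ft f)"
proof -
 note tr = integrable_trunc[OF f(2)] sq_int_trunc[OF f(2)]
 have "sqnorm lborel (%xi. ft (trunc n f) xi - ft f xi) = sqnorm lborel (%x. trunc n f x - f x)" for n
  unfolding ft_diff[OF tr(1) f(1), symmetric]
  by (rule plancherel_L1) (use tr f sq_int_diff[OF tr(2) f(2)] in \<open>auto intro: sq_int_measurable\<close>)
 then show ?thesis
  using trunc_tendsto[OF f(2)] sq_int_ft[OF f] f by (simp add: has_ft_def)
qed

text \<open>Truncation to centred balls does not commute with translation. The translated
  truncations \<open>h n\<close> serve instead: their transforms are exactly modulated, and they
  converge both to the transform of the translate, by Plancherel, and to the modulated
  transform.\<close>

lemma has_ft_modulate: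
 fixes y :: "'a::euclidean_space"
 assumes fg: "has_ft f g"
 shows "has_ft (%x. f (x - y)) (%xi. cis (- 2 * pi * (y \<bullet> xi)) * g xi)"
proof -
 have sq: "sq_int f" "sq_int g" using fg by (auto simp: has_ft_def)
 have [measurable]: "f \<in> Borel" "g \<in> Borel" using sq by (auto simp: sq_int_def)
 have trs: "sqnorm lborel (%x. h (x - y)) = sqnorm lborel h" if [measurable]: "h \<in> Borel" for h :: "'a => complex"
  unfolding sqnorm_def using nn_integral_lborel_translate[where F="%x. ennreal ((cmod (h x))\<^sup>2)" and h="-y"] by simp
 have sqt: "sq_int (%x. h (x - y))" if "sq_int h" for h :: "'a => complex"
  using that trs by (auto simp: sq_int_def)
 obtain k where k: "has_ft (%x. f (x - y)) k" using ex_has_ft[OF sqt[OF sq(1)]] .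
 then have sqk: "sq_int k" by (simp add: has_ft_def)
 define h where "h n = (%x. trunc n f (x - y))" for n
 have h: "integrable lborel (h n)" "sq_int (h n)" for n
  using integrable_lborel_translate[OF integrable_trunc[OF sq(1)], of n "- y"] sqt[OF sq_int_trunc[OF sq(1)]]
  by (auto simp: h_def)
 have fth: "ft (h n) xi = cis (- 2 * pi * (y \<bullet> xi)) * ft (trunc n f) xi" for n xi
 proof -
  have "ft (h n) xi = (LB x. h n (x + y) * cis (- 2 * pi * ((x + y) \<bullet> xi)))"
   unfolding ft_def using h by (intro integral_lborel_translate[symmetric]) (auto simp: sq_int_def)
  also have "... = (LB x. cis (- 2 * pi * (y \<bullet> xi)) * (trunc n f x * cis (- 2 * pi * (x \<bullet> xi))))"
  proof (rule integral_eqI)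
   fix x
   have "cis (- 2 * pi * ((x + y) \<bullet> xi)) = cis (- 2 * pi * (y \<bullet> xi)) * cis (- 2 * pi * (x \<bullet> xi))"
    unfolding cis_mult by (rule arg_cong[where f=cis]) (simp add: inner_add_left algebra_simps)
   then show "h n (x + y) * cis (- 2 * pi * ((x + y) \<bullet> xi)) = cis (- 2 * pi * (y \<bullet> xi)) * (trunc n f x * cis (- 2 * pi * (x \<bullet> xi)))"
    by (simp add: h_def)
  qed simp
  finally show ?thesis by (simp add: ft_def)
 qed
 have "(%n. sqnorm lborel (%xi. ft (h n) xi - k xi)) ~~> 0"
 proof -
  have eq: "sqnorm lborel (%xi. ft (h n) xi - k xi) = sqnorm lborel (%x. trunc n f x - f x)" for n
  proof -
   have "has_ft (%x. h n x + (-1) * f (x - y)) (%xi. ft (h n) xi + (-1) * k xi)"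
    by (rule has_ft_linear[OF has_ft_L1[OF h] k])
   from has_ft_sqnorm[OF this] have "sqnorm lborel (%xi. ft (h n) xi - k xi) = sqnorm lborel (%x. trunc n f (x - y) - f (x - y))"
    by (simp add: h_def)
   also have "... = sqnorm lborel (%x. trunc n f x - f x)"
    by (rule trs[where h="%x. trunc n f x - f x"]) measurable
   finally show ?thesis .
  qed
  show ?thesis unfolding eq by (rule trunc_tendsto[OF sq(1)])
 qed
 moreover have "(%n. sqnorm lborel (%xi. ft (h n) xi - cis (- 2 * pi * (y \<bullet> xi)) * g xi)) ~~> 0"
 proof -
  have "sqnorm lborel (%xi. ft (h n) xi - cis (- 2 * pi * (y \<bullet> xi)) * g xi) = sqnorm lborel (%xi. ft (trunc n f) xi - g xi)" for n
   unfolding sqnorm_def fth right_diff_distrib[symmetric] by (simp add: norm_mult)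
  then show ?thesis using fg by (simp add: has_ft_def)
 qed
 moreover have sqm: "sq_int (%xi. cis (- 2 * pi * (y \<bullet> xi)) * g xi)"
  using sq(2) by (auto simp: sq_int_def sqnorm_def norm_mult)
 ultimately have "AE xi in lborel. k xi = cis (- 2 * pi * (y \<bullet> xi)) * g xi"
  using sqk h sq_int_ft[OF h] by (intro has_ft_tendsto_unique[where h="%n. ft (h n)"]) (auto simp: sq_int_def)
 then show ?thesis by (rule has_ft_cong_right[OF k sqm])
qed

lemma ft_adjoint:
 assumes a: "integrable lborel a" and b: "integrable lborel b"
 shows "cinner lborel (ft a) b = cinner lborel a (%x. cnj (ft (%xi. cnj (b xi)) x))"
 unfolding cinner_def using ft_multiplication[OF a, of "%xi. cnj (b xi)"] b by simp

text \<open>The candidate is the inverse transform in disguise: conjugate, transform, conjugate. Its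
  transform \<open>q\<close> has the norm of \<open>g\<close>, and the multiplication formula gives
  <q, g> = <f, f> = |g|^2, so expanding |q - g|^2 leaves 0.\<close>

lemma has_ft_surj:
 assumes g: "sq_int g" obtains f where "has_ft f g"
proof -
 obtain k where k: "has_ft (%x. cnj (g x)) k" using ex_has_ft[OF sq_int_cnj[OF g]] .
 define f where "f x = cnj (k x)" for x
 have sqk: "sq_int k" using k by (simp add: has_ft_def)
 have sqf: "sq_int f" unfolding f_def[abs_def] by (rule sq_int_cnj[OF sqk])
 obtain q where q: "has_ft f q" using ex_has_ft[OF sqf] .
 have sqq: "sq_int q" using q by (simp add: has_ft_def)
 have nf: "sqnorm lborel f = sqnorm lborel g"
  using has_ft_sqnorm[OF k] by (simp add: f_def sqnorm_def)
 have nq: "sqnorm lborel q = sqnorm lborel g" using has_ft_sqnorm[OF q] nf by simp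
 have "(%n. cinner lborel (ft (trunc n f)) (trunc n g)) ~~> cinner lborel q g"
  by (rule cinner_tendsto) (use q g sqq sqf trunc_tendsto[OF g] in \<open>auto simp: has_ft_def sq_int_def\<close>)
 moreover have "cinner lborel (ft (trunc n f)) (trunc n g) = cinner lborel (trunc n f) (%x. cnj (ft (trunc n (%x. cnj (g x))) x))" for n
 proof -
  have "(%xi. cnj (trunc n g xi)) = trunc n (%x. cnj (g x))" by (auto simp: trunc_def)
  then show ?thesis using ft_adjoint[OF integrable_trunc[OF sqf] integrable_trunc[OF g]] by simp
 qed
 moreover have "(%n. cinner lborel (trunc n f) (%x. cnj (ft (trunc n (%x. cnj (g x))) x))) ~~> cinner lborel f f"
 proof (rule cinner_tendsto)
  have "sqnorm lborel (%x. cnj (ft (trunc n (%x. cnj (g x))) x) - f x) = sqnorm lborel (%x. ft (trunc n (%x. cnj (g x))) x - k x)" for n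
  proof -
   have "cmod (cnj a - cnj b) = cmod (a - b)" for a b
    by (metis complex_cnj_diff complex_mod_cnj)
   then show ?thesis by (simp only: sqnorm_def f_def)
  qed
  then show "(%n. sqnorm lborel (%x. cnj (ft (trunc n (%x. cnj (g x))) x) - f x)) ~~> 0"
   using k by (simp add: has_ft_def)
 qed (use sqf g trunc_tendsto[OF sqf] in \<open>auto simp: sq_int_def\<close>)
 ultimately have qg: "cinner lborel q g = cinner lborel f f"
  using LIMSEQ_unique by simp
 define r where "r = enn2real (sqnorm lborel g)"
 have qg': "cinner lborel q g = r" "cinner lborel q q = r" "cinner lborel g g = r" "cinner lborel g q = r"
  using qg sqf sqq g nf nq cinner_cnj[of lborel g q] by (auto simp: sqnorm_eq_cinner sq_int_def r_def)
 note [simp] = sq_int_measurable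
 have i: "integrable lborel (%x. a x * cnj (b x))" if "sq_int a" "sq_int b" for a b
  using that by (intro integrable_cinner) auto
 have "cx (enn2real (sqnorm lborel (%x. q x - g x))) = cinner lborel (%x. q x - g x) (%x. q x - g x)"
  using sq_int_diff[OF sqq g] by (subst sqnorm_eq_cinner) auto
 also have "... = cinner lborel q (%x. q x - g x) - cinner lborel g (%x. q x - g x)"
  by (rule cinner_diff_left; rule i) (use sqq g sq_int_diff in auto)
 also have "... = (cinner lborel q q - cinner lborel q g) - (cinner lborel g q - cinner lborel g g)"
  using cinner_diff_right[OF i[OF sqq sqq] i[OF sqq g]] cinner_diff_right[OF i[OF g sqq] i[OF g g]] by simp
 also have "... = 0" by (simp add: qg')
 finally have "enn2real (sqnorm lborel (%x. q x - g x)) = 0" by (simp only: of_real_eq_0_iff)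
 then have z: "sqnorm lborel (%x. q x - g x) = 0"
  using sq_int_measurable(2)[OF sq_int_diff[OF sqq g]] unfolding enn2real_eq_0_iff by auto
 have m: "(%x. q x - g x) \<in> borel_measurable lborel"
  using sq_int_measurable(1)[OF sq_int_diff[OF sqq g]] by simp
 have "AE x in lborel. q x - g x = 0"
  by (rule sqnorm_eq_0_iff[OF m, THEN iffD1, OF z])
 then have "AE x in lborel. q x = g x" by simp
 then have "has_ft f g" by (rule has_ft_cong_right[OF q g])
 then show thesis by (rule that)
qed

section \<open>From Borel representatives to \<open>fourier_L2\<close> and
  \<open>inv_fourier_L2\<close>\<close>

lemma ennreal_powr_2: "ennreal_powr (ennreal (cmod z)) 2 = ennreal ((cmod z)\<^sup>2)"
 by (simp add: ennreal_powr_def)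

lemma L2_enorm_eq: "L2_enorm f = (if sqnorm lebesgue f = \<infinity> then \<infinity> else ennreal (sqrt (enn2real (sqnorm lebesgue f))))"
 by (simp add: L2_enorm_def Lp_enorm_def ennreal_powr_2 sqnorm_def[symmetric] ennreal_powr_def[of "sqnorm lebesgue f"] powr_half_sqrt)

lemma L2_enorm_less_top: "L2_enorm f < \<infinity> \<longleftrightarrow> sqnorm lebesgue f < \<infinity>"
 by (auto simp: L2_enorm_eq less_top)

lemma L2_space_iff: "f \<in> L2_space \<longleftrightarrow> f \<in> borel_measurable lebesgue \<and> sqnorm lebesgue f < \<infinity>"
 by (simp only: L2_space_def mem_Collect_eq L2_enorm_less_top)

lemma L2_enorm_less_iff: "e > 0 ==> L2_enorm f < ennreal e \<longleftrightarrow> sqnorm lebesgue f < ennreal (e\<^sup>2)"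
 by (cases "sqnorm lebesgue f") (auto simp: L2_enorm_eq ennreal_less_iff real_sqrt_less_iff[of _ "e\<^sup>2", symmetric] simp del: real_sqrt_less_iff)

lemma ennreal_tendsto_0_iff: "(f \<longlongrightarrow> (0::ennreal)) F \<longleftrightarrow> (\<forall>e>0. \<forall>\<^sub>F n in F. f n < ennreal e)"
proof
 assume "(f \<longlongrightarrow> 0) F"
 then show "\<forall>e>0. \<forall>\<^sub>F n in F. f n < ennreal e" using order_tendstoD(2) by fastforce
next
 assume *: "\<forall>e>0. \<forall>\<^sub>F n in F. f n < ennreal e"
 show "(f \<longlongrightarrow> 0) F"
 proof (rule order_tendstoI)
  fix a :: ennreal assume "0 < a"
  then obtain e where e: "e > 0" "ennreal e < a"
  proof (cases a)
   case (real r)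
   with \<open>0 < a\<close> show ?thesis by (intro that[of "r / 2"]) (auto simp: ennreal_less_iff)
  next
   case top
   then show ?thesis by (intro that[of 1]) auto
  qed
  have "\<forall>\<^sub>F n in F. f n < ennreal e" using * e by blast
  then show "\<forall>\<^sub>F n in F. f n < a"
   by eventually_elim (rule less_trans[OF _ e(2)])
 qed simp
qed

lemma L2_enorm_tendsto_0: "((%n. L2_enorm (f n)) \<longlongrightarrow> 0) F \<longleftrightarrow> ((%n. sqnorm lebesgue (f n)) \<longlongrightarrow> 0) F"
proof -
 have "(\<forall>e>0. \<forall>\<^sub>F n in F. L2_enorm (f n) < ennreal e) \<longleftrightarrow> (\<forall>e>0. \<forall>\<^sub>F n in F. sqnorm lebesgue (f n) < ennreal e)"
 proof safe
  fix e :: real assume *: "\<forall>e>0. \<forall>\<^sub>F n in F. L2_enorm (f n) < ennreal e" and e: "e > 0"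
  have "\<forall>\<^sub>F n in F. L2_enorm (f n) < ennreal (sqrt e)" using * e by simp
  then show "\<forall>\<^sub>F n in F. sqnorm lebesgue (f n) < ennreal e"
   using e by (simp add: L2_enorm_less_iff)
 next
  fix e :: real assume *: "\<forall>e>0. \<forall>\<^sub>F n in F. sqnorm lebesgue (f n) < ennreal e" and e: "e > 0"
  have "\<forall>\<^sub>F n in F. sqnorm lebesgue (f n) < ennreal (e\<^sup>2)" using * e by simp
  then show "\<forall>\<^sub>F n in F. L2_enorm (f n) < ennreal e"
   using e by (simp add: L2_enorm_less_iff)
 qed
 then show ?thesis by (simp add: ennreal_tendsto_0_iff)
qed

lemma lebesgue_ex_borel:
 fixes f :: "'a::euclidean_space => complex"
 assumes [measurable]: "f \<in> borel_measurable lebesgue"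
 obtains f' where "f' \<in> Borel" "AE x in lborel. f x = f' x"
proof -
 have "(%x. Re (f x)) \<in> borel_measurable lebesgue" "(%x. Im (f x)) \<in> borel_measurable lebesgue" by measurable
 from this[THEN completion_ex_borel_measurable_real]
 obtain r i where r: "r \<in> borel_measurable lborel" "AE x in lborel. Re (f x) = r x"
  and i: "i \<in> borel_measurable lborel" "AE x in lborel. Im (f x) = i x" by blast
 have [measurable]: "r \<in> Borel" "i \<in> Borel" using r i by auto
 show thesis
 proof (rule that[of "%x. Complex (r x) (i x)"])
  have "(%x. cx (r x) + \<i> * cx (i x)) \<in> Borel" by measurable
  then show "(%x. Complex (r x) (i x)) \<in> Borel" by (simp add: Complex_eq)
  show "AE x in lborel. f x = Complex (r x) (i x)"
   using r(2) i(2) by eventually_elim (simp add: complex_eq_iff)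
 qed
qed

lemma sq_int_of_L2_space:
 assumes "f \<in> L2_space" obtains f' where "sq_int f'" "AE x in lborel. f x = f' x"
proof -
 obtain f' where f': "f' \<in> Borel" "AE x in lborel. f x = f' x"
  using assms by (auto simp: L2_space_iff intro: lebesgue_ex_borel)
 have "sqnorm lborel f' = sqnorm lebesgue f"
  unfolding sqnorm_completion by (rule sqnorm_cong_AE) (use f' in auto)
 then show thesis using f' assms by (intro that[of f']) (auto simp: sq_int_def L2_space_iff)
qed

lemma L2_space_of_sq_int:
 assumes "sq_int g" "f \<in> borel_measurable lebesgue" "AE x in lborel. f x = g x"
 shows "f \<in> L2_space"
proof -
 have "sqnorm lborel f = sqnorm lborel g" by (rule sqnorm_cong_AE) (rule assms)
 then show ?thesis using assms by (simp add: L2_space_iff sq_int_def sqnorm_completion)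
qed

lemma borel_measurable_lebesgueI: "f \<in> Borel ==> f \<in> borel_measurable lebesgue"
 by (rule measurable_completion) simp

lemma fourier_L1_eq_ft:
 fixes f :: "real^'d => complex"
 assumes f: "f \<in> borel_measurable lebesgue" and f': "f' \<in> Borel" and ae: "AE x in lborel. f x = f' x"
 shows "fourier_L1 f xi = ft f' xi"
proof -
 have [measurable]: "f \<in> borel_measurable lebesgue" "f' \<in> Borel" by fact+
 have [measurable]: "(%x. cis (- 2 * pi * (x \<bullet> xi))) \<in> borel_measurable lebesgue"
  by (rule borel_measurable_lebesgueI) measurable
 have [measurable]: "f' \<in> borel_measurable lebesgue" by (rule borel_measurable_lebesgueI) measurable
 have "fourier_L1 f xi = (LINT x|lebesgue. f' x * cis (- 2 * pi * (x \<bullet> xi)))"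
  unfolding fourier_L1_def
 proof (rule integral_cong_AE)
  show "AE x in lebesgue. f x * cis (- 2 * pi * (x \<bullet> xi)) = f' x * cis (- 2 * pi * (x \<bullet> xi))"
   by (rule AE_completion) (use ae in auto)
 qed measurable
 also have "... = ft f' xi"
  unfolding ft_def by (rule integral_completion) measurable
 finally show ?thesis .
qed

text \<open>The choice behind \<open>fourier_L2\<close> has the witness \<open>g\<close>, and two
  L^2 limits of the same sequence agree almost everywhere.\<close>

lemma fourier_L2_eq:
 fixes f :: "real^'d => complex"
 assumes f: "f \<in> borel_measurable lebesgue" and ae: "AE x in lborel. f x = f' x" and ft: "has_ft f' g"
 shows "fourier_L2 f \<in> L2_space" "AE xi in lborel. fourier_L2 f xi = g xi"
proof -
 have sq: "sq_int f'" "sq_int g" using ft by (auto simp: has_ft_def)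
 let ?F = "%n xi. fourier_L1 (%x. indicator (cball 0 (real n)) x *\<^sub>R f x) xi"
 have eq: "?F n = ft (trunc n f')" for n
 proof
  fix xi
  show "?F n xi = ft (trunc n f') xi"
  proof (rule fourier_L1_eq_ft)
   show "(%x. indicator (cball 0 (real n)) x *\<^sub>R f x) \<in> borel_measurable lebesgue"
    by (intro borel_measurable_scaleR borel_measurable_indicator f) simp
   show "trunc n f' \<in> Borel" using sq by (intro measurable_trunc) (simp add: sq_int_def)
   show "AE x in lborel. indicator (cball 0 (real n)) x *\<^sub>R f x = trunc n f' x"
    using ae by eventually_elim (simp add: trunc_def)
  qed
 qed
 have gL: "g \<in> L2_space" using sq by (intro L2_space_of_sq_int[of g]) (auto simp: sq_int_def intro: borel_measurable_lebesgueI)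
 have glim: "(%n::nat. sqnorm lborel (%xi. ?F n xi - g xi)) ~~> 0"
  using ft by (simp add: eq has_ft_def)
 let ?P = "%g. g \<in> L2_space \<and> (%n::nat. L2_enorm (%xi. ?F n xi - g xi)) ~~> 0"
 have "?P g" using gL glim by (simp add: L2_enorm_tendsto_0 sqnorm_completion)
 then have P: "?P (fourier_L2 f)" unfolding fourier_L2_def by (rule someI[where P="?P"])
 then show "fourier_L2 f \<in> L2_space" by simp
 have "AE xi in lebesgue. fourier_L2 f xi = g xi"
 proof (rule has_ft_tendsto_unique)
  show "(%n. sqnorm lebesgue (%xi. ?F n xi - fourier_L2 f xi)) ~~> 0"
   using P by (simp add: L2_enorm_tendsto_0)
  show "(%n. sqnorm lebesgue (%xi. ?F n xi - g xi)) ~~> 0"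
   using glim by (simp add: sqnorm_completion)
  show "?F n \<in> borel_measurable lebesgue" for n
   unfolding eq using sq by (intro borel_measurable_lebesgueI measurable_ft measurable_trunc) (simp add: sq_int_def)
 qed (use P gL in \<open>auto simp: L2_space_iff\<close>)
 then show "AE xi in lborel. fourier_L2 f xi = g xi" by (simp add: AE_completion_iff)
qed

lemma fourier_L2_has_ft:
 fixes f :: "real^'d => complex"
 assumes "f \<in> L2_space"
 obtains f' g where "has_ft f' g" "AE x in lborel. f x = f' x" "AE xi in lborel. fourier_L2 f xi = g xi"
proof -
 obtain f' where f': "sq_int f'" "AE x in lborel. f x = f' x" using sq_int_of_L2_space[OF assms] .
 obtain g where g: "has_ft f' g" using ex_has_ft[OF f'(1)] .
 show thesis
  by (rule that[OF g f'(2) fourier_L2_eq(2)[OF _ f'(2) g]]) (use assms in \<open>simp add: L2_space_iff\<close>)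
qed

lemma fourier_L2_in_L2_space: "f \<in> L2_space ==> fourier_L2 f \<in> L2_space"
 by (metis fourier_L2_has_ft fourier_L2_eq(1) L2_space_iff)

lemma cinner_lebesgue_cong:
 assumes "f \<in> borel_measurable lebesgue" "g \<in> borel_measurable lebesgue" "f' \<in> Borel" "g' \<in> Borel"
  "AE x in lborel. f x = f' x" "AE x in lborel. g x = g' x"
 shows "cinner lebesgue f g = cinner lborel f' g'"
proof -
 have "cinner lebesgue f g = cinner lebesgue f' g'"
  by (rule cinner_cong_AE) (use assms in \<open>auto intro: borel_measurable_lebesgueI AE_completion\<close>)
 also have "... = cinner lborel f' g'"
  unfolding cinner_def by (rule integral_completion) (use assms in measurable)
 finally show ?thesis .
qed

theorem plancherel_cinner:
 assumes "f \<in> L2_space" "g \<in> L2_space"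
 shows "cinner lebesgue (fourier_L2 f) (fourier_L2 g) = cinner lebesgue f g"
proof -
 obtain f' F where f: "has_ft f' F" "AE x in lborel. f x = f' x" "AE xi in lborel. fourier_L2 f xi = F xi"
  using fourier_L2_has_ft[OF assms(1)] .
 obtain g' G where g: "has_ft g' G" "AE x in lborel. g x = g' x" "AE xi in lborel. fourier_L2 g xi = G xi"
  using fourier_L2_has_ft[OF assms(2)] .
 have m: "fourier_L2 f \<in> borel_measurable lebesgue" "fourier_L2 g \<in> borel_measurable lebesgue"
   "f \<in> borel_measurable lebesgue" "g \<in> borel_measurable lebesgue"
  using assms fourier_L2_in_L2_space by (auto simp: L2_space_iff)
 have sq: "f' \<in> Borel" "g' \<in> Borel" "F \<in> Borel" "G \<in> Borel"
  using f(1) g(1) by (auto simp: has_ft_def sq_int_def)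
 show ?thesis
  unfolding cinner_lebesgue_cong[OF m(1,2) sq(3,4) f(3) g(3)] cinner_lebesgue_cong[OF m(3,4) sq(1,2) f(2) g(2)]
  by (rule has_ft_cinner[OF f(1) g(1)])
qed

lemma L2_space_translate:
 fixes f :: "real^'d => complex"
 assumes f: "f \<in> L2_space"
 shows "translate y f \<in> L2_space" "AE xi in lborel. fourier_L2 (translate y f) xi = cis (- 2 * pi * (y \<bullet> xi)) * fourier_L2 f xi"
proof -
 obtain f' F where f': "has_ft f' F" "AE x in lborel. f x = f' x" "AE xi in lborel. fourier_L2 f xi = F xi"
  using fourier_L2_has_ft[OF f] .
 have sq: "sq_int f'" using f' by (simp add: has_ft_def)
 have "(%x. f (x - y)) \<in> borel_measurable lebesgue"
 proof -
  have "(%x. - y + (\<Sum>j\<in>Basis. (1 * (x \<bullet> j)) *\<^sub>R j)) \<in> lebesgue \<rightarrow>\<^sub>M lebesgue"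
   by (rule lebesgue_affine_measurable) simp
  then have "(%x. x - y) \<in> lebesgue \<rightarrow>\<^sub>M lebesgue"
   by (simp add: euclidean_representation)
  then show ?thesis using f by (auto simp: L2_space_iff intro: measurable_compose)
 qed
 then have m: "translate y f \<in> borel_measurable lebesgue" by (simp add: translate_def)
 \<comment> \<open>The exceptional set of the representative has to be shifted along with
   \<open>f\<close>; invariance of Lebesgue measure keeps it null.\<close>
 obtain N where N: "N \<in> null_sets lborel" "{x. f x \<noteq> f' x} \<subseteq> N"
  using f'(2) by (auto simp: eventually_ae_filter)
 have "AE x in lborel. x \<notin> N" using N by (auto intro: AE_not_in)
 then have "AE x in distr lborel borel ((+) (- y)). x \<notin> N" by (simp only: lborel_distr_plus)
 then have "AE x in lborel. - y + x \<notin> N"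
  using N by (subst (asm) AE_distr_iff) (auto simp: null_sets_def)
 then have ae: "AE x in lborel. translate y f x = f' (x - y)"
  by eventually_elim (use N(2) in \<open>auto simp: translate_def algebra_simps\<close>)
 note hft = has_ft_modulate[OF f'(1), of y]
 show "translate y f \<in> L2_space"
  by (rule L2_space_of_sq_int[OF _ m ae]) (use hft in \<open>simp add: has_ft_def\<close>)
 show "AE xi in lborel. fourier_L2 (translate y f) xi = cis (- 2 * pi * (y \<bullet> xi)) * fourier_L2 f xi"
  using fourier_L2_eq(2)[OF m ae hft] f'(3) by eventually_elim simp
qed

lemma fourier_L2_linear:
 fixes f g :: "real^'d => complex"
 assumes "f \<in> L2_space" "g \<in> L2_space"
 shows "(%x. f x + c * g x) \<in> L2_space"
  "AE xi in lborel. fourier_L2 (%x. f x + c * g x) xi = fourier_L2 f xi + c * fourier_L2 g xi"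
proof -
 obtain f' F where f: "has_ft f' F" "AE x in lborel. f x = f' x" "AE xi in lborel. fourier_L2 f xi = F xi"
  using fourier_L2_has_ft[OF assms(1)] .
 obtain g' G where g: "has_ft g' G" "AE x in lborel. g x = g' x" "AE xi in lborel. fourier_L2 g xi = G xi"
  using fourier_L2_has_ft[OF assms(2)] .
 have m: "(%x. f x + c * g x) \<in> borel_measurable lebesgue"
  using assms by (intro borel_measurable_add borel_measurable_times) (auto simp: L2_space_iff)
 have ae: "AE x in lborel. f x + c * g x = f' x + c * g' x"
  using f(2) g(2) by eventually_elim simp
 note hft = has_ft_linear[OF f(1) g(1), of c]
 show "(%x. f x + c * g x) \<in> L2_space"
  by (rule L2_space_of_sq_int[OF _ m ae]) (use hft in \<open>simp add: has_ft_def\<close>)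
 show "AE xi in lborel. fourier_L2 (%x. f x + c * g x) xi = fourier_L2 f xi + c * fourier_L2 g xi"
  using fourier_L2_eq(2)[OF m ae hft] f(3) g(3) by eventually_elim simp
qed

lemma inv_fourier_L2:
 fixes g :: "real^'d => complex"
 assumes "g \<in> L2_space"
 shows "inv_fourier_L2 g \<in> L2_space" "AE xi in lborel. fourier_L2 (inv_fourier_L2 g) xi = g xi"
proof -
 obtain g' where g': "sq_int g'" "AE x in lborel. g x = g' x" using sq_int_of_L2_space[OF assms] .
 obtain f where f: "has_ft f g'" using has_ft_surj[OF g'(1)] .
 have fm: "f \<in> Borel" using f by (simp add: has_ft_def sq_int_def)
 have fL: "f \<in> L2_space"
  using f by (intro L2_space_of_sq_int[of f]) (auto simp: has_ft_def sq_int_def intro: borel_measurable_lebesgueI)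
 have "AE xi in lborel. fourier_L2 f xi = g xi"
  using fourier_L2_eq(2)[OF borel_measurable_lebesgueI[OF fm] _ f] g'(2) by (auto elim: eventually_elim2)
 then have "f \<in> L2_space \<and> (AE xi in lebesgue. fourier_L2 f xi = g xi)"
  using fL by (simp add: AE_completion_iff)
 then have "inv_fourier_L2 g \<in> L2_space \<and> (AE xi in lebesgue. fourier_L2 (inv_fourier_L2 g) xi = g xi)"
  unfolding inv_fourier_L2_def
  by (rule someI[where P="%f. f \<in> L2_space \<and> (AE xi in lebesgue. fourier_L2 f xi = g xi)"])
 then show "inv_fourier_L2 g \<in> L2_space" "AE xi in lborel. fourier_L2 (inv_fourier_L2 g) xi = g xi"
  by (auto simp: AE_completion_iff)
qed

section \<open>Non-stationary phase\<close>

definition has_dir_deriv :: "'a::real_normed_vector => ('a => complex) => ('a => complex) => bool" where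
 "has_dir_deriv e g g' \<longleftrightarrow> (\<forall>x. ((%t. g (x + t *\<^sub>R e)) has_vector_derivative g' x) (at 0))"

lemma has_dir_deriv_mult:
 "has_dir_deriv e g g' ==> has_dir_deriv e h h' ==> has_dir_deriv e (%x. g x * h x) (%x. g' x * h x + g x * h' x)"
 unfolding has_dir_deriv_def
 by (auto intro!: derivative_eq_intros has_vector_derivative_mult[THEN has_vector_derivative_eq_rhs])

lemma has_dir_deriv_add:
 "has_dir_deriv e g g' ==> has_dir_deriv e h h' ==> has_dir_deriv e (%x. g x + h x) (%x. g' x + h' x)"
 unfolding has_dir_deriv_def by (auto intro!: has_vector_derivative_add)

lemma has_dir_deriv_const: "has_dir_deriv e (%x. c) (%x. 0)"
 unfolding has_dir_deriv_def by simp

lemma has_dir_deriv_at: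
 assumes "has_dir_deriv e g g'"
 shows "((%t. g (x + t *\<^sub>R e)) has_vector_derivative g' (x + s *\<^sub>R e)) (at s)"
proof -
 have "((%t. g ((x + s *\<^sub>R e) + t *\<^sub>R e)) has_vector_derivative g' (x + s *\<^sub>R e)) (at (s - s))"
  using assms by (simp add: has_dir_deriv_def)
 moreover have "((%t::real. t - s) has_vector_derivative 1) (at s)"
  by (auto intro!: derivative_eq_intros)
 ultimately have "((%t. g ((x + s *\<^sub>R e) + t *\<^sub>R e)) \<circ> (%t. t - s) has_vector_derivative 1 *\<^sub>R g' (x + s *\<^sub>R e)) (at s)"
  by (intro vector_diff_chain_at) auto
 then show ?thesis by (simp add: o_def algebra_simps)
qed

lemma has_dir_deriv_inverse:
 assumes "has_dir_deriv e g g'" "\<And>x. g x \<noteq> 0"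
 shows "has_dir_deriv e (%x. inverse (g x)) (%x. - g' x * (inverse (g x) * inverse (g x)))"
 unfolding has_dir_deriv_def
proof
 fix x
 have 1: "((%t. g (x + t *\<^sub>R e)) has_vector_derivative g' x) (at 0)"
  using assms(1) by (simp add: has_dir_deriv_def)
 have 2: "(inverse has_field_derivative - (inverse (g x) * inverse (g x))) (at (g (x + 0 *\<^sub>R e)))"
  using DERIV_inverse[of "g x"] assms(2)[of x] by (simp add: power2_eq_square)
 from field_vector_diff_chain_at[OF 1 2]
 show "((%t. inverse (g (x + t *\<^sub>R e))) has_vector_derivative - g' x * (inverse (g x) * inverse (g x))) (at 0)"
  by (simp add: o_def)
qed

text \<open>
 A symbol calculus in the direction \<open>e\<close>: the \<open>j\<close>-th derivative of \<open>g\<close> is at most \<open>V\<^sup>j M\<close>. The weight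
 \<open>V\<close> will be a power of \<open>v0\<close>.
\<close>

primrec symb :: "nat => 'a::real_normed_vector => ('a => real) => ('a => complex) => ('a => real) => bool" where
 "symb 0 e V g M \<longleftrightarrow> continuous_on UNIV g \<and> (\<forall>x. norm (g x) <= M x)"
| "symb (Suc k) e V g M \<longleftrightarrow> continuous_on UNIV g \<and> (\<forall>x. norm (g x) <= M x) \<and>
   (\<exists>g'. has_dir_deriv e g g' \<and> symb k e V g' (%x. V x * M x))"

lemma symb_bound: "symb k e V g M ==> norm (g x) <= M x"
 by (cases k) auto

lemma symb_nonneg: "symb k e V g M ==> 0 <= M x"
 using symb_bound norm_ge_zero order_trans by blast

lemma symb_cont: "symb k e V g M ==> continuous_on UNIV g"
 by (cases k) auto

lemma symb_mono:
 "symb k e V g M ==> (\<And>x. 0 <= V x) ==> (\<And>x. M x <= M' x) ==> symb k e V g M'"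
proof (induction k arbitrary: g M M')
 case 0
 then show ?case by (auto intro: order_trans)
next
 case (Suc k)
 obtain g' where g': "has_dir_deriv e g g'" "symb k e V g' (%x. V x * M x)" using Suc.prems by auto
 have "symb k e V g' (%x. V x * M' x)"
  by (rule Suc.IH[OF g'(2)]) (use Suc.prems in \<open>auto intro: mult_left_mono\<close>)
 then show ?case using Suc.prems g'(1) by (auto intro: order_trans)
qed

lemma symb_SucI:
 "continuous_on UNIV g ==> (\<And>x. norm (g x) <= M x) ==> has_dir_deriv e g g' ==>
  symb k e V g' (%x. V x * M x) ==> symb (Suc k) e V g M"
 by auto

lemma symb_SucD: "symb (Suc k) e V g M ==> symb k e V g M"
proof (induction k arbitrary: g M)
 case (Suc k)
 then obtain g' where g': "has_dir_deriv e g g'" "symb (Suc k) e V g' (%x. V x * M x)"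
  unfolding symb.simps(2)[of "Suc k"] by blast
 show ?case
  by (rule symb_SucI[OF symb_cont[OF Suc.prems] symb_bound[OF Suc.prems] g'(1) Suc.IH[OF g'(2)]])
qed auto

lemma symb_const: "(\<And>x. norm c <= M x) ==> (\<And>x. 0 <= V x) ==> symb k e V (%x. c) M"
proof (induction k arbitrary: c M)
 case (Suc k)
 have M0: "0 <= M x" for x using Suc.prems(1)[of x] norm_ge_zero[of c] by linarith
 have "symb k e V (%x. 0) (%x. V x * M x)"
  by (rule Suc.IH) (use Suc.prems(2) M0 in auto)
 with has_dir_deriv_const show ?case by (intro symb_SucI Suc.prems(1)) auto
qed auto

lemma symb_add:
 "symb k e V g M ==> symb k e V h M' ==> symb k e V (%x. g x + h x) (%x. M x + M' x)"
proof (induction k arbitrary: g M h M')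
 case 0
 then show ?case by (auto intro!: continuous_intros order_trans[OF norm_triangle_ineq] add_mono)
next
 case (Suc k)
 then obtain g' h' where d: "has_dir_deriv e g g'" "symb k e V g' (%x. V x * M x)"
   "has_dir_deriv e h h'" "symb k e V h' (%x. V x * M' x)" by auto
 show ?case
 proof (rule symb_SucI)
  show "continuous_on UNIV (%x. g x + h x)"
   by (intro continuous_intros symb_cont[OF Suc.prems(1)] symb_cont[OF Suc.prems(2)])
  show "norm (g x + h x) <= M x + M' x" for x
   using norm_triangle_ineq[of "g x" "h x"] symb_bound[OF Suc.prems(1), of x] symb_bound[OF Suc.prems(2), of x] by linarith
  show "has_dir_deriv e (%x. g x + h x) (%x. g' x + h' x)" by (rule has_dir_deriv_add[OF d(1,3)])
  show "symb k e V (%x. g' x + h' x) (%x. V x * (M x + M' x))"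
   using Suc.IH[OF d(2,4)] by (simp add: distrib_left)
 qed
qed

text \<open>Leibniz's rule in symbol form: every differentiation doubles the number of products,
  whence the factor 2^k.\<close>

lemma symb_mult:
 assumes V: "\<And>x. 0 <= V x"
 shows "symb k e V g M ==> symb k e V h M' ==> symb k e V (%x. g x * h x) (%x. 2 ^ k * (M x * M' x))"
proof (induction k arbitrary: g M h M')
 case 0
 have "norm (g x * h x) <= M x * M' x" for x
  unfolding norm_mult
  by (rule mult_mono[OF symb_bound[OF 0(1)] symb_bound[OF 0(2)] symb_nonneg[OF 0(1)]]) simp
 then show ?case using 0 by (auto intro!: continuous_intros)
next
 case (Suc k)
 note nn = symb_nonneg[OF Suc.prems(1)] symb_nonneg[OF Suc.prems(2)]
 from Suc.prems obtain g' h' where d: "has_dir_deriv e g g'" "symb k e V g' (%x. V x * M x)"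
   "has_dir_deriv e h h'" "symb k e V h' (%x. V x * M' x)" by auto
 have "symb k e V (%x. g' x * h x + g x * h' x) (%x. 2 ^ k * (V x * M x * M' x) + 2 ^ k * (M x * (V x * M' x)))"
  by (rule symb_add[OF Suc.IH[OF d(2) symb_SucD[OF Suc.prems(2)]] Suc.IH[OF symb_SucD[OF Suc.prems(1)] d(4)]])
 then have "symb k e V (%x. g' x * h x + g x * h' x) (%x. V x * (2 ^ Suc k * (M x * M' x)))"
  by (simp add: algebra_simps)
 moreover have "norm (g x * h x) <= 2 ^ Suc k * (M x * M' x)" for x
 proof -
  have "norm (g x * h x) <= 1 * (M x * M' x)"
   unfolding norm_mult mult_1 by (rule mult_mono[OF symb_bound[OF Suc.prems(1)] symb_bound[OF Suc.prems(2)] nn(1)]) simp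
  also have "... <= 2 ^ Suc k * (M x * M' x)"
   using nn by (intro mult_right_mono one_le_power mult_nonneg_nonneg) auto
  finally show ?thesis .
 qed
 ultimately show ?case
  by (intro symb_SucI[OF _ _ has_dir_deriv_mult[OF d(1,3)]] continuous_on_mult symb_cont[OF Suc.prems(1)] symb_cont[OF Suc.prems(2)])
qed

lemma symb_cmult:
 assumes V: "\<And>x. 0 <= V x" and g: "symb k e V g M"
 shows "symb k e V (%x. c * g x) (%x. norm c * M x)"
 using g
proof (induction k arbitrary: g M)
 case 0
 then show ?case by (auto intro!: continuous_intros mult_left_mono simp: norm_mult)
next
 case (Suc k)
 from Suc.prems obtain g' where d: "has_dir_deriv e g g'" "symb k e V g' (%x. V x * M x)" by auto
 have "has_dir_deriv e (%x. c * g x) (%x. c * g' x)"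
  using has_dir_deriv_mult[OF has_dir_deriv_const d(1), of c] by simp
 moreover have "symb k e V (%x. c * g' x) (%x. V x * (norm c * M x))"
  using Suc.IH[OF d(2)] by (simp add: mult_ac)
 ultimately show ?case using Suc.prems by (auto intro!: continuous_intros mult_left_mono simp: norm_mult)
qed

lemma symb_power:
 assumes V: "\<And>x. 0 <= V x" and g: "symb k e V g M"
 shows "symb k e V (%x. g x ^ n) (%x. 2 ^ (k * n) * M x ^ n)"
proof (induction n)
 case 0
 show ?case by (simp, rule symb_const) (use V in auto)
next
 case (Suc n)
 have "symb k e V (%x. g x * g x ^ n) (%x. 2 ^ k * (M x * (2 ^ (k * n) * M x ^ n)))"
  by (rule symb_mult[OF V g Suc])
 then show ?case by (simp add: power_add mult_ac)
qed

lemma symb_sum: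
 assumes V: "\<And>x. 0 <= V x" and "finite A" "\<And>i. i \<in> A ==> symb k e V (g i) (M i)"
 shows "symb k e V (%x. \<Sum>i\<in>A. g i x) (%x. \<Sum>i\<in>A. M i x)"
 using assms(2,3)
proof (induction A rule: finite_induct)
 case empty
 show ?case by (simp, rule symb_const) (use V in auto)
next
 case (insert a A)
 have "symb k e V (%x. g a x + (\<Sum>i\<in>A. g i x)) (%x. M a x + (\<Sum>i\<in>A. M i x))"
  by (rule symb_add) (use insert in auto)
 then show ?case using insert(1,2) by simp
qed

lemma symb_prod:
 assumes V: "\<And>x. 0 <= V x" and "finite A" "\<And>i. i \<in> A ==> symb k e V (g i) M"
 shows "symb k e V (%x. \<Prod>i\<in>A. g i x) (%x. 2 ^ (k * card A) * M x ^ card A)"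
 using assms(2,3)
proof (induction A rule: finite_induct)
 case empty
 show ?case by (simp, rule symb_const) (use V in auto)
next
 case (insert a A)
 have "symb k e V (%x. g a x * (\<Prod>i\<in>A. g i x)) (%x. 2 ^ k * (M x * (2 ^ (k * card A) * M x ^ card A)))"
  by (rule symb_mult[OF V]) (use insert in auto)
 then show ?case using insert(1,2) by (simp add: power_add mult_ac)
qed

text \<open>The constant depends on \<open>c\<close> and \<open>k\<close> alone, so one bound serves
  every direction, weight and symbol. The induction differentiates once, to -g'/g^2, and bounds the
  three factors by the product rule for symbols.\<close>

lemma symb_inverse:
 assumes c: "c > 0"
 shows "\<exists>C>0. \<forall>(e::'a::real_normed_vector) V g M. (\<forall>x. 0 <= V x) --> symb k e V g M --> (\<forall>x. 0 < M x \<and> c * M x <= norm (g x)) -->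
  symb k e V (%x. inverse (g x)) (%x. C * inverse (M x))"
proof (induction k)
 case 0
 have "norm (inverse z) <= inverse c * inverse m" if "0 < m" "c * m <= norm z" for z :: complex and m
  using that c le_imp_inverse_le[OF that(2)] by (simp add: norm_inverse)
 moreover have "z \<noteq> 0" if "0 < m" "c * m <= norm z" for z :: complex and m
  using that c by (metis mult_pos_pos norm_zero not_le)
 ultimately have "symb 0 e V (%x. inverse (g x)) (%x. inverse c * inverse (M x))"
  if "symb 0 e V g M" "\<forall>x. 0 < M x \<and> c * M x <= norm (g x)" for e :: 'a and V g M
  using that by (simp, intro continuous_on_inverse) blast+
 then show ?case
  using c by (intro exI[of _ "inverse c"]) (auto simp del: symb.simps)
next
 case (Suc k)
 then obtain C where C: "C > 0" "\<And>(e::'a) V g M. (\<forall>x. 0 <= V x) ==> symb k e V g M ==> (\<forall>x. 0 < M x \<and> c * M x <= norm (g x)) ==>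
  symb k e V (%x. inverse (g x)) (%x. C * inverse (M x))" by blast
 \<comment> \<open>\<open>C\<close> covers the value itself. The second summand covers the
   derivative, where two uses of \<open>symb_mult\<close> give 2^k each and the two inverses give
   \<open>C\<close> each.\<close>
 define C' where "C' = C + 4 ^ k * C\<^sup>2"
 have C': "C' > 0" "C <= C'" "4 ^ k * C\<^sup>2 <= C'" using C(1) by (auto simp: C'_def intro: add_pos_pos)
 show ?case
 proof (intro exI[of _ C'] conjI allI impI)
  fix e :: 'a and V g M assume V: "\<forall>x. 0 <= V x" and g: "symb (Suc k) e V g M" and M: "\<forall>x. 0 < M x \<and> c * M x <= norm (g x)"
  have nz: "g x \<noteq> 0" for x using M c by (metis mult_pos_pos norm_zero not_le)
  obtain g' where g': "has_dir_deriv e g g'" "symb k e V g' (%x. V x * M x)" using g by auto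
  have i: "symb k e V (%x. inverse (g x)) (%x. C * inverse (M x))"
   by (rule C(2)) (use V M symb_SucD[OF g] in auto)
  have "symb k e V (%x. g' x * (inverse (g x) * inverse (g x))) (%x. 2 ^ k * (V x * M x * (2 ^ k * (C * inverse (M x) * (C * inverse (M x))))))"
   by (intro symb_mult g' i) (use V in auto)
  from symb_cmult[OF _ this, of "-1"] have "symb k e V (%x. - g' x * (inverse (g x) * inverse (g x))) (%x. 2 ^ k * (V x * M x * (2 ^ k * (C * inverse (M x) * (C * inverse (M x))))))"
   using V by simp
  then have "symb k e V (%x. - g' x * (inverse (g x) * inverse (g x))) (%x. V x * (C' * inverse (M x)))"
  proof (rule symb_mono)
   fix x
   have Mx: "M x > 0" using M by blast
   have "2 ^ k * (V x * M x * (2 ^ k * (C * inverse (M x) * (C * inverse (M x))))) = V x * ((4 ^ k * C\<^sup>2) * inverse (M x))"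
    using Mx by (simp add: power2_eq_square field_simps power_mult_distrib[symmetric])
   also have "... <= V x * (C' * inverse (M x))"
    using V Mx C' by (intro mult_left_mono mult_right_mono) auto
   finally show "2 ^ k * (V x * M x * (2 ^ k * (C * inverse (M x) * (C * inverse (M x))))) <= V x * (C' * inverse (M x))" .
  qed (use V in auto)
  moreover have "norm (inverse (g x)) <= C' * inverse (M x)" for x
  proof -
   have "norm (inverse (g x)) <= C * inverse (M x)" by (rule symb_bound[OF i])
   also have "... <= C' * inverse (M x)" using C' M by (intro mult_right_mono) (auto intro: less_imp_le)
   finally show ?thesis .
  qed
  ultimately show "symb (Suc k) e V (%x. inverse (g x)) (%x. C' * inverse (M x))"
   using has_dir_deriv_inverse[OF g'(1) nz] symb_cont[OF g] nz by (auto intro!: continuous_on_inverse)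
 qed (rule C')
qed

text \<open>Averaging the derivative over a unit step gives \<open>G (x + e) - G x\<close>, whose
  integral vanishes by translation invariance, while by Fubini the averaging does not change the
  integral of \<open>G'\<close>. Integrability takes the place of boundary terms.\<close>

lemma integral_dir_deriv:
 fixes G :: "'a::euclidean_space => complex"
 assumes d: "has_dir_deriv e G G'" and c: "continuous_on UNIV G'" and G: "integrable lborel G" and G': "integrable lborel G'"
 shows "(LB x. G' x) = 0"
proof -
 have [measurable]: "G \<in> Borel" "G' \<in> Borel"
  using G G' by (auto dest: integrable_meas)
 let ?h = "%x t. indicator {0..1::real} t *\<^sub>R G' (x + t *\<^sub>R e)"
 have eq: "(LB t. ?h x t) = G (x + e) - G x" for x
 proof -
  have "(LB t. ?h x t) = G (x + 1 *\<^sub>R e) - G (x + 0 *\<^sub>R e)"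
  proof (rule integral_FTC_Icc)
   show "((%t. G (x + t *\<^sub>R e)) has_vector_derivative G' (x + t *\<^sub>R e)) (at t within {0..1})" for t
    using has_dir_deriv_at[OF d] by (rule has_vector_derivative_at_within)
   show "continuous_on {0..1} (%t. G' (x + t *\<^sub>R e))"
    by (rule continuous_on_compose2[OF c]) (auto intro!: continuous_intros)
  qed simp
  then show ?thesis by simp
 qed
 have nrm: "(LB x. norm (?h x t)) = indicator {0..1} t * (LB x. norm (G' x))" for t
  using integral_lborel_translate[of "%x. norm (G' x)" "t *\<^sub>R e"] by simp
 have fub: "integrable (lborel \<Otimes>\<^sub>M lborel) (%(t, x). ?h x t)"
 proof (rule lborel_pair.Fubini_integrable)
  show "integrable lborel (%t. LB x. norm (case (t, x) of (t, x) => ?h x t))"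
   unfolding prod.case nrm by (intro integrable_mult_left) simp
  show "AE t in lborel. integrable lborel (%x. case (t, x) of (t, x) => ?h x t)"
   using integrable_lborel_translate[OF G'] by simp
 qed measurable
 have "(LB x. LB t. ?h x t) = (LB t. LB x. ?h x t)"
  by (rule lborel_pair.Fubini_integral[OF fub])
 also have "... = (LB t. indicator {0..1::real} t *\<^sub>R (LB x. G' x))"
  using integral_lborel_translate[of G'] by simp
 also have "... = (LB x. G' x)" by simp
 also have "(LB x. LB t. ?h x t) = (LB x. G (x + e)) - (LB x. G x)"
  unfolding eq using integrable_lborel_translate[OF G] G by simp
 also have "... = 0" using integral_lborel_translate[of G e] by simp
 finally show ?thesis by simp
qed

text \<open>The derivative of \<open>E\<close> is \<open>c0 * b * E\<close>, so one factor of an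
  even power of \<open>b\<close> can be traded for a derivative of \<open>E\<close>. Integrating by
  parts from the power 2k+2 leaves the power 2k with amplitude (2k+1) b' H + b H': two powers of
  \<open>b\<close> are gone, and the amplitude is again a symbol. \<open>W\<close> dominates the
  intermediate integrands and serves integrability; the final estimate contains only
  \<open>W'\<close>.\<close>

lemma iterated_parts:
 "\<exists>C>0. \<forall>(e::'a::euclidean_space) V b m H M E c0 W W'.
  (\<forall>x. 0 <= V x) --> symb k e V b m --> symb k e V H M --> has_dir_deriv e E (%x. c0 * b x * E x) -->
  continuous_on UNIV E --> (\<forall>x. norm (E x) <= 1) --> 1 <= norm (c0::complex) -->
  integrable lborel W --> (\<forall>i\<le>k. \<forall>x. V x ^ i * m x ^ (2 * k - i) * M x <= W x) -->
  (\<forall>i<k. \<forall>x. V x ^ i * m x ^ (2 * k - 1 - i) * M x <= W x) -->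
  integrable lborel W' --> (\<forall>x. V x ^ k * m x ^ k * M x <= W' x) -->
  norm (LB x. b x ^ (2 * k) * H x * E x) <= C * (LB x. W' x)"
proof (induction k)
 case 0
 show ?case
 proof (intro exI[of _ 1] conjI allI impI)
  fix e :: 'a and V m M W W' and b H E :: "'a => complex" and c0 :: complex
  assume H: "symb 0 e V H M" and E: "continuous_on UNIV E" "\<forall>x. norm (E x) <= 1"
   and W': "integrable lborel W'" "\<forall>x. V x ^ 0 * m x ^ 0 * M x <= W' x"
  have b: "norm (b x ^ (2 * 0) * H x * E x) <= W' x" for x
  proof -
   have "norm (H x) * norm (E x) <= M x * 1"
    using symb_bound[OF H, of x] E(2) by (intro mult_mono) (auto intro: order_trans[OF norm_ge_zero])
   then show ?thesis using W'(2) by (auto simp: norm_mult intro: order_trans)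
  qed
  have "continuous_on UNIV (%x. b x ^ (2 * 0) * H x * E x)"
   using symb_cont[OF H] E(1) by (auto intro!: continuous_intros)
  then have bm: "(%x. b x ^ (2 * 0) * H x * E x) \<in> Borel"
   by (rule contI)
  have int: "integrable lborel (%x. b x ^ (2 * 0) * H x * E x)"
  proof (rule integrable_bd[OF W'(1)])
   have "norm (b x ^ (2 * 0) * H x * E x) <= norm (W' x)" for x
    using b[of x] unfolding real_norm_def by linarith
   then show "AE x in lborel. norm (b x ^ (2 * 0) * H x * E x) <= norm (W' x)" by (intro AE_I2)
  qed (use bm in simp)
  have "norm (LB x. b x ^ (2 * 0) * H x * E x) <= (LB x. W' x)"
   by (rule order_trans[OF integral_norm_bound integral_mono[OF integrable_norm[OF int] W'(1) b]])
  then show "norm (LB x. b x ^ (2 * 0) * H x * E x) <= 1 * (LB x. W' x)" by simp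
 qed simp
next
 case (Suc k)
 then obtain C where C: "C > 0" and IH: "\<And>(e::'a) V b m H M E c0 W W'.
  (\<forall>x. 0 <= V x) ==> symb k e V b m ==> symb k e V H M ==> has_dir_deriv e E (%x. c0 * b x * E x) ==>
  continuous_on UNIV E ==> (\<forall>x. norm (E x) <= 1) ==> 1 <= norm (c0::complex) ==>
  integrable lborel W ==> (\<forall>i\<le>k. \<forall>x. V x ^ i * m x ^ (2 * k - i) * M x <= W x) ==>
  (\<forall>i<k. \<forall>x. V x ^ i * m x ^ (2 * k - 1 - i) * M x <= W x) ==>
  integrable lborel W' ==> (\<forall>x. V x ^ k * m x ^ k * M x <= W' x) ==>
  norm (LB x. b x ^ (2 * k) * H x * E x) <= C * (LB x. W' x)" by blast
 \<comment> \<open>From (2k+1) 2^k for the term \<open>b' * H\<close> and another 2^k for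
   \<open>b * H'\<close>.\<close>
 define C1 :: real where "C1 = 2 ^ k * real (2 * k + 2)"
 have C1: "C1 > 0" by (simp add: C1_def)
 show ?case
 proof (intro exI[of _ "C * C1"] conjI allI impI)
  show "C * C1 > 0" using C C1 by simp
  fix e :: 'a and V m M W W' and b H E :: "'a => complex" and c0 :: complex
  assume V: "\<forall>x. 0 <= V x" and b: "symb (Suc k) e V b m" and H: "symb (Suc k) e V H M"
   and E: "has_dir_deriv e E (%x. c0 * b x * E x)" "continuous_on UNIV E" "\<forall>x. norm (E x) <= 1" and c0: "1 <= norm c0"
   and W: "integrable lborel W" "\<forall>i\<le>Suc k. \<forall>x. V x ^ i * m x ^ (2 * Suc k - i) * M x <= W x"
    "\<forall>i<Suc k. \<forall>x. V x ^ i * m x ^ (2 * Suc k - 1 - i) * M x <= W x"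
   and W': "integrable lborel W'" "\<forall>x. V x ^ Suc k * m x ^ Suc k * M x <= W' x"
  obtain b' where b': "has_dir_deriv e b b'" "symb k e V b' (%x. V x * m x)" using b by auto
  obtain H' where H': "has_dir_deriv e H H'" "symb k e V H' (%x. V x * M x)" using H by auto
  note nn = symb_nonneg[OF b] symb_nonneg[OF H]
  note cont = symb_cont[OF b] symb_cont[OF H] symb_cont[OF b'(2)] symb_cont[OF H'(2)] E(2)
  define J where "J x = of_nat (2 * k + 1) * (b' x * H x) + b x * H' x" for x
  have J: "symb k e V J (%x. C1 * (V x * m x * M x))"
  proof -
   have "symb k e V J (%x. norm (of_nat (2 * k + 1) :: complex) * (2 ^ k * (V x * m x * M x)) + 2 ^ k * (m x * (V x * M x)))"
    unfolding J_def[abs_def] by (intro symb_add symb_cmult symb_mult symb_SucD[OF b] symb_SucD[OF H] b' H') (use V in auto)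
   also have "(%x. norm (of_nat (2 * k + 1) :: complex) * (2 ^ k * (V x * m x * M x)) + 2 ^ k * (m x * (V x * M x))) = (%x. C1 * (V x * m x * M x))"
    unfolding norm_of_nat C1_def by (auto simp: algebra_simps)
   finally show ?thesis .
  qed
  have pow: "has_dir_deriv e (%x. b x ^ n) (%x. of_nat n * b x ^ (n - 1) * b' x)" for n
  proof (induction n)
   case 0 show ?case using has_dir_deriv_const[of e 1] by simp
  next
   case (Suc n)
   have "has_dir_deriv e (%x. b x * b x ^ n) (%x. b' x * b x ^ n + b x * (of_nat n * b x ^ (n - 1) * b' x))"
    by (rule has_dir_deriv_mult[OF b'(1) Suc])
   moreover have "b' x * b x ^ n + b x * (of_nat n * b x ^ (n - 1) * b' x) = of_nat (Suc n) * b x ^ (Suc n - 1) * b' x" for x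
    by (cases n) (auto simp: algebra_simps)
   ultimately show ?case by simp
  qed
  \<comment> \<open>The function that would give the boundary terms. Its derivative
    \<open>F'\<close> integrates to zero and so relates the power 2k+2 to the power 2k with
    amplitude \<open>J\<close>.\<close>
  define F where "F x = b x ^ (2 * k + 1) * H x * E x" for x
  define F' where "F' x = b x ^ (2 * k) * J x * E x + c0 * (b x ^ (2 * Suc k) * H x * E x)" for x
  have dF: "has_dir_deriv e F F'"
  proof -
   have "has_dir_deriv e F (%x. (of_nat (2 * k + 1) * b x ^ (2 * k + 1 - 1) * b' x * H x + b x ^ (2 * k + 1) * H' x) * E x
     + b x ^ (2 * k + 1) * H x * (c0 * b x * E x))"
    unfolding F_def[abs_def] by (intro has_dir_deriv_mult pow H' E)
   also have "(%x. (of_nat (2 * k + 1) * b x ^ (2 * k + 1 - 1) * b' x * H x + b x ^ (2 * k + 1) * H' x) * E x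
     + b x ^ (2 * k + 1) * H x * (c0 * b x * E x)) = F'"
    unfolding F'_def J_def by (auto simp: algebra_simps)
   finally show ?thesis .
  qed
  have bm: "norm (b x) <= m x" for x by (rule symb_bound[OF b])
  have nF: "norm (F x) <= W x" for x
  proof -
   have "norm (F x) <= m x ^ (2 * k + 1) * M x * 1"
    unfolding F_def norm_mult norm_power
    by (intro mult_mono power_mono bm symb_bound[OF H] E(3)[rule_format]) (use nn in auto)
   also have "... <= W x" using W(3)[rule_format, of 0 x] by simp
   finally show ?thesis .
  qed
  have n1: "norm (b x ^ (2 * k) * J x * E x) <= C1 * W x" for x
  proof -
   have "norm (b x ^ (2 * k) * J x * E x) <= m x ^ (2 * k) * (C1 * (V x * m x * M x)) * 1"
    unfolding norm_mult norm_power
    by (intro mult_mono power_mono bm symb_bound[OF J] E(3)[rule_format]) (use nn V C1 in auto)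
   also have "... = C1 * (V x ^ 1 * m x ^ (2 * Suc k - 1) * M x)" by (simp add: mult_ac)
   also have "... <= C1 * W x" using W(2)[rule_format, of 1 x] C1 by (intro mult_left_mono) auto
   finally show ?thesis .
  qed
  have n2: "norm (b x ^ (2 * Suc k) * H x * E x) <= W x" for x
  proof -
   have "norm (b x ^ (2 * Suc k) * H x * E x) <= m x ^ (2 * Suc k) * M x * 1"
    unfolding norm_mult norm_power
    by (intro mult_mono power_mono bm symb_bound[OF H] E(3)[rule_format]) (use nn in auto)
   also have "... <= W x" using W(2)[rule_format, of 0 x] by simp
   finally show ?thesis .
  qed
  have intI: "integrable lborel f" if "continuous_on UNIV f" "\<And>x. norm (f x) <= c * W x" for f :: "'a => complex" and c
  proof (rule integrable_bd[OF integrable_mult_right[where c=c, OF W(1)]])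
   show "f \<in> borel_measurable lborel" using contI[OF that(1)] by simp
   have "norm (f x) <= norm (c * W x)" for x
    using that(2)[of x] by simp
   then show "AE x in lborel. norm (f x) <= norm (c * W x)" by (intro AE_I2)
  qed
  have cJ: "continuous_on UNIV J" by (rule symb_cont[OF J])
  have i1: "integrable lborel (%x. b x ^ (2 * k) * J x * E x)"
   by (rule intI[where c=C1]) (use n1 cont cJ in \<open>auto intro!: continuous_intros\<close>)
  have i2: "integrable lborel (%x. b x ^ (2 * Suc k) * H x * E x)"
   by (rule intI[where c=1]) (use n2 cont in \<open>auto intro!: continuous_intros\<close>)
  have iF: "integrable lborel F"
   by (rule intI[where c=1]) (use nF cont in \<open>auto simp: F_def[abs_def] intro!: continuous_intros\<close>)
  have cF': "continuous_on UNIV F'"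
   unfolding F'_def[abs_def]
   by (intro continuous_on_add continuous_on_mult continuous_on_power continuous_on_const cont cJ)
  have iF': "integrable lborel F'"
   unfolding F'_def[abs_def] by (rule Bochner_Integration.integrable_add[OF i1 integrable_mult_right[OF i2]])
  have "(LB x. F' x) = 0"
   by (rule integral_dir_deriv[OF dF cF' iF iF'])
  then have "(LB x. b x ^ (2 * k) * J x * E x) + c0 * (LB x. b x ^ (2 * Suc k) * H x * E x) = 0"
   unfolding F'_def by (subst (asm) Bochner_Integration.integral_add[OF i1 integrable_mult_right[OF i2]]) (simp only: integral_mult_right_zero)
  then have "c0 * (LB x. b x ^ (2 * Suc k) * H x * E x) = - (LB x. b x ^ (2 * k) * J x * E x)"
   by (simp only: eq_neg_iff_add_eq_0 add.commute)
  from arg_cong[OF this, of norm] have "norm c0 * norm (LB x. b x ^ (2 * Suc k) * H x * E x) = norm (LB x. b x ^ (2 * k) * J x * E x)"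
   by (simp only: norm_minus_cancel norm_mult)
  moreover have "norm (LB x. b x ^ (2 * k) * J x * E x) <= C * (LB x. C1 * W' x)"
  proof (rule IH[OF V symb_SucD[OF b] J E c0, of "%x. C1 * W x"])
   show "\<forall>i\<le>k. \<forall>x. V x ^ i * m x ^ (2 * k - i) * (C1 * (V x * m x * M x)) <= C1 * W x"
   proof (intro allI impI)
    fix i x assume "i <= k"
    then have e: "2 * Suc k - Suc i = Suc (2 * k - i)" by simp
    have "V x ^ i * m x ^ (2 * k - i) * (C1 * (V x * m x * M x)) = C1 * (V x ^ Suc i * m x ^ (2 * Suc k - Suc i) * M x)"
     unfolding e by (simp add: mult_ac)
    also have "... <= C1 * W x" using W(2)[rule_format, of "Suc i" x] C1 \<open>i <= k\<close> by (intro mult_left_mono) auto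
    finally show "V x ^ i * m x ^ (2 * k - i) * (C1 * (V x * m x * M x)) <= C1 * W x" .
   qed
   show "\<forall>i<k. \<forall>x. V x ^ i * m x ^ (2 * k - 1 - i) * (C1 * (V x * m x * M x)) <= C1 * W x"
   proof (intro allI impI)
    fix i x assume "i < k"
    then have e: "2 * Suc k - 1 - Suc i = Suc (2 * k - 1 - i)" by simp
    have "V x ^ i * m x ^ (2 * k - 1 - i) * (C1 * (V x * m x * M x)) = C1 * (V x ^ Suc i * m x ^ (2 * Suc k - 1 - Suc i) * M x)"
     unfolding e by (simp add: mult_ac)
    also have "... <= C1 * W x" using W(3)[rule_format, of "Suc i" x] C1 \<open>i < k\<close> by (intro mult_left_mono) auto
    finally show "V x ^ i * m x ^ (2 * k - 1 - i) * (C1 * (V x * m x * M x)) <= C1 * W x" .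
   qed
   show "\<forall>x. V x ^ k * m x ^ k * (C1 * (V x * m x * M x)) <= C1 * W' x"
   proof
    fix x
    have "V x ^ k * m x ^ k * (C1 * (V x * m x * M x)) = C1 * (V x ^ Suc k * m x ^ Suc k * M x)" by (simp add: mult_ac)
    also have "... <= C1 * W' x" using W'(2) C1 by (intro mult_left_mono) auto
    finally show "V x ^ k * m x ^ k * (C1 * (V x * m x * M x)) <= C1 * W' x" .
   qed
  qed (use W(1) W'(1) in auto)
  moreover have "norm (LB x. b x ^ (2 * Suc k) * H x * E x) <= norm c0 * norm (LB x. b x ^ (2 * Suc k) * H x * E x)"
   using c0 by (simp add: mult_le_cancel_right1)
  ultimately show "norm (LB x. b x ^ (2 * Suc k) * H x * E x) <= C * C1 * (LB x. W' x)"
   by simp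
 qed
qed

text \<open>The largest coordinate satisfies |u|^2 <= d u_i^2, and its power is one of the
  summands.\<close>

lemma power_sum_lower:
 fixes u :: "real^'d"
 shows "norm u ^ (2 * n) <= real CARD('d) ^ n * (\<Sum>i\<in>UNIV. (u $ i) ^ (2 * n))"
proof -
 have "Max (range (%j. (u $ j)\<^sup>2)) \<in> range (%j. (u $ j)\<^sup>2)"
  by (rule Max_in) auto
 then obtain i where "Max (range (%j. (u $ j)\<^sup>2)) = (u $ i)\<^sup>2" by (rule rangeE)
 then have i: "(u $ j)\<^sup>2 <= (u $ i)\<^sup>2" for j
  using Max_ge[of "range (%j. (u $ j)\<^sup>2)" "(u $ j)\<^sup>2"] by simp
 have "(norm u)\<^sup>2 = (\<Sum>j\<in>UNIV. (u $ j)\<^sup>2)"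
  by (simp add: norm_vec_def L2_set_def sum_nonneg)
 also have "... <= (\<Sum>j\<in>(UNIV::'d set). (u $ i)\<^sup>2)"
  by (rule sum_mono) (rule i)
 finally have "(norm u)\<^sup>2 <= real CARD('d) * (u $ i)\<^sup>2" by simp
 then have "((norm u)\<^sup>2) ^ n <= (real CARD('d) * (u $ i)\<^sup>2) ^ n"
  by (rule power_mono) simp
 then have "norm u ^ (2 * n) <= real CARD('d) ^ n * (u $ i) ^ (2 * n)"
  by (simp add: power_mult power_mult_distrib)
 also have "... <= real CARD('d) ^ n * (\<Sum>i\<in>UNIV. (u $ i) ^ (2 * n))"
  by (intro mult_left_mono member_le_sum) auto
 finally show ?thesis .
qed

text \<open>The weights \<open>cx (u x $ j) ^ (2 * N) / S x\<close> sum to 1, and the piece with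
  index j is integrated by parts along axis j only; hence the separate bound \<open>MF j\<close> for
  each direction. In the exponent 3N, 2N comes from N derivatives of weight v^2 and N from
  estimating 1/|u| by v/r.\<close>

lemma phase_decay:
 fixes N :: nat
 shows "\<exists>C>0. \<forall>(u :: real^'d => real^'d) v E c0 r F MF.
  (\<forall>x. 1 <= v x) --> 0 < r --> (\<forall>x. r <= v x * norm (u x)) -->
  (\<forall>j i. symb N (axis j 1) (%x. (v x)\<^sup>2) (%x. cx (u x $ i)) (%x. norm (u x))) -->
  (\<forall>j. has_dir_deriv (axis j 1) E (%x. c0 * cx (u x $ j) * E x)) -->
  continuous_on UNIV E --> (\<forall>x. norm (E x) <= 1) --> 1 <= norm c0 -->
  (\<forall>j. symb N (axis j 1) (%x. (v x)\<^sup>2) F (MF j)) -->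
  (\<forall>j. integrable lborel (%x. v x ^ (3 * N) * MF j x)) -->
  norm (LB x. F x * E x) <= C / r ^ N * (\<Sum>j\<in>UNIV. LB x. v x ^ (3 * N) * MF j x)"
proof -
 \<comment> \<open>\<open>K\<close> is the constant in the symbol bound of the power sum
   \<open>S\<close>, and \<open>c\<close> is the ratio between its lower bound and that symbol
   bound, as \<open>symb_inverse\<close> asks.\<close>
 define K :: real where "K = real CARD('d) * 2 ^ (N * (2 * N))"
 define c where "c = 1 / (real CARD('d) ^ N * K)"
 have K: "K > 0" and c: "c > 0" by (auto simp: K_def c_def)
 obtain Ci where Ci: "Ci > 0" and inv: "\<And>(e::real^'d) V g M. (\<forall>x. 0 <= V x) ==> symb N e V g M ==>
   (\<forall>x. 0 < M x \<and> c * M x <= norm (g x)) ==> symb N e V (%x. inverse (g x)) (%x. Ci * inverse (M x))"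
  using symb_inverse[OF c, of N, where 'a="real^'d"] by blast
 obtain Cp where Cp: "Cp > 0" and parts: "\<And>(e::real^'d) V b m H M E c0 W W'.
  (\<forall>x. 0 <= V x) ==> symb N e V b m ==> symb N e V H M ==> has_dir_deriv e E (%x. c0 * b x * E x) ==>
  continuous_on UNIV E ==> (\<forall>x. norm (E x) <= 1) ==> 1 <= norm (c0::complex) ==>
  integrable lborel W ==> (\<forall>i\<le>N. \<forall>x. V x ^ i * m x ^ (2 * N - i) * M x <= W x) ==>
  (\<forall>i<N. \<forall>x. V x ^ i * m x ^ (2 * N - 1 - i) * M x <= W x) ==>
  integrable lborel W' ==> (\<forall>x. V x ^ N * m x ^ N * M x <= W' x) ==>
  norm (LB x. b x ^ (2 * N) * H x * E x) <= Cp * (LB x. W' x)"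
  using iterated_parts[of N, where 'a="real^'d"] by blast
 define C2 where "C2 = 2 ^ N * Ci / K"
 have C2: "C2 > 0" using Ci K by (simp add: C2_def)
 show ?thesis
 proof (intro exI[of _ "Cp * C2"] conjI allI impI)
  show "Cp * C2 > 0" using Cp C2 by simp
  fix u :: "real^'d => real^'d" and v :: "real^'d => real" and E F :: "real^'d => complex" and c0 :: complex and r :: real and MF :: "'d => real^'d => real"
  assume v: "\<forall>x. 1 <= v x" and r: "0 < r" and ru: "\<forall>x. r <= v x * norm (u x)"
   and su: "\<forall>j i. symb N (axis j 1) (%x. (v x)\<^sup>2) (%x. cx (u x $ i)) (%x. norm (u x))"
   and E: "\<forall>j. has_dir_deriv (axis j 1) E (%x. c0 * cx (u x $ j) * E x)" "continuous_on UNIV E" "\<forall>x. norm (E x) <= 1"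
   and c0: "1 <= norm c0"
   and F: "\<forall>j. symb N (axis j 1) (%x. (v x)\<^sup>2) F (MF j)"
   and int: "\<forall>j. integrable lborel (%x. v x ^ (3 * N) * MF j x)"
  have m0: "norm (u x) > 0" for x
   using ru[rule_format, of x] v[rule_format, of x] r by (metis mult_zero_right norm_ge_zero not_le order_le_less)
  have V0: "\<forall>x. 0 <= (v x)\<^sup>2" by simp
  \<comment> \<open>Even exponents keep \<open>S\<close> real, positive and differentiable, and
    supply the even power that \<open>iterated_parts\<close> consumes.\<close>
  define S where "S x = (\<Sum>i\<in>UNIV. cx (u x $ i) ^ (2 * N))" for x
  define H where "H x = F x * inverse (S x)" for x
  have Sreal: "S x = cx (\<Sum>i\<in>UNIV. (u x $ i) ^ (2 * N))" for x
   by (simp add: S_def)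
  have Spos: "norm (u x) ^ (2 * N) <= real CARD('d) ^ N * norm (S x)" for x
   using power_sum_lower[of "u x" N] unfolding Sreal norm_of_real by (simp add: sum_nonneg)
  have Snz: "S x \<noteq> 0" for x
  proof
   assume "S x = 0"
   then have "norm (u x) ^ (2 * N) <= 0" using Spos[of x] by simp
   moreover have "0 < norm (u x) ^ (2 * N)" using m0[of x] by (rule zero_less_power)
   ultimately show False by linarith
  qed
  have sS: "symb N (axis j 1) (%x. (v x)\<^sup>2) S (%x. K * norm (u x) ^ (2 * N))" for j
  proof -
   have "symb N (axis j 1) (%x. (v x)\<^sup>2) S (%x. \<Sum>i\<in>(UNIV::'d set). 2 ^ (N * (2 * N)) * norm (u x) ^ (2 * N))"
    unfolding S_def[abs_def] by (intro symb_sum symb_power) (use su in auto)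
   then show ?thesis by (simp add: K_def mult.assoc)
  qed
  have sI: "symb N (axis j 1) (%x. (v x)\<^sup>2) (%x. inverse (S x)) (%x. Ci * inverse (K * norm (u x) ^ (2 * N)))" for j
  proof (rule inv[OF V0 sS], intro allI conjI)
   fix x
   show "0 < K * norm (u x) ^ (2 * N)" using K m0 by simp
   have "c * (K * norm (u x) ^ (2 * N)) = norm (u x) ^ (2 * N) / real CARD('d) ^ N"
    using K by (simp add: c_def)
   also have "... <= norm (S x)" using Spos[of x] by (simp add: divide_le_eq mult.commute)
   finally show "c * (K * norm (u x) ^ (2 * N)) <= norm (S x)" .
  qed
  define M where "M j x = C2 * (inverse (norm (u x)) ^ (2 * N) * MF j x)" for j x
  have sH: "symb N (axis j 1) (%x. (v x)\<^sup>2) H (M j)" for j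
  proof -
   have "symb N (axis j 1) (%x. (v x)\<^sup>2) H (%x. 2 ^ N * (MF j x * (Ci * inverse (K * norm (u x) ^ (2 * N)))))"
    unfolding H_def[abs_def] by (rule symb_mult[OF _ _ sI]) (use F in auto)
   also have "(%x. 2 ^ N * (MF j x * (Ci * inverse (K * norm (u x) ^ (2 * N))))) = M j"
    by (auto simp: M_def C2_def field_simps)
   finally show ?thesis .
  qed
  have MF0: "0 <= MF j x" for j x using symb_nonneg F by blast
  have im: "inverse (norm (u x)) <= v x / r" for x
   using ru[rule_format, of x] r m0[of x] by (simp add: field_simps)
  have vr: "0 <= v x / r" for x using v[rule_format, of x] r by simp
  have mM: "norm (u x) ^ (2 * N - n) * M j x = C2 * (inverse (norm (u x)) ^ n * MF j x)" if "n <= 2 * N" for n j x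
  proof -
   have "norm (u x) ^ (2 * N) = norm (u x) ^ n * norm (u x) ^ (2 * N - n)"
    using that by (simp add: power_add[symmetric])
   then show ?thesis using m0[of x] by (simp add: M_def field_simps)
  qed
  have key: "(v x)\<^sup>2 ^ i * norm (u x) ^ (2 * N - n) * M j x <= C2 * ((v x ^ (2 * i + n) / r ^ n) * MF j x)" if "n <= 2 * N" for i n j x
  proof -
   have "(v x)\<^sup>2 ^ i * norm (u x) ^ (2 * N - n) * M j x = C2 * (((v x)\<^sup>2 ^ i * inverse (norm (u x)) ^ n) * MF j x)"
    using mM[OF that, of x j] by (simp add: mult_ac)
   also have "... <= C2 * (((v x)\<^sup>2 ^ i * (v x / r) ^ n) * MF j x)"
    using C2 MF0 im m0[of x] by (intro mult_left_mono mult_right_mono power_mono) (auto simp: less_imp_le)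
   also have "(v x)\<^sup>2 ^ i * (v x / r) ^ n = v x ^ (2 * i + n) / r ^ n"
    by (simp add: power_add power_mult power_divide)
   finally show ?thesis .
  qed
  \<comment> \<open>A crude bound for the integrability of intermediate terms, which contain varying
    powers of 1/r up to N. The factor (1 + 1/r)^N stays inside \<open>W\<close> and does not reach
    the final estimate.\<close>
  have pm: "v x ^ a / r ^ n <= (1 + 1 / r) ^ N * v x ^ (3 * N)" if "a <= 3 * N" "n <= N" for a n x
  proof -
   have "v x ^ a / r ^ n = (1 / r) ^ n * v x ^ a" by (simp add: power_divide)
   also have "... <= (1 + 1 / r) ^ N * v x ^ (3 * N)"
   proof (intro mult_mono)
    have "(1 / r) ^ n <= (1 + 1 / r) ^ n" using r by (intro power_mono) auto
    also have "... <= (1 + 1 / r) ^ N" using r that by (intro power_increasing) auto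
    finally show "(1 / r) ^ n <= (1 + 1 / r) ^ N" .
    show "v x ^ a <= v x ^ (3 * N)" using v that by (intro power_increasing) auto
   qed (use r v[rule_format, of x] in auto)
   finally show ?thesis .
  qed
  define W where "W j x = C2 * (1 + 1 / r) ^ N * (v x ^ (3 * N) * MF j x)" for j x
  define W' where "W' j x = C2 / r ^ N * (v x ^ (3 * N) * MF j x)" for j x
  have iW: "integrable lborel (W j)" "integrable lborel (W' j)" for j
   unfolding W_def[abs_def] W'_def[abs_def] using int by (auto intro!: integrable_mult_right)
  have w1: "(v x)\<^sup>2 ^ i * norm (u x) ^ (2 * N - n) * M j x <= W j x" if "n <= N" "2 * i + n <= 3 * N" for i n j x
  proof -
   have "C2 * ((v x ^ (2 * i + n) / r ^ n) * MF j x) <= C2 * (((1 + 1 / r) ^ N * v x ^ (3 * N)) * MF j x)"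
    using C2 MF0 that by (intro mult_left_mono mult_right_mono pm) auto
   then show ?thesis using key[of n x i j] that by (simp add: W_def mult_ac)
  qed
  have "norm (LB x. cx (u x $ j) ^ (2 * N) * H x * E x) <= Cp * (LB x. W' j x)" for j
  proof (rule parts[OF V0 _ sH _ E(2,3) c0 iW(1) _ _ iW(2)])
   show "symb N (axis j 1) (%x. (v x)\<^sup>2) (%x. cx (u x $ j)) (%x. norm (u x))" using su by blast
   show "has_dir_deriv (axis j 1) E (%x. c0 * cx (u x $ j) * E x)" using E by blast
   show "\<forall>i\<le>N. \<forall>x. (v x)\<^sup>2 ^ i * norm (u x) ^ (2 * N - i) * M j x <= W j x"
    by (auto intro!: w1)
   show "\<forall>i<N. \<forall>x. (v x)\<^sup>2 ^ i * norm (u x) ^ (2 * N - 1 - i) * M j x <= W j x"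
   proof (intro allI impI)
    fix i x assume "i < N"
    then show "(v x)\<^sup>2 ^ i * norm (u x) ^ (2 * N - 1 - i) * M j x <= W j x"
     using w1[of "Suc i" i x j] by simp
   qed
   show "\<forall>x. (v x)\<^sup>2 ^ N * norm (u x) ^ N * M j x <= W' j x"
   proof
    fix x
    show "(v x)\<^sup>2 ^ N * norm (u x) ^ N * M j x <= W' j x"
     using key[of N x N j] by (simp add: W'_def mult_ac)
   qed
  qed
  then have bound: "norm (LB x. cx (u x $ j) ^ (2 * N) * H x * E x)
    <= Cp * (C2 / r ^ N * (LB x. v x ^ (3 * N) * MF j x))" for j
   by (simp add: W'_def)
  have inth: "integrable lborel (%x. cx (u x $ j) ^ (2 * N) * H x * E x)" for j
  proof (rule integrable_bd[OF iW(1)[of j]])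
   have su': "symb N (axis j 1) (%x. (v x)\<^sup>2) (%x. cx (u x $ j)) (%x. norm (u x))" using su by blast
   have "continuous_on UNIV (%x. cx (u x $ j) ^ (2 * N) * H x * E x)"
    by (intro continuous_on_mult continuous_on_power symb_cont[OF su'] symb_cont[OF sH] E(2))
   then show "(%x. cx (u x $ j) ^ (2 * N) * H x * E x) \<in> borel_measurable lborel"
    using contI by simp
   have "norm (cx (u x $ j) ^ (2 * N) * H x * E x) <= norm (W j x)" for x
   proof -
    have "norm (cx (u x $ j) ^ (2 * N) * H x * E x) <= norm (u x) ^ (2 * N) * M j x * 1"
     unfolding norm_mult norm_power
     using symb_bound[OF su', of x] symb_bound[OF sH, of x] E(3) symb_nonneg[OF sH]
     by (intro mult_mono power_mono) auto
    also have "... <= W j x" using w1[of 0 0 x j] by simp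
    finally show ?thesis by simp
   qed
   then show "AE x in lborel. norm (cx (u x $ j) ^ (2 * N) * H x * E x) <= norm (W j x)" by (intro AE_I2)
  qed
  have "(LB x. F x * E x) = (LB x. (\<Sum>j\<in>UNIV. cx (u x $ j) ^ (2 * N) * H x * E x))"
  proof (rule integral_eqI)
   fix x
   have "(\<Sum>j\<in>UNIV. cx (u x $ j) ^ (2 * N) * H x * E x) = S x * H x * E x"
    by (simp add: S_def sum_distrib_right)
   also have "... = F x * E x" using Snz by (simp add: H_def)
   finally show "F x * E x = (\<Sum>j\<in>UNIV. cx (u x $ j) ^ (2 * N) * H x * E x)" ..
  qed simp
  also have "... = (\<Sum>j\<in>UNIV. LB x. cx (u x $ j) ^ (2 * N) * H x * E x)"
   by (rule Bochner_Integration.integral_sum) (rule inth)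
  also have "norm ... <= (\<Sum>j\<in>UNIV. Cp * (C2 / r ^ N * (LB x. v x ^ (3 * N) * MF j x)))"
   by (rule sum_norm_le) (rule bound)
  also have "... = Cp * C2 / r ^ N * (\<Sum>j\<in>UNIV. LB x. v x ^ (3 * N) * MF j x)"
   by (simp add: sum_distrib_left mult_ac)
  finally show "norm (LB x. F x * E x) <= Cp * C2 / r ^ N * (\<Sum>j\<in>UNIV. LB x. v x ^ (3 * N) * MF j x)" .
 qed
qed

section \<open>Functions of class C^k as symbols\<close>

lemma Ck_on_continuous: "Ck_on k S f ==> open S ==> continuous_on S f"
 by (cases k) (auto intro!: differentiable_imp_continuous_on differentiable_at_imp_differentiable_on)

lemma partial_deriv_linear:
 assumes L: "bounded_linear L" and f: "f differentiable (at x)"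
 shows "(%x. L (f x)) differentiable (at x)" "partial_deriv j (%x. L (f x)) x = L (partial_deriv j f x)"
proof -
 have "(f has_derivative frechet_derivative f (at x)) (at x)"
  using f by (simp add: frechet_derivative_works)
 then have d: "((%x. L (f x)) has_derivative (%h. L (frechet_derivative f (at x) h))) (at x)"
  by (rule bounded_linear.has_derivative[OF L])
 then show "(%x. L (f x)) differentiable (at x)" by (auto simp: differentiable_def)
 show "partial_deriv j (%x. L (f x)) x = L (partial_deriv j f x)"
  unfolding partial_deriv_def frechet_derivative_at[OF d, symmetric] ..
qed

lemma Ck_on_UNIV_linear:
 assumes L: "bounded_linear L"
 shows "Ck_on k UNIV f ==> Ck_on k UNIV (%x. L (f x))"
proof (induction k arbitrary: f)
 case 0
 then show ?case by (simp add: bounded_linear.continuous_on[OF L])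
next
 case (Suc k)
 have "partial_deriv j (%x. L (f x)) = (%x. L (partial_deriv j f x))" for j
  by (intro ext partial_deriv_linear(2)[OF L]) (use Suc.prems in simp)
 moreover have "(%x. L (f x)) differentiable (at x)" for x
  by (rule partial_deriv_linear(1)[OF L]) (use Suc.prems in simp)
 ultimately show ?case using Suc by simp
qed

lemma Ck_on_UNIV_add:
 "Ck_on k UNIV f ==> Ck_on k UNIV g ==> Ck_on k UNIV (%x. f x + g x)"
proof (induction k arbitrary: f g)
 case 0
 then show ?case by (auto intro: continuous_on_add)
next
 case (Suc k)
 have "partial_deriv j (%x. f x + g x) = (%x. partial_deriv j f x + partial_deriv j g x)" for j
 proof
  fix x
  have "(f has_derivative frechet_derivative f (at x)) (at x)" "(g has_derivative frechet_derivative g (at x)) (at x)"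
   using Suc.prems by (auto simp: frechet_derivative_works)
  from has_derivative_add[OF this] show "partial_deriv j (%x. f x + g x) x = partial_deriv j f x + partial_deriv j g x"
   unfolding partial_deriv_def by (subst frechet_derivative_at[symmetric]) auto
 qed
 then show ?case using Suc by (auto intro: differentiable_add)
qed

lemma Ck_on_UNIV_const: "Ck_on k UNIV (%x. c)"
proof (induction k arbitrary: c)
 case (Suc k)
 have "partial_deriv j (%x. c) = (%x. 0)" for j :: 'a
  by (simp add: partial_deriv_def frechet_derivative_const fun_eq_iff)
 then show ?case using Suc by simp
qed simp

lemma Ck_on_UNIV_sum:
 "finite A ==> (\<And>i. i \<in> A ==> Ck_on k UNIV (f i)) ==> Ck_on k UNIV (%x. \<Sum>i\<in>A. f i x)"
 by (induction A rule: finite_induct) (auto intro: Ck_on_UNIV_const Ck_on_UNIV_add)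

lemma partial_deriv_translate:
 assumes f: "f differentiable (at (x + a))"
 shows "(%x. f (x + a)) differentiable (at x)" "partial_deriv j (%x. f (x + a)) x = partial_deriv j f (x + a)"
proof -
 have "(f has_derivative frechet_derivative f (at (x + a))) (at (x + a))"
  using f by (simp add: frechet_derivative_works)
 moreover have "((%x. x + a) has_derivative (%h. h)) (at x)"
  by (auto intro!: derivative_eq_intros)
 ultimately have d: "((%x. f (x + a)) has_derivative frechet_derivative f (at (x + a))) (at x)"
  using diff_chain_at[of "%x. x + a" "%h. h" x f "frechet_derivative f (at (x + a))"] by (simp add: o_def)
 then show "(%x. f (x + a)) differentiable (at x)" by (auto simp: differentiable_def)
 show "partial_deriv j (%x. f (x + a)) x = partial_deriv j f (x + a)"
  unfolding partial_deriv_def frechet_derivative_at[OF d, symmetric] ..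
qed

lemma Ck_on_UNIV_translate: "Ck_on k UNIV f ==> Ck_on k UNIV (%x. f (x + a))"
proof (induction k arbitrary: f)
 case 0
 then show ?case by (auto intro!: continuous_on_compose2[of UNIV f UNIV "%x. x + a"] continuous_intros)
next
 case (Suc k)
 have "partial_deriv j (%x. f (x + a)) = (%x. partial_deriv j f (x + a))" for j
  by (intro ext partial_deriv_translate(2)) (use Suc.prems in simp)
 moreover have "(%x. f (x + a)) differentiable (at x)" for x
  by (rule partial_deriv_translate(1)) (use Suc.prems in simp)
 ultimately show ?case using Suc by simp
qed

lemma partial_deriv_funpow_translate:
 "Ck_on k UNIV f ==> n <= k ==> (partial_deriv j ^^ n) (%x. f (x + a)) = (%x. (partial_deriv j ^^ n) f (x + a))"
proof (induction n arbitrary: f k)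
 case (Suc n)
 then obtain k' where k: "k = Suc k'" "n <= k'" by (cases k) auto
 have "partial_deriv j (%x. f (x + a)) = (%x. partial_deriv j f (x + a))"
  by (intro ext partial_deriv_translate(2)) (use Suc.prems k in simp)
 then show ?case using Suc.IH[of k' "partial_deriv j f"] Suc.prems k by (simp only: funpow_Suc_right o_def) auto
qed simp

lemma has_dir_deriv_partial:
 assumes "\<And>x. f differentiable (at x)" and L: "bounded_linear L"
 shows "has_dir_deriv (axis j 1) (%x. L (f x)) (%x. L (partial_deriv j f x))"
 unfolding has_dir_deriv_def
proof
 fix x
 have "((%x. L (f x)) has_derivative (%h. L (frechet_derivative f (at x) h))) (at (x + 0 *\<^sub>R axis j 1))"
  using bounded_linear.has_derivative[OF L frechet_derivative_works[THEN iffD1, OF assms(1)[of x]]] by simp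
 moreover have "((%t. x + t *\<^sub>R axis j 1) has_derivative (%t. t *\<^sub>R axis j 1)) (at 0)"
  by (auto intro!: derivative_eq_intros)
 ultimately have "((%t. L (f (x + t *\<^sub>R axis j 1))) has_derivative (%t. L (frechet_derivative f (at x) (t *\<^sub>R axis j 1)))) (at 0)"
  using diff_chain_at[of "%t. x + t *\<^sub>R axis j 1" "%t. t *\<^sub>R axis j 1" 0 "%x. L (f x)"] by (simp add: o_def)
 moreover have "L (frechet_derivative f (at x) (t *\<^sub>R axis j 1)) = t *\<^sub>R L (partial_deriv j f x)" for t
  using linear_frechet_derivative[OF assms(1)[of x]] bounded_linear.linear[OF L]
  by (simp add: partial_deriv_def linear_scale)
 ultimately show "((%t. L (f (x + t *\<^sub>R axis j 1))) has_vector_derivative L (partial_deriv j f x)) (at 0)"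
  by (simp add: has_vector_derivative_def)
qed

text \<open>The link from \<open>Ck_on\<close> to the symbol calculus. The linear map
  \<open>L\<close> is applied after differentiation, so bounds on derivatives of a matrix field
  yield bounds for its entries and for its action on a vector.\<close>

lemma symb_Ck:
 assumes L: "bounded_linear L"
 shows "Ck_on k UNIV f ==> (\<And>n x. n <= k ==> norm (L ((partial_deriv j ^^ n) f x)) <= V x ^ n * M x) ==>
  symb k (axis j 1) V (%x. L (f x)) M"
proof (induction k arbitrary: f M)
 case 0
 then show ?case using 0(2)[of 0] by (auto intro: bounded_linear.continuous_on[OF L])
next
 case (Suc k)
 show ?case
 proof (rule symb_SucI[OF _ _ has_dir_deriv_partial[OF _ L]])
  show "continuous_on UNIV (%x. L (f x))"
   by (rule bounded_linear.continuous_on[OF L Ck_on_continuous[OF Suc.prems(1)]]) simp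
  show "norm (L (f x)) <= M x" for x using Suc.prems(2)[of 0 x] by simp
  show "f differentiable (at x)" for x using Suc.prems(1) by simp
  show "symb k (axis j 1) V (%x. L (partial_deriv j f x)) (%x. V x * M x)"
  proof (rule Suc.IH)
   show "Ck_on k UNIV (partial_deriv j f)" using Suc.prems(1) by simp
   fix n x assume "n <= k"
   then show "norm (L ((partial_deriv j ^^ n) (partial_deriv j f) x)) <= V x ^ n * (V x * M x)"
    using Suc.prems(2)[of "Suc n" x] by (simp add: funpow_swap1 mult_ac)
  qed
 qed
qed

lemma norm_matrix_vector_le: "norm (M *v x) <= mat_norm M * norm (x::real^'d)"
 unfolding mat_norm_def by (rule onorm) (simp add: matrix_vector_mul_bounded_linear)

lemma mat_norm_nonneg: "0 <= mat_norm M"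
 unfolding mat_norm_def by (rule onorm_pos_le) (simp add: matrix_vector_mul_bounded_linear)

lemma abs_entry_le_mat_norm: "\<bar>M $ i $ j\<bar> <= mat_norm (M::real^'d^'d)"
proof -
 have "M $ i $ j = (M *v axis j 1) $ i"
  by (simp add: matrix_vector_mult_basis column_def)
 also have "\<bar>...\<bar> <= norm (M *v axis j 1)" by (rule component_le_norm_cart)
 also have "... <= mat_norm M * norm (axis j 1 :: real^'d)" by (rule norm_matrix_vector_le)
 finally show ?thesis by simp
qed

lemma abs_det_le:
 fixes M :: "real^'d^'d"
 assumes B: "\<And>i j. \<bar>M $ i $ j\<bar> <= B"
 shows "\<bar>det M\<bar> <= fact CARD('d) * B ^ CARD('d)"
proof -
 have "\<bar>det M\<bar> <= (\<Sum>p\<in>{p. p permutes (UNIV::'d set)}. \<bar>of_int (sign p) * (\<Prod>i\<in>UNIV. M $ i $ p i)\<bar>)"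
  unfolding det_def by (rule sum_abs)
 also have "... <= (\<Sum>p\<in>{p. p permutes (UNIV::'d set)}. B ^ CARD('d))"
 proof (rule sum_mono)
  fix p :: "'d => 'd"
  have "\<bar>of_int (sign p) * (\<Prod>i\<in>UNIV. M $ i $ p i)\<bar> = (\<Prod>i\<in>UNIV. \<bar>M $ i $ p i\<bar>)"
   by (auto simp: abs_mult abs_prod sign_def)
  also have "... <= (\<Prod>i\<in>(UNIV::'d set). B)"
   by (rule prod_mono) (use B in auto)
  finally show "\<bar>of_int (sign p) * (\<Prod>i\<in>UNIV. M $ i $ p i)\<bar> <= B ^ CARD('d)" by simp
 qed
 also have "... = fact CARD('d) * B ^ CARD('d)"
  by (simp add: card_permutations[of UNIV "CARD('d)"])
 finally show ?thesis .
qed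

section \<open>Warping functions\<close>

locale warping =
 fixes D :: "(real^'d) set" and Ph :: "real^'d => real^'d" and v0 :: "real^'d => real" and N :: nat
 assumes open_D: "open D" and D_nonempty: "D \<noteq> {}" and admissible: "admissible_warping N D Ph v0"
begin

abbreviation "Ps \<equiv> inv_into D Ph"
abbreviation "A \<equiv> warp_jac D Ph"
abbreviation "w \<equiv> warp_weight D Ph"
abbreviation "phi \<equiv> warp_phi D Ph"

lemma bij: "bij_betw Ph D UNIV"
 using admissible by (simp add: admissible_warping_def Ck_diffeo_def)

lemma Psi_in_D [simp]: "Ps tau \<in> D"
 by (metis bij bij_betw_def UNIV_I inv_into_into)

lemma Phi_Psi [simp]: "Ph (Ps tau) = tau"
 by (metis bij bij_betw_def UNIV_I f_inv_into_f)

lemma Psi_Phi [simp]: "om \<in> D ==> Ps (Ph om) = om"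
 using bij by (simp add: bij_betw_def)

lemma range_Psi: "range Ps = D"
 using bij_betw_imp_surj_on[OF bij_betw_inv_into[OF bij]] .

lemma inj_Psi: "inj Ps"
 using bij_betw_inv_into[OF bij] by (simp add: bij_betw_def)

lemma Ck_Psi: "Ck_on (Suc N) UNIV Ps"
 using admissible by (simp add: admissible_warping_def Ck_diffeo_def)

lemma continuous_Phi: "continuous_on D Ph"
 using admissible open_D by (auto simp: admissible_warping_def Ck_diffeo_def intro: Ck_on_continuous[of "N + 1"])

lemma continuous_Psi: "continuous_on UNIV Ps"
 by (rule Ck_on_continuous[OF Ck_Psi]) simp

lemma v0_pos: "0 < v0 x" and v0_cont: "continuous_on UNIV v0" and v0_submult: "v0 (x + y) <= v0 x * v0 y"
 and v0_mono: "norm x <= norm y ==> v0 x <= v0 y"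
 using admissible by (auto simp: admissible_warping_def submultiplicative_def radially_increasing_def)

text \<open>Submultiplicativity at the origin gives v0(0) <= v0(0)^2, and radial growth carries the
  bound everywhere.\<close>

lemma v0_ge_1: "1 <= v0 x"
proof -
 have "v0 0 * 1 <= v0 0 * v0 0" using v0_submult[of 0 0] by simp
 then have "1 <= v0 0" using v0_pos[of 0] by (simp only: mult_le_cancel_left_pos)
 also have "v0 0 <= v0 x" by (rule v0_mono) simp
 finally show ?thesis .
qed

lemma v0_minus [simp]: "v0 (- x) = v0 x"
 using v0_mono[of x "- x"] v0_mono[of "- x" x] by simp

lemma differentiable_Psi: "Ps differentiable (at tau)"
 using Ck_Psi by simp

lemma A_entry: "A tau $ i $ j = partial_deriv j Ps tau $ i"
 by (simp add: warp_jac_def jacobian_def matrix_def partial_deriv_def)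

lemma Psi_has_derivative: "(Ps has_derivative ((*v) (A tau))) (at tau)"
 using differentiable_Psi[of tau] unfolding warp_jac_def jacobian_works .

lemma w_pos: "0 < w tau"
 using admissible by (simp add: admissible_warping_def warp_weight_def)

lemma A_inv: "A tau ** matrix_inv (A tau) = mat 1" "matrix_inv (A tau) ** A tau = mat 1"
proof -
 have "invertible (A tau)" using w_pos[of tau] by (simp add: invertible_det_nz warp_weight_def)
 then have "\<exists>B. A tau ** B = mat 1 \<and> B ** A tau = mat 1" by (simp add: invertible_def)
 from someI_ex[OF this] show "A tau ** matrix_inv (A tau) = mat 1" "matrix_inv (A tau) ** A tau = mat 1"
  by (auto simp: matrix_inv_def)
qed

lemma phi_mult_A: "phi tau up ** transpose (A tau) = transpose (A (up + tau))"
proof -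
 have "phi tau up ** transpose (A tau) = transpose (A (up + tau)) ** transpose (A tau ** matrix_inv (A tau))"
  by (simp only: warp_phi_def matrix_transpose_mul matrix_mul_assoc)
 then show ?thesis by (simp add: A_inv transpose_mat)
qed

text \<open>The inverse of \<open>phi tau up\<close> is again a value of \<open>phi\<close>, at
  argument \<open>- up\<close>, so it obeys the same control weight. This two-sided control yields
  the lower bound on the phase gradient.\<close>

lemma phi_inverse: "phi (up + tau) (- up) ** phi tau up = mat 1"
proof -
 have "phi (up + tau) (- up) ** phi tau up = phi (up + tau) (- up) ** transpose (A (up + tau)) ** transpose (matrix_inv (A tau))"
  by (simp only: warp_phi_def[of D Ph tau] matrix_mul_assoc)
 also have "... = transpose (A tau) ** transpose (matrix_inv (A tau))"
  using phi_mult_A[of "up + tau" "- up"] by simp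
 also have "... = transpose (matrix_inv (A tau) ** A tau)" by (simp only: matrix_transpose_mul)
 finally show ?thesis by (simp add: A_inv transpose_mat)
qed

lemma det_phi: "det (phi tau up) = w (up + tau) / w tau"
proof -
 have "det (phi tau up) * w tau = w (up + tau)"
  using arg_cong[OF phi_mult_A[of tau up], of det] by (simp add: det_mul warp_weight_def)
 then show ?thesis using w_pos[of tau] by (simp add: field_simps)
qed

lemma phi_deriv_bound: "n <= N ==> mat_norm ((partial_deriv j ^^ n) (phi tau) up) <= v0 up"
proof -
 have "\<forall>tau up js. length js <= N --> mat_norm (multi_deriv js (phi tau) up) <= v0 up"
  using admissible by (simp add: admissible_warping_def)
 from this[rule_format, of "replicate n j" tau up] show "n <= N ==> ?thesis"
  by (simp add: multi_deriv_def)
qed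

lemma phi_bound: "mat_norm (phi tau up) <= v0 up"
 using phi_deriv_bound[of 0] by simp

text \<open>The quotient is the determinant of \<open>phi\<close>, a sum of d! signed products of d
  entries bounded by v0.\<close>

lemma w_quotient_le: "w (up + tau) <= fact CARD('d) * v0 up ^ CARD('d) * w tau"
proof -
 have "\<bar>det (phi tau up)\<bar> <= fact CARD('d) * v0 up ^ CARD('d)"
  by (rule abs_det_le) (rule order_trans[OF abs_entry_le_mat_norm phi_bound])
 then show ?thesis using w_pos[of tau] w_pos[of "up + tau"] by (simp add: det_phi field_simps)
qed

text \<open>\<open>phi tau\<close> depends linearly on the first partial derivatives of the inverse
  warping map, which is of class C^(N+1).\<close>

lemma Ck_phi: "Ck_on N UNIV (phi tau)"
proof -
 define B where "B = transpose (matrix_inv (A tau))"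
 \<comment> \<open>\<open>L r\<close> puts the row vector \<open>z\<close> times \<open>B\<close>
   into row \<open>r\<close>; row \<open>r\<close> of the transposed Jacobian is the partial
   derivative in direction \<open>r\<close>.\<close>
 define L where "L r z = (\<chi> r' s. if r' = r then \<Sum>k\<in>UNIV. z $ k * B $ k $ s else (0 :: real))" for r :: 'd and z :: "real^'d"
 have L: "bounded_linear (L r)" for r
  unfolding linear_conv_bounded_linear[symmetric]
  by (rule linearI) (auto simp: L_def vec_eq_iff sum.distrib[symmetric] algebra_simps sum_distrib_left)
 have "phi tau = (%up. \<Sum>r\<in>UNIV. L r (partial_deriv r Ps (up + tau)))"
 proof
  fix up
  have "phi tau up = transpose (A (up + tau)) ** B" by (simp only: warp_phi_def B_def)
  then show "phi tau up = (\<Sum>r\<in>UNIV. L r (partial_deriv r Ps (up + tau)))"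
   by (simp add: L_def vec_eq_iff matrix_matrix_mult_def transpose_def A_entry)
 qed
 moreover have "Ck_on N UNIV (%up. \<Sum>r\<in>UNIV. L r (partial_deriv r Ps (up + tau)))"
  by (intro Ck_on_UNIV_sum Ck_on_UNIV_linear[OF L] Ck_on_UNIV_translate) (use Ck_Psi in auto)
 ultimately show ?thesis by (simp only:)
qed

lemma v0_sq_power: "1 <= (v0 x)\<^sup>2 ^ n"
 using v0_ge_1 by (simp add: one_le_power)

lemma symb_phi_entry: "symb N (axis j 1) (%x. (v0 x)\<^sup>2) (%up. cx (phi tau up $ i $ l)) v0"
proof (rule symb_Ck[OF _ Ck_phi])
 show "bounded_linear (%M::real^'d^'d. cx (M $ i $ l))"
  by (intro bounded_linear_compose[OF bounded_linear_of_real] bounded_linear_compose[OF bounded_linear_vec_nth bounded_linear_vec_nth])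
 fix n x assume "n <= N"
 have "norm (cx ((partial_deriv j ^^ n) (phi tau) x $ i $ l)) <= v0 x"
  using order_trans[OF abs_entry_le_mat_norm phi_deriv_bound[OF \<open>n <= N\<close>]] by simp
 also have "... <= (v0 x)\<^sup>2 ^ n * v0 x"
  using v0_sq_power[of x n] v0_pos[of x] by simp
 finally show "norm (cx ((partial_deriv j ^^ n) (phi tau) x $ i $ l)) <= (v0 x)\<^sup>2 ^ n * v0 x" .
qed

lemma symb_det_phi:
 "symb N (axis j 1) (%x. (v0 x)\<^sup>2) (%up. cx (det (phi tau up)))
   (%x. fact CARD('d) * 2 ^ (N * CARD('d)) * v0 x ^ CARD('d))"
proof -
 have "symb N (axis j 1) (%x. (v0 x)\<^sup>2)
  (%up. \<Sum>p\<in>{p. p permutes (UNIV::'d set)}. cx (of_int (sign p)) * (\<Prod>i\<in>UNIV. cx (phi tau up $ i $ p i)))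
  (%x. \<Sum>p\<in>{p. p permutes (UNIV::'d set)}. norm (cx (of_int (sign p))) * (2 ^ (N * CARD('d)) * v0 x ^ CARD('d)))"
  by (intro symb_sum symb_cmult symb_prod symb_phi_entry) (auto simp: finite_permutations)
 also have "(%up. \<Sum>p\<in>{p. p permutes (UNIV::'d set)}. cx (of_int (sign p)) * (\<Prod>i\<in>UNIV. cx (phi tau up $ i $ p i)))
  = (%up. cx (det (phi tau up)))"
  by (simp add: det_def)
 also have "(%x. \<Sum>p\<in>{p. p permutes (UNIV::'d set)}. norm (cx (of_int (sign p))) * (2 ^ (N * CARD('d)) * v0 x ^ CARD('d)))
  = (%x. fact CARD('d) * 2 ^ (N * CARD('d)) * v0 x ^ CARD('d))"
 proof
  fix x
  have s: "norm (cx (of_int (sign p))) = 1" for p :: "'d => 'd" by (simp add: sign_def)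
  show "(\<Sum>p\<in>{p. p permutes (UNIV::'d set)}. norm (cx (of_int (sign p))) * (2 ^ (N * CARD('d)) * v0 x ^ CARD('d)))
   = fact CARD('d) * 2 ^ (N * CARD('d)) * v0 x ^ CARD('d)"
   unfolding s by (simp add: card_permutations[of UNIV "CARD('d)"])
 qed
 finally show ?thesis .
qed

lemma phi_vector_lower: "norm x <= v0 up * norm (phi tau up *v x)"
proof -
 have "x = (phi (up + tau) (- up) ** phi tau up) *v x" by (simp add: phi_inverse)
 also have "... = phi (up + tau) (- up) *v (phi tau up *v x)" by (simp only: matrix_vector_mul_assoc)
 also have "norm ... <= mat_norm (phi (up + tau) (- up)) * norm (phi tau up *v x)" by (rule norm_matrix_vector_le)
 also have "... <= v0 up * norm (phi tau up *v x)"
  using phi_bound[of "up + tau" "- up"] by (intro mult_right_mono) auto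
 finally show ?thesis .
qed

text \<open>The reason for the weight v0^2 throughout: a derivative of the gradient is at most v0
  |x|, and |x| is at most v0 times the gradient by \<open>phi_vector_lower\<close>. Measured against
  the gradient itself, differentiation therefore costs v0^2.\<close>

lemma symb_phase_gradient:
 "symb N (axis j 1) (%x. (v0 x)\<^sup>2) (%up. cx ((phi tau up *v x) $ i)) (%up. norm (phi tau up *v x))"
proof (rule symb_Ck[where L="%M. cx ((M *v x) $ i)", OF _ Ck_phi])
 have "linear (%M::real^'d^'d. (M *v x) $ i)"
  by (rule linearI) (auto simp: matrix_vector_mult_def sum.distrib algebra_simps sum_distrib_left)
 then show "bounded_linear (%M::real^'d^'d. cx ((M *v x) $ i))"
  by (intro bounded_linear_compose[OF bounded_linear_of_real]) (simp add: linear_conv_bounded_linear)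
 fix n up assume n: "n <= N"
 show "norm (cx (((partial_deriv j ^^ n) (phi tau) up *v x) $ i)) <= (v0 up)\<^sup>2 ^ n * norm (phi tau up *v x)"
 proof (cases n)
  case 0
  then show ?thesis by (simp add: component_le_norm_cart)
 next
  case (Suc m)
  have "norm (cx (((partial_deriv j ^^ n) (phi tau) up *v x) $ i)) <= norm ((partial_deriv j ^^ n) (phi tau) up *v x)"
   by (simp add: component_le_norm_cart)
  also have "... <= mat_norm ((partial_deriv j ^^ n) (phi tau) up) * norm x" by (rule norm_matrix_vector_le)
  also have "... <= v0 up * (v0 up * norm (phi tau up *v x))"
   using phi_deriv_bound[OF n] v0_pos by (intro mult_mono phi_vector_lower) (auto intro: less_imp_le)
  also have "... = (v0 up)\<^sup>2 * norm (phi tau up *v x)" by (simp add: power2_eq_square)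
  also have "... <= (v0 up)\<^sup>2 ^ n * norm (phi tau up *v x)"
   using mult_left_mono[OF v0_sq_power[of up m], of "(v0 up)\<^sup>2"] by (intro mult_right_mono) (auto simp: Suc)
  finally show ?thesis .
 qed
qed

text \<open>The exponent collects 3N from \<open>phase_decay\<close> and d from the determinant of
  \<open>phi\<close>, less 2a because a symbol of weight v0^2 already grants v0^(2a) to the a-th
  derivative.\<close>

definition env1 :: "(real^'d => complex) => real^'d => real" where
 "env1 th up = (\<Sum>j\<in>UNIV. \<Sum>a\<le>N. v0 up ^ (3 * N + CARD('d) - 2 * a) * cmod ((partial_deriv j ^^ a) th up))"

definition env2 :: "(real^'d => complex) => real^'d => real" where
 "env2 th up = (\<Sum>j\<in>UNIV. \<Sum>a\<le>N. cmod ((partial_deriv j ^^ a) th up))"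

definition env :: "(real^'d => complex) => (real^'d => complex) => real^'d => ennreal" where
 "env th1 th2 sig = (NN up. ennreal (env1 th1 up * env2 th2 (up + sig)))"

lemma continuous_partial_funpow:
 fixes th :: "real^'d => complex"
 shows "Ck_on k UNIV th ==> a <= k ==> continuous_on UNIV ((partial_deriv j ^^ a) th)"
proof (induction a arbitrary: th k)
 case 0
 then show ?case using Ck_on_continuous[of k UNIV th] by simp
next
 case (Suc a)
 then obtain k' where "k = Suc k'" "a <= k'" by (cases k) auto
 then show ?case using Suc.IH[of k' "partial_deriv j th"] Suc.prems by (simp only: funpow_Suc_right o_def) auto
qed

lemma env_nonneg: "0 <= env1 th up" "0 <= env2 th up"
 unfolding env1_def env2_def using v0_pos by (auto intro!: sum_nonneg mult_nonneg_nonneg zero_le_power simp: less_imp_le)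

lemma continuous_env:
 assumes "Ck_on N UNIV th"
 shows "continuous_on UNIV (env1 th)" "continuous_on UNIV (env2 th)"
 unfolding env1_def[abs_def] env2_def[abs_def]
 by (intro continuous_on_sum continuous_on_mult continuous_on_power v0_cont continuous_on_norm continuous_partial_funpow[OF assms]; simp)+

lemma measurable_env:
 assumes "Ck_on N UNIV th"
 shows "env1 th \<in> Borel" "env2 th \<in> Borel"
 using continuous_env[OF assms] by (auto intro: contI)

lemma symb_theta:
 assumes th: "Ck_on N UNIV th"
 shows "symb N (axis j 1) (%x. (v0 x)\<^sup>2) th (%x. \<Sum>a\<le>N. inverse (v0 x) ^ (2 * a) * cmod ((partial_deriv j ^^ a) th x))"
proof (rule symb_Ck[where L="%z. z", OF bounded_linear_ident th])
 fix n x assume n: "n <= N"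
 have "norm ((partial_deriv j ^^ n) th x) = (v0 x)\<^sup>2 ^ n * (inverse (v0 x) ^ (2 * n) * cmod ((partial_deriv j ^^ n) th x))"
  using v0_pos[of x] by (simp add: power_mult[symmetric] field_simps)
 also have "... <= (v0 x)\<^sup>2 ^ n * (\<Sum>a\<le>N. inverse (v0 x) ^ (2 * a) * cmod ((partial_deriv j ^^ a) th x))"
  using n v0_pos[of x] by (intro mult_left_mono member_le_sum) (auto intro!: mult_nonneg_nonneg)
 finally show "norm ((partial_deriv j ^^ n) th x) <= (v0 x)\<^sup>2 ^ n * (\<Sum>a\<le>N. inverse (v0 x) ^ (2 * a) * cmod ((partial_deriv j ^^ a) th x))" .
qed

text \<open>The weight is taken at \<open>x\<close>, the window at \<open>x + sig\<close>, so powers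
  of v0 are not traded against derivatives as in \<open>symb_theta\<close>; they are merely bounded
  below by 1.\<close>

lemma symb_theta_shift:
 assumes th: "Ck_on N UNIV th"
 shows "symb N (axis j 1) (%x. (v0 x)\<^sup>2) (%x. cnj (th (x + sig))) (%x. \<Sum>a\<le>N. cmod ((partial_deriv j ^^ a) th (x + sig)))"
proof (rule symb_Ck[where L=cnj, OF bounded_linear_cnj Ck_on_UNIV_translate[OF th]])
 fix n x assume n: "n <= N"
 have "norm (cnj ((partial_deriv j ^^ n) (%x. th (x + sig)) x)) = 1 * cmod ((partial_deriv j ^^ n) th (x + sig))"
  by (simp add: partial_deriv_funpow_translate[OF th n])
 also have "... <= (v0 x)\<^sup>2 ^ n * (\<Sum>a\<le>N. cmod ((partial_deriv j ^^ a) th (x + sig)))"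
  using n by (intro mult_mono member_le_sum v0_sq_power) auto
 finally show "norm (cnj ((partial_deriv j ^^ n) (%x. th (x + sig)) x)) <= (v0 x)\<^sup>2 ^ n * (\<Sum>a\<le>N. cmod ((partial_deriv j ^^ a) th (x + sig)))" .
qed

section \<open>Decay of the oscillatory integral\<close>

definition osc_integral :: "(real^'d => complex) => (real^'d => complex) => real^'d => real^'d => real^'d => complex" where
 "osc_integral th1 th2 tau sig x = (LB up. cx (det (phi tau up)) * th1 up * cnj (th2 (up + sig)) * cis (2 * pi * (x \<bullet> Ps (up + tau))))"

text \<open>With r = |A(tau)^T x|, absolute values suffice for r <= 1, and
  \<open>phase_decay\<close> gives r^-N for r > 1. Values in \<open>[0,\<infinity>]\<close> let the
  bound stand also where the envelope integral diverges.\<close>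

lemma osc_integral_bound:
 "\<exists>C>0. \<forall>th1 th2 tau sig x. Ck_on N UNIV th1 --> Ck_on N UNIV th2 -->
  ennreal (cmod (osc_integral th1 th2 tau sig x)) <= ennreal (C / (1 + norm (transpose (A tau) *v x)) ^ N) * env th1 th2 sig"
proof -
 obtain Cp where Cp: "Cp > 0" and decay: "\<And>(u :: real^'d => real^'d) v E c0 r F MF.
  (\<forall>x. 1 <= v x) ==> 0 < r ==> (\<forall>x. r <= v x * norm (u x)) ==>
  (\<forall>j i. symb N (axis j 1) (%x. (v x)\<^sup>2) (%x. cx (u x $ i)) (%x. norm (u x))) ==>
  (\<forall>j. has_dir_deriv (axis j 1) E (%x. c0 * cx (u x $ j) * E x)) ==>
  continuous_on UNIV E ==> (\<forall>x. norm (E x) <= 1) ==> 1 <= norm c0 ==>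
  (\<forall>j. symb N (axis j 1) (%x. (v x)\<^sup>2) F (MF j)) ==>
  (\<forall>j. integrable lborel (%x. v x ^ (3 * N) * MF j x)) ==>
  norm (LB x. F x * E x) <= Cp / r ^ N * (\<Sum>j\<in>UNIV. LB x. v x ^ (3 * N) * MF j x)"
  using phase_decay[of N, where 'd='d] by blast
 \<comment> \<open>Two products of symbols, each costing 2^N, and the constant of
   \<open>symb_det_phi\<close>.\<close>
 define K :: real where "K = 2 ^ N * 2 ^ N * (fact CARD('d) * 2 ^ (N * CARD('d)))"
 have K: "K > 0" by (simp add: K_def)
 \<comment> \<open>2^N comes from 1 + r being at most 2 or at most 2r; \<open>Cp + 1\<close> and the
   number of coordinates cover both cases.\<close>
 define C where "C = 2 ^ N * (Cp + 1) * real CARD('d) * K"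
 have C: "C > 0" using Cp K by (simp add: C_def)
 show ?thesis
 proof (intro exI[of _ C] conjI allI impI C)
  fix th1 th2 :: "real^'d => complex" and tau sig x :: "real^'d"
  assume th: "Ck_on N UNIV th1" "Ck_on N UNIV th2"
  define r where "r = norm (transpose (A tau) *v x)"
  have r0: "r \<ge> 0" by (simp add: r_def)
  show "ennreal (cmod (osc_integral th1 th2 tau sig x)) <= ennreal (C / (1 + norm (transpose (A tau) *v x)) ^ N) * env th1 th2 sig"
  proof (cases "env th1 th2 sig = \<infinity>")
   case True
   have "0 < C / (1 + r) ^ N" using C r0 by simp
   then have "ennreal (C / (1 + r) ^ N) * env th1 th2 sig = \<infinity>"
    using True C r0 by (auto simp: ennreal_mult_eq_top_iff)
   then show ?thesis unfolding r_def[symmetric] by simp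
  next
   case False
   let ?g = "%up. env1 th1 up * env2 th2 (up + sig)"
   have cg: "continuous_on UNIV ?g"
    by (intro continuous_on_mult continuous_env th continuous_on_compose2[OF continuous_env(2)[OF th(2)], of UNIV "%x. x + sig"] continuous_intros) auto
   have g0: "0 <= ?g up" for up by (intro mult_nonneg_nonneg env_nonneg)
   have gm: "?g \<in> Borel" by (rule contI[OF cg])
   have ig: "integrable lborel ?g"
    using False gm g0 by (intro integrableI_bounded) (auto simp: env_def less_top)
   define I where "I = (LB up. ?g up)"
   have envI: "env th1 th2 sig = ennreal I"
    unfolding env_def I_def by (rule nn_integral_eq_integral[OF ig]) (use g0 in auto)
   have I0: "I \<ge> 0" unfolding I_def by (rule integral_nonneg_AE) (use g0 in auto)
   define F where "F up = cx (det (phi tau up)) * th1 up * cnj (th2 (up + sig))" for up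
   define E where "E up = cis (2 * pi * (x \<bullet> Ps (up + tau)))" for up
   define m1 where "m1 j up = (\<Sum>a\<le>N. inverse (v0 up) ^ (2 * a) * cmod ((partial_deriv j ^^ a) th1 up))" for j up
   define m2 where "m2 j up = (\<Sum>a\<le>N. cmod ((partial_deriv j ^^ a) th2 (up + sig)))" for j up
   define MF where "MF j up = K * (v0 up ^ CARD('d) * m1 j up * m2 j up)" for j up
   have sF: "symb N (axis j 1) (%x. (v0 x)\<^sup>2) F (MF j)" for j
   proof -
    have "symb N (axis j 1) (%x. (v0 x)\<^sup>2) F
     (%x. 2 ^ N * (2 ^ N * ((fact CARD('d) * 2 ^ (N * CARD('d)) * v0 x ^ CARD('d)) * m1 j x) * m2 j x))"
     unfolding F_def[abs_def] m1_def m2_def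
     by (intro symb_mult symb_det_phi symb_theta symb_theta_shift th) auto
    also have "(%x. 2 ^ N * (2 ^ N * ((fact CARD('d) * 2 ^ (N * CARD('d)) * v0 x ^ CARD('d)) * m1 j x) * m2 j x)) = MF j"
     unfolding MF_def K_def by (auto simp: mult_ac)
    finally show ?thesis .
   qed
   have MFle: "v0 up ^ (3 * N) * MF j up <= K * ?g up" for j up
   proof -
    have "v0 up ^ (3 * N) * v0 up ^ CARD('d) * m1 j up = (\<Sum>a\<le>N. v0 up ^ (3 * N + CARD('d) - 2 * a) * cmod ((partial_deriv j ^^ a) th1 up))"
     unfolding m1_def sum_distrib_left
    proof (rule sum.cong)
     fix a assume "a \<in> {..N}"
     then have "v0 up ^ (3 * N) * v0 up ^ CARD('d) = v0 up ^ (3 * N + CARD('d) - 2 * a) * v0 up ^ (2 * a)"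
      by (simp add: power_add[symmetric])
     then show "v0 up ^ (3 * N) * v0 up ^ CARD('d) * (inverse (v0 up) ^ (2 * a) * cmod ((partial_deriv j ^^ a) th1 up))
      = v0 up ^ (3 * N + CARD('d) - 2 * a) * cmod ((partial_deriv j ^^ a) th1 up)"
      using v0_pos[of up] by (simp add: field_simps)
    qed simp
    also have "... <= env1 th1 up"
     unfolding env1_def
     by (rule member_le_sum) (use v0_pos in \<open>auto intro!: sum_nonneg mult_nonneg_nonneg zero_le_power simp: less_imp_le\<close>)
    finally have 1: "v0 up ^ (3 * N) * v0 up ^ CARD('d) * m1 j up <= env1 th1 up" .
    have 2: "m2 j up <= env2 th2 (up + sig)"
     unfolding m2_def env2_def by (rule member_le_sum) (auto intro!: sum_nonneg)
    have "v0 up ^ (3 * N) * MF j up = K * ((v0 up ^ (3 * N) * v0 up ^ CARD('d) * m1 j up) * m2 j up)"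
     by (simp add: MF_def mult_ac)
    also have "... <= K * ?g up"
     using K 1 2 by (intro mult_left_mono mult_mono env_nonneg) (auto simp: m2_def intro!: sum_nonneg)
    finally show ?thesis .
   qed
   have MF0: "0 <= MF j up" for j up by (rule symb_nonneg[OF sF])
   have cMF: "continuous_on UNIV (%x. v0 x ^ (3 * N) * MF j x)" for j
    unfolding MF_def m1_def m2_def
    by (intro continuous_on_mult continuous_on_power continuous_on_sum continuous_on_const v0_cont continuous_on_inverse continuous_on_norm
      continuous_partial_funpow[OF th(1)] continuous_on_compose2[OF continuous_partial_funpow[OF th(2)], of _ UNIV "%x. x + sig"] continuous_intros)
     (use v0_pos in \<open>auto simp: less_imp_neq[THEN not_sym]\<close>)
   have iMF: "integrable lborel (%x. v0 x ^ (3 * N) * MF j x)" for j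
   proof (rule integrable_bd[OF integrable_mult_right[where c=K, OF ig]])
    show "(%x. v0 x ^ (3 * N) * MF j x) \<in> borel_measurable lborel"
     using contI[OF cMF] by simp
    have "norm (v0 x ^ (3 * N) * MF j x) <= norm (K * ?g x)" for x
    proof -
     have "0 <= v0 x ^ (3 * N) * MF j x" using MF0[of j x] v0_pos[of x] by simp
     then show ?thesis
      unfolding real_norm_def by (simp only: abs_of_nonneg) (rule order_trans[OF MFle abs_ge_self])
    qed
    then show "AE x in lborel. norm (v0 x ^ (3 * N) * MF j x) <= norm (K * ?g x)" by (intro AE_I2)
   qed
   have MFI: "(LB x. v0 x ^ (3 * N) * MF j x) <= K * I" for j
    using integral_mono[OF iMF integrable_mult_right[where c=K, OF ig] MFle] by (simp add: I_def)
   have osc: "osc_integral th1 th2 tau sig x = (LB up. F up * E up)"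
    by (simp add: osc_integral_def F_def E_def)
   have cE: "continuous_on UNIV E"
    unfolding E_def[abs_def]
    by (intro continuous_on_compose2[OF continuous_on_cis[OF continuous_on_id]] continuous_intros continuous_on_compose2[OF continuous_Psi]) auto
   have "cmod (osc_integral th1 th2 tau sig x) <= C / (1 + r) ^ N * I"
   proof (cases "r <= 1")
    case True
    obtain j :: 'd where True by simp
    have Fg: "cmod (F up * E up) <= K * ?g up" for up
    proof -
     have "cmod (F up * E up) <= 1 * MF j up" using symb_bound[OF sF] by (simp add: norm_mult E_def)
     also have "... <= v0 up ^ (3 * N) * MF j up" using MF0 v0_ge_1 by (intro mult_right_mono one_le_power) auto
     also have "... <= K * ?g up" by (rule MFle)
     finally show ?thesis .
    qed
    have iFE: "integrable lborel (%up. F up * E up)"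
    proof (rule integrable_bd[OF integrable_mult_right[where c=K, OF ig]])
     have "continuous_on UNIV (%up. F up * E up)"
      by (intro continuous_on_mult cE symb_cont[OF sF])
     then show "(%up. F up * E up) \<in> borel_measurable lborel" using contI by simp
     have "norm (F up * E up) <= norm (K * ?g up)" for up
      unfolding real_norm_def by (rule order_trans[OF Fg abs_ge_self])
     then show "AE up in lborel. norm (F up * E up) <= norm (K * ?g up)" by (intro AE_I2)
    qed
    have "cmod (osc_integral th1 th2 tau sig x) <= (LB up. K * ?g up)"
     unfolding osc
     by (rule order_trans[OF integral_norm_bound integral_mono[OF integrable_norm[OF iFE] integrable_mult_right[where c=K, OF ig] Fg]])
    also have "... = K * I" by (simp add: I_def)
    also have "... <= C / (1 + r) ^ N * I"
    proof (rule mult_right_mono[OF _ I0])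
     have "K * (1 + r) ^ N <= K * 2 ^ N" using K True r0 by (intro mult_left_mono power_mono) auto
     also have "... = 2 ^ N * 1 * 1 * K" by simp
     also have "... <= C" unfolding C_def using K Cp by (intro mult_right_mono mult_mono) (auto simp: Suc_leI)
     finally show "K <= C / (1 + r) ^ N" using r0 by (simp add: le_divide_eq)
    qed
    finally show ?thesis .
   next
    case False
    have "norm (LB up. F up * E up) <= Cp / r ^ N * (\<Sum>j\<in>UNIV. LB up. v0 up ^ (3 * N) * MF j up)"
    \<comment> \<open>By the chain rule the gradient of x . Psi(up + tau) is A(up + tau)^T x, which
      is phi_tau(up) applied to A(tau)^T x. By \<open>phi_vector_lower\<close> its length is at
      least r / v0(up). The factor 2 pi i is kept apart as \<open>c0\<close>.\<close>
    proof (rule decay[where u="%up. phi tau up *v (transpose (A tau) *v x)" and v=v0 and ?c0.0="\<i> * of_real (2 * pi)"])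
     show "0 < r" using False by simp
     show "\<forall>up. r <= v0 up * norm (phi tau up *v (transpose (A tau) *v x))"
      unfolding r_def using phi_vector_lower by blast
     show "\<forall>j. has_dir_deriv (axis j 1) E (%up. \<i> * of_real (2 * pi) * cx ((phi tau up *v (transpose (A tau) *v x)) $ j) * E up)"
      unfolding has_dir_deriv_def
     proof (intro allI)
      fix j up
      let ?q = "%t. 2 * pi * (x \<bullet> Ps (up + t *\<^sub>R axis j 1 + tau))"
      have "((%t. up + t *\<^sub>R axis j 1 + tau) has_derivative (%t. t *\<^sub>R axis j 1)) (at 0)"
       by (auto intro!: derivative_eq_intros)
      moreover have "(Ps has_derivative ((*v) (A (up + tau)))) (at (up + 0 *\<^sub>R axis j 1 + tau))"
       using Psi_has_derivative[of "up + tau"] by simp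
      ultimately have "((%t. Ps (up + t *\<^sub>R axis j 1 + tau)) has_derivative (%t. A (up + tau) *v (t *\<^sub>R axis j 1))) (at 0)"
       using diff_chain_at[of "%t. up + t *\<^sub>R axis j 1 + tau" "%t. t *\<^sub>R axis j 1" 0 Ps] by (simp add: o_def)
      then have "(?q has_derivative (%t. 2 * pi * (x \<bullet> (A (up + tau) *v (t *\<^sub>R axis j 1))))) (at 0)"
       by (intro has_derivative_mult_right has_derivative_inner_right)
      moreover have "2 * pi * (x \<bullet> (A (up + tau) *v (t *\<^sub>R axis j 1))) = 2 * pi * (phi tau up *v (transpose (A tau) *v x)) $ j * t" for t
      proof -
       have "x \<bullet> (A (up + tau) *v (t *\<^sub>R axis j 1)) = (transpose (A (up + tau)) *v x) \<bullet> (t *\<^sub>R axis j 1)"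
        by (simp only: dot_lmul_matrix[symmetric] transpose_matrix_vector)
       also have "transpose (A (up + tau)) *v x = phi tau up *v (transpose (A tau) *v x)"
        by (simp only: matrix_vector_mul_assoc phi_mult_A)
       finally show ?thesis by (simp add: inner_axis mult_ac)
      qed
      ultimately have dq: "(?q has_real_derivative 2 * pi * (phi tau up *v (transpose (A tau) *v x)) $ j) (at 0)"
       by (simp add: has_field_derivative_def)
      have "((%t. E (up + t *\<^sub>R axis j 1)) has_vector_derivative (2 * pi * (phi tau up *v (transpose (A tau) *v x)) $ j) *\<^sub>R (\<i> * cis (?q 0))) (at 0)"
      proof -
       have "(cis has_vector_derivative (\<i> * cis (?q 0))) (at (?q 0))"
        unfolding cis_conv_exp
        by (auto intro!: derivative_eq_intros has_vector_derivative_eq_rhs[OF has_vector_derivative_real_field])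
       from vector_diff_chain_at[OF dq[unfolded has_real_derivative_iff_has_vector_derivative] this]
       show ?thesis by (simp add: o_def E_def)
      qed
      then show "((%t. E (up + t *\<^sub>R axis j 1)) has_vector_derivative
        \<i> * of_real (2 * pi) * cx ((phi tau up *v (transpose (A tau) *v x)) $ j) * E up) (at 0)"
       by (simp add: E_def scaleR_conv_of_real mult_ac)
     qed
     show "1 <= norm (\<i> * of_real (2 * pi) :: complex)" using pi_ge_two by (simp add: norm_mult)
    qed (use v0_ge_1 symb_phase_gradient cE sF iMF in \<open>auto simp: E_def\<close>)
    also have "... <= Cp / r ^ N * (\<Sum>j\<in>(UNIV::'d set). K * I)"
     using Cp False by (intro mult_left_mono sum_mono MFI) auto
    also have "... = (Cp * real CARD('d) * K) / r ^ N * I" by simp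
    also have "... <= C / (1 + r) ^ N * I"
    proof (rule mult_right_mono[OF _ I0])
     have "(1 + r) ^ N <= (2 * r) ^ N" using False by (intro power_mono) auto
     then have "(Cp * real CARD('d) * K) * (1 + r) ^ N <= (Cp * real CARD('d) * K) * (2 ^ N * r ^ N)"
      using Cp K by (intro mult_left_mono) (auto simp: power_mult_distrib)
     also have "... = 2 ^ N * Cp * real CARD('d) * K * r ^ N" by simp
     also have "... <= C * r ^ N"
      unfolding C_def using K Cp False by (intro mult_right_mono mult_left_mono) auto
     finally show "(Cp * real CARD('d) * K) / r ^ N <= C / (1 + r) ^ N"
      using False by (simp add: divide_le_eq le_divide_eq field_simps)
    qed
    finally show ?thesis unfolding osc .
   qed
   then have "ennreal (cmod (osc_integral th1 th2 tau sig x)) <= ennreal (C / (1 + r) ^ N * I)" by (rule ennreal_leI)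
   also have "... = ennreal (C / (1 + r) ^ N) * env th1 th2 sig"
    unfolding envI using C r0 I0 by (intro ennreal_mult) auto
   finally show ?thesis by (simp add: r_def)
  qed
 qed
qed

end

text \<open>Fatou's lemma is applied to the nonnegative functions 2|f_n|^2 + 2|g|^2 - |f_n - g|^2,
  whose pointwise limit is 4|g|^2. Since the norms converge, the distances are left with limit
  0.\<close>

lemma sqnorm_tendsto_of_pointwise:
 fixes f :: "nat => 'a => complex"
 assumes [measurable]: "\<And>n. f n \<in> borel_measurable M" "g \<in> borel_measurable M"
  and fin: "\<And>n. sqnorm M (f n) < \<infinity>" "sqnorm M g < \<infinity>"
  and pw: "\<And>x. (%n. f n x) ~~> g x"
  and nrm: "(%n. sqnorm M (f n)) ~~> sqnorm M g"
 shows "(%n. sqnorm M (%x. f n x - g x)) ~~> 0"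
proof -
 let ?h = "%n x. 2 * (cmod (f n x))\<^sup>2 + 2 * (cmod (g x))\<^sup>2 - (cmod (f n x - g x))\<^sup>2"
 define H where "H n = (\<integral>\<^sup>+x. ennreal (?h n x) \<partial>M)" for n
 have h0: "0 <= ?h n x" for n x
  using cmod_add_square_le[of "f n x" "- g x"] by simp
 have sum: "H n + sqnorm M (%x. f n x - g x) = 2 * sqnorm M (f n) + 2 * sqnorm M g" for n
 proof -
  have "H n + sqnorm M (%x. f n x - g x) = (\<integral>\<^sup>+x. ennreal (?h n x) + ennreal ((cmod (f n x - g x))\<^sup>2) \<partial>M)"
   unfolding H_def sqnorm_def by (rule nn_integral_add[symmetric]) measurable
  also have "... = (\<integral>\<^sup>+x. 2 * ennreal ((cmod (f n x))\<^sup>2) + 2 * ennreal ((cmod (g x))\<^sup>2) \<partial>M)"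
  proof (rule nn_integral_cong)
   fix x
   have "ennreal (?h n x) + ennreal ((cmod (f n x - g x))\<^sup>2) = ennreal (2 * (cmod (f n x))\<^sup>2 + 2 * (cmod (g x))\<^sup>2)"
    by (subst ennreal_plus[symmetric]) (use h0 in auto)
   also have "... = 2 * ennreal ((cmod (f n x))\<^sup>2) + 2 * ennreal ((cmod (g x))\<^sup>2)"
    by (simp add: ennreal_mult)
   finally show "ennreal (?h n x) + ennreal ((cmod (f n x - g x))\<^sup>2) = 2 * ennreal ((cmod (f n x))\<^sup>2) + 2 * ennreal ((cmod (g x))\<^sup>2)" .
  qed
  also have "... = 2 * sqnorm M (f n) + 2 * sqnorm M g"
   unfolding sqnorm_def by (simp add: nn_integral_add nn_integral_cmult)
  finally show ?thesis .
 qed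
 define L where "L = enn2real (sqnorm M g)"
 have L: "sqnorm M g = ennreal L" "0 <= L" using fin(2) by (auto simp: L_def)
 have "(\<integral>\<^sup>+x. ennreal (4 * (cmod (g x))\<^sup>2) \<partial>M) = (\<integral>\<^sup>+x. liminf (%n. ennreal (?h n x)) \<partial>M)"
 proof (rule nn_integral_cong)
  fix x
  have "(%n. ennreal (?h n x)) ~~> ennreal (2 * (cmod (g x))\<^sup>2 + 2 * (cmod (g x))\<^sup>2 - (cmod (g x - g x))\<^sup>2)"
   by (intro tendsto_ennrealI tendsto_intros pw)
  then show "ennreal (4 * (cmod (g x))\<^sup>2) = liminf (%n. ennreal (?h n x))"
   using lim_imp_Liminf[OF trivial_limit_sequentially, of "%n. ennreal (?h n x)"] by simp
 qed
 also have "... <= liminf H"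
  unfolding H_def[abs_def] by (rule nn_integral_liminf) measurable
 also have "(\<integral>\<^sup>+x. ennreal (4 * (cmod (g x))\<^sup>2) \<partial>M) = ennreal (4 * L)"
  using L by (simp add: ennreal_mult nn_integral_cmult sqnorm_def)
 finally have liminf: "ennreal (4 * L) <= liminf H" .
 show ?thesis
  unfolding ennreal_tendsto_0_iff
 proof (intro allI impI)
  fix e :: real assume e: "e > 0"
  have ev1: "\<forall>\<^sub>F n in sequentially. sqnorm M (f n) < ennreal (L + e / 8)"
   using order_tendstoD(2)[OF nrm, of "ennreal (L + e / 8)"] L e by (simp add: ennreal_less_iff)
  have ev2: "\<forall>\<^sub>F n in sequentially. 4 * L - e / 2 < enn2real (H n) \<or> H n = \<infinity>"
  proof (cases "4 * L - e / 2 < 0")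
   case True
   then show ?thesis by (intro always_eventually allI disjI1) (rule less_le_trans[OF _ enn2real_nonneg])
  next
   case False
   then have "ennreal (4 * L - e / 2) < ennreal (4 * L)" using e L by (simp add: ennreal_less_iff)
   then have "ennreal (4 * L - e / 2) < liminf H" using liminf by (rule less_le_trans)
   then have "\<forall>\<^sub>F n in sequentially. ennreal (4 * L - e / 2) < H n" by (rule less_LiminfD)
   then show ?thesis
   proof eventually_elim
    case (elim n)
    then show ?case using False by (cases "H n") (auto simp: ennreal_less_iff)
   qed
  qed
  show "\<forall>\<^sub>F n in sequentially. sqnorm M (%x. f n x - g x) < ennreal e"
   using ev1 ev2
  proof eventually_elim
   case (elim n)
   define a where "a = enn2real (sqnorm M (f n))"
   define b where "b = enn2real (H n)"
   define c where "c = enn2real (sqnorm M (%x. f n x - g x))"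
   have a: "sqnorm M (f n) = ennreal a" "0 <= a" using fin(1)[of n] by (auto simp: a_def)
   have sfin: "H n + sqnorm M (%x. f n x - g x) < \<infinity>"
    unfolding sum using fin by (simp add: ennreal_mult_less_top)
   then have b: "H n = ennreal b" "0 <= b" and c: "sqnorm M (%x. f n x - g x) = ennreal c" "0 <= c"
    by (auto simp: b_def c_def)
   have "ennreal (b + c) = ennreal (2 * a + 2 * L)"
    using sum[of n] unfolding a b c L using a(2) b(2) c(2) L(2) by (simp add: ennreal_mult ennreal_plus)
   then have "b + c = 2 * a + 2 * L"
    by (rule ennreal_inj[THEN iffD1, rotated 2]) (use a b c L in auto)
   moreover have "a < L + e / 8"
    using elim(1) unfolding a(1) by (rule ennreal_less_iff[THEN iffD1, OF a(2)])
   moreover have "4 * L - e / 2 < b" using elim(2) b by auto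
   ultimately have "c < e" using e by linarith
   then show ?case using c by (simp add: ennreal_less_iff)
  qed
 qed
qed

section \<open>Integration under the warping map\<close>

context warping
begin

lemma open_phase: "open (UNIV \<times> D :: ((real^'d) \<times> (real^'d)) set)"
 using open_D by (intro open_Times) auto

lemma D_borel [measurable]: "D \<in> sets borel"
 using open_D by simp

lemma continuous_A_entry: "continuous_on UNIV (%tau. A tau $ i $ j)"
proof -
 have "continuous_on UNIV (partial_deriv j Ps)"
  using Ck_Psi Ck_on_continuous[of N UNIV "partial_deriv j Ps"] by simp
 then show ?thesis unfolding A_entry by (intro continuous_intros)
qed

lemma continuous_w: "continuous_on UNIV w"
 unfolding warp_weight_def[abs_def] det_def
 by (intro continuous_on_sum continuous_on_mult continuous_on_prod continuous_on_const continuous_A_entry)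

lemma measurable_w [measurable]: "w \<in> Borel"
 by (rule contI[OF continuous_w])

lemma measurable_Psi [measurable]: "Ps \<in> Borel"
 by (rule contI[OF continuous_Psi])

lemma measurable_v0 [measurable]: "v0 \<in> Borel"
 by (rule contI[OF v0_cont])

text \<open>Extension by zero gives a Borel function on the whole space, whatever \<open>Ph\<close>
  is off \<open>D\<close>.\<close>

definition Phi0 :: "real^'d => real^'d" where
 "Phi0 om = (if om \<in> D then Ph om else 0)"

lemma measurable_Phi0 [measurable]: "Phi0 \<in> Borel"
 unfolding Phi0_def[abs_def]
 by (rule borel_measurable_continuous_on_if) (use continuous_Phi in auto)

lemma Phi0_eq [simp]: "om \<in> D ==> Phi0 om = Ph om"
 by (simp add: Phi0_def)

lemma nn_integral_warp:
 assumes [measurable]: "f \<in> Borel"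
 shows "(NN om. indicator D om * f om) = (NN tau. ennreal (w tau) * f (Ps tau))"
proof -
 have "(NN y. indicator (Ps ` UNIV) y * f y) =
     (NN x. indicator UNIV x * (ennreal \<bar>det (matrix ((*v) (A x)))\<bar> * f (Ps x)))"
 proof (rule nn_integral_change_of_variables)
  show "(%x. indicat_real UNIV x * \<bar>det (matrix ((*v) (A x)))\<bar>) \<in> Borel"
   using measurable_w by (simp add: warp_weight_def[symmetric])
 qed (use Psi_has_derivative inj_Psi range_Psi in auto)
 also have "... = (NN tau. ennreal (w tau) * f (Ps tau))"
  using w_pos by (intro nn_integral_cong) (simp add: warp_weight_def[symmetric] abs_of_pos)
 finally show ?thesis by (simp add: range_Psi)
qed

text \<open>The nonnegative case shows that two measures coincide; complex integrands follow from
  their equality.\<close>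

lemma integral_warp:
 fixes f :: "real^'d => complex"
 assumes [measurable]: "f \<in> Borel"
 shows "(LB om. indicator D om *\<^sub>R f om) = (LB tau. w tau *\<^sub>R f (Ps tau))"
proof -
 have "density lborel (%om. ennreal (indicator D om)) = distr (density lborel (%tau. ennreal (w tau))) borel Ps"
 proof (rule measure_eqI)
  fix E assume "E \<in> sets (density lborel (%om. ennreal (indicator D om)))"
  then have [measurable]: "E \<in> sets borel" by simp
  have "emeasure (density lborel (%om. ennreal (indicator D om))) E = (NN om. indicator D om * indicator E om)"
   by (subst emeasure_density) (auto simp: ennreal_indicator)
  also have "... = (NN tau. ennreal (w tau) * indicator E (Ps tau))"
   by (rule nn_integral_warp) measurable
  also have "... = (NN tau. ennreal (w tau) * indicator (Ps -` E) tau)"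
   by (intro nn_integral_cong) (auto simp: indicator_def)
  also have "... = emeasure (distr (density lborel (%tau. ennreal (w tau))) borel Ps) E"
   using measurable_sets_borel[OF measurable_Psi, of E] by (simp add: emeasure_distr emeasure_density)
  finally show "emeasure (density lborel (%om. ennreal (indicator D om))) E = emeasure (distr (density lborel (%tau. ennreal (w tau))) borel Ps) E" .
 qed simp
 then have "(LINT om|density lborel (%om. ennreal (indicator D om)). f om) = (LINT om|distr (density lborel (%tau. ennreal (w tau))) borel Ps. f om)"
  by simp
 then show ?thesis
  using w_pos by (simp add: integral_density integral_distr less_imp_le)
qed

end

section \<open>Atoms and voice transform on the frequency side\<close>

locale window = warping D Ph v0 N
 for D :: "(real^'d) set" and Ph v0 N +
 fixes th :: "real^'d => complex"
 assumes Ck_theta: "Ck_on N UNIV th"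
  and theta_L2: "(NN up. ennreal (v0 up ^ CARD('d) * (cmod (th up))\<^sup>2)) < \<infinity>"

context window
begin

lemma continuous_theta: "continuous_on UNIV th"
 by (rule Ck_on_continuous[OF Ck_theta]) simp

lemma measurable_theta [measurable]: "th \<in> Borel"
 by (rule contI[OF continuous_theta])

definition freq :: "real^'d => real^'d => complex" where
 "freq om xi = (if xi \<in> D then cx (w (Ph om) powr (- 1 / 2)) * th (Ph xi - Ph om) else 0)"

lemma freq_eq: "warped_freq D Ph th = freq"
 by (auto simp: warped_freq_def freq_def translate_def fun_eq_iff)

lemma freq_alt: "freq om xi = indicator D xi *\<^sub>R (cx (w (Ph om) powr (- 1 / 2)) * th (Phi0 xi - Ph om))"
 by (auto simp: freq_def indicator_def)

lemma measurable_freq [measurable]: "freq om \<in> Borel"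
 unfolding freq_alt[abs_def] by measurable

lemma cmod_freq_sq: "(cmod (freq om xi))\<^sup>2 = indicator D xi * (inverse (w (Ph om)) * (cmod (th (Phi0 xi - Ph om)))\<^sup>2)"
proof -
 have "(w (Ph om) powr (- 1 / 2))\<^sup>2 = inverse (w (Ph om))"
  unfolding power2_eq_square powr_add[symmetric] using w_pos[of "Ph om"] by (simp add: powr_minus less_imp_le)
 then show ?thesis
  by (auto simp: freq_alt norm_mult power_mult_distrib indicator_def)
qed

lemma sqnorm_freq: "sqnorm lborel (freq om) = (NN up. ennreal (w (up + Ph om) / w (Ph om) * (cmod (th up))\<^sup>2))"
proof -
 have "sqnorm lborel (freq om) = (NN xi. indicator D xi * ennreal (inverse (w (Ph om)) * (cmod (th (Phi0 xi - Ph om)))\<^sup>2))"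
  unfolding sqnorm_def cmod_freq_sq by (intro nn_integral_cong) (auto simp: indicator_def)
 also have "... = (NN tau. ennreal (w tau) * ennreal (inverse (w (Ph om)) * (cmod (th (Phi0 (Ps tau) - Ph om)))\<^sup>2))"
  by (rule nn_integral_warp) measurable
 also have "... = (NN tau. ennreal (w tau / w (Ph om) * (cmod (th (tau - Ph om)))\<^sup>2))"
  using w_pos by (intro nn_integral_cong) (simp add: ennreal_mult'[symmetric] less_imp_le divide_inverse mult_ac)
 also have "... = (NN up. ennreal (w (up + Ph om) / w (Ph om) * (cmod (th (up + Ph om - Ph om)))\<^sup>2))"
  by (rule nn_integral_lborel_translate[symmetric]) measurable
 finally show ?thesis by simp
qed

text \<open>A bound independent of \<open>tau\<close>. It gives finite norms to all atoms and a
  dominating function for the continuity of these norms.\<close>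

lemma w_ratio_le: "w (up + tau) / w tau * (cmod (th up))\<^sup>2 <= fact CARD('d) * (v0 up ^ CARD('d) * (cmod (th up))\<^sup>2)"
proof -
 have "w (up + tau) / w tau <= fact CARD('d) * v0 up ^ CARD('d)"
  using w_quotient_le[of up tau] w_pos[of tau] by (simp add: divide_le_eq)
 from mult_right_mono[OF this, of "(cmod (th up))\<^sup>2"] show ?thesis by (simp add: mult.assoc)
qed

lemma dominating_finite: "(NN up. ennreal (fact CARD('d) * (v0 up ^ CARD('d) * (cmod (th up))\<^sup>2))) < \<infinity>"
 using theta_L2 v0_pos by (subst ennreal_mult) (auto simp: nn_integral_cmult ennreal_mult_less_top less_imp_le)

lemma sqnorm_freq_finite: "sqnorm lborel (freq om) < \<infinity>"
 unfolding sqnorm_freq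
 by (rule le_less_trans[OF nn_integral_mono dominating_finite]) (intro ennreal_leI w_ratio_le)

lemma sqnorm_theta_finite: "sqnorm lborel th < \<infinity>"
proof -
 have "sqnorm lborel th <= (NN up. ennreal (v0 up ^ CARD('d) * (cmod (th up))\<^sup>2))"
  unfolding sqnorm_def
 proof (intro nn_integral_mono ennreal_leI)
  fix up
  have "1 * (cmod (th up))\<^sup>2 <= v0 up ^ CARD('d) * (cmod (th up))\<^sup>2"
   by (intro mult_right_mono one_le_power v0_ge_1) simp
  then show "(cmod (th up))\<^sup>2 <= v0 up ^ CARD('d) * (cmod (th up))\<^sup>2" by simp
 qed
 then show ?thesis using theta_L2 by (rule le_less_trans)
qed

definition fatom :: "(real^'d) \<times> (real^'d) => real^'d => complex" where
 "fatom mu xi = cis (- 2 * pi * (fst mu \<bullet> xi)) * freq (snd mu) xi"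

lemma measurable_fatom [measurable]: "fatom mu \<in> Borel"
 unfolding fatom_def[abs_def] by measurable

lemma sqnorm_fatom: "sqnorm lborel (fatom mu) = sqnorm lborel (freq (snd mu))"
 by (simp add: sqnorm_def fatom_def norm_mult)

lemma sq_int_fatom: "sq_int (fatom mu)"
 using sqnorm_freq_finite by (auto simp: sq_int_def sqnorm_fatom)

lemma fatom_outside: "xi \<notin> D ==> fatom mu xi = 0"
 by (simp add: fatom_def freq_def)

text \<open>After the substitution in \<open>sqnorm_freq\<close> the norm of an atom depends on
  \<open>mu\<close> only through a quotient of values of \<open>w\<close>, so the norms converge by
  dominated convergence. Pointwise convergence of the atoms does the rest, although they move across
  \<open>D\<close> without a common majorant at hand.\<close>

lemma fatom_tendsto:
 assumes mu: "mu \<in> UNIV \<times> D" and lim: "X ~~> mu"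
 shows "(%n. sqnorm lborel (%xi. fatom (X n) xi - fatom mu xi)) ~~> 0"
proof (rule sqnorm_tendsto_of_pointwise)
 have l1: "(%n. fst (X n)) ~~> fst mu" and l2: "(%n. snd (X n)) ~~> snd mu"
  using lim by (auto intro: tendsto_fst tendsto_snd)
 have "isCont Ph (snd mu)"
  using continuous_Phi open_D mu by (auto simp: continuous_on_eq_continuous_at)
 then have lP: "(%n. Ph (snd (X n))) ~~> Ph (snd mu)"
  using l2 by (rule isCont_tendsto_compose)
 have cw: "isCont w x" and ct: "isCont th x" for x
  using continuous_w continuous_theta by (auto simp: continuous_on_eq_continuous_at)
 have lw: "(%n. w (a + Ph (snd (X n)))) ~~> w (a + Ph (snd mu))" for a
  by (rule isCont_tendsto_compose[OF cw]) (intro tendsto_intros lP)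
 have lw0: "(%n. w (Ph (snd (X n)))) ~~> w (Ph (snd mu))" using lw[of 0] by simp
 show "(%n. fatom (X n) xi) ~~> fatom mu xi" for xi
 proof (cases "xi \<in> D")
  case True
  have "(%n. cis (- 2 * pi * (fst (X n) \<bullet> xi))) ~~> cis (- 2 * pi * (fst mu \<bullet> xi))"
   by (intro tendsto_intros l1)
  moreover have "(%n. cx (w (Ph (snd (X n))) powr (- 1 / 2))) ~~> cx (w (Ph (snd mu)) powr (- 1 / 2))"
   using w_pos[of "Ph (snd mu)"] by (intro tendsto_intros lw0) auto
  moreover have "(%n. th (Ph xi - Ph (snd (X n)))) ~~> th (Ph xi - Ph (snd mu))"
   by (rule isCont_tendsto_compose[OF ct]) (intro tendsto_intros lP)
  ultimately show ?thesis
   using True by (auto simp: fatom_def freq_def intro!: tendsto_mult)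
 qed (simp add: fatom_outside)
 show "(%n. sqnorm lborel (fatom (X n))) ~~> sqnorm lborel (fatom mu)"
  unfolding sqnorm_fatom sqnorm_freq
 proof (rule nn_integral_dominated_convergence[OF _ _ _ _ dominating_finite])
  show "AE up in lborel. ennreal (w (up + Ph (snd (X n))) / w (Ph (snd (X n))) * (cmod (th up))\<^sup>2)
    <= ennreal (fact CARD('d) * (v0 up ^ CARD('d) * (cmod (th up))\<^sup>2))" for n
   by (intro AE_I2 ennreal_leI w_ratio_le)
  show "AE up in lborel. (%n. ennreal (w (up + Ph (snd (X n))) / w (Ph (snd (X n))) * (cmod (th up))\<^sup>2))
    ~~> ennreal (w (up + Ph (snd mu)) / w (Ph (snd mu)) * (cmod (th up))\<^sup>2)"
   using w_pos[of "Ph (snd mu)"] by (intro AE_I2 tendsto_ennrealI tendsto_intros lw lw0) auto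
 qed measurable
qed (use sq_int_fatom in \<open>auto simp: sq_int_def\<close>)

lemma freq_L2: "freq om \<in> L2_space"
 by (rule L2_space_of_sq_int[of "freq om"])
   (use sqnorm_freq_finite in \<open>auto simp: sq_int_def intro!: borel_measurable_lebesgueI\<close>)

lemma atom_fourier:
 "warped_atom D Ph th mu \<in> L2_space"
 "AE xi in lborel. fourier_L2 (warped_atom D Ph th mu) xi = fatom mu xi"
proof -
 obtain y om where mu: "mu = (y, om)" by force
 have a: "warped_atom D Ph th mu = translate y (inv_fourier_L2 (freq om))"
  by (simp add: warped_atom_def mu freq_eq)
 note inv = inv_fourier_L2[OF freq_L2[of om]]
 show "warped_atom D Ph th mu \<in> L2_space"
  unfolding a by (rule L2_space_translate(1)[OF inv(1)])
 show "AE xi in lborel. fourier_L2 (warped_atom D Ph th mu) xi = fatom mu xi"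
  using L2_space_translate(2)[OF inv(1), of y] inv(2)
  unfolding a by eventually_elim (simp add: fatom_def mu)
qed

text \<open>The voice transform of the function with Fourier transform \<open>a\<close>; the value 0
  off \<open>UNIV \<times> D\<close> makes it Borel on the whole product.\<close>

definition vt :: "(real^'d => complex) => (real^'d) \<times> (real^'d) => complex" where
 "vt a mu = (if mu \<in> UNIV \<times> D then cinner lborel a (fatom mu) else 0)"

lemma voice_eq:
 assumes f: "f \<in> L2_space" and a: "a \<in> Borel" "AE xi in lborel. fourier_L2 f xi = a xi"
 shows "voice D Ph th f mu = cinner lborel a (fatom mu)"
proof -
 have "voice D Ph th f mu = cinner lebesgue f (warped_atom D Ph th mu)"
  by (simp add: voice_def L2_inner_def cinner_def)
 also have "... = cinner lebesgue (fourier_L2 f) (fourier_L2 (warped_atom D Ph th mu))"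
  by (rule plancherel_cinner[OF f atom_fourier(1), symmetric])
 also have "... = cinner lborel a (fatom mu)"
  using fourier_L2_in_L2_space[OF f] fourier_L2_in_L2_space[OF atom_fourier(1)] a atom_fourier(2)
  by (intro cinner_lebesgue_cong) (auto simp: L2_space_iff)
 finally show ?thesis .
qed

lemma voice_eq_vt:
 assumes "f \<in> L2_space" "a \<in> Borel" "AE xi in lborel. fourier_L2 f xi = a xi" "mu \<in> UNIV \<times> D"
 shows "voice D Ph th f mu = vt a mu"
 using voice_eq[OF assms(1-3)] assms(4) by (simp add: vt_def)

lemma continuous_vt: assumes a: "sq_int a" shows "continuous_on (UNIV \<times> D) (vt a)"
proof -
 have "continuous_on (UNIV \<times> D) (%mu. cinner lborel a (fatom mu))"
  unfolding continuous_on_sequentially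
 proof (intro ballI allI impI)
  fix mu :: "(real^'d) \<times> (real^'d)" and X :: "nat => (real^'d) \<times> (real^'d)"
  assume mu: "mu \<in> UNIV \<times> D" and X: "(\<forall>n. X n \<in> UNIV \<times> D) \<and> X ~~> mu"
  show "((%mu. cinner lborel a (fatom mu)) \<circ> X) ~~> cinner lborel a (fatom mu)"
   unfolding o_def
  proof (rule cinner_tendsto)
   show "(%n. sqnorm lborel (%x. fatom (X n) x - fatom mu x)) ~~> 0"
    using mu X by (intro fatom_tendsto) auto
  qed (use a sq_int_fatom in \<open>auto simp: sq_int_def sqnorm_def\<close>)
 qed
 then show ?thesis
  by (rule continuous_on_eq) (simp add: vt_def)
qed

lemma measurable_vt [measurable]: assumes a: "sq_int a" shows "vt a \<in> Borel"
proof -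
 have "(%mu. if mu \<in> UNIV \<times> D then vt a mu else 0) \<in> Borel"
  by (rule borel_measurable_continuous_on_if[OF _ continuous_vt[OF a]]) (use open_phase in auto)
 then show ?thesis by (rule measurable_cong[THEN iffD1, rotated]) (simp add: vt_def)
qed

lemma vt_linear:
 assumes "sq_int a" "sq_int b"
 shows "vt (%xi. a xi + c * b xi) mu = vt a mu + c * vt b mu"
proof -
 have i: "integrable lborel (%x. a x * cnj (fatom mu x))" "integrable lborel (%x. c * b x * cnj (fatom mu x))"
  by (rule integrable_cinner; use assms sq_int_fatom sq_int_cmult[OF assms(2)] in \<open>auto simp: sq_int_def\<close>)+
 then show ?thesis
  unfolding vt_def by (subst cinner_add_left) (auto simp: cinner_cmult_left)
qed

text \<open>The normalisation w^(-1/2), squared, cancels the Jacobian of omega = Psi(tau). What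
  remains is the squared norm of the window, the same for every xi in \<open>D\<close>: this is why
  the system is tight.\<close>

lemma nn_integral_freq_omega:
 assumes "xi \<in> D"
 shows "(NN om. indicator D om * ennreal ((cmod (freq om xi))\<^sup>2)) = sqnorm lborel th"
proof -
 have "(NN om. indicator D om * ennreal ((cmod (freq om xi))\<^sup>2)) =
  (NN om. indicator D om * ennreal (inverse (w (Phi0 om)) * (cmod (th (Ph xi - Phi0 om)))\<^sup>2))"
  by (intro nn_integral_cong) (auto simp: cmod_freq_sq indicator_def assms)
 also have "... = (NN tau. ennreal (w tau) * ennreal (inverse (w (Phi0 (Ps tau))) * (cmod (th (Ph xi - Phi0 (Ps tau))))\<^sup>2))"
  by (rule nn_integral_warp) measurable
 also have "... = (NN tau. ennreal ((cmod (th (Ph xi - tau)))\<^sup>2))"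
 proof (intro nn_integral_cong)
  fix tau
  show "ennreal (w tau) * ennreal (inverse (w (Phi0 (Ps tau))) * (cmod (th (Ph xi - Phi0 (Ps tau))))\<^sup>2) = ennreal ((cmod (th (Ph xi - tau)))\<^sup>2)"
   using w_pos[of tau] by (simp add: ennreal_mult'[symmetric])
 qed
 also have "... = (NN tau. ennreal ((cmod (th tau))\<^sup>2))"
 proof -
  have "(NN tau. ennreal ((cmod (th tau))\<^sup>2)) = (NN tau. ennreal ((cmod (th (Ph xi + (-1) *\<^sub>R tau)))\<^sup>2))"
   by (subst lborel_affine[of "-1" "Ph xi"]) (auto simp: nn_integral_density nn_integral_distr)
  then show ?thesis by simp
 qed
 finally show ?thesis by (simp add: sqnorm_def)
qed

text \<open>For fixed frequency the voice transform is, up to conjugation, the Fourier transform in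
  y of \<open>h om\<close>. Plancherel in y, Tonelli and \<open>nn_integral_freq_omega\<close> give
  the product of the norms.\<close>

lemma sqnorm_vt:
 assumes a: "sq_int a" and a0: "\<And>xi. xi \<notin> D ==> a xi = 0"
 shows "sqnorm lborel (vt a) = sqnorm lborel th * sqnorm lborel a"
proof -
 have [measurable]: "a \<in> Borel" using a by (simp add: sq_int_def)
 note [measurable] = measurable_vt[OF a]
 \<comment> \<open>Off \<open>D\<close> nothing is known about how \<open>freq om\<close> depends on
   \<open>om\<close>, so joint measurability is shown after moving such \<open>om\<close> to a fixed
   point of \<open>D\<close>.\<close>
 have mf: "(%(om, xi). ennreal ((cmod (freq (if om \<in> D then om else SOME x. x \<in> D) xi))\<^sup>2)) \<in> Borel2"
 proof -
  define tau0 where "tau0 = Ph (SOME x. x \<in> D)"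
  have "(%(om, xi). ennreal (indicator D xi * (inverse (w (if om \<in> D then Phi0 om else tau0)) * (cmod (th (Phi0 xi - (if om \<in> D then Phi0 om else tau0))))\<^sup>2)))
   \<in> Borel2" by measurable
  also have "(%(om, xi). ennreal (indicator D xi * (inverse (w (if om \<in> D then Phi0 om else tau0)) * (cmod (th (Phi0 xi - (if om \<in> D then Phi0 om else tau0))))\<^sup>2)))
   = (%(om, xi). ennreal ((cmod (freq (if om \<in> D then om else SOME x. x \<in> D) xi))\<^sup>2))"
   by (auto simp: cmod_freq_sq tau0_def fun_eq_iff)
  finally show ?thesis .
 qed
 define q where "q om xi = (if om \<in> D then ennreal ((cmod (freq om xi))\<^sup>2) else 0)" for om xi
 have mq: "(%(om, xi). q om xi) \<in> Borel2"
 proof -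
  have "(%(om, xi). indicator D om * (%(om, xi). ennreal ((cmod (freq (if om \<in> D then om else SOME x. x \<in> D) xi))\<^sup>2)) (om, xi)) \<in> Borel2"
   using mf by measurable
  also have "(%(om, xi). indicator D om * (%(om, xi). ennreal ((cmod (freq (if om \<in> D then om else SOME x. x \<in> D) xi))\<^sup>2)) (om, xi)) = (%(om, xi). q om xi)"
   by (auto simp: q_def fun_eq_iff)
  finally show ?thesis .
 qed
 define h where "h om xi = cnj (a xi) * freq om xi" for om xi
 have [measurable]: "h om \<in> Borel" for om unfolding h_def by measurable
 have ih: "integrable lborel (h om)" for om
 proof -
  have "integrable lborel (%xi. freq om xi * cnj (a xi))"
   by (rule integrable_cinner) (use a sqnorm_freq_finite in \<open>auto simp: sq_int_def\<close>)
  then show ?thesis by (simp add: h_def[abs_def] mult.commute)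
 qed
 have vth: "vt a (y, om) = cnj (ft (h om) y)" if "om \<in> D" for y om
 proof -
  have "cnj (ft (h om) y) = (LB xi. cnj (h om xi * cis (- 2 * pi * (xi \<bullet> y))))"
   unfolding ft_def by (rule Bochner_Integration.integral_cnj[symmetric])
  also have "... = cinner lborel a (fatom (y, om))"
   unfolding cinner_def by (rule integral_eqI) (auto simp: h_def fatom_def inner_commute)
  finally show ?thesis using that by (simp add: vt_def)
 qed
 have hq: "sqnorm lborel (h om) = (NN xi. ennreal ((cmod (a xi))\<^sup>2) * q om xi)" if "om \<in> D" for om
  using that by (simp add: sqnorm_def h_def q_def norm_mult power_mult_distrib ennreal_mult)
 have "(NN om. (NN xi. ennreal ((cmod (a xi))\<^sup>2) * q om xi)) = (NN xi. (NN om. ennreal ((cmod (a xi))\<^sup>2) * q om xi))"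
  by (rule lborel_pair.Fubini'[symmetric]) (use mq in measurable)
 also have "... = (NN xi. ennreal ((cmod (a xi))\<^sup>2) * sqnorm lborel th)"
 proof (rule nn_integral_cong)
  fix xi
  show "(NN om. ennreal ((cmod (a xi))\<^sup>2) * q om xi) = ennreal ((cmod (a xi))\<^sup>2) * sqnorm lborel th"
  proof (cases "xi \<in> D")
   case True
   have "(%om. q om xi) \<in> Borel" using mq by measurable
   then have "(NN om. ennreal ((cmod (a xi))\<^sup>2) * q om xi) = ennreal ((cmod (a xi))\<^sup>2) * (NN om. q om xi)"
    by (simp add: nn_integral_cmult)
   also have "(NN om. q om xi) = sqnorm lborel th"
    unfolding nn_integral_freq_omega[OF True, symmetric] by (intro nn_integral_cong) (simp add: q_def)
   finally show ?thesis .
  qed (simp add: a0)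
 qed
 also have "... = sqnorm lborel a * sqnorm lborel th"
  by (simp add: nn_integral_multc sqnorm_def)
 finally have tot: "(NN om. (NN xi. ennreal ((cmod (a xi))\<^sup>2) * q om xi)) = sqnorm lborel a * sqnorm lborel th" .
 have mm: "(%om. NN xi. ennreal ((cmod (a xi))\<^sup>2) * q om xi) \<in> borel_measurable lborel"
  using mq by measurable
 \<comment> \<open>Plancherel for \<open>h om\<close> requires a finite norm, which the finite total
   integral grants for almost every \<open>om\<close>.\<close>
 have fin: "AE om in lborel. (NN xi. ennreal ((cmod (a xi))\<^sup>2) * q om xi) \<noteq> \<infinity>"
  by (rule nn_integral_noteq_infinite[OF mm])
    (use tot a sqnorm_theta_finite in \<open>auto simp: sq_int_def ennreal_mult_eq_top_iff\<close>)
 have "sqnorm lborel (vt a) = (\<integral>\<^sup>+mu. ennreal ((cmod (vt a mu))\<^sup>2) \<partial>(lborel \<Otimes>\<^sub>M lborel))"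
  by (simp add: sqnorm_def lborel_prod)
 also have "... = (NN om. (NN y. ennreal ((cmod (vt a (y, om)))\<^sup>2)))"
  by (rule lborel_pair.nn_integral_snd[symmetric, of "%mu. ennreal ((cmod (vt a mu))\<^sup>2)", simplified]) (simp add: lborel_prod)
 also have "... = (NN om. (NN xi. ennreal ((cmod (a xi))\<^sup>2) * q om xi))"
 proof (rule nn_integral_cong_AE)
  show "AE om in lborel. (NN y. ennreal ((cmod (vt a (y, om)))\<^sup>2)) = (NN xi. ennreal ((cmod (a xi))\<^sup>2) * q om xi)"
   using fin
  proof eventually_elim
   case (elim om)
   show ?case
   proof (cases "om \<in> D")
    case True
    have "sqnorm lborel (h om) < \<infinity>" using elim hq[OF True] by (simp add: less_top)
    then have "sqnorm lborel (ft (h om)) = sqnorm lborel (h om)" by (rule plancherel_L1[OF ih])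
    then show ?thesis using True by (simp add: vth hq[symmetric]) (simp add: sqnorm_def)
   qed (simp add: vt_def q_def)
  qed
 qed
 also note tot
 finally show ?thesis by (simp only: mult.commute)
qed

lemma sq_int_vt:
 assumes a: "sq_int a" and a0: "\<And>xi. xi \<notin> D ==> a xi = 0"
 shows "sq_int (vt a)"
 using sqnorm_vt[OF a a0] measurable_vt[OF a] a sqnorm_theta_finite by (auto simp: sq_int_def ennreal_mult_less_top)

text \<open>Polarisation of \<open>sqnorm_vt\<close>, by linearity of the voice transform.\<close>

theorem vt_orthogonality:
 assumes a: "sq_int a" "\<And>xi. xi \<notin> D ==> a xi = 0" and b: "sq_int b" "\<And>xi. xi \<notin> D ==> b xi = 0"
 shows "cinner lborel (vt a) (vt b) = cx (enn2real (sqnorm lborel th)) * cinner lborel a b"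
proof -
 note sV = sq_int_vt[OF a] sq_int_vt[OF b]
 have *: "enn2real (sqnorm lborel (%mu. vt a mu + c * vt b mu)) = enn2real (sqnorm lborel th) * enn2real (sqnorm lborel (%xi. a xi + c * b xi))" for c
 proof -
  have "(%mu. vt a mu + c * vt b mu) = vt (%xi. a xi + c * b xi)"
   using vt_linear[OF a(1) b(1), of c] by auto
  then have "sqnorm lborel (%mu. vt a mu + c * vt b mu) = sqnorm lborel th * sqnorm lborel (%xi. a xi + c * b xi)"
   using a b by (simp add: sqnorm_vt[OF sq_int_add[OF a(1) sq_int_cmult[OF b(1)]]])
  then show ?thesis by (simp add: enn2real_mult)
 qed
 define nth where "nth = enn2real (sqnorm lborel th)"
 let ?N = "%M h. cx (enn2real (sqnorm M h))"
 have pa: "4 * cinner lborel (vt a) (vt b) = ?N lborel (%x. vt a x + vt b x) - ?N lborel (%x. vt a x - vt b x)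
   + \<i> * ?N lborel (%x. vt a x + \<i> * vt b x) - \<i> * ?N lborel (%x. vt a x - \<i> * vt b x)"
  by (rule cinner_polarization) (use sV in \<open>auto simp: sq_int_def\<close>)
 have pb: "4 * cinner lborel a b = ?N lborel (%x. a x + b x) - ?N lborel (%x. a x - b x)
   + \<i> * ?N lborel (%x. a x + \<i> * b x) - \<i> * ?N lborel (%x. a x - \<i> * b x)"
  by (rule cinner_polarization) (use a b in \<open>auto simp: sq_int_def\<close>)
 have s: "enn2real (sqnorm lborel (%x. vt a x + vt b x)) = nth * enn2real (sqnorm lborel (%x. a x + b x))"
  "enn2real (sqnorm lborel (%x. vt a x - vt b x)) = nth * enn2real (sqnorm lborel (%x. a x - b x))"
  "enn2real (sqnorm lborel (%x. vt a x + \<i> * vt b x)) = nth * enn2real (sqnorm lborel (%x. a x + \<i> * b x))"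
  "enn2real (sqnorm lborel (%x. vt a x - \<i> * vt b x)) = nth * enn2real (sqnorm lborel (%x. a x - \<i> * b x))"
  using *[of 1] *[of "-1"] *[of \<i>] *[of "-\<i>"] by (simp_all add: nth_def)
 have "4 * cinner lborel (vt a) (vt b) = cx nth * (4 * cinner lborel a b)"
  unfolding pa pb s of_real_mult by (simp add: algebra_simps)
 then have "cinner lborel (vt a) (vt b) = cx nth * cinner lborel a b" by simp
 then show ?thesis by (simp add: nth_def)
qed

end

section \<open>Elementary estimates and the formula for the cross kernel\<close>

lemma radial_decay_le_1: "1 / (1 + norm x) ^ n <= (1::real)"
proof -
 have "0 < 1 + norm x" by (simp add: add_pos_nonneg)
 then show ?thesis using one_le_power[of "1 + norm x" n] by (intro divide_le_eq_1_pos[THEN iffD2]) auto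
qed

text \<open>Dyadic balls: with n least such that |x| <= 2^n, the integrand is at most 2^(d+1)
  2^(-n(d+1)), the ball has volume of order 2^(nd), and a geometric series remains.\<close>

lemma radial_decay_integrable:
 "(NN x. ennreal (1 / (1 + norm (x::'a::euclidean_space)) ^ (DIM('a) + 1))) < \<infinity>"
proof -
 define d where "d = DIM('a)"
 define c where "c n = (2::real) ^ (d + 1) * (1 / 2) ^ (n * (d + 1))" for n :: nat
 have [measurable]: "cball (0::'a) r \<in> sets borel" for r by simp
 have pt: "ennreal (1 / (1 + norm x) ^ (d + 1)) <= (\<Sum>n. ennreal (c n) * indicator (cball 0 (2 ^ n)) x)" for x :: 'a
 proof -
  define n where "n = (LEAST n. norm x <= 2 ^ n)"
  have ex: "\<exists>n::nat. norm x <= 2 ^ n" using real_arch_pow[of 2 "norm x"] less_imp_le by auto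
  have n: "norm x <= 2 ^ n" unfolding n_def by (rule LeastI_ex[OF ex])
  have "1 / (1 + norm x) ^ (d + 1) <= c n"
  proof (cases n)
   case 0
   have "1 / (1 + norm x) ^ (d + 1) <= 1" by (rule radial_decay_le_1)
   also have "1 <= c 0" unfolding c_def by (simp add: one_le_power del: power_Suc)
   finally show ?thesis by (simp add: 0)
  next
   case (Suc k)
   have "\<not> norm x <= 2 ^ k" using not_less_Least[of k "%n. norm x <= 2 ^ n"] Suc by (simp add: n_def)
   then have "(2 ^ k) ^ (d + 1) <= (1 + norm x) ^ (d + 1)" by (intro power_mono) auto
   then have "1 / (1 + norm x) ^ (d + 1) <= 1 / (2 ^ k) ^ (d + 1)"
    by (intro divide_left_mono) (auto intro!: mult_pos_pos zero_less_power add_pos_nonneg)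
   also have "... = c n"
    by (simp add: c_def Suc power_add power_mult[symmetric] power_one_over field_simps)
   finally show ?thesis .
  qed
  then have "ennreal (1 / (1 + norm x) ^ (d + 1)) <= ennreal (c n) * indicator (cball 0 (2 ^ n)) x"
   using n by (auto intro: ennreal_leI)
  also have "... = (\<Sum>i\<in>{n}. ennreal (c i) * indicator (cball 0 (2 ^ i)) x)"
   by (simp only: sum.insert finite.emptyI empty_iff sum.empty add_0_right not_False_eq_True)
  also have "... <= (\<Sum>n. ennreal (c n) * indicator (cball 0 (2 ^ n)) x)" by (rule sum_le_suminf) auto
  finally show ?thesis .
 qed
 define u where "u = unit_ball_vol (real d)"
 have u: "u \<ge> 0" by (simp add: u_def)
 have "(NN x. ennreal (1 / (1 + norm (x::'a)) ^ (d + 1))) <= (NN x. (\<Sum>n. ennreal (c n) * indicator (cball (0::'a) (2 ^ n)) x))"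
  by (rule nn_integral_mono) (rule pt)
 also have "... = (\<Sum>n. NN x. ennreal (c n) * indicator (cball (0::'a) (2 ^ n)) x)"
  by (rule nn_integral_suminf) measurable
 also have "... = (\<Sum>n. ennreal (2 ^ (d + 1) * u * (1 / 2) ^ n))"
 proof (rule suminf_cong)
  fix n
  have e: "((2::real) ^ n) ^ d = (2 ^ d) ^ n" by (metis power_mult mult.commute)
  have "(NN x. ennreal (c n) * indicator (cball (0::'a) (2 ^ n)) x) = ennreal (c n) * emeasure lborel (cball (0::'a) (2 ^ n))"
   by (simp add: nn_integral_cmult_indicator)
  also have "... = ennreal (c n * (u * (2 ^ n) ^ d))"
   by (subst emeasure_cball) (auto simp: u_def d_def c_def ennreal_mult)
  also have "c n * (u * (2 ^ n) ^ d) = 2 ^ (d + 1) * u * (1 / 2) ^ n"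
   by (simp add: c_def power_add power_mult_distrib power_one_over power_mult field_simps e)
  finally show "(NN x. ennreal (c n) * indicator (cball (0::'a) (2 ^ n)) x) = ennreal (2 ^ (d + 1) * u * (1 / 2) ^ n)" .
 qed
 also have "... = ennreal (\<Sum>n. 2 ^ (d + 1) * u * (1 / 2) ^ n)"
  by (rule suminf_ennreal2) (use u in \<open>auto intro!: summable_mult summable_geometric\<close>)
 also have "... < \<infinity>" by simp
 finally show ?thesis by (simp add: d_def)
qed

text \<open>Meant for a quotient r of values of \<open>w\<close>: the root comes from the
  normalisation of the atoms, the maximum from the weight of H^1_v. Half a power and a full power of
  \<open>q\<close> add up to 3/2.\<close>

lemma sqrt_ratio_bound:
 fixes r q :: real
 assumes "0 < r" "1 / q <= r" "r <= q" "1 <= q"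
 shows "sqrt r * max r (1 / r) <= q powr (3 / 2)" "sqrt (1 / r) * max r (1 / r) <= q powr (3 / 2)"
proof -
 have q: "q powr (3 / 2) = sqrt q * q"
 proof -
  have "q powr (3 / 2) = q powr (1 / 2) * q powr 1" by (subst powr_add[symmetric]) simp
  then show ?thesis using assms(4) by (simp add: powr_half_sqrt)
 qed
 have ir: "1 / r <= q" using assms by (simp add: field_simps)
 have m: "max r (1 / r) <= q" using assms ir by simp
 show "sqrt r * max r (1 / r) <= q powr (3 / 2)" "sqrt (1 / r) * max r (1 / r) <= q powr (3 / 2)"
  unfolding q using assms m ir by (auto intro!: mult_mono simp del: max.bounded_iff)
qed

lemma sqrt_quotient_powr:
 fixes a b u :: real
 assumes "0 < a" "0 < b"
 shows "u * (a powr (- 1 / 2) * b powr (- 1 / 2)) = sqrt (a / b) * (u / a)"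
proof -
 have h: "x powr (- 1 / 2) = 1 / sqrt x" if "0 < x" for x :: real
  using powr_minus_divide[of x "1 / 2"] powr_half_sqrt[of x] that by simp
 define s where "s = sqrt a"
 have s: "0 < s" "a = s * s" using assms by (simp_all add: s_def)
 show ?thesis
  unfolding h[OF assms(1)] h[OF assms(2)] real_sqrt_divide s_def[symmetric] using s by simp
qed

context warping
begin

lemma nn_integral_linear_A:
 assumes [measurable]: "f \<in> Borel"
 shows "(NN x. f (transpose (A tau) *v x)) = ennreal (1 / w tau) * (NN x. f x)"
proof -
 let ?g = "(*v) (transpose (A tau))"
 have det: "det (transpose (A tau)) = w tau" by (simp add: warp_weight_def)
 have inv: "invertible (transpose (A tau))" using w_pos[of tau] by (simp add: invertible_det_nz det del: det_transpose)
 have bl: "bounded_linear ?g" by (rule matrix_vector_mul_bounded_linear)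
 have rg: "range ?g = UNIV"
 proof -
  obtain B where "transpose (A tau) ** B = mat 1" using inv by (auto simp: invertible_def)
  then have "?g (B *v y) = y" for y by (simp add: matrix_vector_mul_assoc)
  then show ?thesis by (metis surjI)
 qed
 have gm: "?g \<in> Borel"
  by (rule contI) (rule linear_continuous_on[OF bl])
 have "(NN y. indicator (?g ` UNIV) y * f y) = (NN x. indicator UNIV x * (ennreal \<bar>det (matrix ?g)\<bar> * f (?g x)))"
  by (rule nn_integral_change_of_variables)
    (use inj_matrix_vector_mult[OF inv] bl rg in \<open>auto intro: bounded_linear_imp_has_derivative\<close>)
 then have "(NN y. f y) = (NN x. ennreal (w tau) * f (?g x))"
  using w_pos[of tau] by (simp add: rg det del: det_transpose transpose_matrix_vector)
 also have "... = ennreal (w tau) * (NN x. f (?g x))"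
  using gm by (intro nn_integral_cmult) measurable
 finally have "ennreal (1 / w tau) * (NN y. f y) = (ennreal (1 / w tau) * ennreal (w tau)) * (NN x. f (?g x))"
  by (simp add: mult.assoc)
 also have "ennreal (1 / w tau) * ennreal (w tau) = 1"
  using w_pos[of tau] by (subst ennreal_mult[symmetric]) auto
 finally show ?thesis by simp
qed

text \<open>The substitution is xi = Psi(up + Ph eta). By \<open>det_phi\<close>, its Jacobian and
  the two normalising factors combine to the determinant of \<open>phi\<close> times the root of
  w(Ph eta) / w(Ph om).\<close>

lemma kernel_formula:
 assumes "window D Ph v0 N th1" "window D Ph v0 N th2" and D: "om \<in> D" "eta \<in> D"
 shows "cinner lborel (window.fatom D Ph th1 (z, eta)) (window.fatom D Ph th2 (y, om)) =
  cx (sqrt (w (Ph eta) / w (Ph om))) * osc_integral th1 th2 (Ph eta) (Ph eta - Ph om) (y - z)"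
proof -
 interpret w1: window D Ph v0 N th1 by fact
 interpret w2: window D Ph v0 N th2 by fact
 let ?tau0 = "Ph eta" and ?tau1 = "Ph om"
 define c where "c = w ?tau0 powr (- 1 / 2) * w ?tau1 powr (- 1 / 2)"
 let ?f = "%xi. cx c * th1 (Phi0 xi - ?tau0) * cnj (th2 (Phi0 xi - ?tau1)) * cis (2 * pi * ((y - z) \<bullet> xi))"
 have "cinner lborel (w1.fatom (z, eta)) (w2.fatom (y, om)) = (LB xi. indicator D xi *\<^sub>R ?f xi)"
  unfolding cinner_def
 proof (rule integral_eqI)
  fix xi :: "real^'d"
  have ci: "cis (- 2 * pi * (z \<bullet> xi)) * cnj (cis (- 2 * pi * (y \<bullet> xi))) = cis (2 * pi * ((y - z) \<bullet> xi))"
   unfolding cis_cnj cis_mult by (rule arg_cong[where f=cis]) (simp add: inner_diff_left algebra_simps)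
  show "w1.fatom (z, eta) xi * cnj (w2.fatom (y, om) xi) = indicator D xi *\<^sub>R ?f xi"
   using ci by (auto simp: w1.fatom_def w2.fatom_def w1.freq_def w2.freq_def c_def)
 qed simp
 also have "... = (LB tau. w tau *\<^sub>R ?f (Ps tau))"
  by (rule integral_warp) measurable
 also have "... = (LB up. w (up + ?tau0) *\<^sub>R ?f (Ps (up + ?tau0)))"
  by (rule integral_lborel_translate[symmetric]) measurable
 also have "... = (LB up. cx (sqrt (w ?tau0 / w ?tau1)) *
   (cx (det (phi ?tau0 up)) * th1 up * cnj (th2 (up + (?tau0 - ?tau1))) * cis (2 * pi * ((y - z) \<bullet> Ps (up + ?tau0)))))"
 proof (rule integral_eqI)
  fix up :: "real^'d"
  have wc: "w (up + ?tau0) * c = sqrt (w ?tau0 / w ?tau1) * det (phi ?tau0 up)"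
   unfolding c_def det_phi by (rule sqrt_quotient_powr[OF w_pos w_pos])
  have ar: "up + ?tau0 - ?tau1 = up + (?tau0 - ?tau1)" by simp
  have "w (up + ?tau0) *\<^sub>R ?f (Ps (up + ?tau0)) = cx (w (up + ?tau0) * c) * (th1 up * cnj (th2 (up + (?tau0 - ?tau1))) * cis (2 * pi * ((y - z) \<bullet> Ps (up + ?tau0))))"
   by (simp add: scaleR_conv_of_real ar mult.assoc)
  then show "w (up + ?tau0) *\<^sub>R ?f (Ps (up + ?tau0)) = cx (sqrt (w ?tau0 / w ?tau1)) *
   (cx (det (phi ?tau0 up)) * th1 up * cnj (th2 (up + (?tau0 - ?tau1))) * cis (2 * pi * ((y - z) \<bullet> Ps (up + ?tau0))))"
   unfolding wc of_real_mult by (simp only: mult.assoc)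
 qed simp
 finally show ?thesis by (simp add: osc_integral_def)
qed

end

section \<open>Kernel estimates\<close>

text \<open>
 \<open>schur_bound L e M\<close> dominates the iterated norm of \<open>B_enorm\<close>: for fixed frequencies the kernel has
 \<open>A1\<close>-norm at most \<open>e\<close>, and \<open>e\<close> in turn has \<open>A1\<close>-norm at most \<open>M\<close>.
\<close>

definition schur_bound :: "('a::euclidean_space \<times> 'a => 'a \<times> 'a => ennreal) => ('a => 'a => ennreal) => real => bool" where
 "schur_bound L e M \<longleftrightarrow> 0 <= M \<and> (%(om, eta). e om eta) \<in> Borel \<and>
   (\<forall>y om eta. (NN z. L (y, om) (z, eta)) <= e om eta) \<and> (\<forall>z om eta. (NN y. L (y, om) (z, eta)) <= e om eta) \<and>
   (\<forall>om. (NN eta. e om eta) <= ennreal M) \<and> (\<forall>eta. (NN om. e om eta) <= ennreal M)"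

lemma schur_boundD:
 assumes "schur_bound L e M"
 shows "0 <= M" "(%(om, eta). e om eta) \<in> Borel"
  "(NN z. L (y, om) (z, eta)) <= e om eta" "(NN y. L (y, om) (z, eta)) <= e om eta"
  "(NN eta. e om eta) <= ennreal M" "(NN om. e om eta) <= ennreal M"
 using assms unfolding schur_bound_def by blast+

text \<open>The constant \<open>Rc\<close> is the only trace of R_Phi. The inequality holds with
  \<open>Rc = 1\<close> if \<open>p = 0\<close>, and with a power of a bound on the derivative of
  the warping map if R_Phi is finite.\<close>

locale coorbit_setting = warping D Ph v0 N
 for D :: "(real^'d) set" and Ph v0 N +
 fixes p :: nat and v1 :: "real^'d => real" and m0 :: "'d phase => 'd phase => real" and C0 Rc :: real and nu :: "'d phase"
 assumes N_eq: "N = CARD('d) + p + 1"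
  and Rc: "0 <= Rc" "\<And>tau x. (1 + norm x) ^ p <= Rc * (1 + norm (transpose (A tau) *v x)) ^ p"
  and m0_cont: "continuous_on ((UNIV \<times> D) \<times> (UNIV \<times> D)) (%(mu, rho). m0 mu rho)"
  and m0_ge: "\<And>mu rho. mu \<in> UNIV \<times> D ==> rho \<in> UNIV \<times> D ==> 1 <= m0 mu rho"
  and m0_mult: "\<And>mu rho sig. mu \<in> UNIV \<times> D ==> rho \<in> UNIV \<times> D ==> sig \<in> UNIV \<times> D ==> m0 mu rho <= C0 * m0 mu sig * m0 sig rho"
  and m0_le: "\<And>y z xi eta. xi \<in> D ==> eta \<in> D ==> m0 (y, xi) (z, eta) <= (1 + norm (y - z)) ^ p * v1 (Ph xi - Ph eta)"
  and v1_pos: "\<And>x. 0 < v1 x" and v1_cont: "continuous_on UNIV v1"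
  and v1_submult: "\<And>x y. v1 (x + y) <= v1 x * v1 y" and v1_even: "\<And>x. v1 (- x) = v1 x"
  and nu: "nu \<in> UNIV \<times> D"
begin

definition w2 :: "real^'d => real" where
 "w2 up = (1 + norm up) ^ (CARD('d) + 1) * v1 up * v0 up powr (9 * real CARD('d) / 2 + 3 * real p + 3)"

text \<open>Here \<open>a\<close> counts derivatives, so the power n of v0 in the hypothesis on the
  windows becomes \<open>N - a\<close>.\<close>

definition adm :: "(real^'d => complex) => bool" where
 "adm th \<longleftrightarrow> window D Ph v0 N th \<and>
   (\<forall>j a. a <= N --> (NN up. ennreal ((w2 up * (v0 up ^ (N - a) * cmod ((partial_deriv j ^^ a) th up)))\<^sup>2)) < \<infinity>)"

text \<open>What the weights contribute to the kernel estimate, as a function of the difference of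
  warped frequencies: v1 from the bound on m0, and v0^(3d/2) from \<open>sqrt_ratio_bound\<close>
  with \<open>q\<close> of order v0^d.\<close>

definition V :: "real^'d => real" where
 "V up = v1 up * v0 up powr (3 * real CARD('d) / 2)"

lemma measurable_v1 [measurable]: "v1 \<in> Borel"
 by (rule contI[OF v1_cont])

lemma measurable_V [measurable]: "V \<in> Borel"
 unfolding V_def[abs_def] by measurable

lemma V_pos: "0 < V x"
 unfolding V_def using v1_pos[of x] v0_pos[of x] by (intro mult_pos_pos) simp_all

lemma V_minus [simp]: "V (- x) = V x"
 by (simp add: V_def v1_even)

lemma V_submult: "V (x + y) <= V x * V y"
proof -
 have "V (x + y) <= (v1 x * v1 y) * (v0 x * v0 y) powr (3 * real CARD('d) / 2)"
  unfolding V_def using v1_pos v0_pos by (intro mult_mono v1_submult powr_mono2 v0_submult) (auto simp: less_imp_le)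
 also have "... = V x * V y"
  using v0_pos by (simp add: V_def powr_mult less_imp_le)
 finally show ?thesis .
qed

lemma env2_le_env1: "env2 th up <= env1 th up"
 unfolding env1_def env2_def
proof (intro sum_mono)
 fix j a
 show "cmod ((partial_deriv j ^^ a) th up) <= v0 up ^ (3 * N + CARD('d) - 2 * a) * cmod ((partial_deriv j ^^ a) th up)"
  using mult_right_mono[OF one_le_power[OF v0_ge_1[of up], of "3 * N + CARD('d) - 2 * a"], of "cmod ((partial_deriv j ^^ a) th up)"] by simp
qed

text \<open>Counting powers of v0, the claim is 3d/2 + 3N + d - 2a <= 9d/2 + 3p + 3 + N - a, that is
  2N - a <= 2d + 3p + 3, while 2N = 2d + 2p + 2. The factor (1 + |up|)^(d+1) of \<open>w2\<close> is
  split off for integrability.\<close>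

lemma env_term_le:
 assumes a: "a <= N" and c: "0 <= c"
 shows "V up * (v0 up ^ (3 * N + CARD('d) - 2 * a) * c) <= 1 / (1 + norm up) ^ (CARD('d) + 1) * (w2 up * (v0 up ^ (N - a) * c))"
proof -
 let ?d = "real CARD('d)"
 have pw: "v0 up ^ n = v0 up powr real n" for n by (simp add: powr_realpow v0_pos)
 have "real (3 * N + CARD('d) - 2 * a) = 3 * real N + ?d - 2 * real a"
  using a by (subst of_nat_diff) auto
 moreover have "real (N - a) = real N - real a" using a by (rule of_nat_diff)
 moreover have "real N = ?d + real p + 1" by (simp add: N_eq)
 ultimately have ex: "3 * ?d / 2 + real (3 * N + CARD('d) - 2 * a) <= 9 * ?d / 2 + 3 * real p + 3 + real (N - a)"
  by simp
 have "v0 up powr (3 * ?d / 2) * v0 up ^ (3 * N + CARD('d) - 2 * a) <= v0 up powr (9 * ?d / 2 + 3 * real p + 3) * v0 up ^ (N - a)"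
  unfolding pw powr_add[symmetric] by (rule powr_mono[OF ex v0_ge_1])
 then have "v1 up * (v0 up powr (3 * ?d / 2) * v0 up ^ (3 * N + CARD('d) - 2 * a)) * c <= v1 up * (v0 up powr (9 * ?d / 2 + 3 * real p + 3) * v0 up ^ (N - a)) * c"
  using v1_pos[of up] c by (intro mult_right_mono mult_left_mono) (auto simp: less_imp_le)
 moreover have "0 < 1 + norm up" by (simp add: add_pos_nonneg)
 then have "(1 + norm up) ^ (CARD('d) + 1) \<noteq> 0" by simp
 ultimately show ?thesis by (simp add: V_def w2_def mult_ac)
qed

text \<open>The passage from L^2 hypotheses to an L^1 bound: a product is at most the sum of the
  squares, and the radial factor, being at most 1, dominates its own square.\<close>

lemma env_integral_finite:
 assumes th: "adm th"
 shows "(NN up. ennreal (V up * env1 th up)) < \<infinity>"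
proof -
 interpret window D Ph v0 N th using th by (simp add: adm_def)
 have md: "(partial_deriv j ^^ a) th \<in> Borel" if "a <= N" for j a
  by (rule contI[OF continuous_partial_funpow[OF Ck_theta that]])
 let ?t = "%j a up. V up * (v0 up ^ (3 * N + CARD('d) - 2 * a) * cmod ((partial_deriv j ^^ a) th up))"
 have fin: "(NN up. ennreal (?t j a up)) < \<infinity>" if a: "a <= N" for j a
 proof -
  let ?h = "%up. w2 up * (v0 up ^ (N - a) * cmod ((partial_deriv j ^^ a) th up))"
  let ?r = "%up::real^'d. 1 / (1 + norm up) ^ (CARD('d) + 1)"
  have [measurable]: "?h \<in> Borel"
   unfolding w2_def using md[OF a] by measurable
  have "?t j a up <= ?r up + (?h up)\<^sup>2" for up
  proof -
   have r: "0 <= ?r up" "?r up <= 1" using radial_decay_le_1[of up "CARD('d) + 1"] by auto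
   have "?t j a up <= ?r up * ?h up" by (rule env_term_le[OF a]) simp
   also have "... <= (?r up)\<^sup>2 + (?h up)\<^sup>2"
    using sum_squares_bound[of "?r up" "?h up"] zero_le_power2[of "?r up"] zero_le_power2[of "?h up"] by linarith
   also have "(?r up)\<^sup>2 <= ?r up * 1" unfolding power2_eq_square by (rule mult_left_mono[OF r(2) r(1)])
   finally show ?thesis by simp
  qed
  then have "(NN up. ennreal (?t j a up)) <= (NN up. ennreal (?r up) + ennreal ((?h up)\<^sup>2))"
   by (intro nn_integral_mono) (simp add: ennreal_plus[symmetric] ennreal_leI del: ennreal_plus)
  also have "... = (NN up. ennreal (?r up)) + (NN up. ennreal ((?h up)\<^sup>2))"
   by (rule nn_integral_add) measurable
  also have "... < \<infinity>"
   using radial_decay_integrable[where 'a="real^'d"] th a by (auto simp: adm_def)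
  finally show ?thesis .
 qed
 have "(NN up. ennreal (V up * env1 th up)) = (NN up. (\<Sum>j\<in>UNIV. \<Sum>a\<le>N. ennreal (?t j a up)))"
 proof (rule nn_integral_cong)
  fix up
  have nn: "0 <= ?t j a up" for j a using V_pos[of up] v0_pos[of up] by (simp add: less_imp_le)
  have "V up * env1 th up = (\<Sum>j\<in>UNIV. \<Sum>a\<le>N. ?t j a up)" by (simp add: env1_def sum_distrib_left)
  then show "ennreal (V up * env1 th up) = (\<Sum>j\<in>UNIV. \<Sum>a\<le>N. ennreal (?t j a up))"
   using nn by (simp add: sum_ennreal sum_nonneg)
 qed
 also have "... = (\<Sum>j\<in>UNIV. \<Sum>a\<le>N. NN up. ennreal (?t j a up))"
  using md by (subst nn_integral_sum, measurable)+
 also have "... < \<infinity>" using fin by (simp add: ennreal_sum_less_top)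
 finally show ?thesis .
qed

definition env_total :: "(real^'d => complex) => (real^'d => complex) => ennreal" where
 "env_total th1 th2 = (NN sig. ennreal (V sig) * env th1 th2 sig)"

lemma measurable_env_conv:
 assumes "Ck_on N UNIV th1" "Ck_on N UNIV th2"
 shows "env th1 th2 \<in> Borel"
proof -
 have [measurable]: "env1 th1 \<in> Borel" "env2 th2 \<in> Borel"
  using assms measurable_env by auto
 show ?thesis unfolding env_def[abs_def] by measurable
qed

text \<open>Submultiplicativity and evenness give V(sig) <= V(up + sig) V(up). The weight is thus
  distributed over the two windows, and the double integral factors after a translation.\<close>

lemma env_total_finite:
 assumes th: "adm th1" "adm th2"
 shows "env_total th1 th2 < \<infinity>"
proof -
 have Ck: "Ck_on N UNIV th1" "Ck_on N UNIV th2"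
  using th window.Ck_theta by (auto simp: adm_def)
 have [measurable]: "env1 th1 \<in> Borel" "env2 th2 \<in> Borel" "env1 th2 \<in> Borel"
  using Ck measurable_env by auto
 have "env_total th1 th2 = (NN sig. NN up. ennreal (V sig) * ennreal (env1 th1 up * env2 th2 (up + sig)))"
  unfolding env_total_def env_def by (intro nn_integral_cong nn_integral_cmult[symmetric]) measurable
 also have "... <= (NN sig. NN up. ennreal (V up * env1 th1 up) * ennreal (V (up + sig) * env1 th2 (up + sig)))"
 proof (intro nn_integral_mono)
  fix sig up :: "real^'d"
  have "V sig = V ((up + sig) + (- up))" by simp
  also have "... <= V (up + sig) * V (- up)" by (rule V_submult)
  finally have Vs: "V sig <= V (up + sig) * V up" by simp
  have "V sig * (env1 th1 up * env2 th2 (up + sig)) <= (V (up + sig) * V up) * (env1 th1 up * env1 th2 (up + sig))"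
   using V_pos by (intro mult_mono Vs env2_le_env1 mult_nonneg_nonneg env_nonneg order_refl) (auto simp: less_imp_le)
  also have "... = (V up * env1 th1 up) * (V (up + sig) * env1 th2 (up + sig))" by (simp add: mult_ac)
  finally show "ennreal (V sig) * ennreal (env1 th1 up * env2 th2 (up + sig)) <= ennreal (V up * env1 th1 up) * ennreal (V (up + sig) * env1 th2 (up + sig))"
   using V_pos env_nonneg by (simp add: ennreal_mult'[symmetric] ennreal_leI less_imp_le)
 qed
 also have "... = (NN up. NN sig. ennreal (V up * env1 th1 up) * ennreal (V (up + sig) * env1 th2 (up + sig)))"
  by (rule lborel_pair.Fubini') measurable
 also have "... = (NN up. ennreal (V up * env1 th1 up) * (NN sig. ennreal (V sig * env1 th2 sig)))"
 proof (intro nn_integral_cong)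
  fix up
  have "(NN sig. ennreal (V (up + sig) * env1 th2 (up + sig))) = (NN sig. ennreal (V sig * env1 th2 sig))"
   using nn_integral_lborel_translate[of "%sig. ennreal (V sig * env1 th2 sig)" up] by (simp add: add.commute)
  then show "(NN sig. ennreal (V up * env1 th1 up) * ennreal (V (up + sig) * env1 th2 (up + sig)))
   = ennreal (V up * env1 th1 up) * (NN sig. ennreal (V sig * env1 th2 sig))"
   by (subst nn_integral_cmult) auto
 qed
 also have "... = (NN up. ennreal (V up * env1 th1 up)) * (NN sig. ennreal (V sig * env1 th2 sig))"
  by (rule nn_integral_multc) measurable
 also have "... < \<infinity>"
  using env_integral_finite[OF th(1)] env_integral_finite[OF th(2)] by (simp add: ennreal_mult_less_top)
 finally show ?thesis .
qed

definition ratio :: "real^'d => real^'d => real" where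
 "ratio om eta = max (w (Ph eta) / w (Ph om)) (w (Ph om) / w (Ph eta))"

text \<open>One weight for two demands. The kernel has to act on \<open>Y\<close>, which calls for
  m0, here replaced by its upper bound, and on the weighted L^1 space behind H^1_v, whose weight
  contains max(w, 1/w); the factor \<open>ratio\<close> accounts for the latter.\<close>

definition big_weight :: "'d phase => 'd phase => real" where
 "big_weight = (%(y, om) (z, eta). (1 + norm (y - z)) ^ p * v1 (Ph om - Ph eta) * ratio om eta)"

lemma ratio_ge_1: "1 <= ratio om eta"
 using w_pos[of "Ph om"] w_pos[of "Ph eta"]
 by (cases "w (Ph om) <= w (Ph eta)") (auto simp: ratio_def le_max_iff_disj)

lemma m0_le_big_weight: "mu \<in> UNIV \<times> D ==> rho \<in> UNIV \<times> D ==> m0 mu rho <= big_weight mu rho"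
proof -
 assume mu: "mu \<in> UNIV \<times> D" "rho \<in> UNIV \<times> D"
 obtain y om z eta where e: "mu = (y, om)" "rho = (z, eta)" by force
 have "m0 mu rho <= (1 + norm (y - z)) ^ p * v1 (Ph om - Ph eta) * 1"
  using m0_le[of om eta y z] mu by (simp add: e)
 also have "... <= (1 + norm (y - z)) ^ p * v1 (Ph om - Ph eta) * ratio om eta"
  using v1_pos by (intro mult_left_mono ratio_ge_1 mult_nonneg_nonneg zero_le_power) (auto simp: less_imp_le)
 finally show ?thesis by (simp add: big_weight_def e)
qed

definition ker :: "(real^'d => complex) => (real^'d => complex) => 'd phase => 'd phase => complex" where
 "ker th1 th2 mu rho = (if mu \<in> UNIV \<times> D \<and> rho \<in> UNIV \<times> D then cinner lborel (window.fatom D Ph th1 rho) (window.fatom D Ph th2 mu) else 0)"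

definition wker :: "(real^'d => complex) => (real^'d => complex) => 'd phase => 'd phase => ennreal" where
 "wker th1 th2 mu rho = ennreal (big_weight mu rho * cmod (ker th1 th2 mu rho))"

text \<open>The factor \<open>min 1 (w (Ph eta) / w (Ph om))\<close> keeps the estimate usable in
  both orders of integration: integrating over eta uses the 1, integrating over omega the quotient,
  which exchanges one Jacobian for the other.\<close>

lemma kernel_pointwise:
 assumes th: "adm th1" "adm th2"
 obtains C where "C \<ge> 0" "\<And>y z om eta. om \<in> D ==> eta \<in> D ==>
   wker th1 th2 (y, om) (z, eta) \<le>
   ennreal (C * min 1 (w (Ph eta) / w (Ph om)) * V (Ph eta - Ph om) / (1 + norm (transpose (A (Ph eta)) *v (y - z))) ^ (CARD('d) + 1)) * env th1 th2 (Ph eta - Ph om)"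
proof -
 have win: "window D Ph v0 N th1" "window D Ph v0 N th2" using th by (auto simp: adm_def)
 have Ck: "Ck_on N UNIV th1" "Ck_on N UNIV th2" using window.Ck_theta[OF win(1)] window.Ck_theta[OF win(2)] by auto
 obtain Co where Co: "Co > 0" and osc: "\<And>tau sig x. ennreal (cmod (osc_integral th1 th2 tau sig x)) <= ennreal (Co / (1 + norm (transpose (A tau) *v x)) ^ N) * env th1 th2 sig"
  using osc_integral_bound Ck by blast
 define F :: real where "F = fact CARD('d) powr (3 / 2)"
 define C where "C = Rc * F * Co"
 have F: "F \<ge> 0" by (simp add: F_def)
 show thesis
 proof (rule that)
  show "C \<ge> 0" using Rc Co F by (simp add: C_def)
  fix y z om eta :: "real^'d" assume D: "om \<in> D" "eta \<in> D"
  define tau0 where "tau0 = Ph eta" define tau1 where "tau1 = Ph om" define sig where "sig = tau0 - tau1"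
  define x where "x = y - z"
  define n where "n = norm (transpose (A tau0) *v x)"
  have n: "0 <= n" by (simp add: n_def)
  define r where "r = w tau0 / w tau1"
  \<comment> \<open>Bounds the quotient of \<open>w\<close> in both directions, by
    \<open>w_quotient_le\<close> for \<open>sig\<close> and for \<open>- sig\<close>.\<close>
  define q where "q = fact CARD('d) * v0 sig ^ CARD('d)"
  have w: "0 < w tau0" "0 < w tau1" by (rule w_pos)+
  have "1 * 1 <= q" unfolding q_def by (intro mult_mono one_le_power v0_ge_1) (auto simp: fact_ge_1)
  then have q1: "1 <= q" by simp
  have "w tau0 <= q * w tau1" using w_quotient_le[of sig tau1] by (simp add: q_def sig_def)
  moreover have "w tau1 <= q * w tau0" using w_quotient_le[of "- sig" tau0] by (simp only: q_def v0_minus) (simp add: sig_def)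
  ultimately have r: "0 < r" "1 / q <= r" "r <= q" using w q1 by (auto simp: r_def field_simps)
  have qV: "q powr (3 / 2) = F * v0 sig powr (3 * real CARD('d) / 2)"
   using v0_pos[of sig] unfolding q_def F_def
   by (subst powr_mult) (auto simp: powr_powr powr_realpow[symmetric] mult_ac)
  have rat: "ratio om eta = max r (1 / r)" by (simp add: ratio_def r_def tau0_def tau1_def)
  have s1: "sqrt r * ratio om eta <= q powr (3 / 2) * min 1 r"
  proof -
   have "sqrt r * ratio om eta <= q powr (3 / 2)" unfolding rat by (rule sqrt_ratio_bound(1)[OF r q1])
   moreover have "sqrt r * ratio om eta <= q powr (3 / 2) * r"
   proof -
    have "sqrt r * ratio om eta = (sqrt (1 / r) * ratio om eta) * r"
     using r(1) by (simp add: real_sqrt_divide field_simps)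
    also have "... <= q powr (3 / 2) * r"
     unfolding rat using sqrt_ratio_bound(2)[OF r q1] r by (intro mult_right_mono) auto
    finally show ?thesis .
   qed
   ultimately show ?thesis by (simp add: min_def)
  qed
  have v1s: "v1 (tau1 - tau0) = v1 sig" using v1_even[of sig] by (simp add: sig_def)
  \<comment> \<open>The p powers of |y - z| are paid for with p of the N powers of decay, which
    leaves N - p = d + 1.\<close>
  have R1: "(1 + norm x) ^ p / (1 + n) ^ N <= Rc / (1 + n) ^ (CARD('d) + 1)"
  proof -
   have "(1 + norm x) ^ p / (1 + n) ^ N <= Rc * (1 + n) ^ p / (1 + n) ^ N"
    using Rc(2)[of x tau0] n by (intro divide_right_mono) (auto simp: n_def)
   also have "... = Rc / (1 + n) ^ (CARD('d) + 1)"
    using n by (simp add: N_eq power_add)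
   finally show ?thesis .
  qed
  have "big_weight (y, om) (z, eta) * sqrt r * (Co / (1 + n) ^ N) =
    Co * v1 sig * ((1 + norm x) ^ p / (1 + n) ^ N) * (sqrt r * ratio om eta)"
   unfolding big_weight_def prod.case tau0_def[symmetric] tau1_def[symmetric] v1s x_def[symmetric] by (simp add: mult_ac)
  also have "... <= Co * v1 sig * (Rc / (1 + n) ^ (CARD('d) + 1)) * (q powr (3 / 2) * min 1 r)"
   using Co v1_pos[of sig] n r Rc ratio_ge_1[of om eta]
   by (intro mult_mono mult_nonneg_nonneg R1 s1) (auto simp: less_imp_le)
  also have "... = C * min 1 r * V sig / (1 + n) ^ (CARD('d) + 1)"
   unfolding qV by (simp add: C_def V_def mult_ac)
  finally have real: "big_weight (y, om) (z, eta) * sqrt r * (Co / (1 + n) ^ N) <= C * min 1 r * V sig / (1 + n) ^ (CARD('d) + 1)" .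
  have bw: "0 <= big_weight (y, om) (z, eta)"
   unfolding big_weight_def using v1_pos ratio_ge_1[of om eta] by (auto intro!: mult_nonneg_nonneg simp: less_imp_le)
  have "cmod (ker th1 th2 (y, om) (z, eta)) = sqrt r * cmod (osc_integral th1 th2 tau0 sig x)"
   using kernel_formula[OF win D, of z y] r(1) D
   by (simp add: ker_def norm_mult r_def tau0_def tau1_def sig_def x_def)
  then have "wker th1 th2 (y, om) (z, eta) =
    ennreal (big_weight (y, om) (z, eta) * sqrt r) * ennreal (cmod (osc_integral th1 th2 tau0 sig x))"
   using bw r(1) by (simp add: wker_def ennreal_mult'[symmetric] mult.assoc)
  also have "... <= ennreal (big_weight (y, om) (z, eta) * sqrt r) * (ennreal (Co / (1 + n) ^ N) * env th1 th2 sig)"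
   unfolding n_def by (intro mult_left_mono osc) simp
  also have "... = ennreal (big_weight (y, om) (z, eta) * sqrt r * (Co / (1 + n) ^ N)) * env th1 th2 sig"
   using bw r(1) Co n by (simp add: ennreal_mult'[symmetric] mult.assoc[symmetric])
  also have "... <= ennreal (C * min 1 r * V sig / (1 + n) ^ (CARD('d) + 1)) * env th1 th2 sig"
   by (intro mult_right_mono ennreal_leI real) simp
  finally show "wker th1 th2 (y, om) (z, eta) \<le>
   ennreal (C * min 1 (w (Ph eta) / w (Ph om)) * V (Ph eta - Ph om) / (1 + norm (transpose (A (Ph eta)) *v (y - z))) ^ (CARD('d) + 1)) * env th1 th2 (Ph eta - Ph om)"
   by (simp add: r_def sig_def tau0_def tau1_def n_def x_def)
 qed
qed

text \<open>The integral in y or z is a linear substitution by A(Ph eta)^T and costs 1 / w(Ph eta);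
  the frequency integral brings the Jacobian \<open>w\<close> at the variable of integration. The
  minimum in \<open>kernel_pointwise\<close> lets these cancel in either order, and both orders end
  in the same constant, a multiple of \<open>env_total\<close>.\<close>

theorem wker_schur_bound:
 assumes th: "adm th1" "adm th2"
 obtains e M where "schur_bound (wker th1 th2) e M"
proof -
 have Ck: "Ck_on N UNIV th1" "Ck_on N UNIV th2"
  using th window.Ck_theta by (auto simp: adm_def)
 note [measurable] = measurable_env_conv[OF Ck]
 let ?E = "env th1 th2"
 define R where "R x = ennreal (1 / (1 + norm x) ^ (CARD('d) + 1))" for x :: "real^'d"
 obtain C where C: "C \<ge> 0" and pt: "\<And>y z om eta. om \<in> D ==> eta \<in> D ==> wker th1 th2 (y, om) (z, eta) \<le>
   ennreal (C * min 1 (w (Ph eta) / w (Ph om)) * V (Ph eta - Ph om) / (1 + norm (transpose (A (Ph eta)) *v (y - z))) ^ (CARD('d) + 1)) * ?E (Ph eta - Ph om)"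
  using kernel_pointwise[OF th] by blast
 define J where "J = enn2real (NN x. R x)"
 have J: "(NN x. R x) = ennreal J" "0 <= J"
  using radial_decay_integrable[where 'a="real^'d"] by (auto simp: J_def R_def)
 define M where "M = C * J * enn2real (env_total th1 th2)"
 have M: "ennreal M = ennreal (C * J) * env_total th1 th2" "0 <= M"
  using env_total_finite[OF th] C J by (auto simp: M_def ennreal_mult)
 define b where "b tau tau' = C * min 1 (w tau' / w tau) * V (tau' - tau)" for tau tau'
 have b0: "0 <= b tau tau'" for tau tau'
  using C w_pos[of tau] w_pos[of tau'] V_pos[of "tau' - tau"] by (simp add: b_def less_imp_le min_def)
 define B where "B tau tau' = ennreal (b tau tau') * ?E (tau' - tau)" for tau tau'
 define e where "e om eta = indicator D om * indicator D eta * (B (Phi0 om) (Phi0 eta) * ennreal (J / w (Phi0 eta)))" for om eta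
 have mA: "(%x. transpose (A tau) *v x) \<in> Borel" for tau
  by (rule contI) (rule linear_continuous_on[OF matrix_vector_mul_bounded_linear])
 have mr [measurable]: "(%x. R (transpose (A tau) *v x)) \<in> Borel" for tau
  using mA unfolding R_def by measurable
 have lin: "(NN x. R (transpose (A tau) *v x)) = ennreal (J / w tau)" for tau
 proof -
  have "R \<in> Borel" unfolding R_def[abs_def] by measurable
  then show ?thesis
   using nn_integral_linear_A[of R tau] w_pos[of tau] J by (simp add: ennreal_mult'[symmetric] less_imp_le del: transpose_matrix_vector)
 qed
 have pt': "wker th1 th2 (y, om) (z, eta) <= indicator D om * indicator D eta * B (Phi0 om) (Phi0 eta) * R (transpose (A (Phi0 eta)) *v (y - z))" for y z om eta
 proof (cases "om \<in> D \<and> eta \<in> D")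
  case True
  then show ?thesis
   using pt[of om eta y z] b0[of "Ph om" "Ph eta"]
   unfolding b_def[symmetric] by (simp add: B_def R_def divide_inverse ennreal_mult' mult_ac del: transpose_matrix_vector)
 qed (auto simp: wker_def ker_def)
 have minus: "(NN z. f (y - z)) = (NN x. f x)" "(NN z. f (z - y)) = (NN x. f x)"
  if [measurable]: "f \<in> Borel" for f :: "real^'d => ennreal" and y
 proof -
  have "(NN x. f x) = (NN x. f (y + (-1) *\<^sub>R x))"
   by (subst lborel_affine[of "-1" y]) (auto simp: nn_integral_density nn_integral_distr)
  then show "(NN z. f (y - z)) = (NN x. f x)" by simp
 qed (use nn_integral_lborel_translate[of f "- y"] that in simp)
 have tot: "(NN sig. ennreal (C * J * V sig) * ?E sig) = ennreal M"
  unfolding M env_total_def ennreal_mult'[OF mult_nonneg_nonneg[OF C J(2)]] mult.assoc[of "ennreal _"]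
  by (rule nn_integral_cmult) measurable
 \<comment> \<open>\<open>u\<close> stands for the Jacobian of whichever frequency is
   integrated.\<close>
 have bound: "ennreal u * (B tau tau' * ennreal (J / w tau')) <= ennreal (C * J * V (tau' - tau)) * ?E (tau' - tau)"
  if u: "u = w tau \<or> u = w tau'" for u tau tau'
 proof -
  have w: "0 < w tau" "0 < w tau'" by (rule w_pos)+
  have u0: "0 <= u" using u w by auto
  have "u * min 1 (w tau' / w tau) <= w tau'" using u w by (auto simp: min_def field_simps)
  then have "u * min 1 (w tau' / w tau) / w tau' <= 1" using w by simp
  then have "(C * J * V (tau' - tau)) * (u * min 1 (w tau' / w tau) / w tau') <= (C * J * V (tau' - tau)) * 1"
   using C J V_pos[of "tau' - tau"] by (intro mult_left_mono) auto
  then have "ennreal (u * (b tau tau' * (J / w tau'))) <= ennreal (C * J * V (tau' - tau))"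
   by (intro ennreal_leI) (simp add: b_def mult_ac)
  then have "ennreal u * (ennreal (b tau tau') * ennreal (J / w tau')) <= ennreal (C * J * V (tau' - tau))"
   using u0 b0[of tau tau'] by (simp only: ennreal_mult')
  from mult_right_mono[OF this, of "?E (tau' - tau)"] show ?thesis by (simp add: B_def mult_ac)
 qed
 have sh: "(%z. R (transpose (A tau) *v (y - z))) \<in> Borel" "(%z. R (transpose (A tau) *v (z - y))) \<in> Borel" for tau y
  by (rule measurable_compose[OF _ mr], measurable)+
 have "(NN z. wker th1 th2 (y, om) (z, eta)) <= e om eta" for y om eta
  by (rule order_trans[OF nn_integral_mono[OF pt']]) (simp add: nn_integral_cmult sh minus(1)[OF mr] lin e_def mult.assoc del: transpose_matrix_vector)
 moreover have "(NN y. wker th1 th2 (y, om) (z, eta)) <= e om eta" for z om eta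
  by (rule order_trans[OF nn_integral_mono[OF pt']]) (simp add: nn_integral_cmult sh minus(2)[OF mr] lin e_def mult.assoc del: transpose_matrix_vector)
 moreover have "(NN eta. e om eta) <= ennreal M" for om
 proof -
  have "(NN eta. e om eta) <= (NN eta. indicator D eta * (B (Phi0 om) (Phi0 eta) * ennreal (J / w (Phi0 eta))))"
   by (intro nn_integral_mono) (auto simp: e_def indicator_def)
  also have "... = (NN tau. ennreal (w tau) * (B (Phi0 om) (Phi0 (Ps tau)) * ennreal (J / w (Phi0 (Ps tau)))))"
   unfolding B_def b_def by (rule nn_integral_warp) measurable
  also have "... <= (NN tau. ennreal (C * J * V (tau - Phi0 om)) * ?E (tau - Phi0 om))"
   by (intro nn_integral_mono) (simp add: bound)
  also have "... = ennreal M" unfolding tot[symmetric] by (rule minus(2)) measurable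
  finally show ?thesis .
 qed
 moreover have "(NN om. e om eta) <= ennreal M" for eta
 proof -
  have "(NN om. e om eta) <= (NN om. indicator D om * (B (Phi0 om) (Phi0 eta) * ennreal (J / w (Phi0 eta))))"
   by (intro nn_integral_mono) (auto simp: e_def indicator_def)
  also have "... = (NN tau. ennreal (w tau) * (B (Phi0 (Ps tau)) (Phi0 eta) * ennreal (J / w (Phi0 eta))))"
   unfolding B_def b_def by (rule nn_integral_warp) measurable
  also have "... <= (NN tau. ennreal (C * J * V (Phi0 eta - tau)) * ?E (Phi0 eta - tau))"
   by (intro nn_integral_mono) (simp add: bound)
  also have "... = ennreal M" unfolding tot[symmetric] by (rule minus(1)) measurable
  finally show ?thesis .
 qed
 moreover have "(%(om, eta). e om eta) \<in> Borel"
  unfolding e_def B_def b_def borel_prod[symmetric] by measurable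
 ultimately have "schur_bound (wker th1 th2) e M" using M(2) by (simp add: schur_bound_def)
 then show thesis by (rule that)
qed

end

section \<open>Measurability of iterated norms\<close>

lemma esssup_le_iff: "f \<in> borel_measurable M ==> esssup M f <= a \<longleftrightarrow> (AE x in M. f x <= a)"
 for f :: "'a => ennreal"
proof
 assume a: "esssup M f <= a"
 show "AE x in M. f x <= a" using esssup_AE[of f M] by eventually_elim (rule order_trans[OF _ a])
qed (rule esssup_I)

text \<open>The essential supremum is at most \<open>a\<close> exactly when the set where
  \<open>h\<close> exceeds \<open>a\<close> is null, and the measure of that set depends measurably
  on the parameter by Tonelli.\<close>

lemma measurable_esssup:
 fixes h :: "'b::euclidean_space => 'c::euclidean_space => ennreal"
 assumes "(%(y, t). h y t) \<in> Borel"
 shows "(%t. esssup lebesgue (%y. h y t)) \<in> Borel"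
proof (rule borel_measurableI_le)
 fix a :: ennreal
 let ?M = "borel :: 'c measure"
 have [measurable]: "(%(y, t). h y t) \<in> Borel2"
  using assms by (simp only: borel_prod)
 have "{t \<in> space ?M. esssup lebesgue (%y. h y t) <= a} =
  {t \<in> space ?M. (NN y. indicator {a<..} (h y t)) = 0}"
 proof (rule Collect_cong, rule conj_cong[OF refl])
  fix t assume [measurable]: "t \<in> space ?M"
  have "(%y. h y t) \<in> borel_measurable lborel" by measurable
  then have "esssup lebesgue (%y. h y t) <= a \<longleftrightarrow> (AE y in lborel. h y t <= a)"
   by (simp add: esssup_le_iff measurable_completion AE_completion_iff)
  also have "... \<longleftrightarrow> (AE y in lborel. indicator {a<..} (h y t) = (0::ennreal))"
   by (simp add: indicator_def not_less)
  also have "... \<longleftrightarrow> (NN y. indicator {a<..} (h y t)) = 0"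
   by (rule nn_integral_0_iff_AE[symmetric]) measurable
  finally show "esssup lebesgue (%y. h y t) <= a \<longleftrightarrow> (NN y. indicator {a<..} (h y t)) = 0" .
 qed
 also have "... \<in> sets ?M" by measurable
 finally show "{t \<in> space ?M. esssup lebesgue (%y. h y t) <= a} \<in> sets ?M" .
qed

lemma measurable_nn_integral_param:
 fixes f :: "'b::euclidean_space => 'c::euclidean_space => ennreal"
 assumes "(%x. f (fst x) (snd x)) \<in> Borel"
 shows "(%t. NN z. f t z) \<in> Borel"
proof (rule lborel.borel_measurable_nn_integral)
 have "(%x. f (fst x) (snd x)) \<in> Borel2" using assms by (simp only: borel_prod)
 then show "(%(t, z). f t z) \<in> borel_measurable (borel \<Otimes>\<^sub>M lborel)"
  by (simp add: case_prod_beta' measurable_cong_sets[OF sets_pair_measure_cong[OF refl sets_lborel] refl])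
qed

lemma nn_integral_lebesgue_on:
 assumes "S \<in> sets borel"
 shows "(\<integral>\<^sup>+x. f x \<partial>lebesgue_on S) = (NN x. indicator S x * f x)"
 using assms by (subst nn_integral_restrict_space) (auto simp: nn_integral_completion mult.commute)

lemma measurable_lebesgue_onI:
 assumes "f \<in> Borel" "\<And>x. x \<in> S ==> g x = f x"
 shows "g \<in> borel_measurable (lebesgue_on S)"
proof -
 have "f \<in> borel_measurable (lebesgue_on S)"
  using assms(1) by (intro measurable_restrict_space1 measurable_completion) simp
 then show ?thesis by (rule measurable_cong[THEN iffD1, rotated]) (simp add: assms(2))
qed

lemma nn_integral_phase:
 fixes F :: "(real^'d) \<times> (real^'d) => ennreal"
 assumes "F \<in> Borel"
 shows "(NN mu. F mu) = (NN om. NN y. F (y, om))"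
 using lborel_pair.nn_integral_snd[of F] assms by (simp add: lborel_prod)

lemma phase_sections:
 fixes F :: "((real^'d) \<times> (real^'d)) \<times> ((real^'d) \<times> (real^'d)) => 'b::topological_space"
 assumes "F \<in> Borel"
 shows "(%mu. F (mu, rho)) \<in> Borel" "(%rho. F (mu, rho)) \<in> Borel"
 by (rule measurable_compose[OF _ assms], rule contI, intro continuous_intros)+

section \<open>Cross kernels and the weight of H^1_v\<close>

context coorbit_setting
begin

abbreviation Lam :: "'d phase set" where "Lam \<equiv> UNIV \<times> D"

lemma Lambda_borel [measurable]: "Lam \<in> sets borel"
 using open_phase by simp

text \<open>The value 1 off \<open>Lam\<close> keeps the weight Borel and at least 1 on the whole
  space.\<close>

definition vw :: "'d phase => real" where
 "vw mu = (if mu \<in> Lam then coorbit_weight D Ph m0 nu mu else 1)"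

lemma C0_pos: "0 < C0"
proof -
 have m: "0 < m0 nu nu" "m0 nu nu <= C0 * (m0 nu nu * m0 nu nu)"
  using m0_ge[OF nu nu] m0_mult[OF nu nu nu] by (auto simp: mult.assoc)
 then have "0 < C0 * (m0 nu nu * m0 nu nu)" by linarith
 then show ?thesis using m(1) by (simp add: zero_less_mult_iff)
qed

lemma vw_ge_1: "1 <= vw mu"
proof -
 have "1 <= max t (inverse t)" if "0 < t" for t :: real
  using that by (cases "1 <= t") (auto simp: le_max_iff_disj one_le_inverse_iff)
 then have "1 * 1 <= m0 mu nu * max (w (Ph (snd mu))) (inverse (w (Ph (snd mu))))" if "mu \<in> Lam"
  using m0_ge[OF that nu] w_pos by (intro mult_mono) auto
 then show ?thesis by (cases mu) (auto simp: vw_def coorbit_weight_def)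
qed

lemma big_weight_nonneg: "0 <= big_weight mu rho"
 unfolding big_weight_def using v1_pos ratio_ge_1 order_trans[OF zero_le_one ratio_ge_1]
 by (auto split: prod.split intro!: mult_nonneg_nonneg simp: less_imp_le)

lemma big_weight_sym: "big_weight mu rho = big_weight rho mu"
proof -
 have "v1 (Ph a - Ph b) = v1 (Ph b - Ph a)" for a b
  using v1_even[of "Ph a - Ph b"] by simp
 then show ?thesis by (auto simp: big_weight_def ratio_def norm_minus_commute max.commute split: prod.split)
qed

text \<open>The m0 factor moves by the multiplicative triangle inequality with middle point
  \<open>rho\<close>, the factor max(w, 1/w) by \<open>ratio\<close>; the latter is why
  \<open>big_weight\<close> contains \<open>ratio\<close>.\<close>

lemma vw_le:
 assumes "mu \<in> Lam" "rho \<in> Lam"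
 shows "vw mu <= C0 * big_weight mu rho * vw rho"
proof -
 obtain y om z eta where e: "mu = (y, om)" "rho = (z, eta)" by force
 let ?m = "%t::real. max t (inverse t)"
 let ?a = "w (Ph om)" and ?b = "w (Ph eta)"
 have w: "0 < ?a" "0 < ?b" by (rule w_pos)+
 have "?m ?a <= ratio om eta * ?m ?b"
 proof (rule max.boundedI)
  have "?a = (?a / ?b) * ?b" using w by simp
  also have "... <= ratio om eta * ?m ?b" using w by (intro mult_mono) (auto simp: ratio_def le_max_iff_disj)
  finally show "?a <= ratio om eta * ?m ?b" .
  have "inverse ?a = (?b / ?a) * inverse ?b" using w by (simp add: field_simps)
  also have "... <= ratio om eta * ?m ?b" using w by (intro mult_mono) (auto simp: ratio_def le_max_iff_disj)
  finally show "inverse ?a <= ratio om eta * ?m ?b" .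
 qed
 moreover have "m0 mu nu <= C0 * ((1 + norm (y - z)) ^ p * v1 (Ph om - Ph eta)) * m0 rho nu"
 proof -
  have "m0 mu nu <= C0 * m0 mu rho * m0 rho nu" by (rule m0_mult[OF assms(1) nu assms(2)])
  also have "... <= C0 * ((1 + norm (y - z)) ^ p * v1 (Ph om - Ph eta)) * m0 rho nu"
   using m0_le[of om eta y z] assms C0_pos m0_ge[OF assms(2) nu] by (intro mult_right_mono mult_left_mono) (auto simp: e)
  finally show ?thesis .
 qed
 moreover have "0 <= m0 mu nu" "0 <= m0 rho nu" using m0_ge[OF assms(1) nu] m0_ge[OF assms(2) nu] by auto
 moreover have "0 <= ?m ?a" using w by (simp add: le_max_iff_disj)
 ultimately have "m0 mu nu * ?m ?a <= (C0 * ((1 + norm (y - z)) ^ p * v1 (Ph om - Ph eta)) * m0 rho nu) * (ratio om eta * ?m ?b)"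
  using C0_pos v1_pos[of "Ph om - Ph eta"] by (intro mult_mono mult_nonneg_nonneg) (auto simp: less_imp_le)
 then show ?thesis
  using assms by (simp add: vw_def coorbit_weight_def big_weight_def e mult_ac)
qed

lemma continuous_vw: "continuous_on Lam vw"
proof -
 have "continuous_on Lam (%mu. w (Ph (snd mu)))"
  by (rule continuous_on_compose2[OF continuous_w]) (auto intro!: continuous_on_compose2[OF continuous_Phi] continuous_intros)
 moreover have "continuous_on Lam (%mu. m0 mu nu)"
  using nu by (intro continuous_on_compose2[OF m0_cont, of _ "%mu. (mu, nu)", simplified]) (auto intro!: continuous_intros)
 ultimately have "continuous_on Lam (%mu. m0 mu nu * max (w (Ph (snd mu))) (inverse (w (Ph (snd mu)))))"
  using w_pos by (intro continuous_intros) (auto simp: less_imp_neq[symmetric])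
 then show ?thesis
  by (rule continuous_on_eq) (auto simp: vw_def coorbit_weight_def)
qed

lemma measurable_vw [measurable]: "vw \<in> Borel"
proof -
 have "(%mu. if mu \<in> Lam then vw mu else 1) \<in> Borel"
  by (rule borel_measurable_continuous_on_if[OF _ continuous_vw]) auto
 then show ?thesis by (rule measurable_cong[THEN iffD1, rotated]) (simp add: vw_def)
qed

lemma ker_outside: "mu \<notin> Lam ==> ker th1 th2 mu rho = 0" "rho \<notin> Lam ==> ker th1 th2 mu rho = 0"
 by (auto simp: ker_def)

lemma ker_cnj: "ker th2 th1 rho mu = cnj (ker th1 th2 mu rho)"
 by (simp add: ker_def cinner_cnj[symmetric])

lemma continuous_ker:
 assumes "adm th1" "adm th2"
 shows "continuous_on (Lam \<times> Lam) (%(mu, rho). ker th1 th2 mu rho)"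
proof -
 interpret w1: window D Ph v0 N th1 using assms by (simp add: adm_def)
 interpret w2: window D Ph v0 N th2 using assms by (simp add: adm_def)
 have "continuous_on (Lam \<times> Lam) (%x. cinner lborel (w1.fatom (snd x)) (w2.fatom (fst x)))"
  unfolding continuous_on_sequentially comp_def
 proof (intro ballI allI impI)
  fix a and X :: "nat => 'd phase \<times> 'd phase" assume a: "a \<in> Lam \<times> Lam" and X: "(\<forall>n. X n \<in> Lam \<times> Lam) \<and> X ~~> a"
  show "(%n. cinner lborel (w1.fatom (snd (X n))) (w2.fatom (fst (X n)))) ~~> cinner lborel (w1.fatom (snd a)) (w2.fatom (fst a))"
   by (rule cinner_tendsto)
     (use a X w1.sq_int_fatom w2.sq_int_fatom in \<open>auto simp: sq_int_def intro!: w1.fatom_tendsto w2.fatom_tendsto tendsto_fst tendsto_snd\<close>)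
 qed
 then show ?thesis
  by (rule continuous_on_eq) (auto simp: ker_def)
qed

lemma measurable_ker:
 assumes "adm th1" "adm th2"
 shows "(%(mu, rho). ker th1 th2 mu rho) \<in> Borel"
proof -
 have "(%x. if x \<in> Lam \<times> Lam then case x of (mu, rho) => ker th1 th2 mu rho else 0) \<in> Borel"
  by (rule borel_measurable_continuous_on_if[OF _ continuous_ker[OF assms]])
    (auto intro!: borel_open open_Times open_phase)
 then show ?thesis by (rule measurable_cong[THEN iffD1, rotated]) (auto simp: ker_def split: if_splits)
qed

lemma measurable_m0:
 "(%(mu, rho). if mu \<in> Lam \<and> rho \<in> Lam then m0 mu rho else 0) \<in> Borel"
proof -
 have "(%x. if x \<in> Lam \<times> Lam then case x of (mu, rho) => m0 mu rho else 0) \<in> Borel"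
  by (rule borel_measurable_continuous_on_if[OF _ m0_cont]) (auto intro!: borel_open open_Times open_phase)
 then show ?thesis by (rule measurable_cong[THEN iffD1, rotated]) (auto split: if_splits)
qed

lemma measurable_wker:
 assumes "adm th1" "adm th2"
 shows "(%(mu, rho). wker th1 th2 mu rho) \<in> Borel"
proof -
 note [measurable] = measurable_ker[OF assms]
 have [measurable]: "(%x :: 'd phase \<times> 'd phase. fst (fst x)) \<in> Borel"
  "(%x :: 'd phase \<times> 'd phase. snd (fst x)) \<in> Borel"
  "(%x :: 'd phase \<times> 'd phase. fst (snd x)) \<in> Borel"
  "(%x :: 'd phase \<times> 'd phase. snd (snd x)) \<in> Borel"
  by (rule contI, intro continuous_intros)+
 have "(%x. ennreal ((1 + norm (fst (fst x) - fst (snd x))) ^ p * v1 (Phi0 (snd (fst x)) - Phi0 (snd (snd x))) *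
   max (w (Phi0 (snd (snd x))) / w (Phi0 (snd (fst x)))) (w (Phi0 (snd (fst x))) / w (Phi0 (snd (snd x)))) *
   cmod ((%(mu, rho). ker th1 th2 mu rho) x))) \<in> Borel"
  by measurable
 then show ?thesis
  by (rule measurable_cong[THEN iffD1, rotated]) (auto simp: wker_def big_weight_def ratio_def ker_def)
qed

lemma wker_sections:
 assumes "adm th1" "adm th2"
 shows "wker th1 th2 mu \<in> Borel" "(%mu. wker th1 th2 mu rho) \<in> Borel"
  "ker th1 th2 mu \<in> Borel" "(%mu. ker th1 th2 mu rho) \<in> Borel"
 using phase_sections[OF measurable_wker[OF assms]] phase_sections[OF measurable_ker[OF assms]] by auto

lemma vw_ker_le: "ennreal (vw mu * cmod (ker th1 th2 mu rho)) <= ennreal (C0 * vw rho) * wker th1 th2 mu rho"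
 "ennreal (vw rho * cmod (ker th1 th2 mu rho)) <= ennreal (C0 * vw mu) * wker th1 th2 mu rho"
proof -
 have v: "0 <= vw x" for x using vw_ge_1[of x] by simp
 have *: "ennreal (vw a * cmod z) <= ennreal (C0 * vw b) * ennreal (big_weight mu rho * cmod z)"
  if "vw a <= C0 * big_weight mu rho * vw b" for a b z
  using mult_right_mono[OF that, of "cmod z"] C0_pos v big_weight_nonneg
  by (simp add: ennreal_mult'[symmetric] ennreal_leI mult_ac less_imp_le)
 show "ennreal (vw mu * cmod (ker th1 th2 mu rho)) <= ennreal (C0 * vw rho) * wker th1 th2 mu rho"
  by (cases "mu \<in> Lam \<and> rho \<in> Lam") (auto simp: wker_def ker_def intro!: * vw_le)
 show "ennreal (vw rho * cmod (ker th1 th2 mu rho)) <= ennreal (C0 * vw mu) * wker th1 th2 mu rho"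
  by (cases "mu \<in> Lam \<and> rho \<in> Lam") (auto simp: wker_def ker_def big_weight_sym[of mu] intro!: *[unfolded big_weight_sym[of mu]] vw_le)
qed

text \<open>Two Schur bounds relative to \<open>vw\<close>: the first makes the kernel bounded on
  weighted L^1, the second puts every atom into H^1_v with norm of order
  \<open>vw mu\<close>.\<close>

lemma ker_integrals:
 assumes th: "adm th1" "adm th2"
 obtains M where "M \<ge> 0"
  "\<And>rho. (NN mu. ennreal (vw mu * cmod (ker th1 th2 mu rho))) <= ennreal (M * vw rho)"
  "\<And>mu. (NN rho. ennreal (vw rho * cmod (ker th1 th2 mu rho))) <= ennreal (M * vw mu)"
proof -
 obtain e M where sb: "schur_bound (wker th1 th2) e M" by (rule wker_schur_bound[OF th])
 note M = schur_boundD(1)[OF sb]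
 note [measurable] = wker_sections[OF th]
 have v: "0 <= vw x" for x using vw_ge_1[of x] by simp
 have t1: "(NN mu. wker th1 th2 mu rho) <= ennreal M" for rho
  by (cases rho) (auto simp: nn_integral_phase[OF wker_sections(2)[OF th]] intro!: order_trans[OF nn_integral_mono[OF schur_boundD(4)[OF sb]] schur_boundD(6)[OF sb]])
 have t2: "(NN rho. wker th1 th2 mu rho) <= ennreal M" for mu
  by (cases mu) (auto simp: nn_integral_phase[OF wker_sections(1)[OF th]] intro!: order_trans[OF nn_integral_mono[OF schur_boundD(3)[OF sb]] schur_boundD(5)[OF sb]])
 have fin: "ennreal (C0 * vw x) * ennreal M = ennreal (C0 * M * vw x)" for x
  using M C0_pos v by (simp add: ennreal_mult'[symmetric] mult_ac less_imp_le)
 show thesis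
 proof (rule that[of "C0 * M"])
  show "0 <= C0 * M" using M C0_pos by simp
  show "(NN mu. ennreal (vw mu * cmod (ker th1 th2 mu rho))) <= ennreal (C0 * M * vw rho)" for rho
  proof -
   have "(NN mu. ennreal (vw mu * cmod (ker th1 th2 mu rho))) <= (NN mu. ennreal (C0 * vw rho) * wker th1 th2 mu rho)"
    by (rule nn_integral_mono) (rule vw_ker_le)
   also have "... = ennreal (C0 * vw rho) * (NN mu. wker th1 th2 mu rho)" by (rule nn_integral_cmult) measurable
   also have "... <= ennreal (C0 * vw rho) * ennreal M" by (intro mult_left_mono t1) simp
   finally show ?thesis unfolding fin .
  qed
  show "(NN rho. ennreal (vw rho * cmod (ker th1 th2 mu rho))) <= ennreal (C0 * M * vw mu)" for mu
  proof -
   have "(NN rho. ennreal (vw rho * cmod (ker th1 th2 mu rho))) <= (NN rho. ennreal (C0 * vw mu) * wker th1 th2 mu rho)"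
    by (rule nn_integral_mono) (rule vw_ker_le)
   also have "... = ennreal (C0 * vw mu) * (NN rho. wker th1 th2 mu rho)" by (rule nn_integral_cmult) measurable
   also have "... <= ennreal (C0 * vw mu) * ennreal M" by (intro mult_left_mono t2) simp
   finally show ?thesis unfolding fin .
  qed
 qed
qed

lemma A1_enorm_le:
 assumes "(%x. \<integral>\<^sup>+y. L x y \<partial>M) \<in> borel_measurable M" "(%y. \<integral>\<^sup>+x. L x y \<partial>M) \<in> borel_measurable M"
  "AE x in M. (\<integral>\<^sup>+y. L x y \<partial>M) <= c" "AE y in M. (\<integral>\<^sup>+x. L x y \<partial>M) <= c"
 shows "A1_enorm M L <= c"
 using assms by (simp add: A1_enorm_def esssup_le_iff)

text \<open>Since m0 is below \<open>big_weight\<close>, the Schur bound of \<open>wker\<close>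
  dominates the iterated norm. The essential suprema are estimated through almost-everywhere bounds,
  which presupposes measurability of the inner norm \<open>E\<close>.\<close>

theorem ker_in_B_space:
 assumes th: "adm th1" "adm th2"
 shows "ker th1 th2 \<in> B_space D m0"
proof -
 obtain e M where sb: "schur_bound (wker th1 th2) e M" by (rule wker_schur_bound[OF th])
 define L where "L mu rho = ennreal (cmod (m0 mu rho *\<^sub>R ker th1 th2 mu rho))" for mu rho
 have L_le: "L mu rho <= wker th1 th2 mu rho" for mu rho
  using m0_le_big_weight[of mu rho] m0_ge[of mu rho]
  by (cases "mu \<in> Lam \<and> rho \<in> Lam") (auto simp: L_def wker_def ker_def intro!: ennreal_leI mult_right_mono)
 have Lm: "(%(mu, rho). L mu rho) \<in> Borel"
 proof -
  note [measurable] = measurable_ker[OF th] measurable_m0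
  have "(%x. ennreal (cmod ((%(mu, rho). if mu \<in> Lam \<and> rho \<in> Lam then m0 mu rho else 0) x *\<^sub>R (%(mu, rho). ker th1 th2 mu rho) x))) \<in> Borel"
   by measurable
  then show ?thesis by (rule measurable_cong[THEN iffD1, rotated]) (auto simp: L_def ker_def)
 qed
 have Lc: "(%x. L (g1 x, g2 x) (g3 x, g4 x)) \<in> Borel"
  if "continuous_on UNIV g1" "continuous_on UNIV g2" "continuous_on UNIV g3" "continuous_on UNIV g4"
  for g1 g2 g3 g4 :: "'z::topological_space => real^'d"
 proof -
  have "(%x. ((g1 x, g2 x), (g3 x, g4 x))) \<in> Borel"
   by (rule contI) (intro continuous_intros that)
  from measurable_compose[OF this Lm] show ?thesis by simp
 qed
 define E where "E om eta = A1_enorm lebesgue (%y z. L (y, om) (z, eta))" for om eta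
 have m1: "(%(y, t). NN z. L (y, fst t) (z, snd t)) \<in> Borel"
  unfolding case_prod_beta' by (rule measurable_nn_integral_param, rule Lc) (intro continuous_intros)+
 have m2: "(%(z, t). NN y. L (y, fst t) (z, snd t)) \<in> Borel"
  unfolding case_prod_beta' by (rule measurable_nn_integral_param, rule Lc) (intro continuous_intros)+
 have Em: "(%t. E (fst t) (snd t)) \<in> Borel"
  unfolding E_def A1_enorm_def nn_integral_completion
  by (intro borel_measurable_max measurable_esssup m1 m2)
 have "(snd :: (real^'d) \<times> (real^'d) => real^'d) \<in> Borel"
  by (rule contI) (intro continuous_intros)
 then have Di: "(%t :: (real^'d) \<times> (real^'d). indicator D (snd t) :: ennreal) \<in> Borel"
  by (rule measurable_compose) simp
 have Em': "(%t. E (snd t) (fst t)) \<in> Borel"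
  using measurable_compose[OF contI[of "%t. (snd t, fst t)"] Em] by (simp add: continuous_intros)
 have E_le: "E om eta <= e om eta" for om eta
  unfolding E_def
 proof (rule A1_enorm_le)
  have "(%y. NN z. L (y, om) (z, eta)) \<in> Borel"
   by (rule measurable_nn_integral_param, rule Lc) (intro continuous_intros)+
  then show "(%y. \<integral>\<^sup>+z. L (y, om) (z, eta) \<partial>lebesgue) \<in> borel_measurable lebesgue"
   by (simp add: nn_integral_completion measurable_completion)
  have "(%z. NN y. L (y, om) (z, eta)) \<in> Borel"
   by (rule measurable_nn_integral_param, rule Lc) (intro continuous_intros)+
  then show "(%z. \<integral>\<^sup>+y. L (y, om) (z, eta) \<partial>lebesgue) \<in> borel_measurable lebesgue"
   by (simp add: nn_integral_completion measurable_completion)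
 qed (auto simp: nn_integral_completion intro!: always_eventually order_trans[OF nn_integral_mono[OF L_le] schur_boundD(3)[OF sb]] order_trans[OF nn_integral_mono[OF L_le] schur_boundD(4)[OF sb]])
 have "A1_enorm (lebesgue_on D) E <= ennreal M"
 proof (rule A1_enorm_le)
  have "(%om. NN eta. indicator D eta * E om eta) \<in> Borel"
   by (rule measurable_nn_integral_param) (intro borel_measurable_times_ennreal Di Em)
  then show "(%om. \<integral>\<^sup>+eta. E om eta \<partial>lebesgue_on D) \<in> borel_measurable (lebesgue_on D)"
   by (rule measurable_lebesgue_onI) (simp add: nn_integral_lebesgue_on)
  have "(%eta. NN om. indicator D om * E om eta) \<in> Borel"
   by (rule measurable_nn_integral_param) (intro borel_measurable_times_ennreal Di Em')
  then show "(%eta. \<integral>\<^sup>+om. E om eta \<partial>lebesgue_on D) \<in> borel_measurable (lebesgue_on D)"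
   by (rule measurable_lebesgue_onI) (simp add: nn_integral_lebesgue_on)
  show "AE om in lebesgue_on D. (\<integral>\<^sup>+eta. E om eta \<partial>lebesgue_on D) <= ennreal M"
   by (intro always_eventually allI) (auto simp: nn_integral_lebesgue_on indicator_def intro!: order_trans[OF nn_integral_mono schur_boundD(5)[OF sb]] E_le)
  show "AE eta in lebesgue_on D. (\<integral>\<^sup>+om. E om eta \<partial>lebesgue_on D) <= ennreal M"
   by (intro always_eventually allI) (auto simp: nn_integral_lebesgue_on indicator_def intro!: order_trans[OF nn_integral_mono schur_boundD(6)[OF sb]] E_le)
 qed
 moreover have "B_enorm D m0 (ker th1 th2) = A1_enorm (lebesgue_on D) E"
  by (simp add: B_enorm_def E_def[abs_def] L_def[abs_def])
 ultimately have "B_enorm D m0 (ker th1 th2) < \<infinity>" using le_less_trans[OF _ ennreal_less_top] by auto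
 moreover have "(%(mu, rho). ker th1 th2 mu rho) \<in> borel_measurable (lebesgue_on (Lam \<times> Lam))"
  by (rule measurable_lebesgue_onI[OF measurable_ker[OF th]]) simp
 ultimately show ?thesis by (simp add: B_space_def)
qed

end

lemma nn_integral_cmult_real:
 fixes f :: "'a => real"
 assumes "0 <= c" "f \<in> borel_measurable M"
 shows "(\<integral>\<^sup>+x. ennreal (c * f x) \<partial>M) = ennreal c * (\<integral>\<^sup>+x. ennreal (f x) \<partial>M)"
 unfolding ennreal_mult'[OF assms(1)] using assms(2) by (intro nn_integral_cmult) measurable

section \<open>The spaces H^1_v and their antiduals for different windows\<close>

context coorbit_setting
begin

abbreviation cw :: "'d phase => real" where "cw \<equiv> coorbit_weight D Ph m0 nu"
abbreviation fat :: "(real^'d => complex) => 'd phase => real^'d => complex" where "fat \<equiv> window.fatom D Ph"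
abbreviation VT :: "(real^'d => complex) => (real^'d => complex) => 'd phase => complex" where "VT \<equiv> window.vt D Ph"

lemma adm_window: "adm th ==> window D Ph v0 N th"
 by (simp add: adm_def)

text \<open>\<open>a\<close> is a Borel representative of the Fourier transform of \<open>f\<close> that vanishes outside \<open>D\<close>.\<close>

definition rep :: "(real^'d => complex) => (real^'d => complex) => bool" where
 "rep f a \<longleftrightarrow> sq_int a \<and> (\<forall>xi. xi \<notin> D --> a xi = 0) \<and> f \<in> L2_space \<and> (AE xi in lborel. fourier_L2 f xi = a xi)"

lemma rep_band: "rep f a ==> f \<in> L2_band D"
proof -
 assume r: "rep f a"
 then have "AE xi in lborel. fourier_L2 f xi = a xi" by (simp add: rep_def)
 then have "AE xi in lborel. xi \<notin> D --> fourier_L2 f xi = 0"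
  by eventually_elim (use r in \<open>auto simp: rep_def\<close>)
 then show ?thesis using r by (auto simp: L2_band_def rep_def intro: AE_completion)
qed

lemma band_rep: assumes "f \<in> L2_band D" obtains a where "rep f a"
proof -
 have f: "f \<in> L2_space" "AE xi in lborel. xi \<notin> D --> fourier_L2 f xi = 0"
  using assms by (auto simp: L2_band_def AE_completion_iff)
 obtain b where b: "sq_int b" "AE xi in lborel. fourier_L2 f xi = b xi"
  using sq_int_of_L2_space[OF fourier_L2_in_L2_space[OF f(1)]] by blast
 define a where "a xi = indicator D xi *\<^sub>R b xi" for xi
 have [measurable]: "b \<in> Borel" using b by (simp add: sq_int_def)
 have "sqnorm lborel a <= sqnorm lborel b"
  unfolding sqnorm_def a_def by (intro nn_integral_mono) (auto simp: indicator_def)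
 then have "sq_int a" using b(1) by (auto simp: sq_int_def a_def[abs_def] intro: le_less_trans)
 moreover have "AE xi in lborel. fourier_L2 f xi = a xi"
  using b(2) f(2) by eventually_elim (auto simp: a_def indicator_def)
 ultimately have "rep f a" using f(1) by (simp add: rep_def a_def)
 then show thesis by (rule that)
qed

lemma rep_linear: assumes "rep f a" "rep g b" shows "rep (%x. f x + c * g x) (%xi. a xi + c * b xi)"
proof -
 have "f \<in> L2_space" "g \<in> L2_space" and ae: "AE xi in lborel. fourier_L2 f xi = a xi" "AE xi in lborel. fourier_L2 g xi = b xi"
  using assms by (auto simp: rep_def)
 note l = fourier_L2_linear[OF this(1,2), of c]
 have "AE xi in lborel. fourier_L2 (%x. f x + c * g x) xi = a xi + c * b xi"
  using l(2) ae by eventually_elim simp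
 then show ?thesis using l(1) assms by (simp add: rep_def sq_int_add sq_int_cmult)
qed

lemma rep_atom: assumes "adm th" shows "rep (warped_atom D Ph th mu) (fat th mu)"
proof -
 interpret window D Ph v0 N th by (rule adm_window[OF assms])
 show ?thesis using sq_int_fatom atom_fourier by (auto simp: rep_def fatom_outside)
qed

lemma voice_rep:
 assumes "adm th" "rep f a" "mu \<in> Lam"
 shows "voice D Ph th f mu = VT th a mu"
proof -
 interpret window D Ph v0 N th by (rule adm_window[OF assms(1)])
 show ?thesis using assms(2,3) by (intro voice_eq_vt) (auto simp: rep_def sq_int_def)
qed

lemma VT_outside: "adm th ==> mu \<notin> Lam ==> VT th a mu = 0"
 using window.vt_def[OF adm_window] by simp

lemma VT_measurable: "adm th ==> sq_int a ==> VT th a \<in> Borel"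
 by (rule window.measurable_vt[OF adm_window])

lemma VT_linear: "adm th ==> sq_int a ==> sq_int b ==> VT th (%xi. a xi + c * b xi) mu = VT th a mu + c * VT th b mu"
 by (rule window.vt_linear[OF adm_window])

lemma VT_fat:
 assumes "adm th1" "adm th2" "mu \<in> Lam"
 shows "VT th1 (fat th2 mu) rho = cnj (ker th1 th2 mu rho)"
 using assms(3) window.vt_def[OF adm_window[OF assms(1)]]
 by (auto simp: ker_def cinner_cnj[symmetric])

definition h1n :: "(real^'d => complex) => (real^'d => complex) => ennreal" where
 "h1n th a = (NN mu. ennreal (vw mu * cmod (VT th a mu)))"

lemma H1_enorm_rep:
 assumes "adm th" "rep f a"
 shows "H1_enorm D Ph cw th f = h1n th a"
 unfolding H1_enorm_def h1n_def nn_integral_lebesgue_on[OF Lambda_borel]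
proof (rule nn_integral_cong)
 fix mu
 show "indicator Lam mu * ennreal (cmod (cw mu *\<^sub>R voice D Ph th f mu)) = ennreal (vw mu * cmod (VT th a mu))"
  using vw_ge_1[of mu] by (cases "mu \<in> Lam") (auto simp: voice_rep[OF assms] VT_outside[OF assms(1)] vw_def)
qed

lemma H1_space_rep:
 assumes "adm th" "rep f a"
 shows "f \<in> H1_space D Ph cw th \<longleftrightarrow> h1n th a < \<infinity>"
proof -
 have "voice D Ph th f \<in> borel_measurable (lebesgue_on Lam)"
  using assms by (intro measurable_lebesgue_onI[OF VT_measurable voice_rep]) (auto simp: rep_def)
 then show ?thesis using rep_band[OF assms(2)] by (simp add: H1_space_def H1_enorm_rep[OF assms])
qed

lemma H1_space_obtain:
 assumes "adm th" "f \<in> H1_space D Ph cw th"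
 obtains a where "rep f a" "h1n th a < \<infinity>" "H1_enorm D Ph cw th f = h1n th a"
proof -
 have "f \<in> L2_band D" using assms by (simp add: H1_space_def)
 then obtain a where "rep f a" by (rule band_rep)
 then show thesis using that H1_space_rep[OF assms(1)] H1_enorm_rep[OF assms(1)] assms(2) by blast
qed

lemma h1n_add:
 assumes th: "adm th" and "sq_int a" "sq_int b"
 shows "h1n th (%xi. a xi + c * b xi) <= h1n th a + ennreal (cmod c) * h1n th b"
proof -
 note [measurable] = VT_measurable[OF th assms(2)] VT_measurable[OF th assms(3)]
 have v: "0 <= vw x" for x using vw_ge_1[of x] by simp
 have "h1n th (%xi. a xi + c * b xi) <= (NN mu. ennreal (vw mu * cmod (VT th a mu)) + ennreal (cmod c) * ennreal (vw mu * cmod (VT th b mu)))"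
  unfolding h1n_def VT_linear[OF assms]
 proof (rule nn_integral_mono)
  fix mu
  have "vw mu * cmod (VT th a mu + c * VT th b mu) <= vw mu * (cmod (VT th a mu) + cmod c * cmod (VT th b mu))"
   using v norm_triangle_ineq[of "VT th a mu" "c * VT th b mu"] by (intro mult_left_mono) (auto simp: norm_mult)
  then show "ennreal (vw mu * cmod (VT th a mu + c * VT th b mu)) <= ennreal (vw mu * cmod (VT th a mu)) + ennreal (cmod c) * ennreal (vw mu * cmod (VT th b mu))"
   using v by (simp add: ennreal_mult'[symmetric] ennreal_plus[symmetric] ennreal_leI algebra_simps del: ennreal_plus)
 qed
 also have "... = h1n th a + ennreal (cmod c) * h1n th b"
  unfolding h1n_def by (subst nn_integral_add) (auto simp: nn_integral_cmult)
 finally show ?thesis .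
qed

lemma H1_linear:
 assumes th: "adm th" and f: "f \<in> H1_space D Ph cw th" and g: "g \<in> H1_space D Ph cw th"
 shows "(%x. f x + c * g x) \<in> H1_space D Ph cw th"
proof -
 obtain a where a: "rep f a" "h1n th a < \<infinity>" using H1_space_obtain[OF th f] by blast
 obtain b where b: "rep g b" "h1n th b < \<infinity>" using H1_space_obtain[OF th g] by blast
 have "h1n th (%xi. a xi + c * b xi) < \<infinity>"
  by (rule le_less_trans[OF h1n_add[OF th]]) (use a b in \<open>auto simp: rep_def ennreal_mult_less_top\<close>)
 then show ?thesis using H1_space_rep[OF th rep_linear[OF a(1) b(1)]] by simp
qed

definition nrm :: "(real^'d => complex) => real" where
 "nrm th = enn2real (sqnorm lborel th)"

text \<open>A window is continuous, so one that vanishes almost everywhere vanishes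
  identically.\<close>

lemma nrm_pos:
 assumes "adm th" "th \<noteq> (%x. 0)"
 shows "0 < nrm th"
proof -
 interpret window D Ph v0 N th by (rule adm_window[OF assms(1)])
 have "sqnorm lborel th \<noteq> 0"
 proof
  assume "sqnorm lborel th = 0"
  then have "AE x in lborel. th x = 0" by (subst (asm) sqnorm_eq_0_iff) auto
  then have "AE x in lebesgue. x \<in> {x. th x = 0}" by (auto intro: AE_completion)
  then have "x \<in> {x. th x = 0}" for x
   by (rule mem_closed_if_AE_lebesgue[OF closed_Collect_eq[OF continuous_theta continuous_on_const]])
  then show False using assms(2) by auto
 qed
 then show ?thesis using sqnorm_theta_finite by (simp add: nrm_def enn2real_positive_iff less_top zero_less_iff_neq_zero)
qed

text \<open>As a function of \<open>rho\<close> the kernel is the conjugate of the voice transform,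
  with window \<open>th1\<close>, of the atom of \<open>th2\<close> at \<open>mu\<close>. The
  integral is thus an inner product of voice transforms, which \<open>vt_orthogonality\<close>
  evaluates.\<close>

lemma reproduce:
 assumes th: "adm th1" "adm th2" and a: "sq_int a" "\<forall>xi. xi \<notin> D --> a xi = 0"
 shows "integrable lborel (%rho. ker th1 th2 mu rho * VT th1 a rho)"
  "(LB rho. ker th1 th2 mu rho * VT th1 a rho) = cx (nrm th1) * VT th2 a mu"
proof -
 interpret w1: window D Ph v0 N th1 by (rule adm_window[OF th(1)])
 interpret w2: window D Ph v0 N th2 by (rule adm_window[OF th(2)])
 have a0: "xi \<notin> D ==> a xi = 0" for xi using a(2) by simp
 have "integrable lborel (%rho. ker th1 th2 mu rho * VT th1 a rho) \<and>
  (LB rho. ker th1 th2 mu rho * VT th1 a rho) = cx (nrm th1) * VT th2 a mu"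
 proof (cases "mu \<in> Lam")
  case True
  have k: "ker th1 th2 mu rho * VT th1 a rho = w1.vt a rho * cnj (w1.vt (w2.fatom mu) rho)" for rho
   by (simp add: VT_fat[OF th True] mult.commute)
  have "integrable lborel (%rho. w1.vt a rho * cnj (w1.vt (w2.fatom mu) rho))"
   using w1.sq_int_vt[OF a(1) a0] w1.sq_int_vt[OF w2.sq_int_fatom w2.fatom_outside]
   by (intro integrable_cinner) (auto simp: sq_int_def)
  moreover have "(LB rho. w1.vt a rho * cnj (w1.vt (w2.fatom mu) rho)) = cx (nrm th1) * VT th2 a mu"
   using w1.vt_orthogonality[OF a(1) a0 w2.sq_int_fatom w2.fatom_outside] True
   by (simp add: cinner_def nrm_def w2.vt_def)
  ultimately show ?thesis by (simp add: k)
 qed (simp add: ker_outside VT_outside[OF th(2)])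
 then show "integrable lborel (%rho. ker th1 th2 mu rho * VT th1 a rho)"
  "(LB rho. ker th1 th2 mu rho * VT th1 a rho) = cx (nrm th1) * VT th2 a mu" by auto
qed

lemma schur_L1:
 assumes th: "adm th1" "adm th2"
  and M: "\<And>rho. (NN mu. ennreal (vw mu * cmod (ker th1 th2 mu rho))) <= ennreal (M * vw rho)"
  and [measurable]: "F \<in> Borel"
 shows "(NN mu. NN rho. ennreal (vw mu * cmod (ker th1 th2 mu rho)) * F rho) <= (NN rho. ennreal (M * vw rho) * F rho)"
proof -
 note [measurable] = wker_sections[OF th]
 have km: "(%x. ker th1 th2 (fst x) (snd x)) \<in> Borel2"
  unfolding borel_prod using measurable_ker[OF th] by (simp add: case_prod_beta')
 note [measurable] = km measurable_compose[OF measurable_Pair[OF measurable_snd measurable_fst] km, simplified]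
 have "(NN mu. NN rho. ennreal (vw mu * cmod (ker th1 th2 mu rho)) * F rho) = (NN rho. NN mu. ennreal (vw mu * cmod (ker th1 th2 mu rho)) * F rho)"
  by (rule lborel_pair.Fubini') measurable
 also have "... = (NN rho. (NN mu. ennreal (vw mu * cmod (ker th1 th2 mu rho))) * F rho)"
  by (intro nn_integral_cong nn_integral_multc) measurable
 also have "... <= (NN rho. ennreal (M * vw rho) * F rho)"
  by (intro nn_integral_mono mult_right_mono M) simp
 finally show ?thesis .
qed

text \<open>Absolute values in the reproducing identity, followed by the weighted Schur bound. With
  the windows exchanged it gives the reverse estimate, so nonzero windows with \<open>adm\<close>
  share one space H^1_v with equivalent norms.\<close>

lemma h1n_transfer:
 assumes th: "adm th1" "adm th2" and nz: "th1 \<noteq> (%x. 0)"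
 obtains C where "C \<ge> (0::real)" "\<And>f a. rep f a ==> h1n th2 a <= ennreal C * h1n th1 a"
proof -
 obtain M where M: "M \<ge> 0" "\<And>rho. (NN mu. ennreal (vw mu * cmod (ker th1 th2 mu rho))) <= ennreal (M * vw rho)"
  by (rule ker_integrals[OF th]) (rule that)
 let ?n = "nrm th1"
 have n: "0 < ?n" by (rule nrm_pos[OF th(1) nz])
 have v: "0 <= vw x" for x using vw_ge_1[of x] by simp
 note [measurable] = wker_sections[OF th]
 show thesis
 proof (rule that[of "M / ?n"])
  show "0 <= M / ?n" using M n by simp
  fix f a assume "rep f a"
  then have a: "sq_int a" "\<forall>xi. xi \<notin> D --> a xi = 0" by (auto simp: rep_def)
  note [measurable] = VT_measurable[OF th(1) a(1)] VT_measurable[OF th(2) a(1)]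
  have "ennreal ?n * h1n th2 a = (NN mu. ennreal (?n * (vw mu * cmod (VT th2 a mu))))"
   unfolding h1n_def by (rule nn_integral_cmult_real[symmetric]) (use n in auto)
  also have "... <= (NN mu. NN rho. ennreal (vw mu * cmod (ker th1 th2 mu rho)) * ennreal (cmod (VT th1 a rho)))"
  proof (rule nn_integral_mono)
   fix mu
   have "?n * (vw mu * cmod (VT th2 a mu)) = vw mu * cmod (cx ?n * VT th2 a mu)"
    using n by (simp add: norm_mult)
   also have "ennreal ... = ennreal (vw mu) * ennreal (cmod (cx ?n * VT th2 a mu))"
    by (rule ennreal_mult'[OF v])
   also have "... <= ennreal (vw mu) * (NN rho. ennreal (cmod (ker th1 th2 mu rho * VT th1 a rho)))"
    using integral_norm_bound_ennreal[OF reproduce(1)[OF th a, of mu]]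
    unfolding reproduce(2)[OF th a] by (rule mult_left_mono) simp
   also have "... = (NN rho. ennreal (vw mu) * ennreal (cmod (ker th1 th2 mu rho * VT th1 a rho)))"
    by (rule nn_integral_cmult[symmetric]) measurable
   also have "... = (NN rho. ennreal (vw mu * cmod (ker th1 th2 mu rho)) * ennreal (cmod (VT th1 a rho)))"
    by (simp only: norm_mult ennreal_mult'[OF v] ennreal_mult'[OF norm_ge_zero] mult.assoc)
   finally show "ennreal (?n * (vw mu * cmod (VT th2 a mu))) <= (NN rho. ennreal (vw mu * cmod (ker th1 th2 mu rho)) * ennreal (cmod (VT th1 a rho)))" .
  qed
  also have "... <= (NN rho. ennreal (M * vw rho) * ennreal (cmod (VT th1 a rho)))"
   by (rule schur_L1[OF th M(2)]) measurable
  also have "... = ennreal M * h1n th1 a"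
  proof -
   have "(NN rho. ennreal (M * (vw rho * cmod (VT th1 a rho)))) = ennreal M * h1n th1 a"
    unfolding h1n_def by (rule nn_integral_cmult_real) (use M in auto)
   then show ?thesis by (simp only: ennreal_mult'[OF v] ennreal_mult'[OF M(1)] mult.assoc)
  qed
  finally have le: "ennreal ?n * h1n th2 a <= ennreal M * h1n th1 a" .
  have e: "ennreal (1 / ?n) * (ennreal x * y) = ennreal (x / ?n) * y" if "0 <= x" for x y
   unfolding mult.assoc[symmetric] using n that by (subst ennreal_mult'[symmetric]) auto
  have "h1n th2 a = ennreal (1 / ?n) * (ennreal ?n * h1n th2 a)"
   using n by (subst e) auto
  also have "... <= ennreal (1 / ?n) * (ennreal M * h1n th1 a)" by (rule mult_left_mono[OF le]) simp
  also have "... = ennreal (M / ?n) * h1n th1 a" by (rule e[OF M(1)])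
  finally show "h1n th2 a <= ennreal (M / ?n) * h1n th1 a" .
 qed
qed

lemma H1_subset:
 assumes "adm th1" "adm th2" "th1 \<noteq> (%x. 0)"
 shows "H1_space D Ph cw th1 \<subseteq> H1_space D Ph cw th2"
proof
 fix f assume "f \<in> H1_space D Ph cw th1"
 then obtain a where a: "rep f a" "h1n th1 a < \<infinity>" using H1_space_obtain[OF assms(1)] by blast
 obtain C where "h1n th2 a <= ennreal C * h1n th1 a" using h1n_transfer[OF assms] a(1) by metis
 then have "h1n th2 a < \<infinity>" by (rule le_less_trans) (use a in \<open>simp add: ennreal_mult_less_top\<close>)
 then show "f \<in> H1_space D Ph cw th2" using H1_space_rep[OF assms(2) a(1)] by simp
qed

text \<open>A functional carries its domain, so equality of the two H^1_v spaces has to be settled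
  before the bounds are compared.\<close>

lemma antidual_subset:
 assumes th: "adm th1" "adm th2" "th1 \<noteq> (%x. 0)" "th2 \<noteq> (%x. 0)"
 shows "H1_antidual D Ph cw th1 \<subseteq> H1_antidual D Ph cw th2"
proof
 fix phi assume phi: "phi \<in> H1_antidual D Ph cw th1"
 have eq: "H1_space D Ph cw th2 = H1_space D Ph cw th1"
  using H1_subset[OF th(1,2,3)] H1_subset[OF th(2,1,4)] by auto
 obtain B where B: "\<And>f. f \<in> H1_space D Ph cw th1 ==> cmod (the (phi f)) <= B * enn2real (H1_enorm D Ph cw th1 f)"
  using phi unfolding H1_antidual_def by blast
 obtain C where C: "C \<ge> (0::real)" "\<And>f a. rep f a ==> h1n th1 a <= ennreal C * h1n th2 a"
  using h1n_transfer[OF th(2,1,4)] by blast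
 have "cmod (the (phi f)) <= (\<bar>B\<bar> * C) * enn2real (H1_enorm D Ph cw th2 f)" if f: "f \<in> H1_space D Ph cw th2" for f
 proof -
  obtain a where a: "rep f a" "h1n th2 a < \<infinity>" "H1_enorm D Ph cw th2 f = h1n th2 a" using H1_space_obtain[OF th(2) f] by blast
  have "enn2real (h1n th1 a) <= enn2real (ennreal C * h1n th2 a)"
   using C(2)[OF a(1)] a(2) by (intro enn2real_mono) (auto simp: ennreal_mult_less_top)
  then have le: "enn2real (h1n th1 a) <= C * enn2real (h1n th2 a)" using C(1) by (simp add: enn2real_mult)
  have "cmod (the (phi f)) <= B * enn2real (h1n th1 a)"
   using B[of f] f H1_enorm_rep[OF th(1) a(1)] by (simp add: eq)
  also have "... <= \<bar>B\<bar> * enn2real (h1n th1 a)" by (intro mult_right_mono) auto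
  also have "... <= \<bar>B\<bar> * (C * enn2real (h1n th2 a))" by (intro mult_left_mono le) simp
  finally show ?thesis by (simp add: a(3) mult.assoc)
 qed
 then show "phi \<in> H1_antidual D Ph cw th2" using phi by (auto simp: H1_antidual_def eq)
qed

end

section \<open>Cutting off tails and sampling with finite range\<close>

lemma nn_integral_tail:
 fixes T :: "'a::euclidean_space => ennreal" and C :: "nat => 'a set"
 assumes [measurable]: "T \<in> Borel" "\<And>n. C n \<in> sets borel"
  and fin: "(NN x. T x) < \<infinity>" and inc: "incseq C" and zero: "\<And>x. x \<notin> (\<Union>n. C n) ==> T x = 0"
 shows "(%n. NN x. indicator (- C n) x * T x) ~~> 0"
proof -
 have "(%n. NN x. indicator (- C n) x * T x) ~~> (\<integral>\<^sup>+x. 0 \<partial>(lborel :: 'a measure))"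
 proof (rule nn_integral_dominated_convergence[where w=T])
  show "AE x in lborel. (%n. indicator (- C n) x * T x) ~~> 0"
  proof (rule AE_I2)
   fix x
   show "(%n. indicator (- C n) x * T x) ~~> 0"
   proof (cases "x \<in> (\<Union>n. C n)")
    case True
    then obtain m where m: "x \<in> C m" by blast
    have "\<forall>\<^sub>F n in sequentially. indicator (- C n) x * T x = 0"
     using eventually_ge_at_top[of m] by eventually_elim (use m incseqD[OF inc] in \<open>auto simp: indicator_def\<close>)
    then show ?thesis by (rule tendsto_eventually)
   qed (simp add: zero)
  qed
 qed (use fin in \<open>auto simp: indicator_def\<close>)
 then show ?thesis by simp
qed

text \<open>A bounded image is totally bounded. Each point is sent to the first ball of a finite
  cover that contains its image, and from there to a fixed point of \<open>S\<close> with image in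
  the same ball. Passing through an index makes \<open>s\<close> measurable into the discrete space
  for merely measurable \<open>h\<close>, and the values stay in \<open>S\<close>.\<close>

lemma finite_range_approximation:
 fixes h :: "'a => 'b::euclidean_space"
 assumes [measurable]: "h \<in> borel_measurable M" and bd: "bounded (h ` S)" and e: "0 < e"
 obtains s where "s \<in> M \<rightarrow>\<^sub>M count_space UNIV" "finite (s ` S)" "s ` S \<subseteq> S" "\<And>x. x \<in> S ==> dist (h (s x)) (h x) < e"
proof -
 have "compact (closure (h ` S))" using bd by (simp add: compact_closure)
 then obtain k where k: "finite k" "closure (h ` S) \<subseteq> (\<Union>x\<in>k. ball x (e / 2))"
  using e unfolding compact_eq_totally_bounded by (meson half_gt_zero)
 obtain cs where cs: "set cs = k" using finite_list[OF k(1)] by blast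
 define i where "i x = (LEAST n. h x \<in> ball (cs ! n) (e / 2))" for x
 define q where "q n = (SOME x. x \<in> S \<and> h x \<in> ball (cs ! n) (e / 2))" for n
 have i: "h x \<in> ball (cs ! i x) (e / 2)" "i x < length cs" if x: "x \<in> S" for x
 proof -
  obtain n where n: "n < length cs" "h x \<in> ball (cs ! n) (e / 2)"
   using k(2) closure_subset[of "h ` S"] x cs by (force simp: in_set_conv_nth)
  show "h x \<in> ball (cs ! i x) (e / 2)" unfolding i_def by (rule LeastI[of "%n. h x \<in> ball (cs ! n) (e / 2)", OF n(2)])
  have "i x <= n" unfolding i_def by (rule Least_le[of "%n. h x \<in> ball (cs ! n) (e / 2)", OF n(2)])
  then show "i x < length cs" using n(1) by simp
 qed
 have q: "q (i x) \<in> S" "h (q (i x)) \<in> ball (cs ! i x) (e / 2)" if x: "x \<in> S" for x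
  using someI[of "%z. z \<in> S \<and> h z \<in> ball (cs ! i x) (e / 2)" x] x i[OF x] by (auto simp: q_def)
 show thesis
 proof (rule that[of "%x. q (i x)"])
  have "i \<in> M \<rightarrow>\<^sub>M count_space UNIV"
   unfolding i_def[abs_def] mem_ball by measurable
  then show "(%x. q (i x)) \<in> M \<rightarrow>\<^sub>M count_space UNIV"
   by (rule measurable_compose) simp
  have "(%x. q (i x)) ` S \<subseteq> q ` {..<length cs}" using i by auto
  then show "finite ((%x. q (i x)) ` S)" by (rule finite_subset) simp
  show "(%x. q (i x)) ` S \<subseteq> S" using q by auto
  show "dist (h (q (i x))) (h x) < e" if "x \<in> S" for x
   using i(1)[OF that] q(2)[OF that] dist_triangle_half_r[of "cs ! i x"] by auto
 qed
qed

lemma integral_finite_range: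
 fixes F :: "'a => complex"
 assumes [measurable]: "s \<in> M \<rightarrow>\<^sub>M count_space UNIV" "S \<in> sets M" and fin: "finite (s ` S)" and F: "integrable M F"
 shows "(LINT x|M. indicator S x *\<^sub>R (k (s x) * F x)) = (\<Sum>y\<in>s ` S. k y * (LINT x|M. indicator {x \<in> S. s x = y} x *\<^sub>R F x))"
proof -
 have st: "{x \<in> S. s x = y} \<in> sets M" for y
 proof -
  have "{x \<in> S. s x = y} = S \<inter> (s -` {y} \<inter> space M)" using sets.sets_into_space[OF assms(2)] by auto
  also have "... \<in> sets M" by (intro sets.Int assms measurable_sets[OF assms(1)]) auto
  finally show ?thesis .
 qed
 have i: "integrable M (%x. indicator {x \<in> S. s x = y} x *\<^sub>R F x)" for y
  by (rule integrable_mult_indicator[OF st F])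
 have "(LINT x|M. indicator S x *\<^sub>R (k (s x) * F x)) = (LINT x|M. (\<Sum>y\<in>s ` S. k y * (indicator {x \<in> S. s x = y} x *\<^sub>R F x)))"
 proof (rule integral_eqI[OF refl])
  fix x
  show "indicator S x *\<^sub>R (k (s x) * F x) = (\<Sum>y\<in>s ` S. k y * (indicator {x \<in> S. s x = y} x *\<^sub>R F x))"
  proof (cases "x \<in> S")
   case True
   have "(\<Sum>y\<in>s ` S. k y * (indicator {x \<in> S. s x = y} x *\<^sub>R F x)) = (\<Sum>y\<in>s ` S. if y = s x then k y * F x else 0)"
    by (intro sum.cong) (auto simp: indicator_def True)
   then show ?thesis using True fin by simp
  qed simp
 qed
 also have "... = (\<Sum>y\<in>s ` S. k y * (LINT x|M. indicator {x \<in> S. s x = y} x *\<^sub>R F x))"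
  by (subst Bochner_Integration.integral_sum[OF integrable_mult_right[OF i]]) (simp del: mult_scaleR_right)
 finally show ?thesis .
qed

context coorbit_setting
begin

lemma atom_H1:
 assumes th: "adm th1" "adm th2"
 obtains M where "M \<ge> (0::real)" "\<And>mu. mu \<in> Lam ==> warped_atom D Ph th2 mu \<in> H1_space D Ph cw th1"
  "\<And>mu. mu \<in> Lam ==> enn2real (H1_enorm D Ph cw th1 (warped_atom D Ph th2 mu)) <= M * vw mu"
proof -
 obtain M where M: "M \<ge> 0" "\<And>mu. (NN rho. ennreal (vw rho * cmod (ker th1 th2 mu rho))) <= ennreal (M * vw mu)"
  by (rule ker_integrals[OF th]) (rule that)
 have le: "h1n th1 (fat th2 mu) <= ennreal (M * vw mu)" if "mu \<in> Lam" for mu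
  using M(2)[of mu] by (simp add: h1n_def VT_fat[OF th that])
 show thesis
 proof (rule that[OF M(1)])
  fix mu assume mu: "mu \<in> Lam"
  show "warped_atom D Ph th2 mu \<in> H1_space D Ph cw th1"
   unfolding H1_space_rep[OF th(1) rep_atom[OF th(2)]] using le[OF mu] by (rule le_less_trans) simp
  have "0 <= M * vw mu" using M(1) vw_ge_1[of mu] by simp
  then show "enn2real (H1_enorm D Ph cw th1 (warped_atom D Ph th2 mu)) <= M * vw mu"
   unfolding H1_enorm_rep[OF th(1) rep_atom[OF th(2)]] using enn2real_mono[OF le[OF mu]] by simp
 qed
qed

lemma antidual_linear:
 assumes th: "adm th" and psi: "psi \<in> H1_antidual D Ph cw th" and f: "f \<in> H1_space D Ph cw th" and g: "g \<in> H1_space D Ph cw th"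
 shows "the (psi (%x. f x + c * g x)) = the (psi f) + cnj c * the (psi g)"
proof -
 \<comment> \<open>The zero element is obtained as a difference, since \<open>H1_linear\<close>
   provides sums f + c g; it leads to the scalar multiples, which the definition of the antidual
   treats separately.\<close>
 have z: "(%x. g x + (-1) * g x) \<in> H1_space D Ph cw th" by (rule H1_linear[OF th g g])
 have "(%x. (g x + (-1) * g x) + c * g x) \<in> H1_space D Ph cw th" by (rule H1_linear[OF th z g])
 then have "(%x. c * g x) \<in> H1_space D Ph cw th" by simp
 then show ?thesis using psi f g by (simp add: H1_antidual_def)
qed

lemma antidual_sum:
 assumes th: "adm th" and psi: "psi \<in> H1_antidual D Ph cw th" and fin: "finite P" and P: "P \<subseteq> Lam"
 shows "rep (%x. \<Sum>y\<in>P. c y * warped_atom D Ph th y x) (%xi. \<Sum>y\<in>P. c y * fat th y xi) \<and>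
  (%x. \<Sum>y\<in>P. c y * warped_atom D Ph th y x) \<in> H1_space D Ph cw th \<and>
  the (psi (%x. \<Sum>y\<in>P. c y * warped_atom D Ph th y x)) = (\<Sum>y\<in>P. cnj (c y) * voice_ext D Ph th psi y) \<and>
  (\<forall>mu. VT th (%xi. \<Sum>y\<in>P. c y * fat th y xi) mu = (\<Sum>y\<in>P. c y * ker th th mu y))"
 using fin P
proof (induction P)
 case empty
 \<comment> \<open>The empty sum is the zero function, represented as an atom minus itself.\<close>
 let ?g = "warped_atom D Ph th nu" and ?b = "fat th nu"
 have g: "?g \<in> H1_space D Ph cw th" using atom_H1[OF th th] nu by blast
 have r: "rep ?g ?b" by (rule rep_atom[OF th])
 have sb: "sq_int ?b" using r by (simp add: rep_def)
 show ?case
  using rep_linear[OF r r, of "-1"] H1_linear[OF th g g, of "-1"] antidual_linear[OF th psi g g, of "-1"] VT_linear[OF th sb sb, of "-1"]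
  by simp
next
 case (insert z P)
 let ?f = "%x. \<Sum>y\<in>P. c y * warped_atom D Ph th y x" and ?a = "%xi. \<Sum>y\<in>P. c y * fat th y xi"
 have z: "z \<in> Lam" using insert by simp
 have IH: "rep ?f ?a" "?f \<in> H1_space D Ph cw th" "the (psi ?f) = (\<Sum>y\<in>P. cnj (c y) * voice_ext D Ph th psi y)"
  "\<And>mu. VT th ?a mu = (\<Sum>y\<in>P. c y * ker th th mu y)" using insert by auto
 have g: "warped_atom D Ph th z \<in> H1_space D Ph cw th" using atom_H1[OF th th] z by blast
 have r: "rep (warped_atom D Ph th z) (fat th z)" by (rule rep_atom[OF th])
 have s: "sq_int ?a" "sq_int (fat th z)" using IH(1) r by (simp_all add: rep_def)
 have "VT th (fat th z) mu = ker th th mu z" for mu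
  by (simp add: VT_fat[OF th th z] ker_cnj[of th th mu z])
 then show ?case
  using insert(1,2) rep_linear[OF IH(1) r, of "c z"] H1_linear[OF th IH(2) g, of "c z"] antidual_linear[OF th psi IH(2) g, of "c z"]
   VT_linear[OF th s, of "c z"] IH(3,4) by (simp add: add.commute voice_ext_def)
qed

lemma compact_exhaustion:
 obtains Q where "\<And>n::nat. compact (Q n)" "\<And>n. Q n \<subseteq> Lam" "incseq Q" "(\<Union>n. Q n) = Lam"
proof -
 obtain Q where Q: "\<And>n::nat. compact (Q n)" "\<And>n. Q n \<subseteq> Lam" "\<And>n. Q n \<subseteq> interior (Q (Suc n))" "\<Union> (range Q) = Lam"
  using open_Union_compact_subsets[OF open_phase] by metis
 have "incseq Q" by (rule incseq_SucI) (use Q(3) interior_subset in blast)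
 then show thesis using Q by (intro that[of Q]) auto
qed

section \<open>Sampling the reproducing formula\<close>

text \<open>The same sample points have to serve twice: for the kernel, in the norm of H^1_v, and
  for \<open>G\<close>, which is merely Borel and controlled only off the null set \<open>Z\<close>.
  The kernel is uniformly continuous on compact sets; \<open>G\<close> and the tails of the kernel
  are handled by finite-range approximation.\<close>

lemma riemann_estimate:
 assumes th: "adm th" and psi: "psi \<in> H1_antidual D Ph cw th" and r: "rep f a" and fin: "h1n th a < \<infinity>"
  and G [measurable]: "G \<in> Borel" and Z: "Z \<in> null_sets lborel"
  and B: "0 <= B" "\<And>rho. rho \<in> Lam - Z ==> cmod (G rho) <= B * vw rho" and eps: "0 < eps"
  and M: "M \<ge> 0" "\<And>rho. (NN mu. ennreal (vw mu * cmod (ker th th mu rho))) <= ennreal (M * vw rho)"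
 obtains P c where "finite P" "P \<subseteq> Lam - Z"
  "h1n th (%xi. (\<Sum>y\<in>P. c y * fat th y xi) + (- cx (nrm th)) * a xi) <= ennreal ((3 + M) * eps)"
  "cmod ((\<Sum>y\<in>P. cnj (c y) * G y) - (LB rho. cnj (VT th a rho) * G rho)) <= (1 + B) * eps"
proof -
 have a: "sq_int a" "\<forall>xi. xi \<notin> D --> a xi = 0" using r by (auto simp: rep_def)
 define F where "F = VT th a"
 define K where "K = ker th th"
 define W where "W mu rho = ennreal (vw mu * cmod (K mu rho))" for mu rho
 have [measurable]: "F \<in> Borel" unfolding F_def by (rule VT_measurable[OF th a(1)])
 have Ks [measurable]: "K mu \<in> Borel" "(%mu. K mu rho) \<in> Borel" for mu rho
  unfolding K_def using wker_sections[OF th th] by auto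
 have Kp [measurable]: "(%x. K (fst x) (snd x)) \<in> Borel2"
  unfolding borel_prod K_def using measurable_ker[OF th th] by (simp add: case_prod_beta')
 have Kp' [measurable]: "(%x. K (snd x) (fst x)) \<in> Borel2"
  using measurable_compose[OF measurable_Pair[OF measurable_snd measurable_fst] Kp] by simp
 have Wm [measurable]: "(%mu. W mu rho) \<in> Borel" for rho unfolding W_def by measurable
 have v: "0 <= vw x" "1 <= vw x" for x using vw_ge_1[of x] by auto
 have F0: "F rho = 0" if "rho \<notin> Lam" for rho using that by (simp add: F_def VT_outside[OF th])
 have WM: "(NN mu. W mu rho) <= ennreal (M * vw rho)" for rho unfolding W_def K_def by (rule M(2))
 have vF: "integrable lborel (%rho. vw rho * cmod (F rho))"
  using fin v by (intro integrableI_nonneg) (auto simp: h1n_def F_def[symmetric])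
 have Fint: "integrable lborel F"
 proof (rule integrable_bd[OF vF])
  show "AE rho in lborel. norm (F rho) <= norm (vw rho * cmod (F rho))"
   using mult_right_mono[OF v(2), of "cmod (F _)"] v(1) by (intro AE_I2) (simp add: abs_mult)
 qed simp
 define A where "A = enn2real (NN rho. ennreal (cmod (F rho)))"
 have A: "(NN rho. ennreal (cmod (F rho))) = ennreal A" "0 <= A"
  using Fint by (auto simp: A_def integrable_iff_bounded)
 obtain Q where Q: "\<And>n::nat. compact (Q n)" "\<And>n. Q n \<subseteq> Lam" "incseq Q" "(\<Union>n. Q n) = Lam" by (rule compact_exhaustion) blast
 have Qb [measurable]: "Q n \<in> sets borel" for n using Q(1) by (simp add: compact_imp_closed)
 have M_vF: "(NN rho. ennreal (M * vw rho) * ennreal (cmod (F rho))) = ennreal M * h1n th a"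
 proof -
  have "(NN rho. ennreal (M * (vw rho * cmod (F rho)))) = ennreal M * h1n th a"
   unfolding h1n_def F_def[symmetric] by (rule nn_integral_cmult_real) (use M in auto)
  then show ?thesis using M(1) v by (simp only: ennreal_mult' mult.assoc)
 qed
 have t_le: "(NN mu. indicator (- Q n) mu * W mu rho) <= ennreal (M * vw rho)" for n rho
  by (rule order_trans[OF nn_integral_mono WM]) (auto simp: indicator_def)
 have t_meas [measurable]: "(%rho. NN mu. indicator (- Q n) mu * W mu rho) \<in> Borel" for n
  unfolding W_def by measurable
 have "(%n. NN rho. (NN mu. indicator (- Q n) mu * W mu rho) * ennreal (cmod (F rho))) ~~> (NN (rho::'d phase). 0)"
 proof (rule nn_integral_dominated_convergence[where w="%rho. ennreal (M * vw rho) * ennreal (cmod (F rho))"])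
  show "(NN rho. ennreal (M * vw rho) * ennreal (cmod (F rho))) < \<infinity>"
   using fin by (simp add: M_vF ennreal_mult_less_top)
  show "AE rho in lborel. (NN mu. indicator (- Q n) mu * W mu rho) * ennreal (cmod (F rho)) <= ennreal (M * vw rho) * ennreal (cmod (F rho))" for n
   by (intro AE_I2 mult_right_mono t_le) simp
  show "AE rho in lborel. (%n. (NN mu. indicator (- Q n) mu * W mu rho) * ennreal (cmod (F rho))) ~~> 0"
  proof (rule AE_I2)
   fix rho
   have "(%n. NN mu. indicator (- Q n) mu * W mu rho) ~~> 0"
    by (rule nn_integral_tail[OF Wm Qb le_less_trans[OF WM] Q(3)]) (auto simp: Q(4) W_def K_def ker_outside)
   from ennreal_tendsto_cmult[OF _ this, of "ennreal (cmod (F rho))"]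
   show "(%n. (NN mu. indicator (- Q n) mu * W mu rho) * ennreal (cmod (F rho))) ~~> 0" by (simp add: mult.commute)
  qed
 qed measurable
 then have l1: "(%n. NN rho. (NN mu. indicator (- Q n) mu * W mu rho) * ennreal (cmod (F rho))) ~~> 0" by simp
 have l2: "(%n. NN rho. indicator (- Q n) rho * ennreal (vw rho * cmod (F rho))) ~~> 0"
 proof (rule nn_integral_tail[OF _ Qb _ Q(3)])
  show "(NN rho. ennreal (vw rho * cmod (F rho))) < \<infinity>" using fin by (simp add: h1n_def F_def)
 qed (use Q(4) F0 in auto)
 have "\<forall>\<^sub>F n in sequentially. (NN rho. (NN mu. indicator (- Q n) mu * W mu rho) * ennreal (cmod (F rho))) < ennreal eps \<and>
   (NN rho. indicator (- Q n) rho * ennreal (vw rho * cmod (F rho))) < ennreal eps"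
  using l1 l2 eps unfolding ennreal_tendsto_0_iff by (intro eventually_conj) auto
 then obtain n0 where n0: "(NN rho. (NN mu. indicator (- Q n0) mu * W mu rho) * ennreal (cmod (F rho))) < ennreal eps"
   "(NN rho. indicator (- Q n0) rho * ennreal (vw rho * cmod (F rho))) < ennreal eps"
  using eventually_happens'[OF sequentially_bot] by blast
 \<comment> \<open>One compact set makes two tails small: the mass that the kernel sends out of
   \<open>q\<close>, integrated against |F|, and the weighted mass of \<open>F\<close> itself
   outside \<open>q\<close>.\<close>
 define q where "q = Q n0"
 \<comment> \<open>The weighted mass outside \<open>q\<close> of the kernel column at
   \<open>rho\<close>. The Schur bound makes it finite, so \<open>t\<close> is a real function that
   can be sampled.\<close>
 define t' where "t' rho = (NN mu. indicator (- q) mu * W mu rho)" for rho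
 define t where "t rho = enn2real (t' rho)" for rho
 note tail = n0[folded q_def, folded t'_def]
 have q: "compact q" "q \<subseteq> Lam" and qb [measurable]: "q \<in> sets borel" using Q Qb by (auto simp: q_def)
 have t'm [measurable]: "t' \<in> Borel" using t_meas[of n0] by (simp add: t'_def[abs_def] q_def)
 have tm [measurable]: "t \<in> Borel" unfolding t_def[abs_def] by measurable
 have t: "t' rho = ennreal (t rho)" "0 <= t rho" "t rho <= M * vw rho" for rho
 proof -
  have le: "t' rho <= ennreal (M * vw rho)" unfolding t'_def q_def by (rule t_le)
  then have "t' rho < \<infinity>" by (rule le_less_trans) simp
  then show "t' rho = ennreal (t rho)" by (simp add: t_def)
  show "0 <= t rho" by (simp add: t_def)
  show "t rho <= M * vw rho" using enn2real_mono[OF le] M(1) v by (simp add: t_def)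
 qed
 obtain b where b: "\<And>x. x \<in> q ==> vw x <= b" "0 <= b"
 proof -
  have "bounded (vw ` q)"
   by (intro compact_imp_bounded compact_continuous_image continuous_on_subset[OF continuous_vw]) (use q in auto)
  then obtain b where "\<forall>x\<in>q. norm (vw x) <= b" by (auto simp: bounded_iff)
  then show thesis using that[of "max b 0"] by fastforce
 qed
 define vol where "vol = enn2real (emeasure lborel q)"
 have vol: "emeasure lborel q = ennreal vol" "0 <= vol"
  using emeasure_bounded_finite[OF compact_imp_bounded[OF q(1)]] by (auto simp: vol_def)
 \<comment> \<open>Small enough that an error of (b eta vol + eta) |F| stays below
   \<open>eps\<close> after integration; \<open>b\<close> bounds the weight on \<open>q\<close> and
   \<open>vol\<close> is the measure of \<open>q\<close>.\<close>
 define eta where "eta = eps / ((A + 1) * (b * vol + 1))"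
 have eta: "0 < eta" "eta * A <= eps" "(b * eta * vol + eta) * A <= eps"
 proof -
  have p: "0 < A + 1" "0 < b * vol + 1" using A b vol by (auto intro: add_nonneg_pos)
  then show eta0: "0 < eta" using eps by (simp add: eta_def)
  have e: "eta * ((A + 1) * (b * vol + 1)) = eps" using p by (simp add: eta_def)
  have "A * (b * vol + 1) <= (A + 1) * (b * vol + 1)" using p by (intro mult_right_mono) auto
  then show 2: "(b * eta * vol + eta) * A <= eps" using mult_left_mono[of "A * (b * vol + 1)" "(A + 1) * (b * vol + 1)" eta] eta0 e by (simp add: algebra_simps)
  have "eta * A <= (b * eta * vol + eta) * A" using A b vol eta0 by (intro mult_right_mono) auto
  then show "eta * A <= eps" using 2 by simp
 qed
 obtain \<delta> where \<delta>: "0 < \<delta>" "\<And>mu rho rho'. mu \<in> q ==> rho \<in> q ==> rho' \<in> q ==> dist rho' rho < \<delta> ==> cmod (K mu rho' - K mu rho) < eta"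
 proof -
  have "uniformly_continuous_on (q \<times> q) (%(mu, rho). K mu rho)"
   unfolding K_def by (intro compact_uniformly_continuous continuous_on_subset[OF continuous_ker[OF th th]] compact_Times) (use q in auto)
  then obtain d where d: "0 < d" "\<forall>x\<in>q \<times> q. \<forall>x'\<in>q \<times> q. dist x' x < d --> dist (case x' of (mu, rho) => K mu rho) (case x of (mu, rho) => K mu rho) < eta"
   unfolding uniformly_continuous_on_def using eta(1) by blast
  have "cmod (K mu rho' - K mu rho) < eta" if "mu \<in> q" "rho \<in> q" "rho' \<in> q" "dist rho' rho < d" for mu rho rho'
   using d(2)[rule_format, of "(mu, rho)" "(mu, rho')"] that by (simp add: dist_Pair_Pair dist_norm)
  then show thesis using d(1) that by blast
 qed
 define S where "S = q - Z"
 have Zb [measurable]: "Z \<in> sets borel" using Z by auto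
 have Sb [measurable]: "S \<in> sets borel" by (simp add: S_def)
 \<comment> \<open>Approximating \<open>h\<close> keeps position, \<open>G\<close> and the tail
   close at once. The tail has to be recorded because it also occurs at the sample point, where it
   must be compared with its value at \<open>rho\<close>.\<close>
 define h where "h rho = (rho, G rho, t rho)" for rho :: "'d phase"
 have "bounded (h ` S)"
 proof (rule bounded_subset)
  show "bounded (q \<times> (cball 0 (B * b) \<times> cball 0 (M * b)))"
   by (intro bounded_Times bounded_cball compact_imp_bounded[OF q(1)])
  have "cmod (G rho) <= B * b \<and> \<bar>t rho\<bar> <= M * b" if "rho \<in> S" for rho
  proof -
   have rho: "rho \<in> q" "rho \<in> Lam - Z" using that q(2) by (auto simp: S_def)
   show ?thesis
    using order_trans[OF B(2)[OF rho(2)] mult_left_mono[OF b(1)[OF rho(1)] B(1)]] order_trans[OF t(3) mult_left_mono[OF b(1)[OF rho(1)] M(1)]] t(2) by simp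
  qed
  then show "h ` S \<subseteq> q \<times> (cball 0 (B * b) \<times> cball 0 (M * b))" by (auto simp: h_def S_def dist_norm)
 qed
 moreover have "h \<in> Borel" unfolding h_def[abs_def] by measurable
 moreover have "0 < min \<delta> eta" using \<delta> eta by simp
 ultimately obtain s where s [measurable]: "s \<in> borel \<rightarrow>\<^sub>M count_space UNIV" and sS: "finite (s ` S)" "s ` S \<subseteq> S"
  and sd: "\<And>x. x \<in> S ==> dist (h (s x)) (h x) < min \<delta> eta"
  using finite_range_approximation[of h borel S] by blast
 have sds: "dist (s x) x < \<delta>" "cmod (G (s x) - G x) < eta" "t (s x) <= t x + eta" "s x \<in> q" "x \<in> q" if x: "x \<in> S" for x
 proof -
  have "dist (s x) x <= dist (h (s x)) (h x)" using dist_fst_le[of "h (s x)" "h x"] by (simp add: h_def)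
  then show "dist (s x) x < \<delta>" using sd[OF x] by simp
  have "dist (G (s x)) (G x) <= dist (snd (h (s x))) (snd (h x))" using dist_fst_le[of "snd (h (s x))" "snd (h x)"] by (simp add: h_def)
  then show "cmod (G (s x) - G x) < eta" using sd[OF x] dist_snd_le[of "h (s x)" "h x"] by (simp add: dist_norm)
  have "dist (t (s x)) (t x) <= dist (snd (h (s x))) (snd (h x))" using dist_snd_le[of "snd (h (s x))" "snd (h x)"] by (simp add: h_def)
  then have "\<bar>t (s x) - t x\<bar> < eta" using sd[OF x] dist_snd_le[of "h (s x)" "h x"] unfolding dist_real_def[symmetric] by simp
  then show "t (s x) <= t x + eta" by linarith
  show "s x \<in> q" "x \<in> q" using sS(2) x by (auto simp: S_def)
 qed
 \<comment> \<open>The coefficient of a sample point is the integral of the voice transform over its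
   cell.\<close>
 define c where "c y = (LB rho. indicator {rho \<in> S. s rho = y} rho *\<^sub>R F rho)" for y
 have P: "s ` S \<subseteq> Lam - Z" using sS(2) q(2) by (auto simp: S_def)
 have s': "s \<in> lborel \<rightarrow>\<^sub>M count_space UNIV" "S \<in> sets lborel" using s by simp_all
 have si: "integrable lborel (%rho. indicator S rho *\<^sub>R (k (s rho) * F rho))" for k
 proof (rule integrable_bd)
  show "integrable lborel (%rho. (\<Sum>y\<in>s ` S. cmod (k y)) * norm (F rho))" using Fint by (intro integrable_mult_right integrable_norm)
  have "(%rho. k (s rho)) \<in> Borel" by (rule measurable_compose[OF s]) simp
  then show "(%rho. indicator S rho *\<^sub>R (k (s rho) * F rho)) \<in> borel_measurable lborel" by measurable
  show "AE rho in lborel. norm (indicator S rho *\<^sub>R (k (s rho) * F rho)) <= norm ((\<Sum>y\<in>s ` S. cmod (k y)) * norm (F rho))"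
  proof (rule AE_I2)
   fix rho
   have "cmod (k (s rho)) <= (\<Sum>y\<in>s ` S. cmod (k y))" if "rho \<in> S" using that sS(1) by (intro member_le_sum) auto
   then show "norm (indicator S rho *\<^sub>R (k (s rho) * F rho)) <= norm ((\<Sum>y\<in>s ` S. cmod (k y)) * norm (F rho))"
    by (auto simp: indicator_def norm_mult sum_nonneg intro!: mult_right_mono)
  qed
 qed
 have as: "rep (%x. \<Sum>y\<in>s ` S. c y * warped_atom D Ph th y x) (%xi. \<Sum>y\<in>s ` S. c y * fat th y xi)"
  "\<And>mu. VT th (%xi. \<Sum>y\<in>s ` S. c y * fat th y xi) mu = (\<Sum>y\<in>s ` S. c y * K mu y)"
  using antidual_sum[OF th psi sS(1), of c] P by (auto simp: K_def)
 define g where "g xi = (\<Sum>y\<in>s ` S. c y * fat th y xi) + (- cx (nrm th)) * a xi" for xi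
 define R where "R mu rho = indicator S rho *\<^sub>R (K mu (s rho) * F rho) - K mu rho * F rho" for mu rho
 have KF: "integrable lborel (%rho. K mu rho * F rho)" for mu
  unfolding K_def F_def by (rule reproduce(1)[OF th th a])
 have VTg: "VT th g mu = (LB rho. R mu rho)" for mu
 proof -
  have "VT th g mu = (\<Sum>y\<in>s ` S. c y * K mu y) + (- cx (nrm th)) * VT th a mu"
   unfolding g_def[abs_def] using as a(1) by (subst VT_linear[OF th]) (auto simp: rep_def)
  also have "(\<Sum>y\<in>s ` S. c y * K mu y) = (LB rho. indicator S rho *\<^sub>R (K mu (s rho) * F rho))"
   using integral_finite_range[OF s' sS(1) Fint, of "K mu"] by (simp add: c_def mult.commute)
  also have "(- cx (nrm th)) * VT th a mu = - (LB rho. K mu rho * F rho)"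
   unfolding K_def F_def by (simp add: reproduce(2)[OF th th a])
  finally show ?thesis unfolding R_def using Bochner_Integration.integral_diff[OF si KF] by simp
 qed
 have Ri: "integrable lborel (R mu)" for mu unfolding R_def[abs_def] by (intro integrable_sub si KF)
 have Rm: "(%x. R (fst x) (snd x)) \<in> Borel2"
 proof -
  have "s \<in> Borel" by (rule measurable_compose[OF s, of "%x. x", simplified]) simp
  then have "(%x. (fst x, s (snd x))) \<in> borel \<Otimes>\<^sub>M borel \<rightarrow>\<^sub>M (borel :: 'd phase measure) \<Otimes>\<^sub>M borel" by measurable
  note [measurable] = measurable_compose[OF this Kp, simplified]
  show ?thesis unfolding R_def by measurable
 qed
 \<comment> \<open>Error budget at \<open>rho\<close>: uniform continuity for mu in
   \<open>q\<close>, the kernel tails at \<open>rho\<close> and at its sample for mu outside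
   \<open>q\<close> (the additional \<open>eta\<close> compares the two), and the whole column when
   \<open>rho\<close> lies outside \<open>q\<close>. After integration these give eps, 2 eps and M
   eps.\<close>
 define U where "U rho = ennreal (b * eta * vol + eta) * ennreal (cmod (F rho)) + 2 * (t' rho * ennreal (cmod (F rho))) +
  ennreal M * (indicator (- q) rho * ennreal (vw rho * cmod (F rho)))" for rho
 have R_le: "(NN mu. ennreal (vw mu * cmod (R mu rho))) <= U rho" if rho: "rho \<notin> Z" for rho
 proof (cases "rho \<in> S")
  case True
  have pt: "ennreal (vw mu * cmod (K mu (s rho) - K mu rho)) \<le>
   ennreal (b * eta) * indicator q mu + (indicator (- q) mu * W mu (s rho) + indicator (- q) mu * W mu rho)" for mu
  proof (cases "mu \<in> q")
   case mu: True
   have "vw mu * cmod (K mu (s rho) - K mu rho) <= b * eta"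
    using b(1)[OF mu] v \<delta>(2)[OF mu sds(5)[OF True] sds(4)[OF True] sds(1)[OF True]] b(2) by (intro mult_mono) auto
   then show ?thesis using mu by (simp add: ennreal_leI)
  next
   case False
   have "vw mu * cmod (K mu (s rho) - K mu rho) <= vw mu * (cmod (K mu (s rho)) + cmod (K mu rho))"
    using v by (intro mult_left_mono norm_triangle_ineq4)
   then show ?thesis using False v by (simp add: W_def ennreal_plus[symmetric] ennreal_leI distrib_left del: ennreal_plus)
  qed
  have "R mu rho = (K mu (s rho) - K mu rho) * F rho" for mu using True by (simp add: R_def algebra_simps)
  then have "(NN mu. ennreal (vw mu * cmod (R mu rho))) = (NN mu. ennreal (vw mu * cmod (K mu (s rho) - K mu rho)) * ennreal (cmod (F rho)))"
   using v by (simp add: norm_mult ennreal_mult'[symmetric] mult.assoc)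
  also have "... = (NN mu. ennreal (vw mu * cmod (K mu (s rho) - K mu rho))) * ennreal (cmod (F rho))"
   by (rule nn_integral_multc) measurable
  also have "... <= (NN mu. ennreal (b * eta) * indicator q mu + (indicator (- q) mu * W mu (s rho) + indicator (- q) mu * W mu rho)) * ennreal (cmod (F rho))"
   by (intro mult_right_mono nn_integral_mono pt) simp
  also have "... = (ennreal (b * eta) * ennreal vol + (t' (s rho) + t' rho)) * ennreal (cmod (F rho))"
   by (simp add: nn_integral_add nn_integral_cmult_indicator vol(1) t'_def)
  also have "... <= (ennreal (b * eta * vol + eta) + 2 * t' rho) * ennreal (cmod (F rho))"
  proof (rule mult_right_mono)
   have "t' (s rho) <= t' rho + ennreal eta"
    using ennreal_leI[OF sds(3)[OF True]] eta(1) t(2)[of rho] by (simp add: t(1)[of rho] t(1)[of "s rho"])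
   from add_right_mono[OF this, of "t' rho"] add_left_mono[OF this, of "ennreal (b * eta * vol) + t' rho"]
   show "ennreal (b * eta) * ennreal vol + (t' (s rho) + t' rho) <= ennreal (b * eta * vol + eta) + 2 * t' rho"
    using b(2) eta(1) vol(2) by (simp add: ennreal_mult'[symmetric] mult_2 add_ac)
  qed simp
  also have "... <= U rho" by (simp add: U_def distrib_right mult.assoc)
  finally show ?thesis .
 next
  case False
  then have nq: "rho \<notin> q" using rho by (simp add: S_def)
  have "(NN mu. ennreal (vw mu * cmod (R mu rho))) = (NN mu. W mu rho * ennreal (cmod (F rho)))"
   using False v by (simp add: R_def W_def norm_mult ennreal_mult'[symmetric] mult.assoc)
  also have "... = (NN mu. W mu rho) * ennreal (cmod (F rho))" by (rule nn_integral_multc) measurable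
  also have "... <= ennreal (M * vw rho) * ennreal (cmod (F rho))" by (intro mult_right_mono WM) simp
  also have "... = ennreal M * ennreal (vw rho * cmod (F rho))" using M(1) v by (simp add: ennreal_mult'[symmetric] mult.assoc)
  also have "... <= U rho" using nq by (simp add: U_def)
  finally show ?thesis .
 qed
 have AEZ: "AE rho in lborel. rho \<notin> Z" by (rule AE_not_in[OF Z])
 have "h1n th g <= (NN mu. NN rho. ennreal (vw mu * cmod (R mu rho)))"
  unfolding h1n_def
 proof (rule nn_integral_mono)
  fix mu
  have "ennreal (vw mu * cmod (VT th g mu)) = ennreal (vw mu) * ennreal (cmod (LB rho. R mu rho))"
   unfolding VTg using v by (simp add: ennreal_mult')
  also have "... <= ennreal (vw mu) * (NN rho. ennreal (cmod (R mu rho)))"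
   by (rule mult_left_mono[OF integral_norm_bound_ennreal[OF Ri]]) simp
  also have "... = (NN rho. ennreal (vw mu * cmod (R mu rho)))"
   by (rule nn_integral_cmult_real[symmetric]) (use v integrable_meas[OF Ri] in auto)
  finally show "ennreal (vw mu * cmod (VT th g mu)) <= (NN rho. ennreal (vw mu * cmod (R mu rho)))" .
 qed
 also have "... = (NN rho. NN mu. ennreal (vw mu * cmod (R mu rho)))"
 proof (rule lborel_pair.Fubini')
  note [measurable] = measurable_compose[OF measurable_Pair[OF measurable_snd measurable_fst] Rm, simplified]
  have "(%x. ennreal (vw (snd x) * cmod (R (snd x) (fst x)))) \<in> Borel2" by measurable
  then show "(%(rho, mu). ennreal (vw mu * cmod (R mu rho))) \<in> borel_measurable (lborel \<Otimes>\<^sub>M lborel)"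
   by (simp only: borel_prod lborel_prod case_prod_beta' measurable_lborel2)
 qed
 also have "... <= (NN rho. U rho)"
  by (rule nn_integral_mono_AE[OF eventually_mono[OF AEZ R_le]])
 also have "... = ennreal (b * eta * vol + eta) * ennreal A + 2 * (NN rho. t' rho * ennreal (cmod (F rho))) +
   ennreal M * (NN rho. indicator (- q) rho * ennreal (vw rho * cmod (F rho)))"
  by (simp add: U_def nn_integral_add nn_integral_cmult A(1))
 also have "... <= ennreal eps + 2 * ennreal eps + ennreal M * ennreal eps"
  using eta(3) A(2) b(2) eta(1) vol(2) tail by (intro add_mono mult_left_mono) (auto simp: ennreal_mult'[symmetric] ennreal_leI less_imp_le simp del: ennreal_plus)
 also have "... = ennreal ((3 + M) * eps)"
 proof -
  have "2 * ennreal eps = ennreal (2 * eps)" using eps by (simp add: ennreal_mult')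
  then show ?thesis using eps M(1) by (simp add: ennreal_mult'[symmetric] ennreal_plus[symmetric] algebra_simps del: ennreal_plus)
 qed
 finally have main: "h1n th g <= ennreal ((3 + M) * eps)" .
 have cF: "integrable lborel (%rho. cnj (F rho))" using Fint by simp
 have GF: "cmod (cnj (F rho) * G rho) <= B * (vw rho * cmod (F rho))" if "rho \<notin> Z" for rho
  using mult_right_mono[OF B(2)[of rho], of "cmod (F rho)"] that F0[of rho] by (cases "rho \<in> Lam") (auto simp: norm_mult mult_ac)
 have i1: "integrable lborel (%rho. cnj (F rho) * G rho)"
 proof (rule integrable_bd[OF integrable_mult_right[OF vF, of B]])
  show "AE rho in lborel. norm (cnj (F rho) * G rho) <= norm (B * (vw rho * cmod (F rho)))"
   using AEZ by eventually_elim (use GF B(1) v in \<open>simp add: abs_mult\<close>)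
 qed measurable
 have i2: "integrable lborel (%rho. indicator S rho *\<^sub>R (G (s rho) * cnj (F rho)))"
 proof -
  have "integrable lborel (%rho. cnj (indicator S rho *\<^sub>R (cnj (G (s rho)) * F rho)))"
   using si[of "%y. cnj (G y)"] by (simp only: complex_integrable_cnj)
  moreover have "(%rho. cnj (indicator S rho *\<^sub>R (cnj (G (s rho)) * F rho))) = (%rho. indicator S rho *\<^sub>R (G (s rho) * cnj (F rho)))"
   by (simp add: fun_eq_iff scaleR_conv_of_real)
  ultimately show ?thesis by (simp only:)
 qed
 have "(\<Sum>y\<in>s ` S. cnj (c y) * G y) = (LB rho. indicator S rho *\<^sub>R (G (s rho) * cnj (F rho)))"
 proof -
  have "cnj (c y) = (LB rho. indicator {rho \<in> S. s rho = y} rho *\<^sub>R cnj (F rho))" for y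
   unfolding c_def by (subst Bochner_Integration.integral_cnj[symmetric]) (simp add: scaleR_conv_of_real)
  then show ?thesis using integral_finite_range[OF s' sS(1) cF, of G] by (simp add: mult.commute)
 qed
 then have "(\<Sum>y\<in>s ` S. cnj (c y) * G y) - (LB rho. cnj (F rho) * G rho) = (LB rho. indicator S rho *\<^sub>R (G (s rho) * cnj (F rho)) - cnj (F rho) * G rho)"
  using Bochner_Integration.integral_diff[OF i2 i1] by simp
 also have "ennreal (cmod ...) <= (NN rho. ennreal (cmod (indicator S rho *\<^sub>R (G (s rho) * cnj (F rho)) - cnj (F rho) * G rho)))"
  by (rule integral_norm_bound_ennreal[OF integrable_sub[OF i2 i1]])
 also have "... <= (NN rho. ennreal eta * ennreal (cmod (F rho)) + ennreal B * (indicator (- q) rho * ennreal (vw rho * cmod (F rho))))"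
 proof (rule nn_integral_mono_AE)
  show "AE rho in lborel. ennreal (cmod (indicator S rho *\<^sub>R (G (s rho) * cnj (F rho)) - cnj (F rho) * G rho)) \<le>
   ennreal eta * ennreal (cmod (F rho)) + ennreal B * (indicator (- q) rho * ennreal (vw rho * cmod (F rho)))"
   using AEZ
  proof eventually_elim
   case (elim rho)
   show ?case
   proof (cases "rho \<in> S")
    case True
    have "G (s rho) * cnj (F rho) - cnj (F rho) * G rho = (G (s rho) - G rho) * cnj (F rho)" by (simp add: algebra_simps)
    then have "cmod (G (s rho) * cnj (F rho) - cnj (F rho) * G rho) <= eta * cmod (F rho)"
     using sds(2)[OF True] by (simp add: norm_mult mult_right_mono less_imp_le)
    then show ?thesis using True eta(1) by (auto simp: ennreal_mult'[symmetric] ennreal_leI intro!: add_increasing2)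
   next
    case False
    then have "rho \<notin> q" using elim by (simp add: S_def)
    then show ?thesis using False GF[OF elim] B(1) by (auto simp: ennreal_mult'[symmetric] ennreal_leI norm_mult intro!: add_increasing)
   qed
  qed
 qed
 also have "... = ennreal eta * ennreal A + ennreal B * (NN rho. indicator (- q) rho * ennreal (vw rho * cmod (F rho)))"
  by (subst nn_integral_add) (auto simp: nn_integral_cmult A(1))
 also have "... <= ennreal eps + ennreal B * ennreal eps"
  using eta A tail(2) by (intro add_mono mult_left_mono) (auto simp: ennreal_mult'[symmetric] ennreal_leI less_imp_le)
 also have "... = ennreal ((1 + B) * eps)" using eps B(1) by (simp add: ennreal_mult'[symmetric] ennreal_plus[symmetric] distrib_right del: ennreal_plus)
 finally have main2: "cmod ((\<Sum>y\<in>s ` S. cnj (c y) * G y) - (LB rho. cnj (F rho) * G rho)) <= (1 + B) * eps"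
  using eps B(1) by (simp add: ennreal_le_iff)
 show thesis
  by (rule that[of "s ` S" c]) (use sS(1) P main main2 in \<open>auto simp: g_def[abs_def] F_def\<close>)
qed

end

section \<open>The reproducing formula for functionals and the transfer of coorbit spaces\<close>

context coorbit_setting
begin

lemma voice_ext_bound:
 assumes th: "adm th" and psi: "psi \<in> H1_antidual D Ph cw th"
 obtains B where "0 <= B" "\<And>f. f \<in> H1_space D Ph cw th ==> cmod (the (psi f)) <= B * enn2real (H1_enorm D Ph cw th f)"
  "\<And>rho. rho \<in> Lam ==> cmod (voice_ext D Ph th psi rho) <= B * vw rho"
proof -
 obtain b where b: "\<And>f. f \<in> H1_space D Ph cw th ==> cmod (the (psi f)) <= b * enn2real (H1_enorm D Ph cw th f)"
  using psi unfolding H1_antidual_def by blast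
 obtain M where M: "M \<ge> (0::real)" "\<And>mu. mu \<in> Lam ==> warped_atom D Ph th mu \<in> H1_space D Ph cw th"
  "\<And>mu. mu \<in> Lam ==> enn2real (H1_enorm D Ph cw th (warped_atom D Ph th mu)) <= M * vw mu"
  using atom_H1[OF th th] by blast
 \<comment> \<open>One constant for both bounds: |b| takes care of the functional, |b| M of its
   values on atoms.\<close>
 have b': "cmod (the (psi f)) <= (\<bar>b\<bar> + \<bar>b\<bar> * M) * enn2real (H1_enorm D Ph cw th f)" if "f \<in> H1_space D Ph cw th" for f
 proof -
  have "b <= \<bar>b\<bar> + \<bar>b\<bar> * M" using M(1) abs_ge_self[of b] mult_nonneg_nonneg[OF abs_ge_zero[of b] M(1)] by linarith
  then show ?thesis using b[OF that] mult_right_mono[of b "\<bar>b\<bar> + \<bar>b\<bar> * M" "enn2real (H1_enorm D Ph cw th f)"] by simp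
 qed
 show thesis
 proof (rule that[of "\<bar>b\<bar> + \<bar>b\<bar> * M"])
  fix rho assume rho: "rho \<in> Lam"
  have "cmod (voice_ext D Ph th psi rho) <= b * enn2real (H1_enorm D Ph cw th (warped_atom D Ph th rho))"
   unfolding voice_ext_def by (rule b[OF M(2)[OF rho]])
  also have "... <= \<bar>b\<bar> * (M * vw rho)" using M(3)[OF rho] by (intro mult_mono) auto
  also have "... <= (\<bar>b\<bar> + \<bar>b\<bar> * M) * vw rho"
   using vw_ge_1[of rho] by (simp add: distrib_right)
  finally show "cmod (voice_ext D Ph th psi rho) <= (\<bar>b\<bar> + \<bar>b\<bar> * M) * vw rho" .
 qed (use M(1) b' in auto)
qed

text \<open>The exceptional null set is kept explicit so that sample points can be chosen outside
  it.\<close>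

lemma voice_ext_borel:
 assumes "G \<in> borel_measurable (lebesgue_on Lam)"
 obtains G0 Z where "G0 \<in> Borel" "Z \<in> null_sets lborel" "\<And>rho. rho \<in> Lam - Z ==> G0 rho = (G rho :: complex)"
proof -
 have "(%rho. if rho \<in> Lam then G rho else 0) \<in> borel_measurable lebesgue"
  using assms by (subst borel_measurable_if) auto
 then obtain G0 where G0: "G0 \<in> Borel" "AE rho in lborel. (if rho \<in> Lam then G rho else 0) = G0 rho"
  by (rule lebesgue_ex_borel)
 obtain Z where "{rho \<in> space lborel. \<not> (if rho \<in> Lam then G rho else 0) = G0 rho} \<subseteq> Z" "emeasure lborel Z = 0" "Z \<in> sets lborel"
  using G0(2) by (rule AE_E)
 note Z = this
 have "Z \<in> null_sets lborel" using Z(2,3) by auto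
 moreover have "(if rho \<in> Lam then G rho else 0) = G0 rho" if "rho \<notin> Z" for rho by (rule ccontr) (use subsetD[OF Z(1), of rho] that in auto)
 ultimately show thesis using G0(1) by (intro that[of G0 Z]) (metis DiffD1 DiffD2)+
qed

lemma lebesgue_on_borel_integral:
 assumes G0: "G0 \<in> Borel" and Z: "Z \<in> null_sets lborel" and eq: "\<forall>rho\<in>Lam - Z. G0 rho = (G rho :: complex)"
  and G: "G \<in> borel_measurable (lebesgue_on Lam)" and k: "k \<in> Borel" "\<forall>rho. rho \<notin> Lam --> k rho = 0"
 shows "integrable (lebesgue_on Lam) (%rho. k rho * G rho) \<longleftrightarrow> integrable lborel (%rho. k rho * G0 rho)"
  "(LINT rho|lebesgue_on Lam. k rho * G rho) = (LB rho. k rho * G0 rho)"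
proof -
 note [measurable] = G0 k(1)
 have kl: "k \<in> borel_measurable (lebesgue_on Lam)" by (rule measurable_lebesgue_onI[OF k(1)]) simp
 have m1: "(%rho. indicator Lam rho *\<^sub>R (k rho * G rho)) \<in> borel_measurable lebesgue"
 proof -
  have "(%rho. k rho * G rho) \<in> borel_measurable (lebesgue_on Lam)" using kl G by (intro borel_measurable_times)
  then have "(%rho. if rho \<in> Lam then k rho * G rho else 0) \<in> borel_measurable lebesgue" by (subst borel_measurable_if) auto
  then show ?thesis by (rule measurable_cong[THEN iffD1, rotated]) auto
 qed
 have m2: "(%rho. k rho * G0 rho) \<in> borel_measurable lborel" by measurable
 have m3: "(%rho. k rho * G0 rho) \<in> borel_measurable lebesgue" using m2 by (rule measurable_completion)
 have ae: "AE rho in lebesgue. indicator Lam rho *\<^sub>R (k rho * G rho) = k rho * G0 rho"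
  using AE_completion[OF AE_not_in[OF Z]] by eventually_elim (use eq k(2) in \<open>auto simp: indicator_def\<close>)
 show "integrable (lebesgue_on Lam) (%rho. k rho * G rho) \<longleftrightarrow> integrable lborel (%rho. k rho * G0 rho)"
  using integrable_cong_AE[OF m1 m3 ae] integrable_completion[OF m2] by (subst integrable_restrict_space) auto
 show "(LINT rho|lebesgue_on Lam. k rho * G rho) = (LB rho. k rho * G0 rho)"
  using integral_cong_AE[OF m1 m3 ae] integral_completion[OF m2] by (subst integral_restrict_space) auto
qed

text \<open>Applied to the finite sums of \<open>riemann_estimate\<close>, the functional gives sums
  of values of its voice transform. These differ from \<open>nrm th1\<close> times the value at the
  atom by the H^1_v error, and from the kernel integral by the quadrature error, both multiples of
  \<open>eps\<close>. Since the sample points avoid \<open>Z\<close>, the Borel function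
  \<open>G0\<close> takes the true values there.\<close>

theorem antidual_reproduce:
 assumes th: "adm th1" "adm th2" and nz: "th1 \<noteq> (%x. 0)"
  and psi: "psi \<in> H1_antidual D Ph cw th1" and meas: "voice_ext D Ph th1 psi \<in> borel_measurable (lebesgue_on Lam)" and mu: "mu \<in> Lam"
 shows "integrable (lebesgue_on Lam) (%rho. ker th1 th2 mu rho * voice_ext D Ph th1 psi rho)"
  "cx (nrm th1) * voice_ext D Ph th2 psi mu = kernel_op Lam (ker th1 th2) (voice_ext D Ph th1 psi) mu"
proof -
 let ?G = "voice_ext D Ph th1 psi" and ?n = "cx (nrm th1)"
 obtain B where B: "0 <= B" "\<And>f. f \<in> H1_space D Ph cw th1 ==> cmod (the (psi f)) <= B * enn2real (H1_enorm D Ph cw th1 f)"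
  "\<And>rho. rho \<in> Lam ==> cmod (?G rho) <= B * vw rho" by (rule voice_ext_bound[OF th(1) psi]) blast
 obtain G0 Z where G0 [measurable]: "G0 \<in> Borel" and Z: "Z \<in> null_sets lborel" and eq: "\<And>rho. rho \<in> Lam - Z ==> G0 rho = ?G rho"
  using voice_ext_borel[OF meas] by blast
 obtain M where M: "M \<ge> 0" "\<And>rho. (NN mu. ennreal (vw mu * cmod (ker th1 th1 mu rho))) <= ennreal (M * vw rho)"
  by (rule ker_integrals[OF th(1) th(1)]) (rule that)
 have B0: "cmod (G0 rho) <= B * vw rho" if "rho \<in> Lam - Z" for rho using B(3)[of rho] eq[OF that] that by simp
 let ?f = "warped_atom D Ph th2 mu" and ?a = "fat th2 mu"
 have r: "rep ?f ?a" by (rule rep_atom[OF th(2)])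
 have f: "?f \<in> H1_space D Ph cw th1" using atom_H1[OF th] mu by blast
 have fin: "h1n th1 ?a < \<infinity>" using H1_space_rep[OF th(1) r] f by simp
 define I where "I = (LB rho. cnj (VT th1 ?a rho) * G0 rho)"
 have est: "cmod (?n * the (psi ?f) - I) <= (1 + B + B * (3 + M)) * eps" if eps: "0 < eps" for eps
 proof -
  obtain P c where P: "finite P" "P \<subseteq> Lam - Z"
   and e1: "h1n th1 (%xi. (\<Sum>y\<in>P. c y * fat th1 y xi) + (- ?n) * ?a xi) <= ennreal ((3 + M) * eps)"
   and e2: "cmod ((\<Sum>y\<in>P. cnj (c y) * G0 y) - I) <= (1 + B) * eps"
   unfolding I_def by (rule riemann_estimate[OF th(1) psi r fin G0 Z B(1) B0 eps M])
  have PL: "P \<subseteq> Lam" using P by auto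
  let ?s = "%x. \<Sum>y\<in>P. c y * warped_atom D Ph th1 y x"
  have s: "rep ?s (%xi. \<Sum>y\<in>P. c y * fat th1 y xi)" "?s \<in> H1_space D Ph cw th1"
   "the (psi ?s) = (\<Sum>y\<in>P. cnj (c y) * ?G y)"
   using antidual_sum[OF th(1) psi P(1) PL, of c] by auto
  have sG: "the (psi ?s) = (\<Sum>y\<in>P. cnj (c y) * G0 y)"
   unfolding s(3) using P(2) eq by (intro sum.cong) auto
  let ?g = "%x. ?s x + (- ?n) * ?f x"
  have g: "?g \<in> H1_space D Ph cw th1" by (rule H1_linear[OF th(1) s(2) f])
  have "the (psi ?g) = the (psi ?s) - ?n * the (psi ?f)"
   using antidual_linear[OF th(1) psi s(2) f, of "- ?n"] by simp
  moreover have "cmod (the (psi ?g)) <= B * ((3 + M) * eps)"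
  proof -
   have "enn2real (H1_enorm D Ph cw th1 ?g) <= (3 + M) * eps"
    unfolding H1_enorm_rep[OF th(1) rep_linear[OF s(1) r]] using enn2real_mono[OF e1] eps M(1) by simp
   then show ?thesis by (rule order_trans[OF B(2)[OF g] mult_left_mono[OF _ B(1)]])
  qed
  ultimately have "cmod (the (psi ?s) - ?n * the (psi ?f)) <= B * ((3 + M) * eps)" by simp
  moreover have "?n * the (psi ?f) - I = ((\<Sum>y\<in>P. cnj (c y) * G0 y) - I) - (the (psi ?s) - ?n * the (psi ?f))"
   unfolding sG by simp
  ultimately have "cmod (?n * the (psi ?f) - I) <= (1 + B) * eps + B * ((3 + M) * eps)"
   using e2 norm_triangle_ineq4[of "(\<Sum>y\<in>P. cnj (c y) * G0 y) - I" "the (psi ?s) - ?n * the (psi ?f)"] by simp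
  then show ?thesis by (simp add: algebra_simps)
 qed
 have main: "?n * the (psi ?f) = I"
 proof (rule ccontr)
  assume "?n * the (psi ?f) \<noteq> I"
  then have p: "0 < cmod (?n * the (psi ?f) - I)" by simp
  have c: "0 < 1 + B + B * (3 + M)" using B(1) M(1) by (simp add: add_pos_nonneg)
  have "cmod (?n * the (psi ?f) - I) <= (1 + B + B * (3 + M)) * (cmod (?n * the (psi ?f) - I) / (2 * (1 + B + B * (3 + M))))"
   by (rule est) (use p c in auto)
  also have "... = cmod (?n * the (psi ?f) - I) / 2"
  proof -
   have "a * (x / (2 * a)) = x / 2" if "0 < a" for a x :: real using that by simp
   then show ?thesis using c .
  qed
  finally show False using p by simp
 qed
 have k: "ker th1 th2 mu \<in> Borel" "\<forall>rho. rho \<notin> Lam --> ker th1 th2 mu rho = 0"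
  using wker_sections[OF th] ker_outside by auto
 note [measurable] = k(1)
 have eq': "\<forall>rho\<in>Lam - Z. G0 rho = ?G rho" using eq by blast
 note cv = lebesgue_on_borel_integral[OF G0 Z eq' meas k]
 have v: "0 <= vw x" for x using vw_ge_1[of x] by simp
 have "integrable lborel (%rho. vw rho * cmod (ker th1 th2 mu rho))"
  using fin v by (intro integrableI_nonneg) (auto simp: h1n_def VT_fat[OF th mu])
 then have "integrable lborel (%rho. ker th1 th2 mu rho * G0 rho)"
 proof (rule integrable_bd[OF integrable_mult_right[where c=B]])
  show "AE rho in lborel. norm (ker th1 th2 mu rho * G0 rho) <= norm (B * (vw rho * cmod (ker th1 th2 mu rho)))"
   using AE_not_in[OF Z]
  proof eventually_elim
   case (elim rho)
   then show ?case using mult_right_mono[OF B0[of rho], of "cmod (ker th1 th2 mu rho)"] k(2)[rule_format, of rho] B(1) v[of rho]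
    by (cases "rho \<in> Lam") (auto simp: norm_mult abs_mult mult_ac)
  qed
 qed measurable
 then show "integrable (lebesgue_on Lam) (%rho. ker th1 th2 mu rho * ?G rho)" unfolding cv .
 have "I = kernel_op Lam (ker th1 th2) ?G mu"
  unfolding kernel_op_def cv I_def by (simp add: VT_fat[OF th mu])
 then show "?n * voice_ext D Ph th2 psi mu = kernel_op Lam (ker th1 th2) ?G mu"
  using main by (simp add: voice_ext_def)
qed

text \<open>What the transfer asks of \<open>Y\<close>, shared by the abstract and the mixed-norm
  spaces. \<open>G\<close> is tied to the image under the kernel on \<open>Lam\<close> only, since
  its values elsewhere do not matter.\<close>

definition ker_maps :: "(real^'d => complex) => (real^'d => complex) => ('d phase => complex) set => (('d phase => complex) => real) => real => bool" where
 "ker_maps th1 th2 Y Nn C \<longleftrightarrow> (\<forall>F G. F \<in> Y --> (\<forall>mu\<in>Lam. integrable (lebesgue_on Lam) (%rho. ker th1 th2 mu rho * F rho)) -->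
   (\<forall>mu\<in>Lam. cx (nrm th1) * G mu = kernel_op Lam (ker th1 th2) F mu) --> G \<in> Y \<and> Nn G <= C * Nn F)"

lemma Co_transfer:
 assumes th: "adm th1" "adm th2" and nz: "th1 \<noteq> (%x. 0)" "th2 \<noteq> (%x. 0)"
  and Y: "Y \<subseteq> borel_measurable (lebesgue_on Lam)"
  and step: "ker_maps th1 th2 Y Nn C"
  and psi: "psi \<in> Co D Ph cw th1 Y"
 shows "psi \<in> Co D Ph cw th2 Y" "Co_norm D Ph th2 Nn psi <= C * Co_norm D Ph th1 Nn psi"
proof -
 have p: "psi \<in> H1_antidual D Ph cw th1" "voice_ext D Ph th1 psi \<in> Y" using psi by (auto simp: Co_def)
 then have m: "voice_ext D Ph th1 psi \<in> borel_measurable (lebesgue_on Lam)" using Y by auto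
 have "voice_ext D Ph th2 psi \<in> Y \<and> Nn (voice_ext D Ph th2 psi) <= C * Nn (voice_ext D Ph th1 psi)"
  using antidual_reproduce[OF th nz(1) p(1) m] by (intro step[unfolded ker_maps_def, rule_format, OF p(2)])
 moreover have "psi \<in> H1_antidual D Ph cw th2" using antidual_subset[OF th nz] p(1) by blast
 ultimately show "psi \<in> Co D Ph cw th2 Y" "Co_norm D Ph th2 Nn psi <= C * Co_norm D Ph th1 Nn psi"
  by (auto simp: Co_def Co_norm_def)
qed

lemma Co_eq:
 assumes th: "adm th1" "adm th2" and nz: "th1 \<noteq> (%x. 0)" "th2 \<noteq> (%x. 0)"
  and Y: "Y \<subseteq> borel_measurable (lebesgue_on Lam)" and nn: "\<And>F. F \<in> Y ==> 0 <= Nn F"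
  and step: "\<And>th th'. adm th ==> adm th' ==> th \<noteq> (%x. 0) ==> \<exists>C. ker_maps th th' Y Nn C"
 shows "eq_equiv_norms (Co D Ph cw th1 Y) (Co_norm D Ph th1 Nn) (Co D Ph cw th2 Y) (Co_norm D Ph th2 Nn)"
proof -
 obtain C1 C2 where C1: "ker_maps th1 th2 Y Nn C1" and C2: "ker_maps th2 th1 Y Nn C2"
  using step[OF th nz(1)] step[OF th(2,1) nz(2)] by blast
 note t1 = Co_transfer[OF th nz Y C1]
 note t2 = Co_transfer[OF th(2,1) nz(2,1) Y C2]
 have eq: "Co D Ph cw th1 Y = Co D Ph cw th2 Y" using t1(1) t2(1) by blast
 have pos: "0 <= Co_norm D Ph th1 Nn psi" "0 <= Co_norm D Ph th2 Nn psi" if "psi \<in> Co D Ph cw th1 Y" for psi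
  using nn that that[unfolded eq] by (auto simp: Co_def Co_norm_def)
 have "Co_norm D Ph th1 Nn psi <= max C1 C2 * Co_norm D Ph th2 Nn psi \<and> Co_norm D Ph th2 Nn psi <= max C1 C2 * Co_norm D Ph th1 Nn psi"
  if psi: "psi \<in> Co D Ph cw th1 Y" for psi
  using t1(2)[OF psi] t2(2)[OF psi[unfolded eq]] mult_right_mono[OF max.cobounded1[of C1 C2] pos(1)[OF psi]] mult_right_mono[OF max.cobounded2[of C2 C1] pos(2)[OF psi]]
  by linarith
 then show ?thesis unfolding eq_equiv_norms_def using eq by blast
qed

text \<open>The constant is the norm of the kernel divided by \<open>nrm th\<close>. The voice
  transform agrees with the rescaled image under the kernel on \<open>Lam\<close>, and solidity
  passes membership and norm from the one to the other.\<close>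

theorem Co_eq_banach:
 assumes th: "adm th1" "adm th2" and nz: "th1 \<noteq> (%x. 0)" "th2 \<noteq> (%x. 0)"
  and Y: "banach_function_space Lam Y Nn" "solid_space Lam Y Nn" "B_acts_on D m0 Y Nn"
 shows "eq_equiv_norms (Co D Ph cw th1 Y) (Co_norm D Ph th1 Nn) (Co D Ph cw th2 Y) (Co_norm D Ph th2 Nn)"
proof (rule Co_eq[OF th nz])
 show sub: "Y \<subseteq> borel_measurable (lebesgue_on Lam)" using Y(1) unfolding banach_function_space_def by blast
 show "0 <= Nn F" if "F \<in> Y" for F using Y(1) that unfolding banach_function_space_def by blast
 fix th th' assume a: "adm th" "adm th'" "th \<noteq> (%x. 0)"
 let ?k = "ker th th'" and ?n = "nrm th"
 have n: "0 < ?n" by (rule nrm_pos[OF a(1,3)])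
 have "G \<in> Y \<and> Nn G <= (1 / ?n * enn2real (B_enorm D m0 ?k)) * Nn F"
  if F: "F \<in> Y" and G: "\<forall>mu\<in>Lam. cx ?n * G mu = kernel_op Lam ?k F mu" for F G
 proof -
  let ?K = "%mu. cx (1 / ?n) * kernel_op Lam ?k F mu"
  have k: "kernel_op Lam ?k F \<in> Y" "Nn (kernel_op Lam ?k F) <= enn2real (B_enorm D m0 ?k) * Nn F"
   using Y(3) ker_in_B_space[OF a(1,2)] F unfolding B_acts_on_def by blast+
  have "?K \<in> Y \<and> Nn ?K = cmod (cx (1 / ?n)) * Nn (kernel_op Lam ?k F)"
   using Y(1) k(1) unfolding banach_function_space_def by blast
  then have K: "?K \<in> Y" "Nn ?K = 1 / ?n * Nn (kernel_op Lam ?k F)" using n by (auto simp: norm_divide)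
  have eq: "G mu = ?K mu" if "mu \<in> Lam" for mu
   using G[rule_format, OF that, symmetric] n by simp
  have Km: "?K \<in> borel_measurable (lebesgue_on Lam)" using K(1) sub by blast
  have Gm: "G \<in> borel_measurable (lebesgue_on Lam)"
   by (rule measurable_cong[THEN iffD1, OF _ Km]) (simp add: eq)
  have ae: "AE x in lebesgue_on Lam. cmod (G x) <= cmod (?K x)" by (rule AE_I2) (simp add: eq)
  note sol = Y(2)[unfolded solid_space_def, THEN bspec, OF Gm, THEN bspec, OF K(1), THEN mp, OF ae]
  have g: "G \<in> Y" "Nn G <= Nn ?K" by (rule conjunct1[OF sol], rule conjunct2[OF sol])
  note g(2)
  also have "Nn ?K <= 1 / ?n * (enn2real (B_enorm D m0 ?k) * Nn F)"
   unfolding K(2) by (rule mult_left_mono[OF k(2)]) (use n in simp)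
  finally show ?thesis using g(1) by (simp only: mult.assoc)
 qed
 then show "\<exists>C. ker_maps th th' Y Nn C"
  unfolding ker_maps_def by (intro exI[of _ "1 / ?n * enn2real (B_enorm D m0 ?k)"] allI impI) blast
qed

end

section \<open>Mixed-norm spaces\<close>

lemma ennreal_powr_ennreal: "0 <= r ==> ennreal_powr (ennreal r) a = ennreal (r powr a)"
 by (simp add: ennreal_powr_def)

lemma ennreal_powr_top [simp]: "ennreal_powr top a = top"
 by (simp add: ennreal_powr_def)

lemma ennreal_powr_0 [simp]: "ennreal_powr 0 a = 0"
 by (simp add: ennreal_powr_def)

lemma measurable_ennreal_powr [measurable (raw)]:
 "f \<in> borel_measurable M ==> (%x. ennreal_powr (f x) a) \<in> borel_measurable M"
proof -
 assume f [measurable]: "f \<in> borel_measurable M"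
 have "{x \<in> space M. f x = \<infinity>} = f -` {\<infinity>} \<inter> space M" by auto
 also have "... \<in> sets M" by (rule measurable_sets[OF f]) simp
 finally show ?thesis unfolding ennreal_powr_def by (intro measurable_If measurable_compose[OF powr_real_measurable measurable_ennreal]) simp_all
qed

lemma ennreal_powr_mono:
 assumes "x <= y" "0 <= a" shows "ennreal_powr x a <= ennreal_powr y a"
 using assms by (cases x; cases y) (auto simp: ennreal_powr_ennreal top_unique intro!: ennreal_leI powr_mono2)

lemma ennreal_powr_cmult:
 assumes "0 <= c" shows "ennreal_powr (ennreal c * x) a = ennreal (c powr a) * ennreal_powr x a"
proof (cases x)
 case (real r)
 then show ?thesis using assms by (simp add: ennreal_mult'[symmetric] ennreal_powr_ennreal powr_mult)
next
 case top
 then show ?thesis using assms by (cases "c = 0") (auto simp: ennreal_mult_top)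
qed

lemma ennreal_powr_inverse_le_iff:
 assumes "0 < a" shows "ennreal_powr x (1 / a) <= y \<longleftrightarrow> x <= ennreal_powr y a"
proof (cases x; cases y)
 fix r s assume x: "x = ennreal r" "0 <= r" and y: "y = ennreal s" "0 <= s"
 have "r powr (1 / a) <= s \<longleftrightarrow> r <= s powr a"
 proof
  assume "r powr (1 / a) <= s"
  then have "(r powr (1 / a)) powr a <= s powr a" using assms by (intro powr_mono2) auto
  then show "r <= s powr a" using assms x by (simp add: powr_powr)
 next
  assume "r <= s powr a"
  then have "r powr (1 / a) <= (s powr a) powr (1 / a)" using assms x by (intro powr_mono2) auto
  then show "r powr (1 / a) <= s" using assms y by (simp add: powr_powr)
 qed
 then show ?thesis using x y by (simp add: ennreal_powr_ennreal)
qed (auto simp: ennreal_powr_ennreal top_unique)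

text \<open>The tangent to the convex function x^p at m lies below its graph; it is obtained from
  Young's inequality with exponents p and p/(p-1).\<close>

lemma powr_tangent:
 fixes x m p :: real
 assumes "1 <= p" "0 <= x" "0 < m"
 shows "p * m powr (p - 1) * x <= x powr p + (p - 1) * m powr p"
proof (cases "p = 1")
 case False
 then have p: "1 < p" using assms by simp
 define q where "q = p / (p - 1)"
 have q: "1 < q" "1 / p + 1 / q = 1" using p by (auto simp: q_def field_simps)
 have "x * m powr (p - 1) <= x powr p / p + (m powr (p - 1)) powr q / q"
  by (rule Youngs_inequality[OF p q]) (use assms in auto)
 also have "(m powr (p - 1)) powr q = m powr p" using p by (simp add: powr_powr q_def)
 also have "m powr p / q = (p - 1) * m powr p / p" using p by (simp add: q_def)
 finally have "p * (x * m powr (p - 1)) <= p * (x powr p / p + (p - 1) * m powr p / p)"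
  using p by (intro mult_left_mono) auto
 then show ?thesis using p by (simp add: mult_ac distrib_left)
qed (use assms in simp)

text \<open>The tangent inequality is integrated against \<open>k\<close> and evaluated at m = I/s,
  where it becomes Jensen's inequality for the weight \<open>k\<close> of mass at most
  \<open>s\<close>.\<close>

lemma weighted_jensen:
 assumes [measurable]: "k \<in> borel_measurable M" "g \<in> borel_measurable M" and p: "1 <= p"
  and s: "(\<integral>\<^sup>+x. k x \<partial>M) <= ennreal s" "0 <= s"
 shows "ennreal_powr (\<integral>\<^sup>+x. k x * g x \<partial>M) p <= ennreal (s powr (p - 1)) * (\<integral>\<^sup>+x. k x * ennreal_powr (g x) p \<partial>M)"
proof (cases "s = 0")
 case True
 then have "AE x in M. k x = 0" using s by (simp add: nn_integral_0_iff_AE)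
 then have "(\<integral>\<^sup>+x. k x * g x \<partial>M) = (\<integral>\<^sup>+x. 0 \<partial>M)" by (intro nn_integral_cong_AE) (auto elim: eventually_mono)
 then show ?thesis by simp
next
 case False
 then have s0: "0 < s" using s by simp
 define I where "I = (\<integral>\<^sup>+x. k x * g x \<partial>M)"
 define J where "J = (\<integral>\<^sup>+x. k x * ennreal_powr (g x) p \<partial>M)"
 have tang: "ennreal (p * m powr (p - 1)) * I <= J + ennreal ((p - 1) * m powr p) * ennreal s" if m: "0 < m" for m
 proof -
  have "ennreal (p * m powr (p - 1)) * x <= ennreal_powr x p + ennreal ((p - 1) * m powr p)" for x
  proof (cases x)
   case (real r)
   then show ?thesis using powr_tangent[OF p real(1) m] p
    by (simp add: ennreal_mult'[symmetric] ennreal_powr_ennreal ennreal_plus[symmetric] ennreal_leI del: ennreal_plus)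
  qed simp
  then have "k x * (ennreal (p * m powr (p - 1)) * g x) <= k x * (ennreal_powr (g x) p + ennreal ((p - 1) * m powr p))" for x
   by (intro mult_left_mono) auto
  then have "(\<integral>\<^sup>+x. k x * (ennreal (p * m powr (p - 1)) * g x) \<partial>M) <= (\<integral>\<^sup>+x. k x * (ennreal_powr (g x) p + ennreal ((p - 1) * m powr p)) \<partial>M)"
   by (rule nn_integral_mono)
  also have "... = J + (\<integral>\<^sup>+x. k x \<partial>M) * ennreal ((p - 1) * m powr p)"
   unfolding J_def by (simp add: distrib_left nn_integral_add nn_integral_multc)
  also have "... <= J + ennreal ((p - 1) * m powr p) * ennreal s"
   unfolding mult.commute[of "nn_integral M k"] by (intro add_left_mono mult_left_mono s) simp
  also have "(\<integral>\<^sup>+x. k x * (ennreal (p * m powr (p - 1)) * g x) \<partial>M) = ennreal (p * m powr (p - 1)) * I"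
   unfolding I_def by (subst nn_integral_cmult[symmetric]) (auto simp: mult_ac)
  finally show ?thesis .
 qed
 show ?thesis
 proof (cases J)
  case top
  then show ?thesis using s0 by (simp add: J_def ennreal_mult_top)
 next
  case (real j)
  \<comment> \<open>The tangent at m = 1 shows that \<open>I\<close> is finite, so that the mean m =
    I/s can be formed.\<close>
  have "ennreal p * I < \<infinity>"
   using tang[of 1] real by (intro le_less_trans[OF tang[of 1, simplified]]) (auto simp: ennreal_mult_less_top)
  then have "I < \<infinity>" using p by (auto simp: ennreal_mult_less_top)
  then obtain i where i: "I = ennreal i" "0 <= i" by (cases I) auto
  show ?thesis
  proof (cases "i = 0")
   case False
   define m where "m = i / s"
   have m: "0 < m" "i = m * s" using False i s0 by (auto simp: m_def)
   have "ennreal (p * m powr (p - 1) * i) <= ennreal (j + (p - 1) * m powr p * s)"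
    using tang[OF m(1)] p real s i by (simp add: ennreal_mult'[symmetric] ennreal_plus[symmetric] del: ennreal_plus)
   then have "p * m powr (p - 1) * i <= j + (p - 1) * m powr p * s"
    using real p s by (subst (asm) ennreal_le_iff) auto
   moreover have mp: "m powr p = m powr (p - 1) * m" using m(1) by (simp add: powr_diff)
   ultimately have "m powr p * s <= j" unfolding m(2) by (simp add: algebra_simps)
   then have "s powr (p - 1) * (m powr p * s) <= s powr (p - 1) * j" by (intro mult_left_mono) auto
   moreover have "i powr p = s powr (p - 1) * (m powr p * s)"
   proof -
    have "i powr p = m powr p * s powr p" unfolding m(2) using m s by (simp add: powr_mult)
    also have "s powr p = s powr (p - 1) * s" using s0 by (simp add: powr_diff)
    finally show ?thesis by simp
   qed
   ultimately have "i powr p <= s powr (p - 1) * j" by simp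
   then show ?thesis using i real unfolding I_def[symmetric] J_def[symmetric]
    by (simp add: ennreal_powr_ennreal ennreal_mult'[symmetric] ennreal_leI)
  qed (use i in \<open>simp add: I_def[symmetric]\<close>)
 qed
qed

lemma enn2real_ge_1: "1 <= P ==> P \<noteq> \<infinity> ==> 1 <= enn2real P"
 by (cases P) auto

text \<open>Norms are handled through their upper bounds: a finite exponent turns into an integral
  without the outer root, the exponent \<open>\<infinity>\<close> into an almost-everywhere
  bound.\<close>

lemma Lp_enorm_le_iff:
 assumes "1 <= P" "h \<in> borel_measurable M"
 shows "Lp_enorm P M h <= y \<longleftrightarrow> (if P = \<infinity> then AE x in M. h x <= y
   else (\<integral>\<^sup>+x. ennreal_powr (h x) (enn2real P) \<partial>M) <= ennreal_powr y (enn2real P))"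
 using enn2real_ge_1[OF assms(1)] esssup_le_iff[OF assms(2)] by (auto simp: Lp_enorm_def ennreal_powr_inverse_le_iff)

lemma Lp_enorm_mono_AE:
 assumes "1 <= P" "h \<in> borel_measurable M" "h' \<in> borel_measurable M" "AE x in M. h x <= h' x"
 shows "Lp_enorm P M h <= Lp_enorm P M h'"
proof (cases "P = \<infinity>")
 case True
 have "AE x in M. h' x <= Lp_enorm P M h'" using Lp_enorm_le_iff[OF assms(1,3), of "Lp_enorm P M h'"] True by simp
 with assms(4) have "AE x in M. h x <= Lp_enorm P M h'" by eventually_elim (rule order_trans)
 then show ?thesis using True assms by (simp add: Lp_enorm_le_iff)
next
 case False
 have "(\<integral>\<^sup>+x. ennreal_powr (h x) (enn2real P) \<partial>M) <= (\<integral>\<^sup>+x. ennreal_powr (h' x) (enn2real P) \<partial>M)"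
  by (rule nn_integral_mono_AE) (use assms(4) in eventually_elim, auto intro: ennreal_powr_mono)
 also have "... <= ennreal_powr (Lp_enorm P M h') (enn2real P)"
  using Lp_enorm_le_iff[OF assms(1,3), of "Lp_enorm P M h'"] False by simp
 finally show ?thesis using False assms by (simp add: Lp_enorm_le_iff)
qed

lemma Lp_enorm_cmult:
 assumes "1 <= P" "0 <= c" and [measurable]: "h \<in> borel_measurable M"
 shows "Lp_enorm P M (%x. ennreal c * h x) <= ennreal c * Lp_enorm P M h"
proof (cases "P = \<infinity>")
 case True
 have "AE x in M. h x <= Lp_enorm P M h" using Lp_enorm_le_iff[OF assms(1,3), of "Lp_enorm P M h"] True by simp
 then have "AE x in M. ennreal c * h x <= ennreal c * Lp_enorm P M h" by eventually_elim (rule mult_left_mono, auto)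
 then show ?thesis using True assms by (simp add: Lp_enorm_le_iff)
next
 case False
 have "(\<integral>\<^sup>+x. ennreal_powr (h x) (enn2real P) \<partial>M) <= ennreal_powr (Lp_enorm P M h) (enn2real P)"
  using Lp_enorm_le_iff[OF assms(1,3), of "Lp_enorm P M h"] False by simp
 then show ?thesis using False assms
  by (simp add: Lp_enorm_le_iff ennreal_powr_cmult nn_integral_cmult mult_left_mono)
qed

lemma measurable_completion_AE:
 assumes g: "g \<in> M \<rightarrow>\<^sub>M N" and sp: "\<And>x. x \<in> space M ==> f x \<in> space N" and ae: "AE x in M. f x = g x"
 shows "f \<in> completion M \<rightarrow>\<^sub>M N"
proof (rule measurableI)
 fix A assume A: "A \<in> sets N"
 obtain Z where Z: "{x \<in> space M. f x \<noteq> g x} \<subseteq> Z" "Z \<in> null_sets M"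
  using ae by (auto elim!: AE_E simp: null_sets_def)
 have "f -` A \<inter> space M = ((g -` A \<inter> space M) - Z) \<union> (f -` A \<inter> Z \<inter> space M)" using Z(1) by auto
 moreover have "(g -` A \<inter> space M) - Z \<in> sets (completion M)"
  using measurable_sets[OF g A] Z(2) by (auto intro!: sets_completionI_sets)
 moreover have "f -` A \<inter> Z \<inter> space M \<in> null_sets (completion M)"
  by (rule null_sets_completion_subset[of _ Z]) (use Z(2) in \<open>auto intro: null_sets_completionI\<close>)
 ultimately show "f -` A \<inter> space (completion M) \<in> sets (completion M)" by auto
qed (use sp in simp)

text \<open>Two extended reals with the same upper bounds are equal, and upper bounds do not see
  null sets or completion.\<close>

lemma Lp_enorm_cong_AE_completion:
 assumes P: "1 <= P" and [measurable]: "g \<in> borel_measurable M" and ae: "AE x in M. f x = g x"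
 shows "Lp_enorm P (completion M) f = Lp_enorm P M g"
proof -
 have fm: "f \<in> borel_measurable (completion M)" by (rule measurable_completion_AE[OF _ _ ae]) auto
 have "Lp_enorm P (completion M) f <= y \<longleftrightarrow> Lp_enorm P M g <= y" for y
 proof (cases "P = \<infinity>")
  case True
  have "(AE x in M. f x <= y) \<longleftrightarrow> (AE x in M. g x <= y)"
   by (rule eventually_subst) (use ae in eventually_elim, auto)
  then show ?thesis unfolding Lp_enorm_le_iff[OF P fm] Lp_enorm_le_iff[OF P assms(2)] if_P[OF True] AE_completion_iff .
 next
  case False
  have "(\<integral>\<^sup>+x. ennreal_powr (f x) (enn2real P) \<partial>completion M) = (\<integral>\<^sup>+x. ennreal_powr (g x) (enn2real P) \<partial>M)"
   unfolding nn_integral_completion by (rule nn_integral_cong_AE) (use ae in eventually_elim, auto)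
  then show ?thesis using False by (simp add: Lp_enorm_le_iff[OF P fm] Lp_enorm_le_iff[OF P])
 qed
 then show ?thesis by (meson order_antisym order_refl)
qed

lemma Lp_enorm_lebesgue_on:
 assumes P: "1 <= P" and D: "D \<in> sets borel" and g: "g \<in> Borel" "\<And>x. x \<notin> D ==> g x = 0"
  and ae: "AE x in lborel. x \<in> D --> f x = g x"
 shows "Lp_enorm P (lebesgue_on D) f = Lp_enorm P lborel g"
proof -
 note [measurable] = g(1)
 have ae': "AE x in lborel. (if x \<in> D then f x else 0) = g x"
  using ae by eventually_elim (use g(2) in auto)
 have "(%x. if x \<in> D then f x else 0) \<in> borel_measurable lebesgue"
  by (rule measurable_completion_AE[OF _ _ ae']) auto
 then have "(%x. if x \<in> D then f x else 0) \<in> borel_measurable (lebesgue_on D)" by (rule measurable_restrict_space1)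
 then have fm: "f \<in> borel_measurable (lebesgue_on D)"
  by (rule measurable_cong[THEN iffD1, rotated]) simp
 have gm: "g \<in> borel_measurable lborel" by simp
 have "Lp_enorm P (lebesgue_on D) f <= y \<longleftrightarrow> Lp_enorm P lborel g <= y" for y
 proof (cases "P = \<infinity>")
  case True
  have "(AE x in lebesgue_on D. f x <= y) \<longleftrightarrow> (AE x in lborel. x \<in> D --> f x <= y)"
   using D by (simp add: AE_restrict_space_iff AE_completion_iff)
  also have "... \<longleftrightarrow> (AE x in lborel. g x <= y)"
   by (rule eventually_subst) (use ae in eventually_elim, use g(2) in auto)
  finally show ?thesis unfolding Lp_enorm_le_iff[OF P fm] Lp_enorm_le_iff[OF P gm] if_P[OF True] .
 next
  case False
  have "(\<integral>\<^sup>+x. ennreal_powr (f x) (enn2real P) \<partial>lebesgue_on D) = (NN x. ennreal_powr (g x) (enn2real P))"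
   unfolding nn_integral_lebesgue_on[OF D]
   by (rule nn_integral_cong_AE) (use ae in eventually_elim, use g(2) in \<open>auto simp: indicator_def\<close>)
  then show ?thesis using False by (simp add: Lp_enorm_le_iff[OF P fm] Lp_enorm_le_iff[OF P gm])
 qed
 then show ?thesis by (meson order_antisym order_refl)
qed

lemma measurable_Lp_enorm_param:
 fixes H :: "'b::euclidean_space \<times> 'c::euclidean_space => ennreal"
 assumes P: "1 <= P" and H [measurable]: "H \<in> Borel"
 shows "(%t. Lp_enorm P lborel (%y. H (y, t))) \<in> Borel"
proof (cases "P = \<infinity>")
 case True
 have "(%t. esssup lebesgue (%y. H (y, t))) \<in> Borel"
  by (rule measurable_esssup) simp
 moreover have "esssup lebesgue (%y. H (y, t)) = Lp_enorm P lborel (%y. H (y, t))" for t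
 proof -
  have "(%y. H (y, t)) \<in> borel_measurable lborel"
   using measurable_compose[OF contI H, of "%y. (y, t)"] by (simp add: continuous_intros)
  then show ?thesis using Lp_enorm_cong_AE_completion[OF P, of "%y. H (y, t)" lborel "%y. H (y, t)"] True by (simp add: Lp_enorm_def)
 qed
 ultimately show ?thesis by simp
next
 case False
 have "(%x. ennreal_powr (H (snd x, fst x)) (enn2real P)) \<in> Borel"
  using measurable_compose[OF contI H, of "%x. (snd x, fst x)"] by (simp add: continuous_intros)
 from measurable_nn_integral_param[OF this, simplified] show ?thesis using False by (simp add: Lp_enorm_def)
qed

definition mixed_enorm :: "ennreal => ennreal => ((real^'d) \<times> (real^'d) => ennreal) => ennreal" where
 "mixed_enorm P Q H = Lp_enorm Q lborel (%om. Lp_enorm P lborel (%y. H (y, om)))"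

lemma Lp_enorm_finite_AE:
 assumes Q: "1 <= Q" and [measurable]: "h \<in> borel_measurable M" and fin: "Lp_enorm Q M h < \<infinity>"
 shows "AE x in M. h x < \<infinity>"
proof (cases "Q = \<infinity>")
 case True
 have "AE x in M. h x <= Lp_enorm Q M h" using Lp_enorm_le_iff[OF Q assms(2), of "Lp_enorm Q M h"] True by simp
 then show ?thesis by eventually_elim (rule le_less_trans[OF _ fin])
next
 case False
 have "(\<integral>\<^sup>+x. ennreal_powr (h x) (enn2real Q) \<partial>M) <= ennreal_powr (Lp_enorm Q M h) (enn2real Q)"
  using Lp_enorm_le_iff[OF Q assms(2), of "Lp_enorm Q M h"] False by simp
 also have "... < \<infinity>" using fin by (cases "Lp_enorm Q M h") (auto simp: ennreal_powr_ennreal)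
 finally have "AE x in M. ennreal_powr (h x) (enn2real Q) \<noteq> \<infinity>"
  by (intro nn_integral_PInf_AE) auto
 then show ?thesis
 proof eventually_elim
  case (elim x)
  then show ?case by (cases "h x") auto
 qed
qed

lemma borel_measurable_snd_comp:
 fixes f :: "'b::euclidean_space => ennreal"
 assumes "f \<in> Borel"
 shows "(%x :: 'a::euclidean_space \<times> 'b. f (snd x)) \<in> Borel"
 by (rule measurable_compose[OF contI assms]) (intro continuous_intros)

lemma powr_diff_mult: "0 <= (s::real) ==> 1 <= q ==> s powr (q - 1) * s = s powr q"
 by (cases "s = 0") (auto simp: powr_diff)

text \<open>Jensen with the weight \<open>e om\<close> contributes M^(q-1) from the row bound;
  Tonelli and the column bound contribute a further M, and the q-th root leaves M.\<close>

lemma schur_Lp: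
 fixes e :: "'a::euclidean_space => 'a => ennreal"
 assumes Q: "1 <= Q" and em: "(%x. e (fst x) (snd x)) \<in> Borel" and [measurable]: "h \<in> Borel"
  and e: "\<And>om. (NN eta. e om eta) <= ennreal M" "\<And>eta. (NN om. e om eta) <= ennreal M" and M: "0 <= M"
 shows "Lp_enorm Q lborel (%om. NN eta. e om eta * h eta) <= ennreal M * Lp_enorm Q lborel h"
proof -
 have ep [measurable]: "(%x. e (fst x) (snd x)) \<in> Borel2" using em by (simp only: borel_prod)
 have es [measurable]: "e om \<in> Borel" "(%om. e om eta) \<in> Borel" for om eta
  using measurable_compose[OF measurable_Pair1'[of om borel borel] ep] measurable_compose[OF measurable_Pair2'[of eta borel borel] ep] by simp_all
 let ?N = "Lp_enorm Q lborel h" and ?S = "%om. NN eta. e om eta * h eta"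
 have hm: "h \<in> borel_measurable lborel" by simp
 have "(%x. e (fst x) (snd x) * h (snd x)) \<in> Borel"
  unfolding borel_prod[symmetric] by measurable
 then have Sm: "?S \<in> borel_measurable lborel" by (simp add: measurable_nn_integral_param)
 show ?thesis
 proof (cases "Q = \<infinity>")
  case True
  have h: "AE eta in lborel. h eta <= ?N" using Lp_enorm_le_iff[OF Q hm, of ?N] True by simp
  have "?S om <= ennreal M * ?N" for om
  proof -
   have "?S om <= (NN eta. e om eta * ?N)"
    by (rule nn_integral_mono_AE) (use h in eventually_elim, rule mult_left_mono, auto)
   also have "... = (NN eta. e om eta) * ?N" by (rule nn_integral_multc) simp
   also have "... <= ennreal M * ?N" by (intro mult_right_mono e) simp
   finally show ?thesis .
  qed
  then show ?thesis unfolding Lp_enorm_le_iff[OF Q Sm] if_P[OF True] by simp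
 next
  case False
  define q where "q = enn2real Q"
  have q: "1 <= q" unfolding q_def using enn2real_ge_1 Q False by simp
  have hq: "(NN eta. ennreal_powr (h eta) q) <= ennreal_powr ?N q"
   using Lp_enorm_le_iff[OF Q hm, of ?N] False by (simp add: q_def)
  have "(NN om. ennreal_powr (?S om) q) <= (NN om. ennreal (M powr (q - 1)) * (NN eta. e om eta * ennreal_powr (h eta) q))"
   by (intro nn_integral_mono weighted_jensen q e M) auto
  also have "... = ennreal (M powr (q - 1)) * (NN om. NN eta. e om eta * ennreal_powr (h eta) q)"
  proof (rule nn_integral_cmult)
   have "(%x. e (fst x) (snd x) * ennreal_powr (h (snd x)) q) \<in> Borel"
    unfolding borel_prod[symmetric] by measurable
   then show "(%om. NN eta. e om eta * ennreal_powr (h eta) q) \<in> borel_measurable lborel"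
    by (simp add: measurable_nn_integral_param)
  qed
  also have "(NN om. NN eta. e om eta * ennreal_powr (h eta) q) = (NN eta. NN om. e om eta * ennreal_powr (h eta) q)"
  proof (rule lborel_pair.Fubini')
   have "(%x. e (snd x) (fst x)) \<in> Borel2"
    using measurable_compose[OF measurable_Pair[OF measurable_snd measurable_fst] ep] by simp
   then show "(%(eta, om). e om eta * ennreal_powr (h eta) q) \<in> borel_measurable (lborel \<Otimes>\<^sub>M lborel)"
    unfolding case_prod_beta' measurable_cong_sets[OF sets_pair_measure_cong[OF sets_lborel sets_lborel] refl] by measurable
  qed
  also have "... = (NN eta. (NN om. e om eta) * ennreal_powr (h eta) q)"
   by (intro nn_integral_cong nn_integral_multc) simp
  also have "... <= (NN eta. ennreal M * ennreal_powr (h eta) q)"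
   by (intro nn_integral_mono mult_right_mono e) simp
  also have "... = ennreal M * (NN eta. ennreal_powr (h eta) q)" by (rule nn_integral_cmult) simp
  also have "... <= ennreal M * ennreal_powr ?N q" by (intro mult_left_mono hq) simp
  finally have "(NN om. ennreal_powr (?S om) q) <= ennreal (M powr (q - 1)) * (ennreal M * ennreal_powr ?N q)"
   by (simp add: mult_left_mono)
  also have "... = ennreal_powr (ennreal M * ?N) q"
   using powr_diff_mult[OF M q] M by (simp add: ennreal_powr_cmult mult.assoc[symmetric] ennreal_mult'[symmetric])
  finally show ?thesis unfolding Lp_enorm_le_iff[OF Q Sm] q_def using False by simp
 qed
qed

text \<open>Schur's test in the space variable and Minkowski's inequality in the frequency variable
  at once, without duality. On every frequency slice \<open>H\<close> is divided by its own norm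
  \<open>h eta\<close>. Jensen for the weight \<open>L * h\<close>, of mass at most
  \<open>S\<close>, then yields S^(p-1) times an integral that is again at most
  \<open>S\<close>.\<close>

lemma minkowski_schur:
 fixes L :: "(real^'d) \<times> (real^'d) => (real^'d) \<times> (real^'d) => ennreal" and H :: "(real^'d) \<times> (real^'d) => ennreal"
 assumes P: "1 <= P" and Lm: "(%(mu, rho). L mu rho) \<in> Borel" and Hm [measurable]: "H \<in> Borel"
  and em [measurable]: "e \<in> Borel"
  and k1: "\<And>y eta. (NN z. L (y, om) (z, eta)) <= e eta" and k2: "\<And>z eta. (NN y. L (y, om) (z, eta)) <= e eta"
  and fin: "AE eta in lborel. Lp_enorm P lborel (%z. H (z, eta)) < \<infinity>"
 shows "Lp_enorm P lborel (%y. NN rho. L (y, om) rho * H rho) <= (NN eta. e eta * Lp_enorm P lborel (%z. H (z, eta)))"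
proof -
 define h where "h eta = Lp_enorm P lborel (%z. H (z, eta))" for eta
 have hm [measurable]: "h \<in> Borel" unfolding h_def by (rule measurable_Lp_enorm_param[OF P Hm])
 have sm: "(snd :: (real^'d) \<times> (real^'d) => real^'d) \<in> Borel"
  by (rule contI) (intro continuous_intros)
 note [measurable] = measurable_compose[OF sm hm] measurable_compose[OF sm em]
 have Ls [measurable]: "L mu \<in> Borel" for mu using phase_sections(2)[OF Lm] by simp
 have sec: "(%z. f (z, eta)) \<in> Borel" if "f \<in> Borel" for f :: "(real^'d) \<times> (real^'d) => ennreal" and eta
  using measurable_compose[OF contI that, of "%z. (z, eta)"] by (simp add: continuous_intros)
 note [measurable] = sec[OF Ls] sec[OF Hm]
 let ?T = "%y. NN rho. L (y, om) rho * H rho"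
 define S where "S = (NN eta. e eta * h eta)"
 have Lc: "(%x. L (fst x, om) (snd x)) \<in> Borel2"
  unfolding borel_prod using measurable_compose[OF contI Lm, of "%x. ((fst x, om), snd x)"]
  by (simp add: continuous_intros)
 have Lc' [measurable]: "(%x. L (snd x, om) (fst x)) \<in> Borel2"
  using measurable_compose[OF measurable_Pair[OF measurable_snd measurable_fst] Lc] by simp
 have Lsy [measurable]: "(%y. L (y, om) rho) \<in> Borel" for rho
  using measurable_compose[OF measurable_Pair2'[of rho borel borel] Lc] by simp
 have mT: "(%y. NN rho. L (y, om) rho * W rho) \<in> Borel" if [measurable]: "W \<in> Borel" for W
  by (rule measurable_nn_integral_param) (intro borel_measurable_times_ennreal borel_measurable_snd_comp that Lc[unfolded borel_prod])
 have Tm: "?T \<in> borel_measurable lborel" using mT[OF Hm] by simp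
 have hk: "(NN rho. L (y, om) rho * h (snd rho)) <= S" for y
 proof -
  have "(NN rho. L (y, om) rho * h (snd rho)) = (NN eta. NN z. L (y, om) (z, eta) * h eta)"
   by (subst nn_integral_phase) simp_all
  also have "... = (NN eta. (NN z. L (y, om) (z, eta)) * h eta)"
   by (intro nn_integral_cong nn_integral_multc) simp
  also have "... <= S" unfolding S_def by (intro nn_integral_mono mult_right_mono k1) simp
  finally show ?thesis .
 qed
 have "Lp_enorm P lborel ?T <= S"
 proof (cases "P = \<infinity>")
  case True
  have H_le: "AE z in lborel. H (z, eta) <= h eta" for eta
   using Lp_enorm_le_iff[OF P, of "%z. H (z, eta)" lborel "h eta"] True by (simp add: h_def)
  have "?T y <= S" for y
  proof -
   have "?T y = (NN eta. NN z. L (y, om) (z, eta) * H (z, eta))" by (rule nn_integral_phase) simp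
   also have "... <= (NN eta. NN z. L (y, om) (z, eta) * h eta)"
    by (rule nn_integral_mono, rule nn_integral_mono_AE, rule eventually_mono[OF H_le], rule mult_left_mono) auto
   also have "... = (NN rho. L (y, om) rho * h (snd rho))" by (subst nn_integral_phase) simp_all
   finally show ?thesis using hk by (rule order_trans)
  qed
  then show ?thesis unfolding Lp_enorm_le_iff[OF P Tm] if_P[OF True] by simp
 next
  case False
  define p where "p = enn2real P"
  have p: "1 <= p" unfolding p_def using enn2real_ge_1 P False by simp
  have hp: "(NN z. ennreal_powr (H (z, eta)) p) <= ennreal_powr (h eta) p" for eta
   using Lp_enorm_le_iff[OF P, of "%z. H (z, eta)" lborel "h eta"] False by (simp add: h_def p_def)
  \<comment> \<open>For almost every eta the slice norm is finite. Where it is 0, the slice of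
    \<open>H\<close> vanishes almost everywhere and the weight \<open>L * h\<close> is 0, so the
    default value of the inverse is harmless.\<close>
  define g where "g rho = H rho * inverse (h (snd rho))" for rho
  have gm [measurable]: "g \<in> Borel" unfolding g_def[abs_def] by measurable
  note [measurable] = sec[OF gm]
  \<comment> \<open>Scaled so that the integral over a slice is at most \<open>h eta\<close>; this
    is \<open>W_le\<close>.\<close>
  define W where "W rho = h (snd rho) * ennreal_powr (g rho) p" for rho
  have Wm [measurable]: "W \<in> Borel" unfolding W_def[abs_def] by measurable
  note [measurable] = sec[OF Wm]
  have fin': "AE eta in lborel. h eta < \<infinity>" using fin by (simp add: h_def)
  have split: "?T y = (NN rho. (L (y, om) rho * h (snd rho)) * g rho)" for y
  proof -
   have "?T y = (NN eta. NN z. L (y, om) (z, eta) * H (z, eta))" by (rule nn_integral_phase) simp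
   also have "... = (NN eta. NN z. (L (y, om) (z, eta) * h eta) * g (z, eta))"
   proof (rule nn_integral_cong_AE)
    show "AE eta in lborel. (NN z. L (y, om) (z, eta) * H (z, eta)) = (NN z. (L (y, om) (z, eta) * h eta) * g (z, eta))"
     using fin'
    proof eventually_elim
     case (elim eta)
     show ?case
     proof (cases "h eta = 0")
      case True
      have "AE z in lborel. ennreal_powr (H (z, eta)) p = 0" using hp[of eta] True by (simp add: nn_integral_0_iff_AE)
      then have "AE z in lborel. H (z, eta) = 0"
      proof eventually_elim
       case (elim z)
       then show ?case by (cases "H (z, eta)") (auto simp: ennreal_powr_ennreal)
      qed
      then have "(NN z. L (y, om) (z, eta) * H (z, eta)) = (NN (z::real^'d). 0)"
       by (intro nn_integral_cong_AE) (auto elim: eventually_mono)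
      then show ?thesis using True by simp
     next
      case False
      then have "h eta * inverse (h eta) = 1" using elim by (cases "h eta") (auto simp: inverse_ennreal ennreal_mult'[symmetric])
      then show ?thesis by (intro nn_integral_cong) (simp add: g_def mult_ac, simp add: mult.assoc[symmetric])
     qed
    qed
   qed
   also have "... = (NN rho. (L (y, om) rho * h (snd rho)) * g rho)" by (subst nn_integral_phase) simp_all
   finally show ?thesis .
  qed
  have W_le: "AE eta in lborel. (NN z. W (z, eta)) <= h eta"
   using fin'
  proof eventually_elim
   case (elim eta)
   show ?case
   proof (cases "h eta = 0")
    case False
    then obtain r where r: "h eta = ennreal r" "0 < r" using elim by (cases "h eta") (auto simp: less_le)
    have "(NN z. W (z, eta)) = (NN z. h eta * (ennreal ((1 / r) powr p) * ennreal_powr (H (z, eta)) p))"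
     using r by (intro nn_integral_cong) (simp add: W_def g_def inverse_ennreal mult.commute[of "H _"] ennreal_powr_cmult inverse_eq_divide)
    also have "... = h eta * (ennreal ((1 / r) powr p) * (NN z. ennreal_powr (H (z, eta)) p))"
     by (simp add: nn_integral_cmult)
    also have "... <= h eta * (ennreal ((1 / r) powr p) * ennreal_powr (h eta) p)" by (intro mult_left_mono hp) auto
    also have "ennreal ((1 / r) powr p) * ennreal_powr (h eta) p = 1"
     using r by (simp add: ennreal_powr_ennreal ennreal_mult'[symmetric] powr_mult[symmetric])
    finally show ?thesis by simp
   qed (simp add: W_def)
  qed
  show ?thesis
  proof (cases S)
   case (real s)
   have "(NN y. ennreal_powr (?T y) p) <= (NN y. ennreal (s powr (p - 1)) * (NN rho. L (y, om) rho * W rho))"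
   proof (rule nn_integral_mono)
    fix y
    have "ennreal_powr (?T y) p <= ennreal (s powr (p - 1)) * (NN rho. (L (y, om) rho * h (snd rho)) * ennreal_powr (g rho) p)"
     unfolding split by (rule weighted_jensen) (use p hk[of y] real in auto)
    then show "ennreal_powr (?T y) p <= ennreal (s powr (p - 1)) * (NN rho. L (y, om) rho * W rho)"
     by (simp add: W_def mult.assoc)
   qed
   also have "... = ennreal (s powr (p - 1)) * (NN y. NN rho. L (y, om) rho * W rho)"
    by (rule nn_integral_cmult) (use mT[OF Wm] in simp)
   also have "(NN y. NN rho. L (y, om) rho * W rho) = (NN rho. NN y. L (y, om) rho * W rho)"
   proof (rule lborel_pair.Fubini')
    show "(%(rho, y). L (y, om) rho * W rho) \<in> borel_measurable (lborel \<Otimes>\<^sub>M lborel)"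
     unfolding case_prod_beta' measurable_cong_sets[OF sets_pair_measure_cong[OF sets_lborel sets_lborel] refl] by measurable
   qed
   also have "... = (NN rho. (NN y. L (y, om) rho) * W rho)"
    by (intro nn_integral_cong nn_integral_multc) simp
   also have "... <= (NN rho. e (snd rho) * W rho)"
   proof (intro nn_integral_mono mult_right_mono)
    fix rho show "(NN y. L (y, om) rho) <= e (snd rho)" using k2[of "fst rho" "snd rho"] by simp
   qed simp
   also have "... = (NN eta. e eta * (NN z. W (z, eta)))"
    by (subst nn_integral_phase) (simp_all add: nn_integral_cmult)
   also have "... <= S"
    unfolding S_def by (rule nn_integral_mono_AE) (use W_le in eventually_elim, rule mult_left_mono, auto)
   finally have "(NN y. ennreal_powr (?T y) p) <= ennreal (s powr (p - 1)) * S" by (simp add: mult_left_mono)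
   also have "... = ennreal_powr S p"
    using real powr_diff_mult[of s p] p by (simp add: ennreal_powr_ennreal ennreal_mult'[symmetric])
   finally show ?thesis unfolding Lp_enorm_le_iff[OF P Tm] p_def using False by simp
  qed simp
 qed
 then show ?thesis by (simp add: S_def h_def)
qed

text \<open>The slice estimate leaves the kernel \<open>e\<close> acting on the slice norms, which
  is the situation of \<open>schur_Lp\<close>.\<close>

theorem mixed_schur:
 fixes L :: "(real^'d) \<times> (real^'d) => (real^'d) \<times> (real^'d) => ennreal" and H :: "(real^'d) \<times> (real^'d) => ennreal"
 assumes PQ: "1 <= P" "1 <= Q" and Lm: "(%(mu, rho). L mu rho) \<in> Borel" and Hm: "H \<in> Borel"
  and sb: "schur_bound L e M"
  and fin: "mixed_enorm P Q H < \<infinity>"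
 shows "mixed_enorm P Q (%mu. NN rho. L mu rho * H rho) <= ennreal M * mixed_enorm P Q H"
proof -
 let ?h = "%eta. Lp_enorm P lborel (%z. H (z, eta))" and ?T = "%mu. NN rho. L mu rho * H rho"
 have hm: "?h \<in> Borel" by (rule measurable_Lp_enorm_param[OF PQ(1) Hm])
 have em': "(%x. e (fst x) (snd x)) \<in> Borel" using schur_boundD(2)[OF sb] by (simp add: case_prod_beta')
 have es: "e om \<in> Borel" for om
  using measurable_compose[OF contI em', of "%eta. (om, eta)"] by (simp add: continuous_intros)
 have hf: "AE eta in lborel. ?h eta < \<infinity>"
  by (rule Lp_enorm_finite_AE[OF PQ(2)]) (use hm fin in \<open>auto simp: mixed_enorm_def\<close>)
 have Lp: "(%x. L (fst x) (snd x)) \<in> Borel2" unfolding borel_prod using Lm by (simp add: case_prod_beta')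
 have Tm: "?T \<in> Borel"
  by (rule measurable_nn_integral_param) (intro borel_measurable_times_ennreal borel_measurable_snd_comp Hm Lp[unfolded borel_prod])
 have Sm: "(%om. NN eta. e om eta * ?h eta) \<in> Borel"
  by (rule measurable_nn_integral_param) (intro borel_measurable_times_ennreal borel_measurable_snd_comp em' hm)
 have "mixed_enorm P Q ?T <= Lp_enorm Q lborel (%om. NN eta. e om eta * ?h eta)"
  unfolding mixed_enorm_def
 proof (rule Lp_enorm_mono_AE[OF PQ(2)])
  show "AE om in lborel. Lp_enorm P lborel (%y. ?T (y, om)) <= (NN eta. e om eta * ?h eta)"
   by (intro AE_I2 minkowski_schur[OF PQ(1) Lm Hm es] schur_boundD(3,4)[OF sb] hf)
 qed (use measurable_Lp_enorm_param[OF PQ(1) Tm] Sm in auto)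
 also have "... <= ennreal M * Lp_enorm Q lborel ?h"
  by (rule schur_Lp[OF PQ(2) em' hm schur_boundD(5,6,1)[OF sb]])
 finally show ?thesis by (simp add: mixed_enorm_def)
qed

lemma null_set_sections:
 assumes Z: "Z \<in> null_sets (lborel :: ((real^'d) \<times> (real^'d)) measure)"
 shows "AE om in lborel. AE y in lborel. (y, om) \<notin> Z"
proof -
 have Zb [measurable]: "Z \<in> sets borel" using Z by auto
 have sec: "(%y. (y, om)) -` Z \<in> sets borel" for om
  by (rule measurable_sets_borel[OF contI Zb]) (intro continuous_intros)
 have im: "(%x. indicator Z (snd x, fst x) :: ennreal) \<in> Borel"
  by (rule measurable_compose[OF contI borel_measurable_indicator[OF Zb]]) (intro continuous_intros)
 have "(NN om. NN y. indicator Z (y, om)) = (NN mu. indicator Z mu)"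
  by (rule nn_integral_phase[symmetric]) simp
 also have "... = 0" using Z by (simp add: null_sets_def)
 finally have "AE om in lborel. (NN y. indicator Z (y, om)) = 0"
  using measurable_nn_integral_param[OF im] by (simp add: nn_integral_0_iff_AE)
 then show ?thesis
 proof eventually_elim
  case (elim om)
  have "(%y. indicator Z (y, om) :: ennreal) = indicator ((%y. (y, om)) -` Z)" by (auto simp: indicator_def)
  then have "(%y. indicator Z (y, om) :: ennreal) \<in> borel_measurable lborel" using sec by simp
  then have "AE y in lborel. indicator Z (y, om) = (0::ennreal)" using elim by (simp add: nn_integral_0_iff_AE)
  then show ?case by eventually_elim (auto simp: indicator_def split: if_splits)
 qed
qed

lemma Lp_enorm_zero: "1 <= P ==> Lp_enorm P M (%x. 0) = 0"
 using Lp_enorm_le_iff[of P "%x. 0" M 0] by simp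

lemma phase_section:
 fixes H :: "(real^'d) \<times> (real^'d) => ennreal"
 assumes "H \<in> Borel" shows "(%y. H (y, om)) \<in> Borel"
 by (rule measurable_compose[OF contI assms]) (intro continuous_intros)

text \<open>A null set of the phase space has null slices at almost every frequency, so a Borel
  representative may be substituted inside the iterated norm.\<close>

lemma mixed_enorm_lebesgue:
 fixes H :: "(real^'d) \<times> (real^'d) => ennreal"
 assumes PQ: "1 <= P" "1 <= Q" and D: "D \<in> sets borel" and H: "H \<in> Borel" "\<forall>mu. mu \<notin> UNIV \<times> D --> H mu = 0"
  and Z: "Z \<in> null_sets lborel" and eq: "\<forall>mu\<in>UNIV \<times> D - Z. f mu = H mu"
 shows "Lp_enorm Q (lebesgue_on D) (%om. Lp_enorm P lebesgue (%y. f (y, om))) = mixed_enorm P Q H"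
 unfolding mixed_enorm_def
proof (rule Lp_enorm_lebesgue_on[OF PQ(2) D measurable_Lp_enorm_param[OF PQ(1) H(1)]])
 show "Lp_enorm P lborel (%y. H (y, om)) = 0" if "om \<notin> D" for om
  using that H(2) by (simp add: Lp_enorm_zero[OF PQ(1)])
 show "AE om in lborel. om \<in> D --> Lp_enorm P lebesgue (%y. f (y, om)) = Lp_enorm P lborel (%y. H (y, om))"
  using null_set_sections[OF Z]
 proof eventually_elim
  case (elim om)
  show ?case
  proof
   assume om: "om \<in> D"
   have "AE y in lborel. f (y, om) = H (y, om)" using elim by eventually_elim (use eq om in auto)
   then show "Lp_enorm P lebesgue (%y. f (y, om)) = Lp_enorm P lborel (%y. H (y, om))"
    by (rule Lp_enorm_cong_AE_completion[OF PQ(1), rotated]) (simp add: phase_section[OF H(1)])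
  qed
 qed
qed

lemma mixed_enorm_mono:
 fixes A B :: "(real^'d) \<times> (real^'d) => ennreal"
 assumes PQ: "1 <= P" "1 <= Q" and m: "A \<in> Borel" "B \<in> Borel" and c: "0 <= c"
  and Z: "Z \<in> null_sets lborel" and le: "\<And>mu. mu \<notin> Z ==> A mu <= ennreal c * B mu"
 shows "mixed_enorm P Q A <= ennreal c * mixed_enorm P Q B"
proof -
 have s: "(%y. A (y, om)) \<in> borel_measurable lborel" "(%y. B (y, om)) \<in> borel_measurable lborel" for om
  using phase_section[OF m(1)] phase_section[OF m(2)] by auto
 note pm = measurable_Lp_enorm_param[OF PQ(1)]
 have "mixed_enorm P Q A <= Lp_enorm Q lborel (%om. ennreal c * Lp_enorm P lborel (%y. B (y, om)))"
  unfolding mixed_enorm_def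
 proof (rule Lp_enorm_mono_AE[OF PQ(2)])
  show "AE om in lborel. Lp_enorm P lborel (%y. A (y, om)) <= ennreal c * Lp_enorm P lborel (%y. B (y, om))"
   using null_set_sections[OF Z]
  proof eventually_elim
   case (elim om)
   have "Lp_enorm P lborel (%y. A (y, om)) <= Lp_enorm P lborel (%y. ennreal c * B (y, om))"
    by (rule Lp_enorm_mono_AE[OF PQ(1)]) (use s elim le in \<open>auto elim: eventually_mono\<close>)
   also have "... <= ennreal c * Lp_enorm P lborel (%y. B (y, om))" by (rule Lp_enorm_cmult[OF PQ(1) c s(2)])
   finally show ?case .
  qed
 qed (use pm[OF m(1)] pm[OF m(2)] in auto)
 also have "... <= ennreal c * mixed_enorm P Q B"
  unfolding mixed_enorm_def by (rule Lp_enorm_cmult[OF PQ(2) c]) (use pm[OF m(2)] in simp)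
 finally show ?thesis .
qed

context coorbit_setting
begin

text \<open>\<open>ker_maps\<close> is verified for the kernel at hand, whose Schur bound is
  explicit. The constant collects \<open>c\<close> from the comparison of the values of
  \<open>kap\<close> with m0, 1/n from the reproducing identity and \<open>M\<close> from the Schur
  bound.\<close>

lemma Lpq_step:
 assumes th: "adm th" "adm th'" and nz: "th \<noteq> (%x. 0)" and PQ: "1 <= P" "1 <= Q"
  and kap: "kap \<in> borel_measurable (lebesgue_on Lam)" "\<forall>mu\<in>Lam. 1 <= kap mu" and c: "0 < c"
  and kapm: "\<forall>mu\<in>Lam. \<forall>rho\<in>Lam. max (kap mu / kap rho) (kap rho / kap mu) <= c * m0 mu rho"
 shows "\<exists>C. ker_maps th th' (Lpq_space D P Q kap) (Lpq_norm D P Q kap) C"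
proof -
 let ?k = "ker th th'" and ?w = "wker th th'"
 define n where "n = nrm th"
 have n: "0 < n" unfolding n_def by (rule nrm_pos[OF th(1) nz])
 obtain e M where sb: "schur_bound ?w e M" by (rule wker_schur_bound[OF th])
 note M = schur_boundD(1)[OF sb]
 note [measurable] = wker_sections[OF th]
 have "(%rho. cx (kap rho)) \<in> borel_measurable (lebesgue_on Lam)" using kap(1) by simp
 then obtain kap0 Zk where kap0 [measurable]: "kap0 \<in> Borel" and Zk: "Zk \<in> null_sets lborel"
  and kapeq: "\<And>rho. rho \<in> Lam - Zk ==> kap0 rho = cx (kap rho)"
  by (rule voice_ext_borel) (rule that)
 have "G \<in> Lpq_space D P Q kap \<and> Lpq_norm D P Q kap G <= (c / n * M) * Lpq_norm D P Q kap F"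
  if F: "F \<in> Lpq_space D P Q kap" and int: "\<forall>mu\<in>Lam. integrable (lebesgue_on Lam) (%rho. ?k mu rho * F rho)"
   and G: "\<forall>mu\<in>Lam. cx n * G mu = kernel_op Lam ?k F mu" for F G
 proof -
  have Fm: "F \<in> borel_measurable (lebesgue_on Lam)" using F by (simp add: Lpq_space_def)
  then obtain F0 Z where F0 [measurable]: "F0 \<in> Borel" and Z: "Z \<in> null_sets lborel"
   and Feq: "\<And>rho. rho \<in> Lam - Z ==> F0 rho = F rho" using voice_ext_borel by blast
  have Feq': "\<forall>rho\<in>Lam - Z. F0 rho = F rho" using Feq by blast
  have k0: "\<forall>rho. rho \<notin> Lam --> ?k mu rho = 0" for mu using ker_outside(2) by blast
  note cv = lebesgue_on_borel_integral[OF F0 Z Feq' Fm wker_sections(3)[OF th] k0]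
  have ki: "integrable lborel (%rho. ?k mu rho * F0 rho)" if "mu \<in> Lam" for mu
   using int that unfolding cv(1) by blast
  define I where "I mu = (LB rho. ?k mu rho * F0 rho)" for mu
  have GI: "G mu = I mu / cx n" if "mu \<in> Lam" for mu
  proof -
   have "cx n * G mu = I mu" using G[rule_format, OF that] unfolding kernel_op_def cv(2) I_def .
   then show ?thesis using n by (simp add: eq_divide_eq mult.commute)
  qed
  have Im [measurable]: "I \<in> Borel"
  proof -
   have [measurable]: "(%x. ?k (fst x) (snd x)) \<in> Borel2"
    unfolding borel_prod using measurable_ker[OF th] by (simp add: case_prod_beta')
   have "(%(mu, rho). ?k mu rho * F0 rho) \<in> borel_measurable (borel \<Otimes>\<^sub>M lborel)"
    unfolding case_prod_beta' measurable_cong_sets[OF sets_pair_measure_cong[OF refl sets_lborel] refl] by measurable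
   then show ?thesis unfolding I_def[abs_def] by (rule lborel.borel_measurable_lebesgue_integral)
  qed
  define H where "H rho = indicator Lam rho * ennreal (cmod (kap0 rho * F0 rho))" for rho
  define HG where "HG mu = indicator Lam mu * ennreal (cmod (kap0 mu * (I mu / cx n)))" for mu
  have Hm [measurable]: "H \<in> Borel" unfolding H_def[abs_def] by measurable
  have HGm [measurable]: "HG \<in> Borel" unfolding HG_def[abs_def] by measurable
  have nF: "Lpq_enorm D P Q kap F = mixed_enorm P Q H"
   unfolding Lpq_enorm_def
   by (rule mixed_enorm_lebesgue[where f="%mu. ennreal (cmod (kap mu *\<^sub>R F mu))", OF PQ D_borel Hm _ null_sets.Un[OF Z Zk]])
     (use kapeq Feq in \<open>auto simp: H_def norm_mult\<close>)
  have nG: "Lpq_enorm D P Q kap G = mixed_enorm P Q HG"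
   unfolding Lpq_enorm_def
   by (rule mixed_enorm_lebesgue[where f="%mu. ennreal (cmod (kap mu *\<^sub>R G mu))", OF PQ D_borel HGm _ Zk])
     (use kapeq GI in \<open>auto simp: HG_def norm_mult norm_divide\<close>)
  define T where "T mu = (NN rho. ?w mu rho * H rho)" for mu
  have Tm: "T \<in> Borel"
   unfolding T_def[abs_def]
   by (rule measurable_nn_integral_param) (intro borel_measurable_times_ennreal borel_measurable_snd_comp Hm measurable_wker[OF th, unfolded case_prod_beta'])
  have HT: "HG mu <= ennreal (c / n) * T mu" if mu: "mu \<notin> Zk" for mu
  proof (cases "mu \<in> Lam")
   case True
   have kp: "0 < kap mu" using bspec[OF kap(2) True] by simp
   have "HG mu = ennreal (kap mu / n * cmod (I mu))"
    using kapeq[of mu] True mu kp n by (simp add: HG_def norm_mult norm_divide)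
   also have "... = ennreal (kap mu / n) * ennreal (cmod (I mu))" using kp n by (intro ennreal_mult') simp
   also have "... <= ennreal (kap mu / n) * (NN rho. ennreal (cmod (?k mu rho * F0 rho)))"
    unfolding I_def by (intro mult_left_mono integral_norm_bound_ennreal ki[OF True]) simp
   also have "... = (NN rho. ennreal (kap mu / n * cmod (?k mu rho * F0 rho)))"
    using kp n by (intro nn_integral_cmult_real[symmetric]) auto
   also have "... <= (NN rho. ennreal (c / n) * (?w mu rho * H rho))"
   proof (rule nn_integral_mono_AE)
    show "AE rho in lborel. ennreal (kap mu / n * cmod (?k mu rho * F0 rho)) <= ennreal (c / n) * (?w mu rho * H rho)"
     using AE_not_in[OF Zk]
    proof eventually_elim
     case (elim rho)
     show ?case
     proof (cases "rho \<in> Lam")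
      case rho: True
      have rp: "0 < kap rho" using bspec[OF kap(2) rho] by simp
      have "kap mu / kap rho <= c * m0 mu rho" using bspec[OF bspec[OF kapm True] rho] by simp
      then have "kap mu <= c * m0 mu rho * kap rho" using rp by (simp add: divide_le_eq)
      also have "... <= c * big_weight mu rho * kap rho"
       using m0_le_big_weight[OF True rho] c rp by (intro mult_right_mono mult_left_mono) auto
      finally have "kap mu / n * (cmod (?k mu rho) * cmod (F0 rho)) <= c * big_weight mu rho * kap rho / n * (cmod (?k mu rho) * cmod (F0 rho))"
       using n by (intro mult_right_mono divide_right_mono) auto
      also have "... = c / n * ((big_weight mu rho * cmod (?k mu rho)) * (kap rho * cmod (F0 rho)))" by simp
      finally have "ennreal (kap mu / n * cmod (?k mu rho * F0 rho)) <= ennreal (c / n * ((big_weight mu rho * cmod (?k mu rho)) * (kap rho * cmod (F0 rho))))"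
       by (simp only: norm_mult ennreal_leI)
      also have "... = ennreal (c / n) * (?w mu rho * ennreal (kap rho * cmod (F0 rho)))"
       using c n big_weight_nonneg[of mu rho] by (simp only: wker_def ennreal_mult' divide_nonneg_pos less_imp_le mult_nonneg_nonneg norm_ge_zero)
      also have "ennreal (kap rho * cmod (F0 rho)) = H rho" using rho elim kapeq[of rho] rp by (simp add: H_def norm_mult)
      finally show ?thesis .
     qed (simp add: ker_outside)
    qed
   qed
   also have "... = ennreal (c / n) * T mu" unfolding T_def by (rule nn_integral_cmult) measurable
   finally show ?thesis .
  qed (simp add: HG_def)
  have fin: "mixed_enorm P Q H < \<infinity>" using F by (simp add: Lpq_space_def nF)
  have cn: "0 <= c / n" using c n by simp
  have "mixed_enorm P Q HG <= ennreal (c / n) * mixed_enorm P Q T"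
   by (rule mixed_enorm_mono[OF PQ HGm Tm cn Zk HT])
  also have "... <= ennreal (c / n) * (ennreal M * mixed_enorm P Q H)"
   unfolding T_def[abs_def] by (intro mult_left_mono mixed_schur[OF PQ measurable_wker[OF th] Hm sb fin]) simp
  also have "... = ennreal (c / n * M) * mixed_enorm P Q H" unfolding mult.assoc[symmetric] by (simp only: ennreal_mult'[OF cn])
  finally have le: "Lpq_enorm D P Q kap G <= ennreal (c / n * M) * Lpq_enorm D P Q kap F" by (simp only: nF nG)
  have fin': "ennreal (c / n * M) * Lpq_enorm D P Q kap F < \<infinity>" using fin nF by (simp add: ennreal_mult_less_top)
  have Gm: "G \<in> borel_measurable (lebesgue_on Lam)"
   by (rule measurable_lebesgue_onI[where f="%mu. I mu / cx n", OF _ GI]) measurable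
  have "G \<in> Lpq_space D P Q kap" using Gm le_less_trans[OF le fin'] by (simp add: Lpq_space_def)
  moreover have "Lpq_norm D P Q kap G <= (c / n * M) * Lpq_norm D P Q kap F"
  proof -
   have "Lpq_norm D P Q kap G <= enn2real (ennreal (c / n * M) * Lpq_enorm D P Q kap F)"
    unfolding Lpq_norm_def by (rule enn2real_mono[OF le]) (use fin' in simp)
   also have "... = (c / n * M) * Lpq_norm D P Q kap F" using mult_nonneg_nonneg[OF cn M] by (simp only: Lpq_norm_def enn2real_mult enn2real_ennreal)
   finally show ?thesis .
  qed
  ultimately show ?thesis ..
 qed
 then show ?thesis unfolding n_def ker_maps_def by (intro exI allI impI) blast
qed

theorem Co_eq_Lpq:
 assumes th: "adm th1" "adm th2" and nz: "th1 \<noteq> (%x. 0)" "th2 \<noteq> (%x. 0)" and PQ: "1 <= P" "1 <= Q"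
  and kap: "kap \<in> borel_measurable (lebesgue_on Lam)" "\<forall>mu\<in>Lam. 1 <= kap mu" "0 < c"
   "\<forall>mu\<in>Lam. \<forall>rho\<in>Lam. max (kap mu / kap rho) (kap rho / kap mu) <= c * m0 mu rho"
 shows "eq_equiv_norms (Co D Ph cw th1 (Lpq_space D P Q kap)) (Co_norm D Ph th1 (Lpq_norm D P Q kap))
  (Co D Ph cw th2 (Lpq_space D P Q kap)) (Co_norm D Ph th2 (Lpq_norm D P Q kap))"
proof (rule Co_eq[OF th nz])
 show "Lpq_space D P Q kap \<subseteq> borel_measurable (lebesgue_on Lam)" by (auto simp: Lpq_space_def)
 show "0 <= Lpq_norm D P Q kap F" for F by (simp add: Lpq_norm_def)
qed (rule Lpq_step[OF _ _ _ PQ kap])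

end

section \<open>From the hypotheses of the theorem to the setting above\<close>

lemma norm_transpose_le: "norm (transpose M *v y) <= mat_norm M * norm (y :: real^'d)"
proof -
 let ?z = "transpose M *v y"
 have "norm ?z * norm ?z = ?z \<bullet> ?z" by (simp add: power2_norm_eq_inner[symmetric] power2_eq_square)
 also have "... = y \<bullet> (M *v ?z)" by (simp only: transpose_matrix_vector dot_lmul_matrix)
 also have "... <= norm y * norm (M *v ?z)" by (rule norm_cauchy_schwarz)
 also have "... <= norm y * (mat_norm M * norm ?z)" by (intro mult_left_mono norm_matrix_vector_le) simp
 finally have "norm ?z * norm ?z <= (mat_norm M * norm y) * norm ?z" by (simp only: mult_ac)
 then show ?thesis
  using mat_norm_nonneg[of M] by (cases "norm ?z = 0") (simp_all del: transpose_matrix_vector)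
qed

text \<open>By the chain rule the derivative \<open>?J\<close> of the warping map at
  \<open>Ps tau\<close> inverts \<open>A tau\<close>, so \<open>x\<close> is the transpose of
  \<open>?J\<close> applied to A(tau)^T x, and the norm of \<open>?J\<close> is bounded.\<close>

lemma (in warping) warp_R_bound:
 assumes "warp_R D Ph \<noteq> \<infinity>"
 obtains R where "1 <= R" "\<And>tau x. norm x <= R * norm (transpose (A tau) *v x)"
proof -
 define R where "R = max 1 (enn2real (warp_R D Ph))"
 have R: "mat_norm (jacobian Ph (at xi)) <= R" if "xi \<in> D" for xi
 proof -
  have "ennreal (mat_norm (jacobian Ph (at xi))) <= warp_R D Ph" unfolding warp_R_def by (rule SUP_upper[OF that])
  then have "mat_norm (jacobian Ph (at xi)) <= enn2real (warp_R D Ph)"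
   using enn2real_mono[of "ennreal (mat_norm (jacobian Ph (at xi)))" "warp_R D Ph"] assms by (simp add: mat_norm_nonneg less_top)
  then show ?thesis by (simp add: R_def)
 qed
 show thesis
 proof (rule that[of R])
  show "1 <= R" by (simp add: R_def)
  fix tau x
  let ?J = "jacobian Ph (at (Ps tau))"
  have "Ck_on (Suc N) D Ph" using admissible by (simp add: admissible_warping_def Ck_diffeo_def)
  then have "Ph differentiable (at (Ps tau))" by simp
  then have "(Ph has_derivative ((*v) ?J)) (at (Ps tau))" unfolding jacobian_works .
  from diff_chain_at[OF Psi_has_derivative this] have "((%tau. tau) has_derivative ((*v) ?J \<circ> (*v) (A tau))) (at tau)"
   by (simp add: comp_def)
  then have "(*v) ?J \<circ> (*v) (A tau) = (%h. h)" by (rule has_derivative_unique) (rule has_derivative_ident)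
  then have "(?J ** A tau) *v h = mat 1 *v h" for h by (simp add: fun_eq_iff matrix_vector_mul_assoc[symmetric])
  then have "?J ** A tau = mat 1" by (simp add: matrix_eq)
  then have "A tau ** ?J = mat 1" by (simp add: matrix_left_right_inverse)
  then have "transpose ?J ** transpose (A tau) = mat 1" by (simp only: matrix_transpose_mul[symmetric] transpose_mat)
  then have "x = transpose ?J *v (transpose (A tau) *v x)" by (simp only: matrix_vector_mul_assoc matrix_vector_mul_lid)
  then have "norm x <= mat_norm ?J * norm (transpose (A tau) *v x)" by (metis norm_transpose_le)
  also have "... <= R * norm (transpose (A tau) *v x)" by (intro mult_right_mono R Psi_in_D) simp
  finally show "norm x <= R * norm (transpose (A tau) *v x)" .
 qed
qed

lemma weighted_L2_D:
 assumes "f \<in> weighted_L2 v"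
 shows "(NN x. ennreal ((v x * cmod (f x))\<^sup>2)) < \<infinity>"
proof -
 have "sqnorm lborel (%x. v x *\<^sub>R f x) < \<infinity>" using assms by (simp add: weighted_L2_def L2_space_iff sqnorm_completion)
 then show ?thesis by (simp add: sqnorm_def power_mult_distrib)
qed

theorem theorem7p4:
  fixes D :: "(real^'d) set"
    and \<Phi> :: "real^'d \<Rightarrow> real^'d"
    and v0 v1 w2 :: "real^'d \<Rightarrow> real"
    and m0 :: "'d phase \<Rightarrow> 'd phase \<Rightarrow> real"
    and C0 :: real
    and p :: nat
    and \<theta>1 \<theta>2 :: "real^'d \<Rightarrow> complex"
    and \<nu> :: "'d phase"
    and v :: "'d phase \<Rightarrow> real"
  assumes D: "open D" "D \<noteq> {}"
    and warp: "admissible_warping (CARD('d) + p + 1) D \<Phi> v0"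
    and p: "warp_R D \<Phi> = \<infinity> \<Longrightarrow> p = 0"
    and m0_cont: "continuous_on (phase_space D \<times> phase_space D) (\<lambda>(\<mu>, \<rho>). m0 \<mu> \<rho>)"
    and m0_sym: "\<forall>\<mu>\<in>phase_space D. \<forall>\<rho>\<in>phase_space D. m0 \<mu> \<rho> = m0 \<rho> \<mu>"
    and m0_ge: "\<forall>\<mu>\<in>phase_space D. \<forall>\<rho>\<in>phase_space D. 1 \<le> m0 \<mu> \<rho>"
    and m0_mult: "\<forall>\<mu>\<in>phase_space D. \<forall>\<rho>\<in>phase_space D. \<forall>\<sigma>\<in>phase_space D.
           m0 \<mu> \<rho> \<le> C0 * m0 \<mu> \<sigma> * m0 \<sigma> \<rho>"
    and m0_le: "\<forall>y z. \<forall>\<xi>\<in>D. \<forall>\<eta>\<in>D.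
           m0 (y, \<xi>) (z, \<eta>) \<le> (1 + norm (y - z)) ^ p * v1 (\<Phi> \<xi> - \<Phi> \<eta>)"
    and v1_pos: "\<forall>\<upsilon>. 0 < v1 \<upsilon>"
    and v1_cont: "continuous_on UNIV v1"
    and v1_submult: "submultiplicative v1"
    and v1_even: "\<forall>\<upsilon>. v1 \<upsilon> = v1 (- \<upsilon>)"
    and w2: "w2 = (\<lambda>\<upsilon>. (1 + norm \<upsilon>) ^ (CARD('d) + 1) * v1 \<upsilon> *
                     v0 \<upsilon> powr (9 * real CARD('d) / 2 + 3 * real p + 3))"
    and \<theta>: "\<forall>\<theta>\<in>{\<theta>1, \<theta>2}.
           \<theta> \<in> weighted_L2 (\<lambda>\<upsilon>. v0 \<upsilon> powr (real CARD('d) / 2)) \<and>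
           Ck_on (CARD('d) + p + 1) UNIV \<theta> \<and>
           \<theta> \<noteq> (\<lambda>\<upsilon>. 0) \<and>
           (\<forall>j. \<forall>n\<le>CARD('d) + p + 1.
              (\<lambda>\<upsilon>. v0 \<upsilon> ^ n *\<^sub>R (partial_deriv j ^^ (CARD('d) + p + 1 - n)) \<theta> \<upsilon>) \<in> weighted_L2 w2)"
    and \<nu>: "\<nu> \<in> phase_space D"
    and v: "v = coorbit_weight D \<Phi> m0 \<nu>"
  shows
    "(\<forall>Y N. banach_function_space (phase_space D) Y N \<and>
            embeds_in_L1_loc (phase_space D) Y N \<and>
            solid_space (phase_space D) Y N \<and>
            rich_space (phase_space D) Y \<and>
            B_acts_on D m0 Y N \<longrightarrow>
        eq_equiv_norms (Co D \<Phi> v \<theta>1 Y) (Co_norm D \<Phi> \<theta>1 N)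
                       (Co D \<Phi> v \<theta>2 Y) (Co_norm D \<Phi> \<theta>2 N))
     \<and>
     (\<forall>P Q :: ennreal. \<forall>\<kappa> c.
        1 \<le> P \<and> 1 \<le> Q \<and>
        \<kappa> \<in> borel_measurable (lebesgue_on (phase_space D)) \<and>
        (\<forall>\<mu>\<in>phase_space D. 1 \<le> \<kappa> \<mu>) \<and>
        0 < c \<and>
        (\<forall>\<mu>\<in>phase_space D. \<forall>\<rho>\<in>phase_space D. max (\<kappa> \<mu> / \<kappa> \<rho>) (\<kappa> \<rho> / \<kappa> \<mu>) \<le> c * m0 \<mu> \<rho>) \<longrightarrow>
        eq_equiv_norms
          (Co D \<Phi> v \<theta>1 (Lpq_space D P Q \<kappa>)) (Co_norm D \<Phi> \<theta>1 (Lpq_norm D P Q \<kappa>))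
          (Co D \<Phi> v \<theta>2 (Lpq_space D P Q \<kappa>)) (Co_norm D \<Phi> \<theta>2 (Lpq_norm D P Q \<kappa>)))"
proof -
  let ?N = "CARD('d) + p + 1"
  interpret warping D \<Phi> v0 ?N by unfold_locales (use D warp in auto)
  obtain Rc where Rc: "0 \<le> Rc" "\<And>\<tau> x. (1 + norm x) ^ p \<le> Rc * (1 + norm (transpose (A \<tau>) *v x)) ^ p"
  proof (cases "warp_R D \<Phi> = \<infinity>")
    case True
    \<comment> \<open>With \<open>p = 0\<close> both powers are 1.\<close>
    then show thesis using p by (intro that[of 1]) auto
  next
    case False
    obtain R where R: "1 \<le> R" "\<And>\<tau> x. norm x \<le> R * norm (transpose (A \<tau>) *v x)" by (rule warp_R_bound[OF False]) blast
    show thesis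
    \<comment> \<open>\<open>1 \<le> R\<close> absorbs the summand 1 when \<open>R\<close> is
      factored out of 1 + |x|.\<close>
    proof (rule that[of "R ^ p"])
      fix \<tau> x
      have "1 + norm x \<le> R * (1 + norm (transpose (A \<tau>) *v x))" using R(1) R(2)[of x \<tau>] by (simp only: distrib_left)
      then have "(1 + norm x) ^ p \<le> (R * (1 + norm (transpose (A \<tau>) *v x))) ^ p" by (intro power_mono) auto
      then show "(1 + norm x) ^ p \<le> R ^ p * (1 + norm (transpose (A \<tau>) *v x)) ^ p" by (simp only: power_mult_distrib)
    qed (use R in simp)
  qed
  interpret coorbit_setting D \<Phi> v0 ?N p v1 m0 C0 Rc \<nu>
  proof unfold_locales
    show "v1 (x + y) \<le> v1 x * v1 y" for x y using v1_submult by (simp add: submultiplicative_def)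
    show "v1 (- x) = v1 x" for x using v1_even by (rule allE[where x=x]) simp
  qed (use Rc m0_cont m0_ge m0_mult m0_le v1_pos v1_cont \<nu> in auto)
  have adm: "adm \<theta>" if t: "\<theta> \<in> {\<theta>1, \<theta>2}" for \<theta>
    unfolding adm_def
  proof (intro conjI allI impI)
    note th = bspec[OF \<theta> t]
    show "window D \<Phi> v0 ?N \<theta>"
    proof unfold_locales
      show "Ck_on ?N UNIV \<theta>" using th by blast
      \<comment> \<open>Squaring turns the weight v0^(d/2) into an integer power.\<close>
      have "(v0 \<upsilon> powr (real CARD('d) / 2) * cmod (\<theta> \<upsilon>))\<^sup>2 = v0 \<upsilon> ^ CARD('d) * (cmod (\<theta> \<upsilon>))\<^sup>2" for \<upsilon>
        using v0_pos[of \<upsilon>] by (simp add: power_mult_distrib powr_power powr_realpow)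
      then show "(\<integral>\<^sup>+\<upsilon>. ennreal (v0 \<upsilon> ^ CARD('d) * (cmod (\<theta> \<upsilon>))\<^sup>2) \<partial>lborel) < \<infinity>"
        using weighted_L2_D[OF conjunct1[OF th]] by simp
    qed
    fix j a assume a: "a \<le> ?N"
    \<comment> \<open>The hypothesis on derivatives is used with n = N - a, so that the order N - n
      of the derivative is a.\<close>
    have "(\<lambda>\<upsilon>. v0 \<upsilon> ^ (?N - a) *\<^sub>R (partial_deriv j ^^ (?N - (?N - a))) \<theta> \<upsilon>) \<in> weighted_L2 w2"
      using th diff_le_self by blast
    then have "(\<integral>\<^sup>+\<upsilon>. ennreal ((w2 \<upsilon> * cmod (v0 \<upsilon> ^ (?N - a) *\<^sub>R (partial_deriv j ^^ a) \<theta> \<upsilon>))\<^sup>2) \<partial>lborel) < \<infinity>"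
      unfolding diff_diff_cancel[OF a] by (rule weighted_L2_D)
    then have "(\<integral>\<^sup>+\<upsilon>. ennreal ((w2 \<upsilon> * (v0 \<upsilon> ^ (?N - a) * cmod ((partial_deriv j ^^ a) \<theta> \<upsilon>)))\<^sup>2) \<partial>lborel) < \<infinity>"
      using v0_pos by (simp add: abs_of_pos)
    moreover have "w2 = coorbit_setting.w2 v0 p v1" by (simp add: w2 w2_def[abs_def])
    ultimately show "(\<integral>\<^sup>+\<upsilon>. ennreal ((coorbit_setting.w2 v0 p v1 \<upsilon> * (v0 \<upsilon> ^ (?N - a) * cmod ((partial_deriv j ^^ a) \<theta> \<upsilon>)))\<^sup>2) \<partial>lborel) < \<infinity>" by simp
  qed
  have \<theta>': "adm \<theta>1" "adm \<theta>2" "\<theta>1 \<noteq> (\<lambda>x. 0)" "\<theta>2 \<noteq> (\<lambda>x. 0)" using adm \<theta> by auto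
  show ?thesis
    unfolding v using Co_eq_banach[OF \<theta>'] Co_eq_Lpq[OF \<theta>'] by blast
qed

end
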